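(* Let $m>0$ and $a\in\mathbb{R}$ with $|a|\le m$, and let $s\in\mathbb{R}$. If $u$ is a quasinormal mode solution to the Teukolsky equation $\mathrm{L}_s(e^{-i\sigma t-ik\phi}u)=0$ with parameters $(\sigma,k)\in(\mathbb{R}\setminus\{0\})\times\mathbb{Z}$, then $u=0$.
   Context: Kerr exterior: $M=\mathbb{R}_t\times(r_+,\infty)_r\times S^2_{\phi,\theta}$ in Boyer–Lindquist coordinates, $\mu(r)=r^2-2mr+a^2$, $r_\pm=m\pm\sqrt{m^2-a^2}$. Teukolsky operator: $$\mathrm{L}_s=-\partial_r\mu(r)\partial_r+\frac{1}{\mu(r)}\Big((r^2+a^2)\partial_t+a\partial_\phi-(r-m)s\Big)^2+4s(r+ia\cos\theta)\partial_t-\frac{1}{\sin\theta}\partial_\theta(\sin\theta\,\partial_\theta)-\frac{1}{\sin^2\theta}\Big(a\sin^2\theta\,\partial_t+\partial_\phi+is\cos\theta\Big)^2 .$$ Mode solution with parameters $(\sigma,k)$: a solution of $\mathrm{L}_sv=0$ of the form $v(t,r,\phi,\theta)=e^{-it\sigma-ik\phi}u(r,\theta)$, where $e^{-ik\phi}u(r,\theta)$ extends to a smooth function on $S^2_{\phi,\theta}$. One also calls $u$ the mode solution. Let $H:\mathbb{R}\setminus\{r_-,r_+\}\to\mathbb{C}$ be a smooth function with $$H'(r)=\frac{i\big((r^2+a^2)\sigma+ak\big)+(r-m)s}{\mu(r)} .$$ Quasinormal mode solution with parameters $(\sigma,k)$: a mode solution $u$ with no incoming radiation, meaning that (i) $e^{H(r)}u(r,\theta)$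 (with the factor $e^{-ik\phi}$ understood) is a smooth function on $[r_+,\infty)\times S^2$; (ii) $e^{-H(r)}u(r,\theta)$ is conormal at $r=\infty$, i.e. there is $\beta\in\mathbb{R}$ such that $(r\partial_r)^j\big(r^{\beta}e^{-H(r)}u(r,\theta)\big)$ is uniformly bounded on $(r_++1,\infty)\times S^2$ for every $j\in\mathbb{N}_0$. *)

theory Defs
  imports "HOL-Analysis.Analysis"
begin

section \<open>Smooth functions\<close>

text \<open>On open sets only; for open \<open>U\<close> this says that \<open>f\<close> is of class \<open>C\<^sup>n\<close> on \<open>U\<close>.\<close>

primrec Cn_on :: "'a::euclidean_space set \<Rightarrow> ('a \<Rightarrow> 'b::real_normed_vector) \<Rightarrow> nat \<Rightarrow> bool" where
  "Cn_on U f 0 \<longleftrightarrow> continuous_on U f"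
| "Cn_on U f (Suc n) \<longleftrightarrow> (\<forall>x\<in>U. f differentiable (at x)) \<and>
     (\<forall>v. Cn_on U (\<lambda>x. frechet_derivative f (at x) v) n)"

text \<open>Smoothness on an arbitrary subset of a Euclidean space means that \<open>f\<close> is locally the
  restriction of a smooth function on an open set. For submanifolds, possibly with boundary, such as
  \<open>[r\<^sub>+,\<infinity>) \<times> S\<^sup>2 \<subseteq> \<real> \<times> \<real>\<^sup>3\<close>, this is the usual notion, smoothness up to the boundary included.\<close>

definition smooth_on :: "'a::euclidean_space set \<Rightarrow> ('a \<Rightarrow> 'b::real_normed_vector) \<Rightarrow> bool" where
  "smooth_on S f \<longleftrightarrow> (\<forall>x\<in>S. \<exists>U g. open U \<and> x \<in> U \<and> (\<forall>n. Cn_on U g n) \<and> (\<forall>y\<in>S \<inter> U. g y = f y))"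

section \<open>Kerr exterior in Boyer-Lindquist coordinates\<close>

definition mu :: "real \<Rightarrow> real \<Rightarrow> real \<Rightarrow> real" where
  "mu m a r = r^2 - 2 * m * r + a^2"

definition r_plus :: "real \<Rightarrow> real \<Rightarrow> real" where
  "r_plus m a = m + sqrt (m^2 - a^2)"

definition r_minus :: "real \<Rightarrow> real \<Rightarrow> real" where
  "r_minus m a = m - sqrt (m^2 - a^2)"

definition sph :: "real \<Rightarrow> real \<Rightarrow> real^3" where
  "sph \<phi> \<theta> = vector [sin \<theta> * cos \<phi>, sin \<theta> * sin \<phi>, cos \<theta>]"

section \<open>The Teukolsky operator\<close>

text \<open>Functions are given in the coordinates \<open>(t, r, \<phi>, \<theta>)\<close>, in this order, with \<open>\<phi>\<close> running over
  the universal cover \<open>\<real>\<close> of the circle and \<open>0 < \<theta> < \<pi>\<close>.\<close>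

type_synonym field4 = "real \<Rightarrow> real \<Rightarrow> real \<Rightarrow> real \<Rightarrow> complex"

definition D_t :: "field4 \<Rightarrow> field4" where
  "D_t v t r \<phi> \<theta> = vector_derivative (\<lambda>x. v x r \<phi> \<theta>) (at t)"

definition D_r :: "field4 \<Rightarrow> field4" where
  "D_r v t r \<phi> \<theta> = vector_derivative (\<lambda>x. v t x \<phi> \<theta>) (at r)"

definition D_phi :: "field4 \<Rightarrow> field4" where
  "D_phi v t r \<phi> \<theta> = vector_derivative (\<lambda>x. v t r x \<theta>) (at \<phi>)"

definition D_theta :: "field4 \<Rightarrow> field4" where
  "D_theta v t r \<phi> \<theta> = vector_derivative (\<lambda>x. v t r \<phi> x) (at \<theta>)"

text \<open>The two first-order operators whose squares appear in the Teukolsky operator.\<close>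

definition radial_factor :: "real \<Rightarrow> real \<Rightarrow> real \<Rightarrow> field4 \<Rightarrow> field4" where
  "radial_factor m a s v t r \<phi> \<theta> =
     of_real (r^2 + a^2) * D_t v t r \<phi> \<theta> + of_real a * D_phi v t r \<phi> \<theta>
       - of_real ((r - m) * s) * v t r \<phi> \<theta>"

definition angular_factor :: "real \<Rightarrow> real \<Rightarrow> field4 \<Rightarrow> field4" where
  "angular_factor a s v t r \<phi> \<theta> =
     of_real (a * (sin \<theta>)^2) * D_t v t r \<phi> \<theta> + D_phi v t r \<phi> \<theta>
       + \<i> * of_real (s * cos \<theta>) * v t r \<phi> \<theta>"

definition Teukolsky :: "real \<Rightarrow> real \<Rightarrow> real \<Rightarrow> field4 \<Rightarrow> field4" where
  "Teukolsky m a s v t r \<phi> \<theta> =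
     - D_r (\<lambda>t r \<phi> \<theta>. of_real (mu m a r) * D_r v t r \<phi> \<theta>) t r \<phi> \<theta>
     + of_real (1 / mu m a r) * radial_factor m a s (radial_factor m a s v) t r \<phi> \<theta>
     + of_real (4 * s) * (of_real r + \<i> * of_real (a * cos \<theta>)) * D_t v t r \<phi> \<theta>
     - of_real (1 / sin \<theta>) *
         D_theta (\<lambda>t r \<phi> \<theta>. of_real (sin \<theta>) * D_theta v t r \<phi> \<theta>) t r \<phi> \<theta>
     - of_real (1 / (sin \<theta>)^2) * angular_factor a s (angular_factor a s v) t r \<phi> \<theta>"

section \<open>Mode solutions and quasinormal mode solutions\<close>

text \<open>\<open>e\<^bsup>-ik\<phi>\<^esup> w(r,\<theta>)\<close>, given for \<open>r > r\<^sub>+\<close> and \<open>0 < \<theta> < \<pi>\<close>, extends to a smooth function on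
  \<open>I \<times> S\<^sup>2\<close>, that is, across the poles and, if \<open>r\<^sub>+ \<in> I\<close>, up to the horizon.\<close>

definition extends_smoothly ::
    "real \<Rightarrow> real \<Rightarrow> int \<Rightarrow> real set \<Rightarrow> (real \<Rightarrow> real \<Rightarrow> complex) \<Rightarrow> bool" where
  "extends_smoothly m a k I w \<longleftrightarrow>
     (\<exists>F :: real \<times> (real^3) \<Rightarrow> complex. smooth_on (I \<times> sphere 0 1) F \<and>
        (\<forall>r>r_plus m a. \<forall>\<phi>. \<forall>\<theta>\<in>{0<..<pi}.
           F (r, sph \<phi> \<theta>) = exp (- \<i> * of_int k * of_real \<phi>) * w r \<theta>))"

text \<open>The coefficients of the operator are singular on the axis, so the equation is imposed on the
  dense open set \<open>0 < \<theta> < \<pi>\<close>.\<close>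

definition mode_solution ::
    "real \<Rightarrow> real \<Rightarrow> real \<Rightarrow> complex \<Rightarrow> int \<Rightarrow> (real \<Rightarrow> real \<Rightarrow> complex) \<Rightarrow> bool" where
  "mode_solution m a s \<sigma> k u \<longleftrightarrow>
     extends_smoothly m a k {r_plus m a<..} u \<and>
     (\<forall>t. \<forall>r>r_plus m a. \<forall>\<phi>. \<forall>\<theta>\<in>{0<..<pi}.
        Teukolsky m a s
          (\<lambda>t r \<phi> \<theta>. exp (- \<i> * of_real t * \<sigma> - \<i> * of_int k * of_real \<phi>) * u r \<theta>) t r \<phi> \<theta> = 0)"

text \<open>\<open>H\<close> is determined only up to an additive constant on each component of its domain.\<close>

definition phase_function ::
    "real \<Rightarrow> real \<Rightarrow> real \<Rightarrow> complex \<Rightarrow> int \<Rightarrow> (real \<Rightarrow> complex) \<Rightarrow> bool" where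
  "phase_function m a s \<sigma> k H \<longleftrightarrow>
     smooth_on (- {r_minus m a, r_plus m a}) H \<and>
     (\<forall>r. r \<notin> {r_minus m a, r_plus m a} \<longrightarrow>
        (H has_vector_derivative
           (\<i> * (of_real (r^2 + a^2) * \<sigma> + of_real a * of_int k) + of_real ((r - m) * s))
             / of_real (mu m a r)) (at r))"

definition r_ddr :: "(real \<Rightarrow> complex) \<Rightarrow> real \<Rightarrow> complex" where
  "r_ddr f r = of_real r * vector_derivative f (at r)"

definition conormal_at_infinity ::
    "real \<Rightarrow> real \<Rightarrow> (real \<Rightarrow> real \<Rightarrow> complex) \<Rightarrow> bool" where
  "conormal_at_infinity m a w \<longleftrightarrow>
     (\<exists>\<beta>::real. \<forall>j::nat. \<exists>C::real. \<forall>r>r_plus m a + 1. \<forall>\<theta>\<in>{0<..<pi}.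
        norm ((r_ddr ^^ j) (\<lambda>r. of_real (r powr \<beta>) * w r \<theta>) r) \<le> C)"

definition quasinormal_mode_solution ::
    "real \<Rightarrow> real \<Rightarrow> real \<Rightarrow> complex \<Rightarrow> int \<Rightarrow> (real \<Rightarrow> complex) \<Rightarrow> (real \<Rightarrow> real \<Rightarrow> complex) \<Rightarrow> bool" where
  "quasinormal_mode_solution m a s \<sigma> k H u \<longleftrightarrow>
     mode_solution m a s \<sigma> k u \<and>
     extends_smoothly m a k {r_plus m a..} (\<lambda>r \<theta>. exp (H r) * u r \<theta>) \<and>
     conormal_at_infinity m a (\<lambda>r \<theta>. exp (- H r) * u r \<theta>)"

end

(* The equation separates into a radial operator and the angular operator
   S = -(1/sin) d/dtheta (sin d/dtheta) + V, which is symmetric and bounded below.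
   A nonzero mode u spans, through its restrictions u(r, .), a subspace on which the Rayleigh quotient of S
   is minimized; compactness of the minimizing sequence yields X and a real lambda such that
   c(r) = int u(r, theta) X(theta) dtheta is not identically zero, solves the radial equation with S replaced
   by lambda, and inherits both boundary conditions.  No completeness of angular eigenfunctions is needed.

   For the radial equation, W = exp(H) c is smooth up to the horizon, and the Laplace transform f of exp(-2H) W
   (regularized at the horizon by integration by parts when s > 0, where the weight is not integrable)
   solves a second order equation with singular points 0 and -2 i sigma.
   Along rays leaving -2 i sigma at a small angle alpha, the flux Im(p g' conj g) of a rescaled transform g is
   monotone up to O(alpha) and tends to 0 at infinity, which as alpha tends to 0 forces f(-2 i sigma) = 0.
   The indicial equation at -2 i sigma then makes f flat there, so f = 0 and W = 0.  If 2s is a positive integer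
   the regularization may break down, and the derivative of W of order 2s, which solves the equation for -s,
   is used instead. *)
theory Submission
  imports Defs "HOL-Complex_Analysis.Complex_Analysis" "HOL-Real_Asymp.Real_Asymp"
begin

section \<open>Ordinary differential equations at a singular point\<close>

text \<open>Already for \<open>s = 0\<close> an energy estimate for the radial equation fails: the
  flux at the horizon has the sign of \<open>\<kappa>\<close>, in the application
  \<open>2 * m * \<rho> * \<sigma> + a * k\<close>, which may oppose that of \<open>\<sigma>\<close>
  (superradiance). The transform, a form of Whiting's integral transformation, exchanges it for the
  flux at -2 i \<sigma>, governed by \<open>TT 0\<close>, which is 4 i m \<sigma> and contains
  neither \<open>a\<close> nor \<open>k\<close>. Conormality gives only polynomial bounds, so the
  integral need not converge on the imaginary axis, where the transformed potential is real and the
  flux would be conserved; rays inside the half-plane restore convergence at the price of an error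
  O(\<alpha>). Derivatives of conormal functions gain decay, hence the transform and its derivatives
  stay bounded up to the axis away from 0, and limits at -2 i \<sigma> exist. The potential grows
  like d^2 z^2; for \<open>d = 0\<close> its leading term is 2 \<sigma> \<kappa> z, of either sign,
  which explains the extra rotation \<open>b\<close> in the flux. If also
  \<open>\<kappa> = 0\<close>, neither growing term remains, but then the horizon is a regular
  singular point of the radial equation and Taylor coefficients there suffice.\<close>

lemma has_real_derivative_inner:
  fixes f g :: "real \<Rightarrow> 'a::real_inner"
  assumes "(f has_vector_derivative f') (at t)" "(g has_vector_derivative g') (at t)"
  shows "((\<lambda>t. f t \<bullet> g t) has_real_derivative (f t \<bullet> g' + f' \<bullet> g t)) (at t)"
  using has_derivative_inner[OF assms[unfolded has_vector_derivative_def]]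
  by (simp add: has_field_derivative_def) (erule has_derivative_eq_rhs, simp add: fun_eq_iff algebra_simps)

lemma has_real_derivative_norm_squared:
  fixes f :: "real \<Rightarrow> 'a::real_inner"
  assumes "(f has_vector_derivative f') (at t)"
  shows "((\<lambda>t. (norm (f t))\<^sup>2) has_real_derivative 2 * (f t \<bullet> f')) (at t)"
  using has_real_derivative_inner[OF assms assms]
  by (simp add: power2_norm_eq_inner inner_commute)

lemma vector_derivative_bound:
  fixes f :: "real \<Rightarrow> 'a::real_normed_vector"
  assumes "convex S" "\<And>x. x \<in> S \<Longrightarrow> (f has_vector_derivative f' x) (at x within S)"
    and "\<And>x. x \<in> S \<Longrightarrow> norm (f' x) \<le> K" "x \<in> S" "y \<in> S"
  shows "norm (f x - f y) \<le> K * norm (x - y)"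
proof (rule differentiable_bound[OF assms(1) _ _ assms(4,5)])
  fix x assume x: "x \<in> S"
  show "(f has_derivative (\<lambda>h. h *\<^sub>R f' x)) (at x within S)"
    using assms(2)[OF x] by (simp add: has_vector_derivative_def)
  show "onorm (\<lambda>h. h *\<^sub>R f' x) \<le> K"
    using assms(3)[OF x] by (intro onorm_le) (simp add: mult.commute[of K] mult_left_mono)
qed

text \<open>The differential inequality makes \<open>E t / t ^ n\<close> nonincreasing once
  \<open>n \<ge> M\<close>, while flatness of order \<open>Suc n\<close> makes the same quotient
  O(t) at 0. A nonincreasing nonnegative function with limit 0 on the left end vanishes.\<close>

lemma singular_gronwall:
  fixes E E' :: "real \<Rightarrow> real"
  assumes der: "\<And>t. 0 < t \<Longrightarrow> t \<le> T \<Longrightarrow> (E has_real_derivative E' t) (at t)"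
    and grow: "\<And>t. 0 < t \<Longrightarrow> t \<le> T \<Longrightarrow> t * E' t \<le> M * E t"
    and nonneg: "\<And>t. 0 < t \<Longrightarrow> t \<le> T \<Longrightarrow> 0 \<le> E t"
    and flat: "\<And>N::nat. \<exists>C. \<forall>t. 0 < t \<longrightarrow> t \<le> T \<longrightarrow> E t \<le> C * t ^ N"
    and t: "0 < t" "t \<le> T"
  shows "E t = 0"
proof (rule ccontr)
  assume "E t \<noteq> 0"
  then have pos: "E t > 0" using nonneg[OF t] by simp
  obtain n :: nat where n: "M \<le> real n" using real_arch_simple by blast
  obtain C where C: "\<And>t. 0 < t \<Longrightarrow> t \<le> T \<Longrightarrow> E t \<le> C * t ^ Suc n"
    using flat[of "Suc n"] by blast
  define F where "F t = E t / t ^ n" for t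
  have Fpos: "F t > 0" using pos t by (simp add: F_def)
  have Fle: "F x \<le> C * x" if "0 < x" "x \<le> T" for x
    using C[OF that] that by (simp add: F_def field_simps)
  have Fle': "F t \<le> C * x" if x: "0 < x" "x \<le> t" for x
  proof -
    have "F t \<le> F x"
    proof (rule DERIV_nonpos_imp_nonincreasing[OF x(2)])
      fix y assume y: "x \<le> y" "y \<le> t"
      have y0: "0 < y" "y \<le> T" using x y t by auto
      have "(F has_real_derivative (E' y * y ^ n - E y * (real n * y ^ (n - 1))) / (y ^ n * y ^ n)) (at y)"
        unfolding F_def using y0 by (auto intro!: derivative_eq_intros der)
      moreover have "E' y * y ^ n - E y * (real n * y ^ (n - 1)) \<le> 0"
      proof -
        have "y * E' y \<le> real n * E y"
          using grow[OF y0] nonneg[OF y0] n by (meson mult_right_mono order_trans)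
        then have le: "(y * E' y) * y ^ n \<le> (real n * E y) * y ^ n" using y0 by (simp add: mult_right_mono)
        have "real n * y ^ n = y * (real n * y ^ (n - 1))" by (cases n) auto
        then have "(real n * E y) * y ^ n = y * (E y * (real n * y ^ (n - 1)))" by (cases n) auto
        moreover have "(y * E' y) * y ^ n = y * (E' y * y ^ n)" by simp
        ultimately have "y * (E' y * y ^ n) \<le> y * (E y * (real n * y ^ (n - 1)))"
          using le by (simp only:)
        then show ?thesis using y0 by simp
      qed
      ultimately show "\<exists>D. (F has_real_derivative D) (at y) \<and> D \<le> 0"
        using y0 by (intro exI conjI) (auto simp: divide_nonpos_nonneg)
    qed
    also have "F x \<le> C * x" using Fle x t by auto
    finally show ?thesis .
  qed
  have C0: "C > 0" using Fle'[of t] Fpos t by (smt (verit) mult_nonneg_nonpos2 zero_less_mult_iff)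
  define x where "x = min t (F t / (2 * C))"
  have "0 < x" "x \<le> t" using C0 Fpos t by (auto simp: x_def)
  from Fle'[OF this] have "F t \<le> C * x" .
  also have "C * x \<le> C * (F t / (2 * C))" unfolding x_def using C0 by (intro mult_left_mono) auto
  also have "\<dots> = F t / 2" using C0 by simp
  finally show False using Fpos by simp
qed

text \<open>A bounded derivative gives a Lipschitz function on \<open>{0<..T}\<close>, which extends
  continuously to the closure. This supplies the values of all derivatives at a singular point,
  where the equation itself gives no information.\<close>

lemma limit_at_right_if_derivative_bounded:
  fixes f f' :: "real \<Rightarrow> 'a::euclidean_space"
  assumes T: "0 < T"
    and der: "\<And>t. 0 < t \<Longrightarrow> t \<le> T \<Longrightarrow> (f has_vector_derivative f' t) (at t)"
    and bdd: "\<And>t. 0 < t \<Longrightarrow> t \<le> T \<Longrightarrow> norm (f' t) \<le> K"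
  shows "\<exists>L. (f \<longlongrightarrow> L) (at_right 0)"
proof -
  have K: "K \<ge> 0" using bdd[of T] T by (meson norm_ge_zero order_refl order_trans)
  have lip: "norm (f x - f y) \<le> K * norm (x - y)" if "x \<in> {0<..T}" "y \<in> {0<..T}" for x y
    by (rule vector_derivative_bound[where S = "{0<..T}" and f' = f'])
       (use that in \<open>auto intro: bdd has_vector_derivative_at_within[OF der]\<close>)
  have "K-lipschitz_on {0<..T} f"
    using K lip by (intro lipschitz_onI) (auto simp: dist_norm)
  then have "uniformly_continuous_on {0<..T} f" by (rule lipschitz_on_uniformly_continuous)
  then obtain g where g: "uniformly_continuous_on (closure {0<..T}) g" "\<And>x. x \<in> {0<..T} \<Longrightarrow> f x = g x"
    using uniformly_continuous_on_extension_on_closure by (metis (no_types, lifting))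
  have "closure {0<..T} = {0..T}" using T by simp
  then have "continuous_on {0..T} g" using g(1) uniformly_continuous_imp_continuous by force
  then have "(g \<longlongrightarrow> g 0) (at 0 within {0..T})" using T by (auto simp: continuous_on_def)
  then have "(g \<longlongrightarrow> g 0) (at_right 0)"
    using T by (metis at_within_Icc_at_right)
  moreover have "eventually (\<lambda>x. g x = f x) (at_right 0)"
    unfolding eventually_at_right[OF T] using g(2) T by (intro exI[of _ T]) auto
  ultimately have "(f \<longlongrightarrow> g 0) (at_right 0)" using tendsto_cong by fastforce
  then show ?thesis ..
qed

text \<open>One integration from 0 gains one power of \<open>t\<close>. The induction runs over all
  \<open>j\<close> at once, because order \<open>Suc N\<close> of \<open>f j\<close> comes from
  order \<open>N\<close> of \<open>f (Suc j)\<close>.\<close>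

lemma flat_if_derivatives_vanish:
  fixes f :: "nat \<Rightarrow> real \<Rightarrow> 'a::euclidean_space"
  assumes T: "0 < T"
    and der: "\<And>j t. 0 < t \<Longrightarrow> t \<le> T \<Longrightarrow> (f j has_vector_derivative f (Suc j) t) (at t)"
    and bdd: "\<And>j. \<exists>C. \<forall>t. 0 < t \<longrightarrow> t \<le> T \<longrightarrow> norm (f j t) \<le> C"
    and lim: "\<And>j. (f j \<longlongrightarrow> 0) (at_right 0)"
  shows "\<exists>C. \<forall>t. 0 < t \<longrightarrow> t \<le> T \<longrightarrow> norm (f j t) \<le> C * t ^ N"
proof (induction N arbitrary: j)
  case 0
  then show ?case using bdd by simp
next
  case (Suc N)
  obtain C where C: "\<And>t. 0 < t \<Longrightarrow> t \<le> T \<Longrightarrow> norm (f (Suc j) t) \<le> C * t ^ N"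
    using Suc[of "Suc j"] by blast
  have C0: "C \<ge> 0"
  proof (rule ccontr)
    assume "\<not> C \<ge> 0"
    then have "C * T ^ N < 0" using T by (intro mult_neg_pos) auto
    with order_trans[OF norm_ge_zero C[OF T order_refl]] show False by simp
  qed
  have main: "norm (f j t) \<le> C * t ^ Suc N" if t: "0 < t" "t \<le> T" for t
  proof -
    have ev: "eventually (\<lambda>e. norm (f j t - f j e) \<le> C * t ^ Suc N) (at_right 0)"
      unfolding eventually_at_right[OF t(1)]
    proof (intro exI[of _ t] conjI allI impI)
      fix e :: real assume e: "0 < e" "e < t"
      have "norm (f j t - f j e) \<le> (C * t ^ N) * norm (t - e)"
      proof (rule vector_derivative_bound[where S = "{e..t}" and f' = "f (Suc j)"])
        fix x assume x: "x \<in> {e..t}"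
        show "(f j has_vector_derivative f (Suc j) x) (at x within {e..t})"
          by (rule has_vector_derivative_at_within[OF der]) (use x e t in auto)
        have "norm (f (Suc j) x) \<le> C * x ^ N" using C x e t by auto
        also have "\<dots> \<le> C * t ^ N" using C0 x e by (intro mult_left_mono power_mono) auto
        finally show "norm (f (Suc j) x) \<le> C * t ^ N" .
      qed (use e in auto)
      also have "\<dots> \<le> (C * t ^ N) * t" using e C0 t by (intro mult_left_mono) auto
      finally show "norm (f j t - f j e) \<le> C * t ^ Suc N" by (simp add: mult_ac)
    qed (use t in auto)
    have "((\<lambda>e. norm (f j t - f j e)) \<longlongrightarrow> norm (f j t - 0)) (at_right 0)"
      by (rule tendsto_norm[OF tendsto_diff[OF tendsto_const lim]])
    from tendsto_upperbound[OF this ev] show ?thesis by simp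
  qed
  then show ?case by blast
qed

text \<open>The energy |f|^2 + t^2 |f'|^2 is invariant under the Euler scaling of a regular singular
  point, so the equation turns into \<open>t * E' \<le> (4 + 4 * K) * E\<close>. Vanishing of all
  derivatives at 0 makes the energy flat, and \<open>singular_gronwall\<close> applies.\<close>

lemma regular_singular_point_unique:
  fixes f :: "nat \<Rightarrow> real \<Rightarrow> complex"
  assumes T: "0 < T"
    and der: "\<And>j t. 0 < t \<Longrightarrow> t \<le> T \<Longrightarrow> (f j has_vector_derivative f (Suc j) t) (at t)"
    and bdd: "\<And>j. \<exists>C. \<forall>t. 0 < t \<longrightarrow> t \<le> T \<longrightarrow> norm (f j t) \<le> C"
    and lim: "\<And>j. (f j \<longlongrightarrow> 0) (at_right 0)"
    and ode: "\<And>t. 0 < t \<Longrightarrow> t \<le> T \<Longrightarrow>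
      of_real (t\<^sup>2) * f 2 t = A t * of_real t * f 1 t + B t * f 0 t"
    and A: "\<And>t. 0 < t \<Longrightarrow> t \<le> T \<Longrightarrow> norm (A t) \<le> K"
    and B: "\<And>t. 0 < t \<Longrightarrow> t \<le> T \<Longrightarrow> norm (B t) \<le> K"
    and t: "0 < t" "t \<le> T"
  shows "f 0 t = 0"
proof -
  define E where "E t = (norm (f 0 t))\<^sup>2 + t\<^sup>2 * (norm (f 1 t))\<^sup>2" for t
  define E' where "E' t = 2 * (f 0 t \<bullet> f 1 t) + (2 * t * (norm (f 1 t))\<^sup>2 + t\<^sup>2 * (2 * (f 1 t \<bullet> f 2 t)))" for t
  have K: "K \<ge> 0" using A[of T] T by (meson norm_ge_zero order_refl order_trans)
  have "E t = 0"
  proof (rule singular_gronwall[of T E E' "4 + 4 * K"])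
    fix t :: real assume t: "0 < t" "t \<le> T"
    have 1: "((\<lambda>t. (norm (f 0 t))\<^sup>2) has_real_derivative 2 * (f 0 t \<bullet> f 1 t)) (at t)"
      using has_real_derivative_norm_squared[OF der[OF t, of 0]] by simp
    have 2: "((\<lambda>t. (norm (f 1 t))\<^sup>2) has_real_derivative 2 * (f 1 t \<bullet> f 2 t)) (at t)"
      using has_real_derivative_norm_squared[OF der[OF t, of 1]] by (simp add: numeral_2_eq_2)
    show "(E has_real_derivative E' t) (at t)"
      unfolding E_def E'_def
      by (rule DERIV_cong[OF DERIV_add[OF 1 DERIV_mult[OF DERIV_pow[of 2] 2]]]) (simp add: algebra_simps)
    show "0 \<le> E t" by (simp add: E_def)
    define a b where "a = norm (f 0 t)" and "b = t * norm (f 1 t)"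
    have ab: "0 \<le> a" "0 \<le> b" using t by (auto simp: a_def b_def)
    have i1: "t * (f 0 t \<bullet> f 1 t) \<le> a * b"
      using norm_cauchy_schwarz[of "f 0 t" "f 1 t"] t by (simp add: a_def b_def mult_left_mono mult.left_commute)
    have "t\<^sup>2 * norm (f 2 t) = norm (of_real (t\<^sup>2) * f 2 t)" by (simp add: norm_mult norm_power)
    also have "\<dots> \<le> norm (A t * of_real t * f 1 t) + norm (B t * f 0 t)"
      unfolding ode[OF t] by (rule norm_triangle_ineq)
    also have "\<dots> \<le> K * b + K * a"
      using A[OF t] B[OF t] t by (auto simp: norm_mult a_def b_def mult.assoc intro!: add_mono mult_right_mono)
    finally have i2: "t\<^sup>2 * norm (f 2 t) \<le> K * b + K * a" .
    have "t * (t\<^sup>2 * (f 1 t \<bullet> f 2 t)) \<le> t * (t\<^sup>2 * (norm (f 1 t) * norm (f 2 t)))"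
      using t by (intro mult_left_mono norm_cauchy_schwarz) auto
    also have "\<dots> = b * (t\<^sup>2 * norm (f 2 t))" by (simp add: b_def)
    also have "\<dots> \<le> b * (K * b + K * a)" using ab i2 by (intro mult_left_mono)
    finally have i3: "t * (t\<^sup>2 * (f 1 t \<bullet> f 2 t)) \<le> b * (K * b + K * a)" .
    have i4: "2 * (a * b) \<le> a\<^sup>2 + b\<^sup>2" using sum_squares_bound[of a b] by simp
    have "t * E' t = 2 * (t * (f 0 t \<bullet> f 1 t)) + 2 * b\<^sup>2 + 2 * (t * (t\<^sup>2 * (f 1 t \<bullet> f 2 t)))"
      by (simp add: E'_def b_def algebra_simps power2_eq_square)
    also have "\<dots> \<le> 2 * (a * b) + 2 * b\<^sup>2 + 2 * (b * (K * b + K * a))" using i1 i3 by simp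
    also have "\<dots> = (1 + K) * (2 * (a * b)) + (2 + 2 * K) * b\<^sup>2" by (simp add: algebra_simps power2_eq_square)
    also have "\<dots> \<le> (1 + K) * (a\<^sup>2 + b\<^sup>2) + (2 + 2 * K) * b\<^sup>2" using i4 K by (intro add_right_mono mult_left_mono) auto
    also have "\<dots> \<le> (4 + 4 * K) * (a\<^sup>2 + b\<^sup>2)" using K by (simp add: algebra_simps)
    also have "a\<^sup>2 + b\<^sup>2 = E t" by (simp add: E_def a_def b_def power_mult_distrib)
    finally show "t * E' t \<le> (4 + 4 * K) * E t" .
  next
    fix N :: nat
    obtain C0 where C0: "\<And>t. 0 < t \<Longrightarrow> t \<le> T \<Longrightarrow> norm (f 0 t) \<le> C0 * t ^ N"
      using flat_if_derivatives_vanish[where f = f and T = T and j = 0 and N = N] T der bdd lim by blast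
    obtain C1 where C1: "\<And>t. 0 < t \<Longrightarrow> t \<le> T \<Longrightarrow> norm (f 1 t) \<le> C1 * t ^ N"
      using flat_if_derivatives_vanish[where f = f and T = T and j = 1 and N = N] T der bdd lim by blast
    show "\<exists>C. \<forall>t. 0 < t \<longrightarrow> t \<le> T \<longrightarrow> E t \<le> C * t ^ N"
    proof (intro exI allI impI)
      fix t :: real assume t: "0 < t" "t \<le> T"
      have h: "t ^ N * t ^ N \<le> T ^ N * t ^ N" using t by (intro mult_right_mono power_mono) auto
      have "(norm (f 0 t))\<^sup>2 \<le> (C0 * t ^ N)\<^sup>2" using C0[OF t] by (intro power_mono) auto
      also have "\<dots> = C0\<^sup>2 * (t ^ N * t ^ N)" by (simp add: power2_eq_square algebra_simps)
      also have "\<dots> \<le> C0\<^sup>2 * (T ^ N * t ^ N)" using h by (intro mult_left_mono) auto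
      finally have 1: "(norm (f 0 t))\<^sup>2 \<le> C0\<^sup>2 * (T ^ N * t ^ N)" .
      have "(norm (f 1 t))\<^sup>2 \<le> (C1 * t ^ N)\<^sup>2" using C1[OF t] by (intro power_mono) auto
      also have "\<dots> = C1\<^sup>2 * (t ^ N * t ^ N)" by (simp add: power2_eq_square algebra_simps)
      also have "\<dots> \<le> C1\<^sup>2 * (T ^ N * t ^ N)" using h by (intro mult_left_mono) auto
      finally have "t\<^sup>2 * (norm (f 1 t))\<^sup>2 \<le> T\<^sup>2 * (C1\<^sup>2 * (T ^ N * t ^ N))"
        using t by (intro mult_mono power_mono) auto
      with 1 show "E t \<le> (C0\<^sup>2 * T ^ N + T\<^sup>2 * C1\<^sup>2 * T ^ N) * t ^ N"
        by (simp add: E_def algebra_simps)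
    qed
  qed (use t in auto)
  then show ?thesis using t by (simp add: E_def add_nonneg_eq_0_iff)
qed

text \<open>Product-rule bookkeeping for the induction step below: the right side is what
  differentiation of the order \<open>N\<close> equation yields, the left side is the same sum
  collected in the shape of order \<open>1 + N\<close>.\<close>

lemma quadratic_ode_step_identity:  fixes X N f0 f1 f2 f3 :: complex
  shows "(p0 + p1 * X + p2 * X\<^sup>2) * f3
        + ((1 + N) * (p1 + 2 * p2 * X) + (q0 + q1 * X + q2 * X\<^sup>2)) * f2
        + ((1 + N) * N * p2 + (1 + N) * (q1 + 2 * q2 * X) + (r0 + r1 * X)) * f1
        + ((1 + N) * N * q2 + (1 + N) * r1) * f0
      = ((p0 + p1 * X + p2 * X\<^sup>2) * f3 + (p1 + 2 * p2 * X) * f2)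
      + ((N * (p1 + 2 * p2 * X) + (q0 + q1 * X + q2 * X\<^sup>2)) * f2
        + (N * (2 * p2) + (q1 + 2 * q2 * X)) * f1)
      + ((N * (N - 1) * p2 + N * (q1 + 2 * q2 * X) + (r0 + r1 * X)) * f1
        + (N * (2 * q2) + r1) * f0)
      + (N * (N - 1) * q2 + N * r1) * f0"
  by (simp add: ring_distribs)

text \<open>With quadratic \<open>p\<close>, \<open>q\<close> and linear \<open>r\<close> the
  Leibniz rule reaches only one order below \<open>n\<close>; for \<open>n = 0\<close> the term
  \<open>f (n - 1)\<close> has coefficient 0. It serves twice: for the recurrence of the limits at a
  singular point and for the derivative of order 2s.\<close>

lemma quadratic_ode_iterated_derivative:
  fixes f :: "nat \<Rightarrow> real \<Rightarrow> complex"
  assumes der: "\<And>j x. 0 < x \<Longrightarrow> (f j has_vector_derivative f (Suc j) x) (at x)"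
    and ode: "\<And>x. 0 < x \<Longrightarrow>
      (p0 + p1 * of_real x + p2 * of_real x ^ 2) * f 2 x + (q0 + q1 * of_real x + q2 * of_real x ^ 2) * f 1 x
        + (r0 + r1 * of_real x) * f 0 x = 0"
    and x: "0 < x"
  shows "(p0 + p1 * of_real x + p2 * of_real x ^ 2) * f (Suc (Suc n)) x
      + (of_nat n * (p1 + 2 * p2 * of_real x) + (q0 + q1 * of_real x + q2 * of_real x ^ 2)) * f (Suc n) x
      + (of_nat n * (of_nat n - 1) * p2 + of_nat n * (q1 + 2 * q2 * of_real x) + (r0 + r1 * of_real x)) * f n x
      + (of_nat n * (of_nat n - 1) * q2 + of_nat n * r1) * f (n - 1) x = 0"
  using x
proof (induction n arbitrary: x)
  case 0
  then show ?case using ode[of x] by (simp add: numeral_2_eq_2)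
next
  case (Suc n)
  define G where "G = (\<lambda>x::real. (p0 + p1 * of_real x + p2 * of_real x ^ 2) * f (Suc (Suc n)) x
      + (of_nat n * (p1 + 2 * p2 * of_real x) + (q0 + q1 * of_real x + q2 * of_real x ^ 2)) * f (Suc n) x
      + (of_nat n * (of_nat n - 1) * p2 + of_nat n * (q1 + 2 * q2 * of_real x) + (r0 + r1 * of_real x)) * f n x
      + (of_nat n * (of_nat n - 1) * q2 + of_nat n * r1) * f (n - 1) x)"
  define L where "L = (\<lambda>x. (of_nat n * (of_nat n - 1) * q2 + of_nat n * r1) * f (n - 1) x)"
  have last: "(L has_vector_derivative (of_nat n * (of_nat n - 1) * q2 + of_nat n * r1) * f n x) (at x)"
  proof (cases n)
    case (Suc k)
    show ?thesis unfolding L_def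
      by (rule has_vector_derivative_mult_right) (use der[OF Suc.prems, of k] in \<open>simp add: Suc\<close>)
  qed (simp add: L_def)
  have p: "((\<lambda>x. p0 + p1 * of_real x + p2 * of_real x ^ 2) has_vector_derivative p1 + 2 * p2 * of_real x) (at x)"
    by (rule has_vector_derivative_real_field) (auto intro!: derivative_eq_intros simp: algebra_simps)
  have q: "((\<lambda>x. of_nat n * (p1 + 2 * p2 * of_real x) + (q0 + q1 * of_real x + q2 * of_real x ^ 2)) has_vector_derivative
      of_nat n * (2 * p2) + (q1 + 2 * q2 * of_real x)) (at x)"
    by (rule has_vector_derivative_real_field) (auto intro!: derivative_eq_intros simp: algebra_simps)
  have r: "((\<lambda>x. of_nat n * (of_nat n - 1) * p2 + of_nat n * (q1 + 2 * q2 * of_real x) + (r0 + r1 * of_real x)) has_vector_derivative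
      of_nat n * (2 * q2) + r1) (at x)"
    by (rule has_vector_derivative_real_field) (auto intro!: derivative_eq_intros simp: algebra_simps)
  note d = der[OF Suc.prems]
  have "(G has_vector_derivative
      ((p0 + p1 * of_real x + p2 * of_real x ^ 2) * f (Suc (Suc (Suc n))) x
        + (p1 + 2 * p2 * of_real x) * f (Suc (Suc n)) x)
      + ((of_nat n * (p1 + 2 * p2 * of_real x) + (q0 + q1 * of_real x + q2 * of_real x ^ 2)) * f (Suc (Suc n)) x
        + (of_nat n * (2 * p2) + (q1 + 2 * q2 * of_real x)) * f (Suc n) x)
      + ((of_nat n * (of_nat n - 1) * p2 + of_nat n * (q1 + 2 * q2 * of_real x) + (r0 + r1 * of_real x)) * f (Suc n) x
        + (of_nat n * (2 * q2) + r1) * f n x)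
      + (of_nat n * (of_nat n - 1) * q2 + of_nat n * r1) * f n x) (at x)" (is "(_ has_vector_derivative ?D) _")
    unfolding G_def
    by (rule has_vector_derivative_add[OF has_vector_derivative_add[OF has_vector_derivative_add[OF
      has_vector_derivative_mult[OF p d[of "Suc (Suc n)"]] has_vector_derivative_mult[OF q d[of "Suc n"]]]
      has_vector_derivative_mult[OF r d[of n]]] last[unfolded L_def]])
  moreover have "(G has_vector_derivative 0) (at x)"
  proof (rule has_vector_derivative_transform_within_open[where f = "\<lambda>_. 0" and S = "{0<..}"])
    fix y :: real assume "y \<in> {0<..}"
    then have "0 < y" by simp
    from Suc.IH[OF this] show "0 = G y" by (simp add: G_def)
  qed (use Suc.prems in auto)
  ultimately have D0: "?D = 0" using vector_derivative_unique_at by blast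
  have De: "?D = (p0 + p1 * of_real x + p2 * (of_real x)\<^sup>2) * f (Suc (Suc (Suc n))) x
        + ((1 + of_nat n) * (p1 + 2 * p2 * of_real x) + (q0 + q1 * of_real x + q2 * (of_real x)\<^sup>2)) * f (Suc (Suc n)) x
        + ((1 + of_nat n) * of_nat n * p2 + (1 + of_nat n) * (q1 + 2 * q2 * of_real x) + (r0 + r1 * of_real x)) * f (Suc n) x
        + ((1 + of_nat n) * of_nat n * q2 + (1 + of_nat n) * r1) * f n x"
    using quadratic_ode_step_identity[where X = "of_real x" and N = "of_nat n" and ?f0.0 = "f n x" and ?f1.0 = "f (Suc n) x"
      and ?f2.0 = "f (Suc (Suc n)) x" and ?f3.0 = "f (Suc (Suc (Suc n))) x" and ?p0.0 = p0 and ?p1.0 = p1 and ?p2.0 = p2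
      and ?q0.0 = q0 and ?q1.0 = q1 and ?q2.0 = q2 and ?r0.0 = r0 and ?r1.0 = r1] by (rule sym)
  show ?case unfolding of_nat_Suc add_diff_cancel_left' diff_Suc_1 by (rule trans[OF sym[OF De] D0])
qed

section \<open>Laplace transforms on the half-line\<close>

lemma powr_le_exp:
  fixes e :: real
  assumes "e > 0"
  shows "\<exists>K. \<forall>x\<ge>1. x powr N \<le> K * exp (e * x)"
proof -
  obtain n :: nat where n: "max N 1 \<le> real n" using real_arch_simple by blast
  then have n0: "n > 0" by auto
  show ?thesis
  proof (intro exI allI impI)
    fix x :: real assume x: "x \<ge> 1"
    have "x powr N \<le> x powr real n" using n x by (intro powr_mono) auto
    also have "\<dots> = x ^ n" using x by (simp add: powr_realpow)
    also have "\<dots> = (real n / e) ^ n * (e * x / real n) ^ n" using assms n0 by (simp add: power_mult_distrib[symmetric])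
    also have "\<dots> \<le> (real n / e) ^ n * exp (e * x / real n) ^ n"
      using exp_ge_add_one_self[of "e * x / real n"] assms x n0
      by (intro mult_left_mono power_mono) (linarith | simp)+
    also have "exp (e * x / real n) ^ n = exp (e * x)" using n0 by (simp add: exp_of_nat_mult[symmetric])
    finally show "x powr N \<le> (real n / e) ^ n * exp (e * x)" .
  qed
qed

lemma set_integrable_Ioi_dominated:
  fixes h :: "real \<Rightarrow> 'a::{banach, second_countable_topology}" and g :: "real \<Rightarrow> real"
  assumes "continuous_on {c<..} h" "set_integrable lborel {c<..} g" "\<And>x. c < x \<Longrightarrow> norm (h x) \<le> g x"
  shows "set_integrable lborel {c<..} h"
    and "norm (LINT x:{c<..}|lborel. h x) \<le> (LINT x:{c<..}|lborel. g x)"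
proof -
  show h: "set_integrable lborel {c<..} h"
  proof (rule set_integrable_bound[OF assms(2)])
    show "set_borel_measurable lborel {c<..} h"
      unfolding set_borel_measurable_def
      using borel_measurable_continuous_on_indicator[OF _ assms(1)] by simp
    show "AE x in lborel. x \<in> {c<..} \<longrightarrow> norm (h x) \<le> norm (g x)"
      using assms(3) by (force intro!: AE_I2)
  qed
  have "norm (LINT x:{c<..}|lborel. h x) \<le> (LINT x:{c<..}|lborel. norm (h x))"
    by (rule set_integral_norm_bound[OF h])
  also have "\<dots> \<le> (LINT x:{c<..}|lborel. g x)"
    by (rule set_integral_mono[OF set_integrable_norm[OF h] assms(2)]) (use assms(3) in auto)
  finally show "norm (LINT x:{c<..}|lborel. h x) \<le> (LINT x:{c<..}|lborel. g x)" .
qed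

lemma set_integral_Ioi_FTC_nonneg:
  fixes f F :: "real \<Rightarrow> real"
  assumes "\<And>x. c < x \<Longrightarrow> (F has_real_derivative f x) (at x)" "\<And>x. c < x \<Longrightarrow> isCont f x"
    "\<And>x. c < x \<Longrightarrow> 0 \<le> f x" "(F \<longlongrightarrow> A) (at_right c)" "(F \<longlongrightarrow> B) at_top"
  shows "set_integrable lborel {c<..} f" "(LINT x:{c<..}|lborel. f x) = B - A"
  using interval_integral_FTC_nonneg[of "ereal c" \<infinity> F f A B] assms
  by (auto simp: ereal_tendsto_simps interval_integral_to_infinity_eq)

lemma set_integral_Ioi_FTC:
  fixes f F :: "real \<Rightarrow> complex"
  assumes "\<And>x. c < x \<Longrightarrow> (F has_vector_derivative f x) (at x)" "continuous_on {c<..} f"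
    "set_integrable lborel {c<..} f" "(F \<longlongrightarrow> A) (at_right c)" "(F \<longlongrightarrow> B) at_top"
  shows "(LINT x:{c<..}|lborel. f x) = B - A"
proof -
  have "isCont f x" if "c < x" for x
    using assms(2) that by (simp add: continuous_on_eq_continuous_at)
  then show ?thesis
    using interval_integral_FTC_integrable[of "ereal c" \<infinity> F f A B] assms
    by (auto simp: ereal_tendsto_simps interval_integral_to_infinity_eq)
qed

lemma set_integral_Ioi_exp:
  fixes a :: real
  assumes "a > 0"
  shows "set_integrable lborel {c<..} (\<lambda>x. exp (-a * x))"
    and "(LINT x:{c<..}|lborel. exp (-a * x)) = exp (-a * c) / a"
proof -
  have 1: "((\<lambda>x. - exp (-a * x) / a) has_real_derivative exp (-a * x)) (at x)" for x
    using assms by (auto intro!: derivative_eq_intros)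
  have 2: "((\<lambda>x. - exp (-a * x) / a) \<longlongrightarrow> - exp (-a * c) / a) (at_right c)"
    using assms by (auto intro!: tendsto_intros)
  have 3: "((\<lambda>x. - exp (-a * x) / a) \<longlongrightarrow> 0) at_top"
    using assms by real_asymp
  from set_integral_Ioi_FTC_nonneg[OF 1 _ _ 2 3]
  show "set_integrable lborel {c<..} (\<lambda>x. exp (-a * x))"
    and "(LINT x:{c<..}|lborel. exp (-a * x)) = exp (-a * c) / a" by auto
qed

lemma set_integral_Ioi_exp_dominated:
  fixes h :: "real \<Rightarrow> complex"
  assumes "a > 0" "continuous_on {c<..} h" "\<And>x. c < x \<Longrightarrow> norm (h x) \<le> K * exp (-a * x)"
  shows "set_integrable lborel {c<..} h"
    and "norm (LINT x:{c<..}|lborel. h x) \<le> K * exp (-a * c) / a"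
proof -
  have i: "set_integrable lborel {c<..} (\<lambda>x. K * exp (-a * x))"
    using set_integral_Ioi_exp(1)[OF assms(1)] by (intro set_integrable_mult_right) auto
  show "set_integrable lborel {c<..} h"
    by (rule set_integrable_Ioi_dominated(1)[OF assms(2) i assms(3)])
  have "norm (LINT x:{c<..}|lborel. h x) \<le> (LINT x:{c<..}|lborel. K * exp (-a * x))"
    by (rule set_integrable_Ioi_dominated(2)[OF assms(2) i assms(3)])
  also have "\<dots> = K * exp (-a * c) / a" using set_integral_Ioi_exp(2)[OF assms(1)] by simp
  finally show "norm (LINT x:{c<..}|lborel. h x) \<le> K * exp (-a * c) / a" .
qed

text \<open>Arbitrarily small exponential rates make the transform holomorphic on the whole right
  half-plane. The bound is required from \<open>x > 0\<close> on, so boundedness near the origin is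
  included.\<close>

definition subexponential :: "(real \<Rightarrow> complex) \<Rightarrow> bool" where
  "subexponential \<phi> \<longleftrightarrow> continuous_on {0<..} \<phi> \<and> (\<forall>e>0. \<exists>K. \<forall>x>0. norm (\<phi> x) \<le> K * exp (e * x))"

definition laplace :: "(real \<Rightarrow> complex) \<Rightarrow> complex \<Rightarrow> complex" where
  "laplace \<phi> z = (LINT x:{0<..}|lborel. exp (- z * of_real x) * \<phi> x)"

lemma subexponentialD:
  assumes "subexponential \<phi>" "e > 0"
  obtains K where "K \<ge> 0" "\<And>x. x > 0 \<Longrightarrow> norm (\<phi> x) \<le> K * exp (e * x)"
proof -
  obtain K where K: "\<And>x. x > 0 \<Longrightarrow> norm (\<phi> x) \<le> K * exp (e * x)"
    using assms unfolding subexponential_def by blast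
  have "0 \<le> K * exp (e * 1)" using order_trans[OF norm_ge_zero K[of 1]] by simp
  then have "K \<ge> 0" by (simp add: zero_le_mult_iff)
  with K that show thesis by blast
qed

lemma subexponential_continuous: "subexponential \<phi> \<Longrightarrow> continuous_on {0<..} \<phi>"
  by (simp add: subexponential_def)

lemma subexponential_mult_x:
  assumes "subexponential \<phi>"
  shows "subexponential (\<lambda>x. of_real x * \<phi> x)"
  unfolding subexponential_def
proof (intro conjI allI impI)
  show "continuous_on {0<..} (\<lambda>x. of_real x * \<phi> x)"
    by (intro continuous_intros subexponential_continuous[OF assms])
  fix e :: real assume e: "e > 0"
  obtain K where K: "K \<ge> 0" "\<And>x. x > 0 \<Longrightarrow> norm (\<phi> x) \<le> K * exp (e / 2 * x)"
    using subexponentialD[OF assms, of "e / 2"] e by auto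
  show "\<exists>K. \<forall>x>0. norm (of_real x * \<phi> x) \<le> K * exp (e * x)"
  proof (intro exI allI impI)
    fix x :: real assume x: "x > 0"
    have "e / 2 * x \<le> exp (e / 2 * x)" using exp_ge_add_one_self[of "e / 2 * x"] by linarith
    then have "x \<le> 2 / e * exp (e / 2 * x)" using e by (simp add: field_simps)
    then have "norm (of_real x * \<phi> x) \<le> (2 / e * exp (e / 2 * x)) * (K * exp (e / 2 * x))"
      unfolding norm_mult using K x by (intro mult_mono) auto
    also have "\<dots> = 2 / e * K * exp (e * x)" by (simp add: exp_add[symmetric] field_simps)
    finally show "norm (of_real x * \<phi> x) \<le> (2 / e * K) * exp (e * x)" .
  qed
qed

lemma subexponential_laplace_integrable:
  assumes "subexponential \<phi>" "Re z > 0"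
  shows "set_integrable lborel {0<..} (\<lambda>x. exp (- z * of_real x) * \<phi> x)"
proof -
  obtain K where K: "K \<ge> 0" "\<And>x. x > 0 \<Longrightarrow> norm (\<phi> x) \<le> K * exp (Re z / 2 * x)"
    using subexponentialD[OF assms(1), of "Re z / 2"] assms(2) by auto
  show ?thesis
  proof (rule set_integral_Ioi_exp_dominated(1)[of "Re z / 2" _ _ K])
    show "continuous_on {0<..} (\<lambda>x. exp (- z * of_real x) * \<phi> x)"
      by (intro continuous_intros subexponential_continuous[OF assms(1)])
    fix x :: real assume x: "0 < x"
    have "norm (exp (- z * of_real x) * \<phi> x) \<le> exp (- Re z * x) * (K * exp (Re z / 2 * x))"
      unfolding norm_mult using K(2)[OF x] by (intro mult_mono) auto
    also have "\<dots> = K * exp (- (Re z / 2) * x)" by (simp add: exp_add[symmetric])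
    finally show "norm (exp (- z * of_real x) * \<phi> x) \<le> K * exp (- (Re z / 2) * x)" .
  qed (use assms in auto)
qed

text \<open>The second-order Taylor remainder of exp (- h x) is at most |h|^2 x^2 exp (|h| x), so
  the difference quotient misses the claimed derivative by O(|h|).\<close>

lemma laplace_has_field_derivative:
  assumes "subexponential \<phi>" and z: "Re z > 0"
  shows "(laplace \<phi> has_field_derivative - laplace (\<lambda>x. of_real x * \<phi> x) z) (at z)"
proof -
  define a where "a = Re z"
  have a: "a > 0" using z by (simp add: a_def)
  define \<psi> where "\<psi> x = of_real x * (of_real x * \<phi> x)" for x :: real
  have se1: "subexponential (\<lambda>x. of_real x * \<phi> x)" by (rule subexponential_mult_x[OF assms(1)])
  have se2: "subexponential \<psi>" unfolding \<psi>_def by (rule subexponential_mult_x[OF se1])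
  \<comment> \<open>Budget of rates: the decay \<open>a\<close> loses \<open>a / 2\<close> to exp
    (|h| x) and \<open>a / 4\<close> to \<open>\<psi>\<close>, which leaves \<open>a / 4\<close> for
    integrability.\<close>
  obtain K where K: "K \<ge> 0" "\<And>x. x > 0 \<Longrightarrow> norm (\<psi> x) \<le> K * exp (a / 4 * x)"
    using subexponentialD[OF se2, of "a / 4"] a by auto
  define C where "C = K / (a / 4)"
  have bound: "norm (laplace \<phi> (z + h) - laplace \<phi> z + h * laplace (\<lambda>x. of_real x * \<phi> x) z) \<le> C * (norm h)\<^sup>2"
    if h: "norm h < a / 2" for h
  proof -
    have zh: "Re (z + h) > 0" using abs_Re_le_cmod[of h] h a by (simp add: a_def)
    define r where "r x = exp (- (z + h) * of_real x) * \<phi> x - exp (- z * of_real x) * \<phi> x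
        + h * (exp (- z * of_real x) * (of_real x * \<phi> x))" for x :: real
    note i1 = subexponential_laplace_integrable[OF assms(1) zh]
    note i2 = subexponential_laplace_integrable[OF assms(1) z]
    note i3 = subexponential_laplace_integrable[OF se1 z]
    have i3': "set_integrable lborel {0<..} (\<lambda>x. h * (exp (- z * of_real x) * (of_real x * \<phi> x)))"
      by (rule set_integrable_mult_right) (use i3 in auto)
    have "(LINT x:{0<..}|lborel. r x) = laplace \<phi> (z + h) - laplace \<phi> z + h * laplace (\<lambda>x. of_real x * \<phi> x) z"
      unfolding r_def laplace_def
      using set_integral_add(2)[OF set_integral_diff(1)[OF i1 i2] i3'] set_integral_diff(2)[OF i1 i2]
      by simp
    moreover have "norm (LINT x:{0<..}|lborel. r x) \<le> ((norm h)\<^sup>2 * K) * exp (- (a / 4) * 0) / (a / 4)"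
    proof (rule set_integral_Ioi_exp_dominated(2))
      show "a / 4 > 0" using a by simp
      show "continuous_on {0<..} r" unfolding r_def
        by (intro continuous_intros subexponential_continuous[OF assms(1)])
      fix x :: real assume x: "0 < x"
      have "r x = exp (- z * of_real x) * (exp (- (h * of_real x)) - (1 + - (h * of_real x))) * \<phi> x"
      proof -
        have "exp (- (z + h) * of_real x) = exp (- z * of_real x) * exp (- (h * of_real x))"
          by (simp add: exp_add[symmetric] algebra_simps)
        then show ?thesis unfolding r_def by (simp add: algebra_simps)
      qed
      then have "norm (r x) = exp (- a * x) * norm (exp (- (h * of_real x)) - (1 + - (h * of_real x))) * norm (\<phi> x)"
        by (simp add: norm_mult a_def)
      also have "norm (exp (- (h * of_real x)) - (1 + - (h * of_real x))) \<le> exp (norm (- (h * of_real x))) * norm (- (h * of_real x)) ^ 2"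
        using Taylor_exp_field[of "- (h * of_real x)" 1] by (simp add: numeral_2_eq_2)
      also have "\<dots> = exp (norm h * x) * ((norm h)\<^sup>2 * x\<^sup>2)" using x by (simp add: norm_mult power_mult_distrib)
      also have "exp (norm h * x) \<le> exp (a / 2 * x)" using h x by (simp add: mult_right_mono)
      finally have "norm (r x) \<le> exp (- a * x) * (exp (a / 2 * x) * ((norm h)\<^sup>2 * x\<^sup>2)) * norm (\<phi> x)"
        by (simp add: mult_left_mono mult_right_mono)
      also have "\<dots> = exp (- (a / 2) * x) * (norm h)\<^sup>2 * norm (\<psi> x)"
        using x by (simp add: \<psi>_def norm_mult power2_eq_square exp_add[symmetric])
      also have "\<dots> \<le> exp (- (a / 2) * x) * (norm h)\<^sup>2 * (K * exp (a / 4 * x))"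
        using K(2)[OF x] by (intro mult_left_mono) auto
      also have "\<dots> = (norm h)\<^sup>2 * K * exp (- (a / 4) * x)" by (simp add: exp_add[symmetric])
      finally show "norm (r x) \<le> (norm h)\<^sup>2 * K * exp (- (a / 4) * x)" .
    qed
    ultimately show ?thesis by (simp add: C_def mult_ac)
  qed
  show ?thesis
    unfolding has_field_derivative_iff
  proof (rule Lim_null_comparison[THEN iffD1[OF LIM_zero_iff]])
    show "eventually (\<lambda>y. norm ((laplace \<phi> y - laplace \<phi> z) / (y - z) - - laplace (\<lambda>x. of_real x * \<phi> x) z) \<le> C * norm (y - z)) (at z)"
      unfolding eventually_at
    proof (intro exI conjI ballI impI)
      show "0 < a / 2" using a by simp
      fix y assume y: "y \<noteq> z \<and> dist y z < a / 2"
      have n: "norm (y - z) > 0" using y by simp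
      have "(laplace \<phi> y - laplace \<phi> z) / (y - z) - - laplace (\<lambda>x. of_real x * \<phi> x) z
        = (laplace \<phi> (z + (y - z)) - laplace \<phi> z + (y - z) * laplace (\<lambda>x. of_real x * \<phi> x) z) / (y - z)"
        using y by (simp add: field_simps)
      also have "norm \<dots> \<le> C * (norm (y - z))\<^sup>2 / norm (y - z)"
        unfolding norm_divide using bound[of "y - z"] y by (intro divide_right_mono) (auto simp: dist_norm)
      also have "\<dots> = C * norm (y - z)" using n by (simp add: power2_eq_square)
      finally show "norm ((laplace \<phi> y - laplace \<phi> z) / (y - z) - - laplace (\<lambda>x. of_real x * \<phi> x) z) \<le> C * norm (y - z)" .
    qed
    have "((\<lambda>y. C * norm (y - z)) \<longlongrightarrow> C * norm (z - z)) (at z)" by (intro tendsto_intros)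
    then show "((\<lambda>y. C * norm (y - z)) \<longlongrightarrow> 0) (at z)" by simp
  qed
qed

text \<open>Lerch's theorem by Weierstrass approximation. The values at positive integers are the
  integrals of powers of exp (-x) against \<open>exp (- x) * \<phi> x\<close>; hence every
  continuous function of exp (-x) integrates to 0 against it, and a multiple of (the real or
  imaginary part of) \<open>\<phi>\<close> itself can be taken as test function.\<close>

lemma laplace_injective:
  assumes "subexponential \<phi>" and zero: "\<And>t. t > 0 \<Longrightarrow> laplace \<phi> (of_real t) = 0" and x: "x > 0"
    and bdd: "\<And>x. 0 < x \<Longrightarrow> x \<le> 1 \<Longrightarrow> norm (\<phi> x) \<le> B"
  shows "\<phi> x = 0"
proof -
  note cont = subexponential_continuous[OF assms(1)]
  note int1 = subexponential_laplace_integrable[OF assms(1), of 1, simplified]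
  have poly: "(LINT x:{0<..}|lborel. of_real (\<Sum>i\<le>n. a i * exp (-x) ^ i) * (exp (- of_real x) * \<phi> x)) = 0"
    (is "?I = 0") for a :: "nat \<Rightarrow> real" and n
  proof -
    have e: "of_real (\<Sum>i\<le>n. a i * exp (-x) ^ i) * (exp (- of_real x) * \<phi> x)
        = (\<Sum>i\<le>n. of_real (a i) * (exp (- of_real (real i + 1) * of_real x) * \<phi> x))" for x :: real
    proof -
      have "of_real (a i * exp (-x) ^ i) * (exp (- of_real x) * \<phi> x)
          = of_real (a i) * (exp (- of_real (real i + 1) * of_real x) * \<phi> x)" for i
      proof -
        have "exp (- of_real (real i + 1) * of_real x :: complex) = exp (of_nat i * (- of_real x) + - of_real x)"
          by (simp add: algebra_simps)
        also have "\<dots> = exp (- of_real x) ^ i * exp (- of_real x)"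
          by (simp only: exp_add exp_of_nat_mult)
        finally show ?thesis by (simp add: exp_of_real[symmetric])
      qed
      then show ?thesis by (simp only: of_real_sum sum_distrib_right)
    qed
    have i: "set_integrable lborel {0<..} (\<lambda>x. of_real (a i) * (exp (- of_real (real i + 1) * of_real x) * \<phi> x))" for i
      by (rule set_integrable_mult_right) (rule subexponential_laplace_integrable[OF assms(1)], simp)
    have "?I = (LINT x:{0<..}|lborel. (\<Sum>i\<le>n. of_real (a i) * (exp (- of_real (real i + 1) * of_real x) * \<phi> x)))"
      by (simp only: e)
    also have "\<dots> = (\<Sum>i\<le>n. (LINT x:{0<..}|lborel. of_real (a i) * (exp (- of_real (real i + 1) * of_real x) * \<phi> x)))"
      using i unfolding set_lebesgue_integral_def set_integrable_def scaleR_sum_right by (intro Bochner_Integration.integral_sum) auto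
    also have "\<dots> = (\<Sum>i\<le>n. of_real (a i) * laplace \<phi> (of_real (real i + 1)))"
      unfolding set_integral_mult_right laplace_def by simp
    also have "\<dots> = 0" using zero[of "real i + 1" for i] by (intro sum.neutral ballI) (simp only: mult_zero_right of_nat_0_le_iff add_nonneg_pos zero_less_one)
    finally show ?thesis .
  qed
  define M where "M = (LINT x:{0<..}|lborel. norm (exp (- of_real x) * \<phi> x))"
  have cts: "(LINT x:{0<..}|lborel. of_real (g (exp (-x))) * (exp (- of_real x) * \<phi> x)) = 0"
    if g: "continuous_on {0..1} g" for g :: "real \<Rightarrow> real"
  proof -
    have "norm (LINT x:{0<..}|lborel. of_real (g (exp (-x))) * (exp (- of_real x) * \<phi> x)) \<le> e * M" if e: "e > 0" for e
    proof -
      obtain p where p: "real_polynomial_function p" "\<And>y. y \<in> {0..1} \<Longrightarrow> \<bar>g y - p y\<bar> < e"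
        using Stone_Weierstrass_real_polynomial_function[OF compact_Icc g e] by auto
      obtain a n where an: "p = (\<lambda>x. \<Sum>i\<le>n. a i * x ^ i)"
        using p(1) unfolding real_polynomial_function_iff_sum by blast
      have gc: "continuous_on {0<..} (\<lambda>x. g (exp (-x)))"
        by (rule continuous_on_compose2[OF g]) (auto intro!: continuous_intros)
      have pc: "continuous_on {0<..} (\<lambda>x. p (exp (-x)))"
        unfolding an by (intro continuous_intros)
      have ne: "set_integrable lborel {0<..} (\<lambda>x. e * norm (exp (- of_real x) * \<phi> x))"
        by (rule set_integrable_mult_right) (rule set_integrable_norm[OF int1])
      have dc: "continuous_on {0<..} (\<lambda>x. of_real (g (exp (-x)) - p (exp (-x))) * (exp (- of_real x) * \<phi> x))"
        by (intro continuous_intros gc pc cont)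
      have db: "norm (of_real (g (exp (-x)) - p (exp (-x))) * (exp (- of_real x) * \<phi> x)) \<le> e * norm (exp (- of_real x) * \<phi> x)"
        if "0 < x" for x
        unfolding norm_mult[of "of_real _"] using p(2)[of "exp (-x)"] that by (intro mult_right_mono) (auto simp del: of_real_diff)
      have pcc: "continuous_on {0<..} (\<lambda>x. of_real (p (exp (-x))) * (exp (- of_real x) * \<phi> x))"
        by (intro continuous_intros pc cont)
      obtain G where G: "\<And>y. y \<in> {0..1} \<Longrightarrow> norm (p y) \<le> G"
      proof -
        have "continuous_on {0..1} p" unfolding an by (intro continuous_intros)
        then have "bounded (p ` {0..1})" by (intro compact_imp_bounded compact_continuous_image) auto
        then show thesis using that unfolding bounded_iff by blast
      qed
      have pint: "set_integrable lborel {0<..} (\<lambda>x. of_real (p (exp (-x))) * (exp (- of_real x) * \<phi> x))"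
      proof (rule set_integrable_Ioi_dominated(1)[OF pcc])
        show "set_integrable lborel {0<..} (\<lambda>x. G * norm (exp (- of_real x) * \<phi> x))"
          by (rule set_integrable_mult_right) (rule set_integrable_norm[OF int1])
        fix x :: real assume x: "0 < x"
        have "norm (p (exp (-x))) \<le> G" using x by (intro G) auto
        then show "norm (of_real (p (exp (-x))) * (exp (- of_real x) * \<phi> x)) \<le> G * norm (exp (- of_real x) * \<phi> x)"
          unfolding norm_mult[of "of_real _"] by (intro mult_right_mono) auto
      qed
      have "(LINT x:{0<..}|lborel. of_real (g (exp (-x))) * (exp (- of_real x) * \<phi> x))
        = (LINT x:{0<..}|lborel. of_real (g (exp (-x)) - p (exp (-x))) * (exp (- of_real x) * \<phi> x)
            + of_real (p (exp (-x))) * (exp (- of_real x) * \<phi> x))"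
        by (simp add: algebra_simps)
      also have "\<dots> = (LINT x:{0<..}|lborel. of_real (g (exp (-x)) - p (exp (-x))) * (exp (- of_real x) * \<phi> x))
            + (LINT x:{0<..}|lborel. of_real (p (exp (-x))) * (exp (- of_real x) * \<phi> x))"
        by (rule set_integral_add(2)[OF set_integrable_Ioi_dominated(1)[OF dc ne db] pint])
      also have "(LINT x:{0<..}|lborel. of_real (p (exp (-x))) * (exp (- of_real x) * \<phi> x)) = 0"
        unfolding an by (rule poly)
      finally show ?thesis
        using set_integrable_Ioi_dominated(2)[OF dc ne db] by (simp add: M_def)
    qed
    moreover have "M \<ge> 0" unfolding M_def set_lebesgue_integral_def by (rule Bochner_Integration.integral_nonneg) auto
    ultimately have "norm (LINT x:{0<..}|lborel. of_real (g (exp (-x))) * (exp (- of_real x) * \<phi> x)) \<le> 0 + e" if "e > 0" for e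
    proof -
      have "e / (M + 1) * M \<le> e" using \<open>M \<ge> 0\<close> \<open>e > 0\<close> by (simp add: field_simps)
      then show ?thesis
        using \<open>\<And>e. 0 < e \<Longrightarrow> _ \<le> e * M\<close>[of "e / (M + 1)"] \<open>M \<ge> 0\<close> \<open>e > 0\<close> by fastforce
    qed
    from field_le_epsilon[OF this] show ?thesis by simp
  qed
  have part: "f (\<phi> x) = 0"
    if f: "bounded_linear f" and fle: "\<And>w. \<bar>f w\<bar> \<le> norm w" and fm: "\<And>r w. f (of_real r * w) = r * f w"
    for f :: "complex \<Rightarrow> real"
  proof -
    \<comment> \<open>In the variable y = exp (-x) this is the function \<open>f (\<phi> x)\<close>.
      The factors \<open>y\<close> and \<open>1 - y\<close> force continuity at the two ends, i.e.
      at infinity and at the origin, where only bounds on \<open>\<phi>\<close> are known.\<close>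
    define g where "g y = y * (1 - y) * f (\<phi> (- ln y))" for y :: real
    have fc: "continuous_on {0<..} (\<lambda>x. f (\<phi> x))"
      by (rule bounded_linear.continuous_on[OF f cont])
    have lc: "continuous_on {0<..<1} (\<lambda>y. f (\<phi> (- ln y)))"
      by (rule continuous_on_compose2[OF fc]) (auto intro!: continuous_intros)
    \<comment> \<open>At rate 1/2 the growth costs 1 / sqrt y, so the factor \<open>y\<close> still
      leaves sqrt y, which vanishes at 0.\<close>
    obtain K where K: "K \<ge> 0" "\<And>x. x > 0 \<Longrightarrow> norm (\<phi> x) \<le> K * exp (1 / 2 * x)"
      using subexponentialD[OF assms(1), of "1 / 2"] by auto
    have gb: "\<bar>g y\<bar> \<le> K * (sqrt y * \<bar>1 - y\<bar>)" if y: "y \<in> {0..1}" for y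
    proof (cases "y = 0 \<or> y = 1")
      case False
      then have y: "0 < y" "y < 1" using y by auto
      have "\<bar>f (\<phi> (- ln y))\<bar> \<le> K * exp (1 / 2 * (- ln y))"
        using order_trans[OF fle K(2)[of "- ln y"]] y by auto
      also have "exp (1 / 2 * (- ln y)) = 1 / sqrt y"
        using y by (simp add: exp_minus ln_sqrt[symmetric] field_simps)
      finally have "\<bar>y * (1 - y)\<bar> * \<bar>f (\<phi> (- ln y))\<bar> \<le> \<bar>y * (1 - y)\<bar> * (K * (1 / sqrt y))"
        by (intro mult_left_mono) auto
      also have "\<dots> = K * ((y / sqrt y) * \<bar>1 - y\<bar>)" using y by (simp add: abs_mult)
      also have "y / sqrt y = sqrt y" using y by (simp add: real_div_sqrt)
      finally show ?thesis by (simp add: g_def abs_mult)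
    qed (auto simp: g_def K)
    have gcont: "continuous_on {0..1} g"
      unfolding continuous_on_eq_continuous_within
    proof
      fix y :: real assume y: "y \<in> {0..1}"
      show "continuous (at y within {0..1}) g"
      proof (cases "y = 0 \<or> y = 1")
        case True
        then have g0: "g y = 0" by (auto simp: g_def)
        have "((\<lambda>z. K * (sqrt z * \<bar>1 - z\<bar>)) \<longlongrightarrow> K * (sqrt y * \<bar>1 - y\<bar>)) (at y within {0..1})"
          by (intro tendsto_intros)
        then have "((\<lambda>z. K * (sqrt z * \<bar>1 - z\<bar>)) \<longlongrightarrow> 0) (at y within {0..1})" using True by auto
        then have "(g \<longlongrightarrow> 0) (at y within {0..1})"
        proof (rule Lim_null_comparison[rotated])
          show "eventually (\<lambda>z. norm (g z) \<le> K * (sqrt z * \<bar>1 - z\<bar>)) (at y within {0..1})"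
            unfolding eventually_at_filter using gb by (intro always_eventually allI impI) (simp only: real_norm_def)
        qed
        then show ?thesis by (simp add: continuous_within g0)
      next
        case False
        then have "y \<in> {0<..<1}" using y by auto
        moreover have "continuous_on {0<..<1} g" unfolding g_def by (intro continuous_intros lc)
        ultimately have "isCont g y" by (simp add: continuous_on_eq_continuous_at)
        then show ?thesis by (rule continuous_at_imp_continuous_at_within)
      qed
    qed
    \<comment> \<open>The test function turns the vanishing integral into that of a nonnegative
      continuous function, positive wherever \<open>f (\<phi> x)\<close> is nonzero.\<close>
    define q where "q x = exp (-x) * (1 - exp (-x)) * exp (-x) * (f (\<phi> x))\<^sup>2" for x
    have qe: "f (of_real (g (exp (-x))) * (exp (- of_real x) * \<phi> x)) = q x" for x
    proof -
      have "of_real (g (exp (-x))) * (exp (- of_real x) * \<phi> x) = of_real (g (exp (-x)) * exp (-x)) * \<phi> x"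
        by (simp add: exp_of_real[symmetric])
      then show ?thesis by (simp only: fm) (simp add: g_def q_def power2_eq_square)
    qed
    obtain Gb where Gb: "\<And>y. y \<in> {0..1} \<Longrightarrow> norm (g y) \<le> Gb"
      using compact_continuous_image[OF gcont compact_Icc] by (meson bounded_iff compact_imp_bounded imageI)
    have gi: "set_integrable lborel {0<..} (\<lambda>x. of_real (g (exp (-x))) * (exp (- of_real x) * \<phi> x))"
    proof (rule set_integrable_Ioi_dominated(1))
      show "continuous_on {0<..} (\<lambda>x. of_real (g (exp (-x))) * (exp (- of_real x) * \<phi> x))"
        by (intro continuous_intros cont continuous_on_compose2[OF gcont, of _ "\<lambda>x. exp (-x)"]) auto
      show "set_integrable lborel {0<..} (\<lambda>x. Gb * norm (exp (- of_real x) * \<phi> x))"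
        by (rule set_integrable_mult_right) (rule set_integrable_norm[OF int1])
      fix x :: real assume x: "0 < x"
      have "norm (g (exp (-x))) \<le> Gb" using x by (intro Gb) auto
      then show "norm (of_real (g (exp (-x))) * (exp (- of_real x) * \<phi> x)) \<le> Gb * norm (exp (- of_real x) * \<phi> x)"
        unfolding norm_mult[of "of_real _"] by (intro mult_right_mono) auto
    qed
    have qi: "set_integrable lborel {0<..} q" and q0: "(LINT x:{0<..}|lborel. q x) = 0"
    proof -
      have "integrable lborel (\<lambda>x. f (indicator {0<..} x *\<^sub>R (of_real (g (exp (-x))) * (exp (- of_real x) * \<phi> x))))"
        by (rule integrable_bounded_linear[OF f gi[unfolded set_integrable_def]])
      moreover have e: "f (indicator {0<..} x *\<^sub>R (of_real (g (exp (-x))) * (exp (- of_real x) * \<phi> x))) = indicator {0<..} x *\<^sub>R q x" for x :: real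
        by (simp only: linear_scale[OF bounded_linear.linear[OF f]] qe)
      ultimately show "set_integrable lborel {0<..} q" by (simp only: set_integrable_def)
      have "(LINT x:{0<..}|lborel. q x) = (LINT x|lborel. f (indicator {0<..} x *\<^sub>R (of_real (g (exp (-x))) * (exp (- of_real x) * \<phi> x))))"
        by (simp only: set_lebesgue_integral_def e)
      also have "\<dots> = f (LINT x:{0<..}|lborel. (of_real (g (exp (-x))) * (exp (- of_real x) * \<phi> x)))"
        unfolding set_lebesgue_integral_def by (rule integral_bounded_linear[OF f gi[unfolded set_integrable_def]])
      also have "\<dots> = 0" using cts[OF gcont] linear_0[OF bounded_linear.linear[OF f]] by simp
      finally show "(LINT x:{0<..}|lborel. q x) = 0" .
    qed
    have qn: "0 \<le> q x" if "0 < x" for x using that by (simp add: q_def)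
    have "q x = 0"
    proof (rule has_integral_0_cbox_imp_0[where a = x and b = "x + 1" and f = q and x = x])
      have "cbox x (x + 1) \<subseteq> {0<..}" using x by auto
      then have "continuous_on (cbox x (x + 1)) (\<lambda>x. f (\<phi> x))" by (rule continuous_on_subset[OF fc])
      then show "continuous_on (cbox x (x + 1)) q" unfolding q_def by (intro continuous_intros)
      show "\<And>y. y \<in> box x (x + 1) \<Longrightarrow> 0 \<le> q y" using x qn by (auto simp: box_real)
      have si: "set_integrable lborel {x..x+1} q" using qi by (rule set_integrable_subset) (use x in auto)
      have "(LINT y:{x..x+1}|lborel. q y) \<le> (LINT y:{0<..}|lborel. q y)"
        using si qi qn x unfolding set_lebesgue_integral_def set_integrable_def
        by (intro Bochner_Integration.integral_mono) (auto simp: indicator_def)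
      moreover have "0 \<le> (LINT y:{x..x+1}|lborel. q y)"
        using qn x unfolding set_lebesgue_integral_def by (intro Bochner_Integration.integral_nonneg) (auto simp: indicator_def)
      ultimately have "(LINT y:{x..x+1}|lborel. q y) = 0" using q0 by simp
      then show "(q has_integral 0) (cbox x (x + 1))"
        using set_borel_integral_eq_integral[OF si] by (simp add: has_integral_iff)
    qed auto
    then show ?thesis using x by (simp add: q_def)
  qed
  have "Re (\<phi> x) = 0" by (rule part[of Re]) (auto intro: bounded_linear_Re abs_Re_le_cmod)
  moreover have "Im (\<phi> x) = 0" by (rule part[of Im]) (auto intro: bounded_linear_Im abs_Im_le_cmod)
  ultimately show ?thesis by (simp add: complex_eq_iff)
qed

section \<open>Symbols at infinity\<close>

text \<open>Symbols of order \<open>N\<close> with \<open>n\<close> controlled derivatives, each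
  lowering the order by one. Asking for some derivative \<open>h'\<close> carries differentiability
  along, and the finite count \<open>n\<close> is what integrations by parts consume.\<close>

primrec symb :: "nat \<Rightarrow> real \<Rightarrow> (real \<Rightarrow> complex) \<Rightarrow> bool" where
  "symb 0 N h \<longleftrightarrow> (\<exists>C. \<forall>x>1. norm (h x) \<le> C * x powr N)"
| "symb (Suc n) N h \<longleftrightarrow> (\<exists>C. \<forall>x>1. norm (h x) \<le> C * x powr N) \<and>
     (\<exists>h'. (\<forall>x>1. (h has_vector_derivative h' x) (at x)) \<and> symb n (N - 1) h')"

lemma symb_bound:
  assumes "symb n N h"
  obtains C where "C \<ge> 0" "\<And>x. x > 1 \<Longrightarrow> norm (h x) \<le> C * x powr N"
proof -
  obtain C where C: "\<And>x. x > 1 \<Longrightarrow> norm (h x) \<le> C * x powr N"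
    using assms by (cases n) auto
  have "0 \<le> C * 2 powr N" using order_trans[OF norm_ge_zero C[of 2]] by simp
  then have "C \<ge> 0" by (simp add: zero_le_mult_iff)
  with C that show thesis by blast
qed

lemma symb_Suc: "symb (Suc n) N h \<Longrightarrow> symb n N h"
proof (induction n arbitrary: N h)
  case (Suc n)
  then show ?case by (metis symb.simps(2))
qed auto

lemma symb_cong:
  assumes "\<And>x. x > 1 \<Longrightarrow> h x = g x" "symb n N h"
  shows "symb n N g"
proof (cases n)
  case 0
  then show ?thesis using assms by auto
next
  case (Suc k)
  then obtain C h' where C: "\<forall>x>1. norm (h x) \<le> C * x powr N"
    and h': "\<And>x. x > 1 \<Longrightarrow> (h has_vector_derivative h' x) (at x)" "symb k (N - 1) h'"
    using assms(2) by auto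
  have "(g has_vector_derivative h' x) (at x)" if "x > 1" for x
    by (rule has_vector_derivative_transform_within_open[OF h'(1)[OF that], of "{1<..}"]) (use that assms(1) in auto)
  then show ?thesis unfolding Suc symb.simps using C assms(1) h'(2) by metis
qed

lemma symb_mono:
  assumes "N \<le> M" "symb n N h"
  shows "symb n M h"
  using assms
proof (induction n arbitrary: N M h)
  have b: "\<exists>C. \<forall>x>1. norm (h x) \<le> C * x powr M" if NM: "N \<le> M" and sN: "symb n N h" for n N M h
  proof -
    obtain C where C: "C \<ge> 0" "\<And>x. x > 1 \<Longrightarrow> norm (h x) \<le> C * x powr N" using symb_bound[OF sN] by blast
    have "norm (h x) \<le> C * x powr M" if "x > 1" for x
    proof -
      have "norm (h x) \<le> C * x powr N" by (rule C(2)[OF that])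
      also have "\<dots> \<le> C * x powr M" using C(1) NM that by (intro mult_left_mono powr_mono) auto
      finally show ?thesis .
    qed
    then show ?thesis by blast
  qed
  { case 0
    show ?case unfolding symb.simps(1) by (rule b[OF 0]) }
  { case (Suc n)
    obtain h' where "\<forall>x>1. (h has_vector_derivative h' x) (at x)" "symb n (N - 1) h'"
      using Suc.prems(2) by auto
    moreover have "symb n (M - 1) h'" by (rule Suc.IH[of "N - 1"]) (use Suc.prems calculation in auto)
    ultimately show ?case using b[OF Suc.prems] by auto }
qed

lemma symb_add:
  assumes "symb n N f" "symb n N g"
  shows "symb n N (\<lambda>x. f x + g x)"
  using assms
proof (induction n arbitrary: N f g)
  have b: "\<exists>C. \<forall>x>1. norm (f x + g x) \<le> C * x powr N" if sf: "symb n N f" and sg: "symb n N g" for n N f g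
  proof -
    obtain C where C: "C \<ge> 0" "\<And>x. x > 1 \<Longrightarrow> norm (f x) \<le> C * x powr N" using symb_bound[OF sf] by blast
    obtain D where D: "D \<ge> 0" "\<And>x. x > 1 \<Longrightarrow> norm (g x) \<le> D * x powr N" using symb_bound[OF sg] by blast
    have "norm (f x + g x) \<le> (C + D) * x powr N" if "x > 1" for x
      using norm_triangle_ineq[of "f x" "g x"] C(2)[OF that] D(2)[OF that] by (simp add: distrib_right)
    then show ?thesis by blast
  qed
  { case 0
    show ?case unfolding symb.simps(1) by (rule b[OF 0]) }
  { case (Suc n)
    obtain f' g' where "\<forall>x>1. (f has_vector_derivative f' x) (at x)" "symb n (N - 1) f'"
      "\<forall>x>1. (g has_vector_derivative g' x) (at x)" "symb n (N - 1) g'"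
      using Suc.prems by auto
    then have "\<forall>x>1. ((\<lambda>x. f x + g x) has_vector_derivative f' x + g' x) (at x)" "symb n (N - 1) (\<lambda>x. f' x + g' x)"
      using Suc.IH by (auto intro: has_vector_derivative_add)
    then show ?case using b[OF Suc.prems] by auto }
qed

lemma symb_mult:
  assumes "symb n N f" "symb n M g"
  shows "symb n (N + M) (\<lambda>x. f x * g x)"
  using assms
proof (induction n arbitrary: N M f g)
  have b: "\<exists>C. \<forall>x>1. norm (f x * g x) \<le> C * x powr (N + M)" if sf: "symb n N f" and sg: "symb n M g" for n N M f g
  proof -
    obtain C where C: "C \<ge> 0" "\<And>x. x > 1 \<Longrightarrow> norm (f x) \<le> C * x powr N" using symb_bound[OF sf] by blast
    obtain D where D: "D \<ge> 0" "\<And>x. x > 1 \<Longrightarrow> norm (g x) \<le> D * x powr M" using symb_bound[OF sg] by blast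
    have "norm (f x * g x) \<le> (C * D) * x powr (N + M)" if "x > 1" for x
    proof -
      have "norm (f x * g x) \<le> (C * x powr N) * (D * x powr M)"
        unfolding norm_mult using C D that by (intro mult_mono) auto
      then show ?thesis by (simp add: powr_add mult_ac)
    qed
    then show ?thesis by blast
  qed
  { case 0
    show ?case unfolding symb.simps(1) by (rule b[OF 0]) }
  { case (Suc n)
    obtain f' g' where *: "\<forall>x>1. (f has_vector_derivative f' x) (at x)" "symb n (N - 1) f'"
      "\<forall>x>1. (g has_vector_derivative g' x) (at x)" "symb n (M - 1) g'"
      using Suc.prems by auto
    have "\<forall>x>1. ((\<lambda>x. f x * g x) has_vector_derivative f x * g' x + f' x * g x) (at x)"
      using * by (auto intro: has_vector_derivative_mult)
    moreover have "symb n (N + (M - 1)) (\<lambda>x. f x * g' x)" "symb n ((N - 1) + M) (\<lambda>x. f' x * g x)"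
      using Suc.IH symb_Suc[OF Suc.prems(1)] symb_Suc[OF Suc.prems(2)] * by blast+
    then have "symb n (N + M - 1) (\<lambda>x. f x * g' x + f' x * g x)"
      by (intro symb_add) (simp_all add: algebra_simps)
    ultimately show ?case using b[OF Suc.prems] by auto }
qed

lemma symb_zero: "symb n N (\<lambda>_. 0)"
proof (induction n arbitrary: N)
  case 0
  show ?case by (auto intro: exI[of _ 0])
next
  case (Suc n)
  then show ?case by (auto intro!: exI[of _ 0] exI[of _ "\<lambda>_. 0"])
qed

lemma symb_const: "symb n 0 (\<lambda>_. c)"
  using symb_zero by (cases n) (auto intro!: exI[of _ "norm c"] exI[of _ "\<lambda>_. 0"])

lemma symb_of_real: "symb n 1 of_real"
proof (cases n)
  case 0
  then show ?thesis by (auto intro!: exI[of _ 1])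
next
  case (Suc k)
  have "((\<lambda>x. of_real x :: complex) has_vector_derivative 1) (at x)" for x :: real
    by (rule has_vector_derivative_real_field) (auto intro!: derivative_eq_intros)
  then show ?thesis using symb_const[of k 1] Suc by (auto intro!: exI[of _ 1] exI[of _ "\<lambda>_. 1"])
qed

lemma symb_cmult: "symb n N f \<Longrightarrow> symb n N (\<lambda>x. c * f x)"
  using symb_mult[OF symb_const[of n c], of N f] by simp

text \<open>The lower bound is ellipticity. The induction rests on (1/f)' = - (1/f)^2 f', a product
  of order - N - N + (N - 1).\<close>

lemma symb_inverse:
  assumes "symb n N f" "c > 0" "\<And>x. x > 1 \<Longrightarrow> norm (f x) \<ge> c * x powr N"
  shows "symb n (- N) (\<lambda>x. 1 / f x)"
  using assms(1)
proof (induction n)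
  have pos: "f x \<noteq> 0" if "x > 1" for x 
  proof -
    have "0 < c * x powr N" using assms(2) that by (intro mult_pos_pos) auto
    also have "\<dots> \<le> norm (f x)" by (rule assms(3)[OF that])
    finally show ?thesis by simp
  qed
  have b: "\<exists>C. \<forall>x>1. norm (1 / f x) \<le> C * x powr (- N)"
  proof (intro exI allI impI)
    fix x :: real assume x: "x > 1"
    have "norm (1 / f x) = 1 / norm (f x)" by (simp add: norm_divide)
    also have "\<dots> \<le> 1 / (c * x powr N)" using assms(2) assms(3)[OF x] pos[OF x] x by (intro divide_left_mono) (auto intro!: mult_pos_pos)
    also have "\<dots> = (1 / c) * x powr (- N)" by (simp add: powr_minus_divide)
    finally show "norm (1 / f x) \<le> (1 / c) * x powr (- N)" .
  qed
  { case 0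
    show ?case using b by auto }
  { case (Suc n)
    obtain f' where f': "\<And>x. x > 1 \<Longrightarrow> (f has_vector_derivative f' x) (at x)" "symb n (N - 1) f'"
      using Suc.prems by auto
    have i: "symb n (- N) (\<lambda>x. 1 / f x)" by (rule Suc.IH[OF symb_Suc[OF Suc.prems]])
    have "symb n (- N + (- N + (N - 1))) (\<lambda>x. (1 / f x) * ((1 / f x) * f' x))"
      by (intro symb_mult i f')
    then have sy: "symb n (- N - 1) (\<lambda>x. - 1 * ((1 / f x) * ((1 / f x) * f' x)))"
      by (intro symb_cmult) simp
    have dv: "((\<lambda>x. 1 / f x) has_vector_derivative - 1 * ((1 / f x) * ((1 / f x) * f' x))) (at x)" if "x > 1" for x
    proof -
      have "((\<lambda>x. inverse (f x)) has_derivative (\<lambda>h. - (inverse (f x) * (h *\<^sub>R f' x) * inverse (f x)))) (at x)"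
        by (rule Deriv.has_derivative_inverse[OF pos[OF that] f'(1)[OF that, unfolded has_vector_derivative_def]])
      moreover have "(\<lambda>h. - (inverse (f x) * (h *\<^sub>R f' x) * inverse (f x)))
          = (\<lambda>h. h *\<^sub>R (- 1 * ((1 / f x) * ((1 / f x) * f' x))))"
        by (simp add: fun_eq_iff divide_inverse mult_ac)
      ultimately show ?thesis
        unfolding has_vector_derivative_def by (simp add: divide_inverse)
    qed
    show ?case unfolding symb.simps by (intro conjI b exI[of _ "\<lambda>x. - 1 * ((1 / f x) * ((1 / f x) * f' x))"] allI impI dv sy) }
qed

lemma symb_derivative:
  assumes "symb (Suc n) N f" "\<And>x. x > 1 \<Longrightarrow> (f has_vector_derivative f' x) (at x)"
  shows "symb n (N - 1) f'"
proof -
  obtain h where h: "\<And>x. x > 1 \<Longrightarrow> (f has_vector_derivative h x) (at x)" "symb n (N - 1) h"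
    using assms(1) by auto
  have "h x = f' x" if "x > 1" for x using vector_derivative_unique_at[OF h(1)[OF that] assms(2)[OF that]] .
  then show ?thesis using symb_cong h(2) by blast
qed

lemma symb_continuous:
  assumes "symb (Suc n) N f"
  shows "continuous_on {1<..} f"
proof -
  obtain h where h: "\<And>x. x > 1 \<Longrightarrow> (f has_vector_derivative h x) (at x)"
    using assms by auto
  show ?thesis by (rule continuous_on_vector_derivative[of _ _ h], rule has_vector_derivative_at_within[OF h]) simp
qed

text \<open>Nonstationary phase: each integration by parts costs a factor 1 / |z|, at most
  \<open>1 / c\<close>, and lowers the order of \<open>h\<close> by one, until it is below -1 and
  the integral converges absolutely. Since then only |exp (- z x)| \<le> 1 is used, the bound is
  uniform up to the imaginary axis. The start at 2 keeps the endpoint inside the domain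
  \<open>x > 1\<close> of the symbol.\<close>

lemma symb_oscillatory_integral_bounded:
  assumes "c > 0" "N < real n - 1" "symb (Suc n) N h"
  shows "\<exists>K. \<forall>z. Re z > 0 \<longrightarrow> norm z \<ge> c \<longrightarrow> norm (LINT x:{2<..}|lborel. exp (- z * of_real x) * h x) \<le> K"
  using assms(2,3)
proof (induction n arbitrary: N h)
  case 0
  obtain C where C: "C \<ge> 0" "\<And>x. x > 1 \<Longrightarrow> norm (h x) \<le> C * x powr N" using symb_bound 0(2) by blast
  have N: "N + 1 < 0" using 0 by simp
  have d: "((\<lambda>x. C * x powr (N + 1) / (N + 1)) has_real_derivative C * x powr N) (at x)" if "2 < x" for x
  proof -
    have "((\<lambda>x. x powr (N + 1)) has_real_derivative (N + 1) * x powr (N + 1 - 1)) (at x)"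
      using that by (intro has_real_derivative_powr) auto
    from DERIV_cdivide[OF DERIV_cmult[OF this, of C], of "N + 1"] show ?thesis using N by simp
  qed
  have c: "isCont (\<lambda>x. C * x powr N) x" if "2 < x" for x
    using that by (intro continuous_intros) auto
  have l: "((\<lambda>x. C * x powr (N + 1) / (N + 1)) \<longlongrightarrow> C * 2 powr (N + 1) / (N + 1)) (at_right 2)"
    using N by (intro tendsto_intros) auto
  have u: "((\<lambda>x. C * x powr (N + 1) / (N + 1)) \<longlongrightarrow> 0) at_top"
    using N by real_asymp
  have gi: "set_integrable lborel {2<..} (\<lambda>x. C * x powr N)"
    by (rule set_integral_Ioi_FTC_nonneg(1)[OF d c _ l u]) (use C in auto)
  show ?case
  proof (intro exI allI impI)
    fix z :: complex assume z: "Re z > 0"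
    show "norm (LINT x:{2<..}|lborel. exp (- z * of_real x) * h x) \<le> (LINT x:{2<..}|lborel. C * x powr N)"
    proof (rule set_integrable_Ioi_dominated(2)[OF _ gi])
      show "continuous_on {2<..} (\<lambda>x. exp (- z * of_real x) * h x)"
        by (intro continuous_intros continuous_on_subset[OF symb_continuous[OF 0(2)]]) auto
      fix x :: real assume x: "2 < x"
      have "norm (exp (- z * of_real x)) \<le> 1" using z x by simp
      then have "norm (exp (- z * of_real x) * h x) \<le> 1 * (C * x powr N)"
        unfolding norm_mult using C(2)[of x] x by (intro mult_mono) auto
      then show "norm (exp (- z * of_real x) * h x) \<le> C * x powr N" by simp
    qed
  qed
next
  case (Suc n)
  obtain h' where h': "\<And>x. x > 1 \<Longrightarrow> (h has_vector_derivative h' x) (at x)" "symb (Suc n) (N - 1) h'"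
    using Suc.prems(2) by auto
  obtain K where K: "\<And>z. Re z > 0 \<Longrightarrow> norm z \<ge> c \<Longrightarrow> norm (LINT x:{2<..}|lborel. exp (- z * of_real x) * h' x) \<le> K"
    using Suc.IH[OF _ h'(2)] Suc.prems(1) by auto
  obtain C where C: "C \<ge> 0" "\<And>x. x > 1 \<Longrightarrow> norm (h x) \<le> C * x powr N" using symb_bound Suc(3) by blast
  obtain D where D: "D \<ge> 0" "\<And>x. x > 1 \<Longrightarrow> norm (h' x) \<le> D * x powr (N - 1)" using symb_bound h'(2) by blast
  have hc: "continuous_on {1<..} h" by (rule symb_continuous[OF Suc.prems(2)])
  have hc': "continuous_on {1<..} h'" by (rule symb_continuous[OF h'(2)])
  have int: "set_integrable lborel {2<..} (\<lambda>x. exp (- z * of_real x) * q x)"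
    if z: "Re z > 0" and q: "continuous_on {1<..} q" "\<And>x. x > 1 \<Longrightarrow> norm (q x) \<le> B * x powr M" and B: "B \<ge> 0"
    for z q B M
  proof -
    obtain L where L: "\<And>x. x \<ge> 1 \<Longrightarrow> x powr M \<le> L * exp (Re z / 2 * x)"
      using powr_le_exp[of "Re z / 2" M] z by auto
    show ?thesis
    proof (rule set_integral_Ioi_exp_dominated(1)[of "Re z / 2" _ _ "B * L"])
      show "continuous_on {2<..} (\<lambda>x. exp (- z * of_real x) * q x)"
        by (intro continuous_intros continuous_on_subset[OF q(1)]) auto
      fix x :: real assume x: "2 < x"
      have "norm (q x) \<le> B * (L * exp (Re z / 2 * x))"
        using q(2)[of x] L[of x] x B by (meson mult_left_mono order_trans less_imp_le one_less_numeral_iff semiring_norm(76) less_trans)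
      then have "norm (exp (- z * of_real x) * q x) \<le> exp (- Re z * x) * (B * (L * exp (Re z / 2 * x)))"
        unfolding norm_mult by (intro mult_mono) auto
      also have "\<dots> = B * L * exp (- (Re z / 2) * x)" by (simp add: exp_add[symmetric])
      finally show "norm (exp (- z * of_real x) * q x) \<le> B * L * exp (- (Re z / 2) * x)" .
    qed (use z in auto)
  qed
  show ?case
  proof (intro exI allI impI)
    fix z :: complex assume z: "Re z > 0" "norm z \<ge> c"
    have z0: "z \<noteq> 0" using z by auto
    define F where "F x = - exp (- z * of_real x) * h x / z" for x :: real
    have ed: "((\<lambda>x. - exp (- z * of_real x) / z) has_vector_derivative exp (- z * of_real x)) (at x)" for x :: real
      by (rule has_vector_derivative_real_field) (use z0 in \<open>auto intro!: derivative_eq_intros\<close>)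
    have Fd: "(F has_vector_derivative (- exp (- z * of_real x) / z) * h' x + exp (- z * of_real x) * h x) (at x)" if "2 < x" for x
    proof -
      have "F = (\<lambda>x. (- exp (- z * of_real x) / z) * h x)" by (auto simp: F_def)
      then show ?thesis using has_vector_derivative_mult[OF ed h'(1)] that by auto
    qed
    have i1: "set_integrable lborel {2<..} (\<lambda>x. exp (- z * of_real x) * h x)" by (rule int[OF z(1) hc C(2,1)])
    have i2: "set_integrable lborel {2<..} (\<lambda>x. exp (- z * of_real x) * h' x)" by (rule int[OF z(1) hc' D(2,1)])
    have i2': "set_integrable lborel {2<..} (\<lambda>x. (- 1 / z) * (exp (- z * of_real x) * h' x))"
      by (rule set_integrable_mult_right) (rule i2)
    have e: "(- exp (- z * of_real x) / z) * h' x + exp (- z * of_real x) * h x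
        = (- 1 / z) * (exp (- z * of_real x) * h' x) + exp (- z * of_real x) * h x" for x :: real by simp
    have "isCont h 2" using hc by (simp add: continuous_on_eq_continuous_at)
    then have "isCont F 2" unfolding F_def using z0 by (intro continuous_intros) auto
    then have l: "(F \<longlongrightarrow> F 2) (at_right 2)" by (simp add: isCont_def filterlim_at_split)
    have u: "(F \<longlongrightarrow> 0) at_top"
    proof (rule Lim_null_comparison)
      show "eventually (\<lambda>x. norm (F x) \<le> C / norm z * (exp (- Re z * x) * x powr N)) at_top"
        using eventually_gt_at_top[of 1]
      proof eventually_elim
        case (elim x)
        have "norm (F x) = exp (- Re z * x) * norm (h x) / norm z" by (simp add: F_def norm_mult norm_divide)
        also have "\<dots> \<le> exp (- Re z * x) * (C * x powr N) / norm z"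
          using C(2)[OF elim] by (intro divide_right_mono mult_left_mono) auto
        finally show ?case by (simp add: mult_ac)
      qed
      have "((\<lambda>x. exp (- Re z * x) * x powr N) \<longlongrightarrow> 0) at_top" using z(1) by real_asymp
      from tendsto_mult_left[OF this, of "C / norm z"]
      show "((\<lambda>x. C / norm z * (exp (- Re z * x) * x powr N)) \<longlongrightarrow> 0) at_top" by simp
    qed
    have "(LINT x:{2<..}|lborel. (- exp (- z * of_real x) / z) * h' x + exp (- z * of_real x) * h x) = 0 - F 2"
    proof (rule set_integral_Ioi_FTC[OF Fd _ _ l u])
      show "continuous_on {2<..} (\<lambda>x. (- exp (- z * of_real x) / z) * h' x + exp (- z * of_real x) * h x)"
        using z0 by (intro continuous_intros continuous_on_subset[OF hc] continuous_on_subset[OF hc']) auto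
      show "set_integrable lborel {2<..} (\<lambda>x. (- exp (- z * of_real x) / z) * h' x + exp (- z * of_real x) * h x)"
        unfolding e by (rule set_integral_add(1)[OF i2' i1])
    qed
    then have "(LINT x:{2<..}|lborel. exp (- z * of_real x) * h x) = - F 2 + (1 / z) * (LINT x:{2<..}|lborel. exp (- z * of_real x) * h' x)"
      unfolding e set_integral_add(2)[OF i2' i1] set_integral_mult_right by (simp add: field_simps)
    also have "norm \<dots> \<le> norm (F 2) + norm (1 / z) * norm (LINT x:{2<..}|lborel. exp (- z * of_real x) * h' x)"
      by (rule order_trans[OF norm_triangle_ineq]) (simp add: norm_mult norm_divide)
    also have "\<dots> \<le> norm (h 2) / c + 1 / c * K"
    proof (intro add_mono mult_mono)
      have "norm (exp (- z * of_real 2)) * norm (h 2) \<le> 1 * norm (h 2)" using z(1) by (intro mult_right_mono) auto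
      then have "norm (F 2) \<le> norm (h 2) / norm z" by (simp add: F_def norm_mult norm_divide divide_right_mono)
      also have "\<dots> \<le> norm (h 2) / c" using z assms(1) by (intro divide_left_mono) (auto intro!: mult_pos_pos)
      finally show "norm (F 2) \<le> norm (h 2) / c" .
      show "norm (1 / z) \<le> 1 / c" using z assms(1) by (auto simp: norm_divide intro!: divide_left_mono mult_pos_pos)
    qed (use K z assms(1) in auto)
    finally show "norm (LINT x:{2<..}|lborel. exp (- z * of_real x) * h x) \<le> norm (h 2) / c + 1 / c * K" .
  qed
qed

section \<open>Regularized moments of a radial mode\<close>

text \<open>Here \<open>x\<close> is the distance to the outer horizon and \<open>d\<close> the gap
  between the two horizons, so \<open>x * (x + d)\<close> is \<open>mu\<close>, and \<open>P\<close>
  is the numerator of H'. \<open>W 0\<close> stands for the mode multiplied by exp H, regular at the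
  horizon, and exp (- 2 H) times it for the mode multiplied by exp (- H), which is conormal at
  infinity. All derivatives \<open>W j\<close> belong to the data, since the regularized moments
  involve them.\<close>

locale radial_mode =
  fixes m d \<sigma> s \<kappa> lam N0 :: real and H :: "real \<Rightarrow> complex" and W :: "nat \<Rightarrow> real \<Rightarrow> complex"
    and P :: "real \<Rightarrow> complex"
  defines "P \<equiv> \<lambda>x. (\<i> * of_real \<kappa> + of_real (s * d / 2)) + (\<i> * of_real (\<sigma> * d) + (2 * \<i> * of_real (m * \<sigma>) + of_real s)) * of_real x
      + \<i> * of_real \<sigma> * of_real x ^ 2"
  assumes m: "m > 0" and d: "d \<ge> 0" and \<sigma>: "\<sigma> > 0"
    and H: "\<And>x. x > 0 \<Longrightarrow> (H has_vector_derivative P x / of_real (x * (x + d))) (at x)"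
    and W: "\<And>j x. x > 0 \<Longrightarrow> (W j has_vector_derivative W (Suc j) x) (at x)"
    and ode: "\<And>x. x > 0 \<Longrightarrow>
      of_real (x * (x + d)) * W 2 x + (of_real (2 * x + d) - 2 * P x) * W 1 x
      + (- (\<i> * of_real \<sigma> * of_real (2 * x + d) + (2 * \<i> * of_real (m * \<sigma>) + of_real s))
          + 4 * \<i> * of_real (s * \<sigma>) * of_real (x + m + d / 2) - of_real lam) * W 0 x = 0"
    and W_bdd: "\<And>j. \<exists>C. \<forall>x. 0 < x \<longrightarrow> x \<le> 1 \<longrightarrow> norm (W j x) \<le> C"
    and w_symb: "\<And>n. symb n N0 (\<lambda>x. exp (- 2 * H x) * W 0 x)"
begin

definition w where "w x = exp (- 2 * H x) * W 0 x"


lemma exp_H_deriv: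
  assumes "x > 0"
  shows "((\<lambda>x. exp (- 2 * H x)) has_vector_derivative (- 2 * (P x / of_real (x * (x + d)))) * exp (- 2 * H x)) (at x)"
proof -
  have "((\<lambda>x. - 2 * H x) has_vector_derivative - 2 * (P x / of_real (x * (x + d)))) (at x)"
    by (rule has_vector_derivative_mult_right[OF H[OF assms]])
  from field_vector_diff_chain_at[OF this DERIV_exp] show ?thesis by (simp add: o_def)
qed

text \<open>The real part of \<open>P\<close> is s/2 times the derivative 2 x + d of x (x + d), so
  Re H and s/2 ln (x (x + d)) differ by a constant.\<close>

lemma norm_exp_H:
  obtains A where "A > 0" "\<And>x. x > 0 \<Longrightarrow> norm (exp (- 2 * H x)) = A * (x * (x + d)) powr (- s)"
proof -
  define D where "D x = Re (H x) - s / 2 * ln (x * (x + d))" for x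
  have D: "(D has_real_derivative 0) (at x)" if x: "x > 0" for x
  proof -
    have xd: "x * (x + d) > 0" using x d by (intro mult_pos_pos) auto
    have "((\<lambda>x. Re (H x)) has_vector_derivative Re (P x / of_real (x * (x + d)))) (at x)"
      by (rule bounded_linear.has_vector_derivative[OF bounded_linear_Re H[OF x]])
    then have 1: "((\<lambda>x. Re (H x)) has_real_derivative Re (P x) / (x * (x + d))) (at x)"
      by (simp add: has_real_derivative_iff_has_vector_derivative)
    have 2: "((\<lambda>x. s / 2 * ln (x * (x + d))) has_real_derivative s / 2 * ((2 * x + d) / (x * (x + d)))) (at x)"
      using xd by (auto intro!: derivative_eq_intros simp: divide_simps) (auto simp: algebra_simps)?
    have "Re (P x) = s / 2 * (2 * x + d)" by (simp add: P_def power2_eq_square algebra_simps)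
    then have "Re (P x) / (x * (x + d)) - s / 2 * ((2 * x + d) / (x * (x + d))) = 0"
      by (simp only: times_divide_eq_right diff_self)
    with DERIV_diff[OF 1 2] show ?thesis unfolding D_def by simp
  qed
  have "D x = D 1" if x: "x > 0" for x
  proof -
    have "\<exists>c. \<forall>x\<in>{0<..}. D x = c"
      by (rule has_field_derivative_zero_constant) (auto intro: has_field_derivative_at_within[OF D])
    then show ?thesis using x by auto
  qed
  then have e: "Re (H x) = D 1 + s / 2 * ln (x * (x + d))" if "x > 0" for x
    using that unfolding D_def by (metis add.commute add_diff_cancel_left' diff_add_cancel)
  have "norm (exp (- 2 * H x)) = exp (- 2 * D 1) * (x * (x + d)) powr (- s)" if x: "x > 0" for x
  proof -
    have xd: "x * (x + d) > 0" using x d by (intro mult_pos_pos) auto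
    have "norm (exp (- 2 * H x)) = exp (- 2 * Re (H x))" by simp
    also have "\<dots> = exp (- 2 * D 1 + - s * ln (x * (x + d)))" unfolding e[OF x] by (simp add: algebra_simps)
    also have "\<dots> = exp (- 2 * D 1) * (x * (x + d)) powr (- s)" unfolding exp_add using x d by (simp add: powr_def)
    finally show ?thesis .
  qed
  then show thesis using that[of "exp (- 2 * D 1)"] by simp
qed

lemma rational_symb: "symb n 0 (\<lambda>x. P x / of_real (x * (x + d)))"
proof -
  have x2: "symb n 2 (\<lambda>x. of_real x * of_real x :: complex)"
    using symb_mult[OF symb_of_real symb_of_real, of n] by simp
  have mu: "symb n 2 (\<lambda>x. of_real (x * (x + d)))"
  proof -
    have "symb n 2 (\<lambda>x. of_real d * of_real x :: complex)"
      by (rule symb_mono[of 1]) (auto intro: symb_cmult symb_of_real)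
    from symb_add[OF x2 this] show ?thesis by (rule symb_cong[rotated]) (simp add: algebra_simps)
  qed
  have "symb n (- 2) (\<lambda>x. 1 / of_real (x * (x + d)) :: complex)"
  proof (rule symb_inverse[OF mu, of 1])
    fix x :: real assume x: "1 < x"
    then have "x * x \<le> x * (x + d)" using d by (intro mult_left_mono) auto
    then show "1 * x powr 2 \<le> norm (of_real (x * (x + d)) :: complex)"
      using x d unfolding norm_of_real by (simp add: power2_eq_square)
  qed simp
  moreover have "symb n 2 P"
  proof -
    have a: "symb n 2 (\<lambda>x. (\<i> * of_real \<kappa> + of_real (s * d / 2)))" by (rule symb_mono[of 0]) (auto intro: symb_const)
    have b: "symb n 2 (\<lambda>x. (\<i> * of_real (\<sigma> * d) + (2 * \<i> * of_real (m * \<sigma>) + of_real s)) * of_real x)"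
      by (rule symb_mono[of 1]) (auto intro: symb_cmult symb_of_real)
    have c: "symb n 2 (\<lambda>x. \<i> * of_real \<sigma> * of_real x ^ 2)"
      using symb_cmult[OF x2] by (simp add: power2_eq_square)
    show ?thesis unfolding P_def by (rule symb_add[OF symb_add[OF a b] c])
  qed
  ultimately have "symb n (2 + - 2) (\<lambda>x. P x * (1 / of_real (x * (x + d))))" by (intro symb_mult)
  then show ?thesis by simp
qed

lemma exp_H_W_deriv:
  assumes "x > 0"
  shows "((\<lambda>x. exp (- 2 * H x) * W j x) has_vector_derivative
    exp (- 2 * H x) * W (Suc j) x + (- 2 * (P x / of_real (x * (x + d)))) * (exp (- 2 * H x) * W j x)) (at x)"
  using has_vector_derivative_mult[OF exp_H_deriv[OF assms] W[OF assms, of j]] by (simp add: algebra_simps)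

text \<open>Solving the product rule for the top term, exp (- 2 H) W_(j+1) is the derivative of exp
  (- 2 H) W_j plus 2 H' times that function, and H' has order 0. The order \<open>N0\<close> is
  therefore kept for every \<open>j\<close>.\<close>

lemma exp_H_W_symb: "symb n N0 (\<lambda>x. exp (- 2 * H x) * W j x)"
proof (induction j arbitrary: n)
  case 0
  show ?case by (rule w_symb)
next
  case (Suc j)
  define v' where "v' x = exp (- 2 * H x) * W (Suc j) x + (- 2 * (P x / of_real (x * (x + d)))) * (exp (- 2 * H x) * W j x)" for x
  have "symb n (N0 - 1) v'"
    by (rule symb_derivative[OF Suc[of "Suc n"]]) (use exp_H_W_deriv in \<open>auto simp: v'_def\<close>)
  then have 1: "symb n N0 v'" by (rule symb_mono[rotated]) simp
  have "symb n (0 + N0) (\<lambda>x. (2 * (P x / of_real (x * (x + d)))) * (exp (- 2 * H x) * W j x))"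
    by (intro symb_mult symb_cmult rational_symb Suc)
  then have 2: "symb n N0 (\<lambda>x. (2 * (P x / of_real (x * (x + d)))) * (exp (- 2 * H x) * W j x))" by simp
  show ?case
    by (rule symb_cong[OF _ symb_add[OF 1 2]]) (simp add: v'_def)
qed

section \<open>Coefficients of the radial equation and families of derivatives\<close>

definition "coefC = \<i> * of_real \<kappa> + of_real (s * d / 2)"
definition "coefB = 2 * \<i> * of_real (m * \<sigma>) + of_real s"
definition "coefA = \<i> * of_real (\<sigma> * d) + coefB"
text \<open>The divisor in the integration by parts of the moment with power \<open>n\<close>.
  Written out it is d (n + 1 - s) - 2 i \<kappa>.\<close>

definition "denom n = of_real (d * (real n + 1)) - 2 * coefC"

lemma P_coef: "P x = coefC + coefA * of_real x + \<i> * of_real \<sigma> * of_real x ^ 2"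
  by (simp only: P_def coefC_def coefA_def coefB_def)

text \<open>A function together with all its derivatives. The class is closed under differentiation,
  linear combinations and multiplication by \<open>x\<close>, so the left side of the radial
  equation is a member too. One order \<open>N\<close> serves all derivatives.\<close>

definition admissible :: "(nat \<Rightarrow> real \<Rightarrow> complex) \<Rightarrow> bool" where
  "admissible V \<longleftrightarrow> (\<forall>j x. x > 0 \<longrightarrow> (V j has_vector_derivative V (Suc j) x) (at x)) \<and>
     (\<forall>j. \<exists>C. \<forall>x. 0 < x \<longrightarrow> x \<le> 1 \<longrightarrow> norm (V j x) \<le> C) \<and>
     (\<exists>N. \<forall>n j. symb n N (\<lambda>x. exp (- 2 * H x) * V j x))"

lemma admissible_W: "admissible W"
  unfolding admissible_def using W W_bdd exp_H_W_symb by blast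

lemma admissible_Suc: "admissible V \<Longrightarrow> admissible (\<lambda>j. V (Suc j))"
  unfolding admissible_def by blast

lemma admissible_deriv: "admissible V \<Longrightarrow> x > 0 \<Longrightarrow> (V j has_vector_derivative V (Suc j) x) (at x)"
  unfolding admissible_def by blast

lemma admissible_add:
  assumes "admissible V" "admissible U"
  shows "admissible (\<lambda>j x. V j x + U j x)"
  unfolding admissible_def
proof (intro conjI allI impI)
  fix j and x :: real assume "x > 0"
  then show "((\<lambda>x. V j x + U j x) has_vector_derivative V (Suc j) x + U (Suc j) x) (at x)"
    by (intro has_vector_derivative_add admissible_deriv assms)
next
  fix j
  obtain C where C: "\<And>x. 0 < x \<Longrightarrow> x \<le> 1 \<Longrightarrow> norm (V j x) \<le> C" using assms(1) unfolding admissible_def by blast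
  obtain D where D: "\<And>x. 0 < x \<Longrightarrow> x \<le> 1 \<Longrightarrow> norm (U j x) \<le> D" using assms(2) unfolding admissible_def by blast
  show "\<exists>C. \<forall>x. 0 < x \<longrightarrow> x \<le> 1 \<longrightarrow> norm (V j x + U j x) \<le> C"
    by (intro exI[of _ "C + D"] allI impI order_trans[OF norm_triangle_ineq] add_mono C D)
next
  obtain N where N: "\<And>n j. symb n N (\<lambda>x. exp (- 2 * H x) * V j x)" using assms(1) unfolding admissible_def by blast
  obtain K where K: "\<And>n j. symb n K (\<lambda>x. exp (- 2 * H x) * U j x)" using assms(2) unfolding admissible_def by blast
  show "\<exists>N. \<forall>n j. symb n N (\<lambda>x. exp (- 2 * H x) * (V j x + U j x))"
  proof (intro exI allI)
    fix n j
    have "symb n (max N K) (\<lambda>x. exp (- 2 * H x) * V j x + exp (- 2 * H x) * U j x)"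
      by (intro symb_add symb_mono[OF max.cobounded1 N] symb_mono[OF max.cobounded2 K])
    then show "symb n (max N K) (\<lambda>x. exp (- 2 * H x) * (V j x + U j x))" by (simp add: distrib_left)
  qed
qed

lemma admissible_cmult:
  assumes "admissible V"
  shows "admissible (\<lambda>j x. c * V j x)"
  unfolding admissible_def
proof (intro conjI allI impI)
  fix j and x :: real assume "x > 0"
  then show "((\<lambda>x. c * V j x) has_vector_derivative c * V (Suc j) x) (at x)"
    by (intro has_vector_derivative_mult_right admissible_deriv assms)
next
  fix j
  obtain C where C: "\<And>x. 0 < x \<Longrightarrow> x \<le> 1 \<Longrightarrow> norm (V j x) \<le> C" using assms(1) unfolding admissible_def by blast
  show "\<exists>C. \<forall>x. 0 < x \<longrightarrow> x \<le> 1 \<longrightarrow> norm (c * V j x) \<le> C"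
    using C by (intro exI[of _ "norm c * C"]) (auto simp: norm_mult intro!: mult_left_mono)
next
  obtain N where N: "\<And>n j. symb n N (\<lambda>x. exp (- 2 * H x) * V j x)" using assms(1) unfolding admissible_def by blast
  show "\<exists>N. \<forall>n j. symb n N (\<lambda>x. exp (- 2 * H x) * (c * V j x))"
  proof (intro exI allI)
    fix n j
    show "symb n N (\<lambda>x. exp (- 2 * H x) * (c * V j x))" using symb_cmult[OF N[of n j], of c] by (simp add: mult_ac)
  qed
qed

text \<open>Leibniz rule for the derivatives of x V; at \<open>j = 0\<close> the truncated index
  \<open>j - 1\<close> meets the coefficient 0.\<close>

definition xmul :: "(nat \<Rightarrow> real \<Rightarrow> complex) \<Rightarrow> nat \<Rightarrow> real \<Rightarrow> complex" where
  "xmul V j x = of_real x * V j x + of_nat j * V (j - 1) x"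

lemma xmul_0: "xmul V 0 x = of_real x * V 0 x"
  by (simp add: xmul_def)

lemma xmul_Suc: "(\<lambda>j. xmul V (Suc j)) = (\<lambda>j x. xmul (\<lambda>j. V (Suc j)) j x + V j x)"
proof (intro ext)
  fix j x show "xmul V (Suc j) x = xmul (\<lambda>j. V (Suc j)) j x + V j x"
    by (cases j) (auto simp: xmul_def algebra_simps)
qed

lemma admissible_xmul:
  assumes "admissible V"
  shows "admissible (xmul V)"
  unfolding admissible_def
proof (intro conjI allI impI)
  fix j and x :: real assume x: "x > 0"
  have d1: "((\<lambda>x. of_real x * V j x) has_vector_derivative of_real x * V (Suc j) x + 1 * V j x) (at x)"
    by (rule has_vector_derivative_mult[OF _ admissible_deriv[OF assms x]])
      (rule has_vector_derivative_real_field, auto intro!: derivative_eq_intros)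
  have "((\<lambda>x. of_nat j * V (j - 1) x) has_vector_derivative of_nat j * V j x) (at x)"
  proof (cases j)
    case (Suc i)
    then show ?thesis using has_vector_derivative_mult_right[OF admissible_deriv[OF assms x, of i], of "of_nat j"] by simp
  qed simp
  from has_vector_derivative_add[OF d1 this]
  show "(xmul V j has_vector_derivative xmul V (Suc j) x) (at x)"
    unfolding xmul_def[abs_def] by (simp add: algebra_simps)
next
  fix j
  obtain C where C: "\<And>x. 0 < x \<Longrightarrow> x \<le> 1 \<Longrightarrow> norm (V j x) \<le> C" using assms(1) unfolding admissible_def by blast
  obtain D where D: "\<And>x. 0 < x \<Longrightarrow> x \<le> 1 \<Longrightarrow> norm (V (j - 1) x) \<le> D" using assms(1) unfolding admissible_def by blast
  show "\<exists>C. \<forall>x. 0 < x \<longrightarrow> x \<le> 1 \<longrightarrow> norm (xmul V j x) \<le> C"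
  proof (intro exI allI impI)
    fix x :: real assume x: "0 < x" "x \<le> 1"
    have "norm (of_real x * V j x) \<le> 1 * C" unfolding norm_mult using x C[OF x] by (intro mult_mono) auto
    moreover have "norm (of_nat j * V (j - 1) x) \<le> real j * D" unfolding norm_mult using D[OF x] by (simp add: mult_left_mono)
    ultimately show "norm (xmul V j x) \<le> 1 * C + real j * D"
      unfolding xmul_def by (intro order_trans[OF norm_triangle_ineq] add_mono)
  qed
next
  obtain N where N: "\<And>n j. symb n N (\<lambda>x. exp (- 2 * H x) * V j x)" using assms(1) unfolding admissible_def by blast
  show "\<exists>N. \<forall>n j. symb n N (\<lambda>x. exp (- 2 * H x) * xmul V j x)"
  proof (intro exI allI)
    fix n j
    have 1: "symb n (1 + N) (\<lambda>x. of_real x * (exp (- 2 * H x) * V j x))" by (rule symb_mult[OF symb_of_real N])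
    have 2: "symb n (1 + N) (\<lambda>x. of_nat j * (exp (- 2 * H x) * V (j - 1) x))"
      by (rule symb_mono[OF _ symb_cmult[OF N]]) simp
    show "symb n (1 + N) (\<lambda>x. exp (- 2 * H x) * xmul V j x)"
      by (rule symb_cong[OF _ symb_add[OF 1 2]]) (simp add: xmul_def algebra_simps)
  qed
qed

end

section \<open>Convergent moments of the weighted mode\<close>

locale radial_mode_regular = radial_mode +
  assumes nd: "d > 0 \<or> \<kappa> \<noteq> 0" and s: "s \<le> 0 \<or> (\<forall>n::nat. s \<noteq> real n)"
begin

text \<open>In the extremal case the weight has a singularity of order 2 s at \<open>x = 0\<close>,
  the worst possible one. Hence \<open>reg\<close> powers of \<open>x\<close> make the integrand
  bounded there for every \<open>d\<close>; for \<open>s \<le> 0\<close> none is needed.\<close>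

definition "reg = nat \<lceil>2 * s\<rceil>"
text \<open>Order of the singularity of the weight at the horizon. For \<open>s > 0\<close> it
  depends on whether the root of \<open>mu\<close> is simple or double; for \<open>s \<le> 0\<close>
  the value \<open>s\<close> is an upper bound in both cases, because \<open>x \<le> 1\<close>
  there.\<close>

definition "ex0 = (if s \<le> 0 \<or> d > 0 then s else 2 * s)"

lemma reg_ge: "2 * s \<le> real reg" "ex0 \<le> real reg"
proof -
  show "2 * s \<le> real reg" unfolding reg_def by linarith
  then show "ex0 \<le> real reg" by (auto simp: ex0_def)
qed

lemma reg_pos: "n < reg \<Longrightarrow> s > 0"
  by (rule ccontr) (simp add: reg_def)

text \<open>The imaginary part gives \<kappa> = 0, hence \<open>d > 0\<close>, and then the real
  part makes \<open>s\<close> the natural number n + 1, which the locale excludes.\<close>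

lemma denom_nz:
  assumes "s > 0"
  shows "denom n \<noteq> 0"
proof
  assume "denom n = 0"
  then have "Re (denom n) = 0" "Im (denom n) = 0" by auto
  then have *: "d * (real n + 1 - s) = 0" "\<kappa> = 0" by (auto simp: denom_def coefC_def algebra_simps)
  then have "d > 0" using nd by auto
  with * have "s = real (Suc n)" by simp
  then show False using s assms by (metis not_less)
qed

text \<open>Combines the singularity at 0 with the polynomial growth at infinity. The rate
  \<open>e\<close> must be arbitrary, since in the decay estimate it has to be small compared with
  the opening of the sector.\<close>

lemma weight_bound:
  assumes V: "admissible V" and e: "e > 0"
  obtains K where "K \<ge> 0" "\<And>x. x > 0 \<Longrightarrow> norm (exp (- 2 * H x) * V 0 x) \<le> K * x powr (- ex0) * exp (e * x)"
proof -
  obtain A where A: "A > 0" "\<And>x. x > 0 \<Longrightarrow> norm (exp (- 2 * H x)) = A * (x * (x + d)) powr (- s)"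
    using norm_exp_H by blast
  obtain B where B: "\<And>x. 0 < x \<Longrightarrow> x \<le> 1 \<Longrightarrow> norm (V 0 x) \<le> B" using V unfolding admissible_def by blast
  have B0: "B \<ge> 0" using order_trans[OF norm_ge_zero B[of 1]] by simp
  obtain N where N: "\<And>n j. symb n N (\<lambda>x. exp (- 2 * H x) * V j x)" using V unfolding admissible_def by blast
  obtain C where C: "C \<ge> 0" "\<And>x. x > 1 \<Longrightarrow> norm (exp (- 2 * H x) * V 0 x) \<le> C * x powr N"
    using symb_bound[OF N[of 0 0]] by blast
  obtain L where L: "\<And>x. x \<ge> 1 \<Longrightarrow> x powr (N + ex0) \<le> L * exp (e * x)" using powr_le_exp[OF e] by blast
  have "0 \<le> L * exp (e * 1)" using order_trans[OF powr_ge_zero L[of 1]] by simp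
  then have L0: "L \<ge> 0" by (simp add: zero_le_mult_iff)
  have "\<exists>D\<ge>0. \<forall>x. 0 < x \<longrightarrow> x \<le> 1 \<longrightarrow> (x * (x + d)) powr (- s) \<le> D * x powr (- ex0)"
  proof -
    consider "s \<le> 0" | "s > 0" "d > 0" | "s > 0" "d = 0" using d by linarith
    then show ?thesis
    proof cases
      case 1
      have "(x * (x + d)) powr (- s) \<le> (1 + d) powr (- s) * x powr (- ex0)" if x: "0 < x" "x \<le> 1" for x
      proof -
        have "(x * (x + d)) powr (- s) \<le> (x * (1 + d)) powr (- s)" using 1 x d by (intro powr_mono2) auto
        then show ?thesis using x d 1 by (simp add: powr_mult ex0_def mult_ac)
      qed
      then show ?thesis by (intro exI[of _ "(1 + d) powr (- s)"]) auto
    next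
      case 2
      have "(x * (x + d)) powr (- s) \<le> d powr (- s) * x powr (- ex0)" if x: "0 < x" "x \<le> 1" for x
      proof -
        have "(x * (x + d)) powr (- s) \<le> (x * d) powr (- s)" using 2 x by (intro powr_mono2') auto
        then show ?thesis using x 2 by (simp add: powr_mult ex0_def mult_ac)
      qed
      then show ?thesis by (intro exI[of _ "d powr (- s)"]) auto
    next
      case 3
      have ex: "ex0 = 2 * s" unfolding ex0_def using 3 by simp
      have "(x * (x + d)) powr (- s) \<le> 1 * x powr (- ex0)" if x: "0 < x" "x \<le> 1" for x
        unfolding ex using x 3 by (simp add: powr_mult powr_add[symmetric])
      then show ?thesis by (intro exI[of _ 1]) auto
    qed
  qed
  then obtain D where D: "D \<ge> 0" "\<And>x. 0 < x \<Longrightarrow> x \<le> 1 \<Longrightarrow> (x * (x + d)) powr (- s) \<le> D * x powr (- ex0)" by blast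
  define K where "K = A * D * B + C * L"
  have K0: "A * D * B \<ge> 0" "C * L \<ge> 0" using A B0 C L0 D by auto
  show thesis
  proof (rule that)
    show "K \<ge> 0" using K0 by (simp add: K_def)
    fix x :: real assume x: "x > 0"
    show "norm (exp (- 2 * H x) * V 0 x) \<le> K * x powr (- ex0) * exp (e * x)"
    proof (cases "x \<le> 1")
      case True
      have "norm (exp (- 2 * H x) * V 0 x) = A * (x * (x + d)) powr (- s) * norm (V 0 x)" by (simp only: norm_mult A(2)[OF x])
      also have "\<dots> \<le> A * (D * x powr (- ex0)) * B"
        using A B[OF x True] D(2)[OF x True] D(1) by (intro mult_mono) auto
      also have "\<dots> = A * D * B * x powr (- ex0)" by (simp add: mult_ac)
      also have "\<dots> \<le> K * x powr (- ex0) * 1" using K0 by (simp add: K_def mult_right_mono)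
      also have "\<dots> \<le> K * x powr (- ex0) * exp (e * x)"
        using e x K0 by (intro mult_left_mono) (auto simp: K_def)
      finally show ?thesis .
    next
      case False
      then have x1: "x > 1" by simp
      have "norm (exp (- 2 * H x) * V 0 x) \<le> C * x powr N" by (rule C(2)[OF x1])
      also have "\<dots> = C * (x powr (N + ex0) * x powr (- ex0))" using x by (simp add: powr_add[symmetric])
      also have "\<dots> \<le> C * ((L * exp (e * x)) * x powr (- ex0))"
        using C L[of x] x1 by (intro mult_left_mono mult_right_mono) auto
      also have "\<dots> = C * L * (x powr (- ex0) * exp (e * x))" by (simp add: mult_ac)
      also have "\<dots> \<le> K * (x powr (- ex0) * exp (e * x))" using K0 by (intro mult_right_mono) (auto simp: K_def)
      finally show ?thesis by (simp add: mult_ac)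
    qed
  qed
qed

lemma weight_cont:
  assumes "admissible V"
  shows "continuous_on {0<..} (\<lambda>x. exp (- 2 * H x) * V 0 x)"
  by (rule continuous_on_vector_derivative,
      rule has_vector_derivative_at_within[OF has_vector_derivative_mult[OF exp_H_deriv admissible_deriv[OF assms]]]) auto

lemma powr_le_max_exp:
  assumes "e > 0" "q \<ge> 0" and L: "\<And>x. x \<ge> 1 \<Longrightarrow> x powr q \<le> L * exp (e * x)" and x: "x > (0::real)"
  shows "x powr q \<le> max L 1 * exp (e * x)"
proof (cases "x \<ge> 1")
  case True
  have "L * exp (e * x) \<le> max L 1 * exp (e * x)" by (intro mult_right_mono) auto
  then show ?thesis using L[OF True] by linarith
next
  case False
  have "x powr q \<le> 1" using False x assms(2) by (intro powr_le1) auto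
  moreover have "1 * 1 \<le> max L 1 * exp (e * x)" using assms(1) x by (intro mult_mono) auto
  ultimately show ?thesis by linarith
qed

lemma moment_subexponential:
  assumes V: "admissible V" and n: "reg \<le> n"
  shows "subexponential (\<lambda>x. of_real x ^ n * (exp (- 2 * H x) * V 0 x))"
  unfolding subexponential_def
proof (intro conjI allI impI)
  show "continuous_on {0<..} (\<lambda>x. of_real x ^ n * (exp (- 2 * H x) * V 0 x))"
    by (intro continuous_intros weight_cont V)
  fix e :: real assume e: "e > 0"
  obtain K where K: "K \<ge> 0" "\<And>x. x > 0 \<Longrightarrow> norm (exp (- 2 * H x) * V 0 x) \<le> K * x powr (- ex0) * exp (e / 2 * x)"
    using weight_bound[OF V, of "e / 2"] e by auto
  define q where "q = real n - ex0"
  have q: "q \<ge> 0" using reg_ge(2) n by (simp add: q_def)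
  obtain L where L: "\<And>x. x \<ge> 1 \<Longrightarrow> x powr q \<le> L * exp (e / 2 * x)" using powr_le_exp[of "e / 2" q] e by auto
  show "\<exists>K. \<forall>x>0. norm (of_real x ^ n * (exp (- 2 * H x) * V 0 x)) \<le> K * exp (e * x)"
  proof (intro exI allI impI)
    fix x :: real assume x: "x > 0"
    have "norm (of_real x ^ n * (exp (- 2 * H x) * V 0 x)) \<le> x ^ n * (K * x powr (- ex0) * exp (e / 2 * x))"
      unfolding norm_mult[of "_ ^ n"] norm_power using x K(2)[OF x] by (intro mult_mono) auto
    also have "\<dots> = K * x powr q * exp (e / 2 * x)"
      using x by (simp add: q_def powr_diff powr_minus powr_realpow[symmetric] field_simps)
    also have "\<dots> \<le> K * (max L 1 * exp (e / 2 * x)) * exp (e / 2 * x)"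
      using K powr_le_max_exp[OF _ q L x] e by (intro mult_right_mono mult_left_mono) auto
    also have "\<dots> = (K * max L 1) * exp (e * x)" by (simp add: exp_add[symmetric] field_simps)
    finally show "norm (of_real x ^ n * (exp (- 2 * H x) * V 0 x)) \<le> (K * max L 1) * exp (e * x)" .
  qed
qed

text \<open>Rescaling \<open>x\<close> by t = |z| extracts the power of \<open>t\<close>: in a
  sector the size of the transform at infinity is dictated by the singularity of order
  \<open>ex0\<close> at the horizon. Of the rate c t, one quarter goes to the weight and one quarter
  to the power, and c t / 2 remains.\<close>

lemma moment_decay:
  assumes V: "admissible V" and n: "reg \<le> n" and c: "0 < c"
  shows "\<exists>K. \<forall>z. norm z \<ge> 1 \<longrightarrow> Re z \<ge> c * norm z \<longrightarrow>
    norm (laplace (\<lambda>x. of_real x ^ n * (exp (- 2 * H x) * V 0 x)) z) \<le> K * norm z powr (ex0 - 1 - real n)"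
proof -
  obtain K where K: "K \<ge> 0" "\<And>x. x > 0 \<Longrightarrow> norm (exp (- 2 * H x) * V 0 x) \<le> K * x powr (- ex0) * exp (c / 4 * x)"
    using weight_bound[OF V, of "c / 4"] c by auto
  define w where "w x = exp (- 2 * H x) * V 0 x" for x
  note K = K[folded w_def]
  define q where "q = real n - ex0"
  have q0: "q \<ge> 0" using reg_ge(2) n by (simp add: q_def)
  obtain L where L: "\<And>x. x \<ge> 1 \<Longrightarrow> x powr q \<le> L * exp (c / 4 * x)" using powr_le_exp[of "c / 4" q] c by auto
  have b: "x powr q \<le> max L 1 * exp (c / 4 * x)" if x: "x > 0" for x
    using powr_le_max_exp[OF _ q0 L x] c by auto
  show ?thesis
    unfolding w_def[symmetric]
  proof (intro exI allI impI)
    fix z :: complex assume z: "norm z \<ge> 1" "Re z \<ge> c * norm z"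
    define t where "t = norm z"
    have t: "t \<ge> 1" "Re z \<ge> c * t" using z by (auto simp: t_def)
    define M where "M = K * max L 1 * t powr (- q)"
    have "norm (laplace (\<lambda>x. of_real x ^ n * w x) z) \<le> M * exp (- (c * t / 2) * 0) / (c * t / 2)"
      unfolding laplace_def
    proof (rule set_integral_Ioi_exp_dominated(2))
      show "0 < c * t / 2" using c t by auto
      show "continuous_on {0<..} (\<lambda>x. exp (- z * of_real x) * (of_real x ^ n * w x))"
        unfolding w_def by (intro continuous_intros weight_cont V)
      fix x :: real assume x: "0 < x"
      have "exp (- Re z * x) \<le> exp (- (c * t) * x)" using t x by simp
      moreover have "c / 4 * x \<le> c / 4 * (t * x)" using t x c by simp
      then have "exp (c / 4 * x) \<le> exp (c * t / 4 * x)" by (simp add: mult_ac)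
      then have "norm (w x) \<le> K * x powr (- ex0) * exp (c * t / 4 * x)"
        using K(1) by (intro order_trans[OF K(2)[OF x]] mult_left_mono) auto
      ultimately have "norm (exp (- z * of_real x) * (of_real x ^ n * w x))
        \<le> exp (- (c * t) * x) * (x ^ n * (K * x powr (- ex0) * exp (c * t / 4 * x)))"
        unfolding norm_mult norm_power using x by (intro mult_mono) auto
      also have "\<dots> = K * x powr q * exp (- (3 * c * t / 4) * x)"
        using x by (simp add: q_def powr_diff powr_minus powr_realpow[symmetric] exp_add[symmetric] field_simps)
      also have "x powr q = t powr (- q) * (t * x) powr q" using t x by (simp add: powr_mult powr_minus)
      also have "K * (t powr (- q) * (t * x) powr q) * exp (- (3 * c * t / 4) * x)
        \<le> K * (t powr (- q) * (max L 1 * exp (c / 4 * (t * x)))) * exp (- (3 * c * t / 4) * x)"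
        using b[of "t * x"] t x K by (intro mult_right_mono mult_left_mono) auto
      also have "\<dots> = M * exp (- (c * t / 2) * x)"
        by (simp add: M_def exp_add[symmetric] field_simps)
      finally show "norm (exp (- z * of_real x) * (of_real x ^ n * w x)) \<le> M * exp (- (c * t / 2) * x)" .
    qed
    also have "\<dots> = (2 * K * max L 1 / c) * (t powr (- q) * t powr (- 1))"
      using t c by (simp add: M_def powr_minus_divide field_simps)
    also have "t powr (- q) * t powr (- 1) = t powr (ex0 - 1 - real n)" by (simp only: powr_add[symmetric] q_def) (simp add: algebra_simps)
    finally show "norm (laplace (\<lambda>x. of_real x ^ n * w x) z) \<le> (2 * K * max L 1 / c) * norm z powr (ex0 - 1 - real n)" by (simp add: t_def)
  qed
qed

lemma moment_bounded:
  assumes V: "admissible V" and n: "reg \<le> j" and c: "0 < c"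
  shows "\<exists>K. \<forall>z. Re z > 0 \<longrightarrow> norm z \<ge> c \<longrightarrow> norm (laplace (\<lambda>x. of_real x ^ j * (exp (- 2 * H x) * V 0 x)) z) \<le> K"
proof -
  define w where "w x = exp (- 2 * H x) * V 0 x" for x
  obtain N where N: "\<And>n. symb n N w"
    using V unfolding admissible_def w_def by blast
  have pw: "symb i (N + real j) (\<lambda>x. of_real x ^ j * w x)" for i
  proof (induction j)
    case 0
    then show ?case using N[of i] by simp
  next
    case (Suc j)
    from symb_mult[OF symb_of_real this] show ?case by (simp add: mult.assoc add_ac)
  qed
  have sub: "subexponential (\<lambda>x. of_real x ^ j * w x)" unfolding w_def by (rule moment_subexponential[OF V n])
  obtain n :: nat where n: "N + real j + 1 < real n" using reals_Archimedean2 by blast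
  obtain K where K: "\<And>z. Re z > 0 \<Longrightarrow> norm z \<ge> c \<Longrightarrow>
      norm (LINT x:{2<..}|lborel. exp (- z * of_real x) * (of_real x ^ j * w x)) \<le> K"
    using symb_oscillatory_integral_bounded[OF c _ pw[of "Suc n"]] n by auto
  obtain B where B: "B \<ge> 0" "\<And>x. x > 0 \<Longrightarrow> norm (of_real x ^ j * w x) \<le> B * exp (1 * x)"
    using subexponentialD[OF sub, of 1] by auto
  show ?thesis
    unfolding w_def[symmetric]
  proof (intro exI allI impI)
    fix z :: complex assume z: "Re z > 0" "norm z \<ge> c"
    let ?f = "\<lambda>x. exp (- z * of_real x) * (of_real x ^ j * w x)"
    have i: "set_integrable lborel {0<..} ?f"
      by (rule subexponential_laplace_integrable[OF sub z(1)])
    have i1: "set_integrable lborel {0<..2} ?f" "set_integrable lborel {2<..} ?f"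
      using i by (auto intro: set_integrable_subset)
    have u: "{0<..} = {0<..2} \<union> {2::real<..}" by auto
    have "laplace (\<lambda>x. of_real x ^ j * w x) z = (LINT x:{0<..2}|lborel. ?f x) + (LINT x:{2<..}|lborel. ?f x)"
      unfolding laplace_def u using i1 by (intro set_integral_Un) auto
    moreover have "norm (LINT x:{0<..2}|lborel. ?f x) \<le> (LINT x:{0<..2::real}|lborel. B * exp 2)"
    proof (rule order_trans[OF set_integral_norm_bound[OF i1(1)]])
      have c1: "set_integrable lborel {0<..2::real} (\<lambda>_. B * exp 2)"
        unfolding set_integrable_def by (rule integrable_scaleR_left) (auto simp: integrable_indicator_iff)
      show "(LINT x:{0<..2}|lborel. norm (?f x)) \<le> (LINT x:{0<..2::real}|lborel. B * exp 2)"
      proof (rule set_integral_mono[OF set_integrable_norm[OF i1(1)] c1])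
        fix x :: real assume x: "x \<in> {0<..2}"
        have "norm (?f x) \<le> 1 * (B * exp (1 * x))"
          unfolding norm_mult[of "exp _"] using z x B(2)[of x] by (intro mult_mono) auto
        also have "\<dots> \<le> B * exp 2" using x B(1) by (simp add: mult_left_mono)
        finally show "norm (?f x) \<le> B * exp 2" .
      qed
    qed
    ultimately show "norm (laplace (\<lambda>x. of_real x ^ j * w x) z) \<le> (LINT x:{0<..2::real}|lborel. B * exp 2) + K"
      using K[OF z] norm_triangle_ineq[of "LINT x:{0<..2}|lborel. ?f x" "LINT x:{2<..}|lborel. ?f x"] by simp
  qed
qed

text \<open>The integrated function is exp (- z x) x^(n+1) (x + d) exp (- 2 H) V; its factor x (x +
  d) cancels the denominator of H'. The lowest power then appears with coefficient
  \<open>denom n\<close>, and \<open>reg \<le> n\<close> makes both boundary terms vanish. The name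
  \<open>mom\<close> is a parameter because the regularized moments are built from this identity
  afterwards.\<close>

lemma moment_by_parts:
  assumes V: "admissible V" and n: "reg \<le> n" and z: "Re z > 0"
    and mom: "\<And>n V z. mom n V z = laplace (\<lambda>x. of_real x ^ n * (exp (- 2 * H x) * V 0 x)) z"
  shows "denom n * mom n V z = (z + 2 * \<i> * of_real \<sigma>) * mom (n + 2) V z
    + (z * of_real d - of_nat n - 2 + 2 * coefA) * mom (n + 1) V z
    - mom (n + 2) (\<lambda>j. V (Suc j)) z - of_real d * mom (n + 1) (\<lambda>j. V (Suc j)) z"
proof -
  define g where "g x = x ^ (n + 1) * (x + d)" for x :: real
  define f where "f n V x = exp (- z * of_real x) * (of_real x ^ n * (exp (- 2 * H x) * V 0 x))" for n and V :: "nat \<Rightarrow> real \<Rightarrow> complex" and x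
  define F where "F x = exp (- z * of_real x) * (of_real (g x) * (exp (- 2 * H x) * V 0 x))" for x
  define FD where "FD x = - (z + 2 * \<i> * of_real \<sigma>) * f (n + 2) V x + (- (z * of_real d - of_nat n - 2 + 2 * coefA)) * f (n + 1) V x
    + denom n * f n V x + 1 * f (n + 2) (\<lambda>j. V (Suc j)) x + of_real d * f (n + 1) (\<lambda>j. V (Suc j)) x" for x
  have Fd: "(F has_vector_derivative FD x) (at x)" if x: "x > 0" for x
  proof -
    have M0: "of_real (x * (x + d)) \<noteq> (0::complex)" using x d by (simp del: of_real_mult)
    have e1: "((\<lambda>x. exp (- z * of_real x)) has_vector_derivative - z * exp (- z * of_real x)) (at x)"
      by (rule has_vector_derivative_real_field) (auto intro!: derivative_eq_intros)
    have gd: "((\<lambda>x. of_real (g x) :: complex) has_vector_derivative of_real ((real n + 1) * x ^ n * (x + d) + x ^ (n + 1))) (at x)"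
    proof (rule has_vector_derivative_of_real)
      have "((\<lambda>x. x ^ (n + 1)) has_real_derivative real (n + 1) * x ^ n) (at x)" using DERIV_pow[of "n + 1" x] by simp
      moreover have "((\<lambda>x. x + d) has_real_derivative 1) (at x)" by (auto intro!: derivative_eq_intros)
      ultimately have "(g has_real_derivative real (n + 1) * x ^ n * (x + d) + 1 * x ^ (n + 1)) (at x)"
        unfolding g_def by (rule DERIV_mult)
      then show "(g has_real_derivative (real n + 1) * x ^ n * (x + d) + x ^ (n + 1)) (at x)" by (simp add: add.commute)
    qed
    define q where "q = P x / of_real (x * (x + d))"
    have V1: "(V 0 has_vector_derivative V 1 x) (at x)" using admissible_deriv[OF V x, of 0] by simp
    define E where "E = exp (- 2 * H x)"
    define v where "v = V 0 x"
    have "(F has_vector_derivative exp (- z * of_real x) * (of_real (g x) * (E * V 1 x + (- 2 * q * E) * v)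
          + of_real ((real n + 1) * x ^ n * (x + d) + x ^ (n + 1)) * (E * v))
        + (- z * exp (- z * of_real x)) * (of_real (g x) * (E * v))) (at x)"
      (is "(_ has_vector_derivative ?D) _")
      unfolding F_def E_def v_def
      by (rule has_vector_derivative_mult[OF e1 has_vector_derivative_mult[OF gd
            has_vector_derivative_mult[OF exp_H_deriv[OF x, folded q_def] V1]]])
    moreover have "?D = FD x"
    proof -
      have qm: "q * of_real (g x) = P x * of_real x ^ n"
      proof -
        have "of_real (g x) = of_real (x * (x + d)) * (of_real x ^ n :: complex)" by (simp add: g_def mult_ac)
        then show ?thesis using M0 by (simp add: q_def)
      qed
      have "?D = exp (- z * of_real x) * E * (of_real (g x) * V 1 x - 2 * (q * of_real (g x)) * v
          + of_real ((real n + 1) * x ^ n * (x + d) + x ^ (n + 1)) * v - z * of_real (g x) * v)"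
        by (simp add: algebra_simps)
      also have "\<dots> = FD x"
        unfolding qm unfolding P_coef FD_def f_def denom_def E_def[symmetric] v_def[symmetric] g_def
        by (simp add: algebra_simps power2_eq_square)
      finally show ?thesis .
    qed
    ultimately show ?thesis by simp
  qed
  have fi: "set_integrable lborel {0<..} (\<lambda>x. c * f i U x)" if "admissible U" "reg \<le> i" for c i U
    unfolding f_def
    by (rule set_integrable_mult_right) (rule subexponential_laplace_integrable[OF moment_subexponential[OF that] z])
  have r: "reg \<le> n + 2" "reg \<le> n + 1" using n by auto
  note V' = admissible_Suc[OF V]
  note i = fi[OF V r(1)] fi[OF V r(2)] fi[OF V n] fi[OF V' r(1)] fi[OF V' r(2)]
  note i2 = set_integral_add(1)[OF i(1,2)]
  note i3 = set_integral_add(1)[OF i2 i(3)]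
  note i4 = set_integral_add(1)[OF i3 i(4)]
  have FDi: "set_integrable lborel {0<..} FD" unfolding FD_def by (rule set_integral_add(1)[OF i4 i(5)])
  have FDv: "(LINT x:{0<..}|lborel. FD x) = - (z + 2 * \<i> * of_real \<sigma>) * mom (n + 2) V z + (- (z * of_real d - of_nat n - 2 + 2 * coefA)) * mom (n + 1) V z
    + denom n * mom n V z + 1 * mom (n + 2) (\<lambda>j. V (Suc j)) z + of_real d * mom (n + 1) (\<lambda>j. V (Suc j)) z"
    unfolding FD_def set_integral_add(2)[OF i4 i(5)] set_integral_add(2)[OF i3 i(4)] set_integral_add(2)[OF i2 i(3)]
      set_integral_add(2)[OF i(1,2)] set_integral_mult_right
    by (simp only: mom laplace_def f_def)
  have fc: "continuous_on {0<..} (\<lambda>x. c * f i U x)" if U: "admissible U" for c i U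
    unfolding f_def by (intro continuous_on_mult continuous_on_const continuous_on_power continuous_on_exp continuous_on_of_real continuous_on_id weight_cont[OF U])
  note c2 = continuous_on_add[OF fc[OF V] fc[OF V]]
  note c3 = continuous_on_add[OF c2 fc[OF V]]
  note c4 = continuous_on_add[OF c3 fc[OF V']]
  have FDc: "continuous_on {0<..} FD" unfolding FD_def by (rule continuous_on_add[OF c4 fc[OF V']])
  obtain K where K: "K \<ge> 0" "\<And>x. x > 0 \<Longrightarrow> norm (of_real x ^ n * (exp (- 2 * H x) * V 0 x)) \<le> K * exp (Re z / 2 * x)"
    using subexponentialD[OF moment_subexponential[OF V n], of "Re z / 2"] z by auto
  have Fb: "norm (F x) \<le> K * (x * (x + d) * exp (- (Re z / 2) * x))" if x: "x > 0" for x
  proof -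
    have xd: "x * (x + d) \<ge> 0" using x d by auto
    have "F x = exp (- z * of_real x) * (of_real (x * (x + d)) * (of_real x ^ n * (exp (- 2 * H x) * V 0 x)))"
      by (simp add: F_def g_def mult_ac)
    then have "norm (F x) = exp (- Re z * x) * (x * (x + d) * norm (of_real x ^ n * (exp (- 2 * H x) * V 0 x)))"
      using xd by (simp only: norm_mult[of "exp _"] norm_mult[of "of_real _"] norm_of_real) simp
    also have "\<dots> \<le> exp (- Re z * x) * (x * (x + d) * (K * exp (Re z / 2 * x)))"
      using K(2)[OF x] xd by (intro mult_left_mono) auto
    also have "\<dots> = K * (x * (x + d) * (exp (- Re z * x) * exp (Re z / 2 * x)))" by (simp add: mult_ac)
    also have "exp (- Re z * x) * exp (Re z / 2 * x) = exp (- (Re z / 2) * x)" by (simp add: exp_add[symmetric])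
    finally show ?thesis .
  qed
  have lim0: "(F \<longlongrightarrow> 0) (at_right 0)"
  proof (rule Lim_null_comparison)
    show "eventually (\<lambda>x. norm (F x) \<le> K * (x * (x + d) * exp (- (Re z / 2) * x))) (at_right 0)"
      using eventually_at_right_less[of "0::real"] by eventually_elim (rule Fb)
    have "((\<lambda>x. K * (x * (x + d) * exp (- (Re z / 2) * x))) \<longlongrightarrow> K * (0 * (0 + d) * exp (- (Re z / 2) * 0))) (at_right 0)"
      by (intro tendsto_intros)
    then show "((\<lambda>x. K * (x * (x + d) * exp (- (Re z / 2) * x))) \<longlongrightarrow> 0) (at_right 0)" by simp
  qed
  have limI: "(F \<longlongrightarrow> 0) at_top"
  proof (rule Lim_null_comparison)
    show "eventually (\<lambda>x. norm (F x) \<le> K * (x * (x + d) * exp (- (Re z / 2) * x))) at_top"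
      using eventually_gt_at_top[of "0::real"] by eventually_elim (rule Fb)
    define b where "b = Re z / 2"
    have b: "b > 0" using z by (simp add: b_def)
    have "((\<lambda>x. x * (x + d) * exp (- b * x)) \<longlongrightarrow> 0) at_top" using b by real_asymp
    from tendsto_mult_left[OF this, of K]
    show "((\<lambda>x. K * (x * (x + d) * exp (- (Re z / 2) * x))) \<longlongrightarrow> 0) at_top" by (simp add: b_def)
  qed
  have "(LINT x:{0<..}|lborel. FD x) = 0 - 0"
    by (rule set_integral_Ioi_FTC[OF Fd FDc FDi lim0 limI])
  then show ?thesis unfolding FDv by (simp add: algebra_simps add_eq_0_iff)
qed

end

section \<open>Moments regularized at the horizon\<close>

context radial_mode_regular
begin

text \<open>A finite-part integral: \<open>k\<close> counts formal integrations by parts, each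
  trading the power \<open>n\<close> for \<open>n + 1\<close> and \<open>n + 2\<close>. The value is
  meaningful when \<open>reg \<le> n + k\<close>, as then only convergent integrals occur at the
  bottom; otherwise it may contain the default value of a divergent integral.\<close>

primrec moment :: "nat \<Rightarrow> nat \<Rightarrow> (nat \<Rightarrow> real \<Rightarrow> complex) \<Rightarrow> complex \<Rightarrow> complex" where
  "moment 0 n V z = laplace (\<lambda>x. of_real x ^ n * (exp (- 2 * H x) * V 0 x)) z"
| "moment (Suc k) n V z = ((z + 2 * \<i> * of_real \<sigma>) * moment k (n + 2) V z
    + (z * of_real d - of_nat n - 2 + 2 * coefA) * moment k (n + 1) V z
    - moment k (n + 2) (\<lambda>j. V (Suc j)) z - of_real d * moment k (n + 1) (\<lambda>j. V (Suc j)) z) / denom n"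

text \<open>Independence of the number of steps: at the bottom it is the true integration by parts,
  and the recursion transports it upwards.\<close>

lemma moment_Suc:
  assumes "admissible V" "reg \<le> n + k" "Re z > 0" "s > 0"
  shows "moment (Suc k) n V z = moment k n V z"
  using assms
proof (induction k arbitrary: n V)
  case 0
  from 0 have "denom n * moment 0 n V z = (z + 2 * \<i> * of_real \<sigma>) * moment 0 (n + 2) V z
    + (z * of_real d - of_nat n - 2 + 2 * coefA) * moment 0 (n + 1) V z
    - moment 0 (n + 2) (\<lambda>j. V (Suc j)) z - of_real d * moment 0 (n + 1) (\<lambda>j. V (Suc j)) z"
    by (intro moment_by_parts[where mom = "moment 0"]) auto
  then show ?case using denom_nz[OF 0(4), of n] unfolding moment.simps(2)[of 0] by (metis nonzero_mult_div_cancel_left)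
next
  case (Suc k)
  have "moment (Suc k) (n + 2) V z = moment k (n + 2) V z" "moment (Suc k) (n + 1) V z = moment k (n + 1) V z"
    "moment (Suc k) (n + 2) (\<lambda>j. V (Suc j)) z = moment k (n + 2) (\<lambda>j. V (Suc j)) z"
    "moment (Suc k) (n + 1) (\<lambda>j. V (Suc j)) z = moment k (n + 1) (\<lambda>j. V (Suc j)) z"
    using Suc.prems by (intro Suc.IH admissible_Suc; simp)+
  then show ?case unfolding moment.simps(2)[of "Suc k" n V z] by (simp only: moment.simps(2)[of k n V z, symmetric])
qed

lemma moment_regular:
  assumes "admissible V" "reg \<le> n" "Re z > 0"
  shows "moment reg n V z = moment 0 n V z"
proof (cases "s > 0")
  case True
  have "moment k n V z = moment 0 n V z" for k
    using moment_Suc[OF assms(1) _ assms(3) True] assms(2) by (induction k) (auto simp del: moment.simps)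
  then show ?thesis .
next
  case False
  then have "reg = 0" by (simp add: reg_def)
  then show ?thesis by simp
qed

text \<open>For positive \<open>s\<close> this is the definition of one further step, which by
  \<open>moment_Suc\<close> changes nothing; for \<open>s \<le> 0\<close> the moments are genuine
  integrals.\<close>

lemma moment_recursion:
  assumes V: "admissible V" and z: "Re z > 0"
  shows "denom n * moment reg n V z = (z + 2 * \<i> * of_real \<sigma>) * moment reg (n + 2) V z
    + (z * of_real d - of_nat n - 2 + 2 * coefA) * moment reg (n + 1) V z
    - moment reg (n + 2) (\<lambda>j. V (Suc j)) z - of_real d * moment reg (n + 1) (\<lambda>j. V (Suc j)) z"
proof (cases "s > 0")
  case True
  have "moment (Suc reg) n V z = moment reg n V z" by (rule moment_Suc[OF V _ z True]) simp
  then show ?thesis using denom_nz[OF True, of n] unfolding moment.simps(2)[of reg] by (simp add: field_simps)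
next
  case False
  then have "reg = 0" by (simp add: reg_def)
  then show ?thesis using moment_by_parts[OF V _ z, of n "moment 0"] by simp
qed

text \<open>The recursion at \<open>n + 1\<close>, rewritten with \<open>denom n\<close>, which
  differs from \<open>denom (n + 1)\<close> by \<open>d\<close>. In this shape it can absorb the
  extra terms of the next two rules and cancel the divisor of level \<open>n\<close>.\<close>

lemma moment_recursion_Suc:
  assumes V: "admissible V" "reg \<le> n + 1 + k" "Re z > 0" "s > 0"
  shows "denom n * moment k (n + 1) V z = (z + 2 * \<i> * of_real \<sigma>) * moment k (n + 3) V z
    + (z * of_real d - of_nat n - 3 + 2 * coefA) * moment k (n + 2) V z
    - moment k (n + 3) (\<lambda>j. V (Suc j)) z - of_real d * moment k (n + 2) (\<lambda>j. V (Suc j)) z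
    - of_real d * moment k (n + 1) V z"
proof -
  have mult_div: "c * (X / c) = X" if "c \<noteq> 0" for c X :: complex using that by simp
  have n: "n + 1 + 2 = n + 3" "n + 1 + 1 = n + 2" "of_nat (n + 1) + (2::complex) = of_nat n + 3" by auto
  have "denom (n + 1) * moment (Suc k) (n + 1) V z = (z + 2 * \<i> * of_real \<sigma>) * moment k (n + 1 + 2) V z
    + (z * of_real d - of_nat (n + 1) - 2 + 2 * coefA) * moment k (n + 1 + 1) V z
    - moment k (n + 1 + 2) (\<lambda>j. V (Suc j)) z - of_real d * moment k (n + 1 + 1) (\<lambda>j. V (Suc j)) z"
    unfolding moment.simps(2) by (rule mult_div[OF denom_nz[OF V(4)]])
  then have "(denom n + of_real d) * moment k (n + 1) V z = (z + 2 * \<i> * of_real \<sigma>) * moment k (n + 3) V z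
    + (z * of_real d - of_nat n - 3 + 2 * coefA) * moment k (n + 2) V z
    - moment k (n + 3) (\<lambda>j. V (Suc j)) z - of_real d * moment k (n + 2) (\<lambda>j. V (Suc j)) z"
    unfolding n moment_Suc[OF V] diff_diff_eq n by (simp add: denom_def algebra_simps)
  then show ?thesis by (simp only: distrib_right eq_diff_eq)
qed

lemma moment_cong:
  assumes "\<And>j x. x > 0 \<Longrightarrow> V j x = U j x"
  shows "moment k n V z = moment k n U z"
  using assms
proof (induction k arbitrary: n V U)
  case 0
  then show ?case unfolding moment.simps laplace_def by (intro set_lebesgue_integral_cong) auto
next
  case (Suc k)
  show ?case unfolding moment.simps(2)
    using Suc.IH[of V U] Suc.IH[of "\<lambda>j. V (Suc j)" "\<lambda>j. U (Suc j)"] Suc.prems by simp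
qed

lemma moment_add:
  assumes "admissible V" "admissible U" "reg \<le> n + k" "Re z > 0"
  shows "moment k n (\<lambda>j x. V j x + U j x) z = moment k n V z + moment k n U z"
  using assms
proof (induction k arbitrary: n V U)
  case 0
  have i: "set_integrable lborel {0<..} (\<lambda>x. exp (- z * of_real x) * (of_real x ^ n * (exp (- 2 * H x) * V 0 x)))"
      "set_integrable lborel {0<..} (\<lambda>x. exp (- z * of_real x) * (of_real x ^ n * (exp (- 2 * H x) * U 0 x)))"
    by (rule subexponential_laplace_integrable[OF moment_subexponential]; use 0 in simp)+
  show ?case unfolding moment.simps laplace_def set_integral_add(2)[OF i, symmetric] by (simp only: distrib_left)
next
  case (Suc k)
  have e: "moment k (n + 2) (\<lambda>j x. V j x + U j x) z = moment k (n + 2) V z + moment k (n + 2) U z"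
    "moment k (n + 1) (\<lambda>j x. V j x + U j x) z = moment k (n + 1) V z + moment k (n + 1) U z"
    "moment k (n + 2) (\<lambda>j x. V (Suc j) x + U (Suc j) x) z = moment k (n + 2) (\<lambda>j. V (Suc j)) z + moment k (n + 2) (\<lambda>j. U (Suc j)) z"
    "moment k (n + 1) (\<lambda>j x. V (Suc j) x + U (Suc j) x) z = moment k (n + 1) (\<lambda>j. V (Suc j)) z + moment k (n + 1) (\<lambda>j. U (Suc j)) z"
    using Suc.prems by (intro Suc.IH admissible_Suc; simp)+
  show ?case unfolding moment.simps(2) e add_divide_distrib[symmetric] by (simp add: algebra_simps)
qed

lemma moment_cmult: "moment k n (\<lambda>j x. c * V j x) z = c * moment k n V z"
proof (induction k arbitrary: n V)
  case 0
  show ?case unfolding moment.simps laplace_def set_integral_mult_right[symmetric]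
    by (intro set_lebesgue_integral_cong) (auto simp: mult_ac)
next
  case (Suc k)
  show ?case unfolding moment.simps(2) Suc[of _ V] Suc[of _ "\<lambda>j. V (Suc j)"] by (simp add: algebra_simps)
qed

text \<open>For a formal recursion this is a genuine consistency statement. The derivative of x V
  contributes the additional term V, and the resulting moments are exactly the difference between
  the recursions at \<open>n\<close> and at \<open>n + 1\<close>.\<close>

lemma moment_xmul:
  assumes "admissible V" "reg \<le> n + k" "Re z > 0" "k > 0 \<Longrightarrow> s > 0"
  shows "moment k n (xmul V) z = moment k (n + 1) V z"
  using assms
proof (induction k arbitrary: n V)
  case 0
  show ?case by (simp add: xmul_0 mult_ac)
next
  case (Suc k)
  have s0: "s > 0" using Suc.prems by simp
  note V = Suc.prems(1) and V' = admissible_Suc[OF Suc.prems(1)]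
  have e1: "moment k (n + 2) (xmul V) z = moment k (n + 2 + 1) V z" "moment k (n + 1) (xmul V) z = moment k (n + 1 + 1) V z"
    using Suc.prems s0 by (intro Suc.IH; simp)+
  have e2: "moment k i (\<lambda>j. xmul V (Suc j)) z = moment k (i + 1) (\<lambda>j. V (Suc j)) z + moment k i V z"
    if "i = n + 2 \<or> i = n + 1" for i
  proof -
    have i: "reg \<le> i + k" using that Suc.prems by auto
    have "moment k i (\<lambda>j. xmul V (Suc j)) z = moment k i (xmul (\<lambda>j. V (Suc j))) z + moment k i V z"
      unfolding xmul_Suc by (intro moment_add admissible_xmul V V' i Suc.prems)
    also have "moment k i (xmul (\<lambda>j. V (Suc j))) z = moment k (i + 1) (\<lambda>j. V (Suc j)) z"
      using Suc.prems s0 by (intro Suc.IH V' i) auto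
    finally show ?thesis .
  qed
  have e3: "moment (Suc k) (n + 1) V z = moment k (n + 1) V z" using Suc.prems by (intro moment_Suc s0) auto
  have r: "reg \<le> n + 1 + k" using Suc.prems by simp
  have n: "n + 2 + 1 = n + 3" "n + 1 + 1 = n + 2" by auto
  have "(z + 2 * \<i> * of_real \<sigma>) * moment k (n + 2) (xmul V) z
    + (z * of_real d - of_nat n - 2 + 2 * coefA) * moment k (n + 1) (xmul V) z
    - moment k (n + 2) (\<lambda>j. xmul V (Suc j)) z - of_real d * moment k (n + 1) (\<lambda>j. xmul V (Suc j)) z
    = denom n * moment k (n + 1) V z"
    unfolding e1 e2[OF disjI1[OF refl]] e2[OF disjI2[OF refl]] n moment_recursion_Suc[OF V r Suc.prems(3) s0]
    by (simp add: algebra_simps)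
  then have "moment (Suc k) n (xmul V) z = moment k (n + 1) V z"
    unfolding moment.simps(2) using denom_nz[OF s0, of n] by simp
  then show ?case unfolding e3 .
qed

text \<open>The coefficients of the recursion depend on \<open>z\<close>; their derivatives 1 and
  \<open>d\<close> produce the same correction as the Leibniz term in \<open>moment_xmul\<close>,
  again absorbed by \<open>moment_recursion_Suc\<close>.\<close>

lemma moment_deriv:
  assumes "admissible V" "reg \<le> n + k" "Re z > 0" "k > 0 \<Longrightarrow> s > 0"
  shows "(moment k n V has_field_derivative - moment k (n + 1) V z) (at z)"
  using assms
proof (induction k arbitrary: n V)
  case 0
  have "subexponential (\<lambda>x. of_real x ^ n * (exp (- 2 * H x) * V 0 x))" using 0 by (intro moment_subexponential) auto
  from laplace_has_field_derivative[OF this 0(3)] show ?case by (simp add: mult_ac)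
next
  case (Suc k)
  have s0: "s > 0" using Suc.prems by simp
  note V = Suc.prems(1) and V' = admissible_Suc[OF Suc.prems(1)]
  have d: "(moment k (n + 2) V has_field_derivative - moment k (n + 2 + 1) V z) (at z)"
    "(moment k (n + 1) V has_field_derivative - moment k (n + 1 + 1) V z) (at z)"
    "(moment k (n + 2) (\<lambda>j. V (Suc j)) has_field_derivative - moment k (n + 2 + 1) (\<lambda>j. V (Suc j)) z) (at z)"
    "(moment k (n + 1) (\<lambda>j. V (Suc j)) has_field_derivative - moment k (n + 1 + 1) (\<lambda>j. V (Suc j)) z) (at z)"
    using Suc.prems s0 by (intro Suc.IH V'; simp)+
  have l: "((\<lambda>z. z + 2 * \<i> * of_real \<sigma>) has_field_derivative 1) (at z)"
    "((\<lambda>z. z * of_real d - of_nat n - 2 + 2 * coefA) has_field_derivative of_real d) (at z)"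
    by (auto intro!: derivative_eq_intros)
  note D = DERIV_cdivide[OF DERIV_diff[OF DERIV_diff[OF DERIV_add[OF DERIV_mult'[OF l(1) d(1)] DERIV_mult'[OF l(2) d(2)]] d(3)]
     DERIV_cmult[OF d(4), of "of_real d"]], of "denom n"]
  have e: "moment (Suc k) (n + 1) V z = moment k (n + 1) V z"
    using Suc.prems by (intro moment_Suc s0) auto
  have r: "reg \<le> n + 1 + k" using Suc.prems by simp
  have n: "n + 2 + 1 = n + 3" "n + 1 + 1 = n + 2" by auto
  have "(z + 2 * \<i> * of_real \<sigma>) * - moment k (n + 2 + 1) V z + 1 * moment k (n + 2) V z
     + ((z * of_real d - of_nat n - 2 + 2 * coefA) * - moment k (n + 1 + 1) V z + of_real d * moment k (n + 1) V z)
     - - moment k (n + 2 + 1) (\<lambda>j. V (Suc j)) z - of_real d * - moment k (n + 1 + 1) (\<lambda>j. V (Suc j)) z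
    = denom n * - moment k (n + 1) V z"
    unfolding n mult_minus_right moment_recursion_Suc[OF V r Suc.prems(3) s0]
    by (simp add: algebra_simps)
  with D have "((\<lambda>z. moment (Suc k) n V z) has_field_derivative denom n * - moment k (n + 1) V z / denom n) (at z)"
    unfolding moment.simps(2) by simp
  then show ?case using denom_nz[OF s0, of n] unfolding e by simp
qed

text \<open>The outer radius is there because the coefficients of the recursion grow linearly in
  \<open>z\<close>.\<close>

lemma moment_bounded_on_annulus:
  assumes "admissible V" "reg \<le> n + k" "c > 0"
  shows "\<exists>K. \<forall>z. Re z > 0 \<longrightarrow> norm z \<ge> c \<longrightarrow> norm z \<le> R \<longrightarrow> norm (moment k n V z) \<le> K"
  using assms
proof (induction k arbitrary: n V)
  case 0
  then show ?case using moment_bounded[of V n c] by auto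
next
  case (Suc k)
  note V' = admissible_Suc[OF Suc.prems(1)]
  have r: "reg \<le> n + 2 + k" "reg \<le> n + 1 + k" using Suc.prems by auto
  obtain K1 where K1: "\<And>z. Re z > 0 \<Longrightarrow> norm z \<ge> c \<Longrightarrow> norm z \<le> R \<Longrightarrow> norm (moment k (n + 2) V z) \<le> K1"
    using Suc.IH[OF Suc.prems(1) r(1) Suc.prems(3)] by blast
  obtain K2 where K2: "\<And>z. Re z > 0 \<Longrightarrow> norm z \<ge> c \<Longrightarrow> norm z \<le> R \<Longrightarrow> norm (moment k (n + 1) V z) \<le> K2"
    using Suc.IH[OF Suc.prems(1) r(2) Suc.prems(3)] by blast
  obtain K3 where K3: "\<And>z. Re z > 0 \<Longrightarrow> norm z \<ge> c \<Longrightarrow> norm z \<le> R \<Longrightarrow> norm (moment k (n + 2) (\<lambda>j. V (Suc j)) z) \<le> K3"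
    using Suc.IH[OF V' r(1) Suc.prems(3)] by blast
  obtain K4 where K4: "\<And>z. Re z > 0 \<Longrightarrow> norm z \<ge> c \<Longrightarrow> norm z \<le> R \<Longrightarrow> norm (moment k (n + 1) (\<lambda>j. V (Suc j)) z) \<le> K4"
    using Suc.IH[OF V' r(2) Suc.prems(3)] by blast
  show ?case
  proof (intro exI allI impI)
    fix z assume z: "Re z > 0" "norm z \<ge> c" "norm z \<le> R"
    have a: "norm (z + 2 * \<i> * of_real \<sigma>) \<le> R + 2 * \<sigma>"
      by (rule order_trans[OF norm_triangle_ineq]) (use z \<sigma> in \<open>simp add: norm_mult\<close>)
    have b: "norm (z * of_real d - of_nat n - 2 + 2 * coefA) \<le> R * d + real n + 2 + 2 * norm coefA"
    proof -
      have "norm (z * of_real d) \<le> R * d" using z d by (simp add: norm_mult mult_right_mono)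
      moreover have "norm (z * of_real d - of_nat n - 2 + 2 * coefA) \<le> norm (z * of_real d) + norm (of_nat n :: complex) + norm (2::complex) + norm (2 * coefA)"
        by (intro order_trans[OF norm_triangle_ineq] order_trans[OF norm_triangle_ineq4] add_mono order_refl)
      ultimately show ?thesis by (simp add: norm_mult)
    qed
    have R: "R \<ge> 0" using z norm_ge_zero order_trans by blast
    have t: "norm (A + B - C - D) \<le> norm A + norm B + norm C + norm D" for A B C D :: complex
      by (intro order_trans[OF norm_triangle_ineq4] order_trans[OF norm_triangle_ineq] add_mono order_refl)
    have "norm ((z + 2 * \<i> * of_real \<sigma>) * moment k (n + 2) V z
      + (z * of_real d - of_nat n - 2 + 2 * coefA) * moment k (n + 1) V z
      - moment k (n + 2) (\<lambda>j. V (Suc j)) z - of_real d * moment k (n + 1) (\<lambda>j. V (Suc j)) z)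
      \<le> (R + 2 * \<sigma>) * K1 + (R * d + real n + 2 + 2 * norm coefA) * K2 + K3 + d * K4"
      using a b K1[OF z] K2[OF z] K3[OF z] K4[OF z] \<sigma> d R
      by (intro order_trans[OF t] add_mono) (auto simp: norm_mult intro!: mult_mono)
    then show "norm (moment (Suc k) n V z) \<le> ((R + 2 * \<sigma>) * K1 + (R * d + real n + 2 + 2 * norm coefA) * K2 + K3 + d * K4) / norm (denom n)"
      unfolding moment.simps(2) norm_divide by (rule divide_right_mono) simp
  qed
qed

text \<open>A step pays a factor |z| for each term. The terms with power \<open>n + 2\<close> gain
  two powers of decay, those with \<open>n + 1\<close> only one, and the growing part of their
  coefficient carries the factor \<open>d\<close>. So a step is neutral for \<open>d > 0\<close> and
  gains one power in the extremal case.\<close>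

lemma moment_decay_regularized:
  assumes "admissible V" "reg \<le> n + k" "c > 0"
  shows "\<exists>K. \<forall>z. norm z \<ge> 1 \<longrightarrow> Re z \<ge> c * norm z \<longrightarrow>
    norm (moment k n V z) \<le> K * norm z powr (ex0 - 1 - real n - (if d = 0 then real k else 0))"
  using assms
proof (induction k arbitrary: n V)
  case 0
  then show ?case using moment_decay[of V n c] by auto
next
  case (Suc k)
  note V' = admissible_Suc[OF Suc.prems(1)]
  \<comment> \<open>The gain per step: 1 in the extremal case, 0 otherwise.\<close>
  define \<delta> :: real where "\<delta> = (if d = 0 then 1 else 0)"
  have e: "(if d = 0 then real k else 0) = \<delta> * real k" for k by (simp add: \<delta>_def)
  have r: "reg \<le> n + 2 + k" "reg \<le> n + 1 + k" using Suc.prems by auto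
  note IH = Suc.IH[unfolded e]
  obtain K1 where K1: "\<And>z. norm z \<ge> 1 \<Longrightarrow> Re z \<ge> c * norm z \<Longrightarrow> norm (moment k (n + 2) V z) \<le> K1 * norm z powr (ex0 - 1 - real (n + 2) - \<delta> * real k)"
    using IH[OF Suc.prems(1) r(1) Suc.prems(3)] by blast
  obtain K2 where K2: "\<And>z. norm z \<ge> 1 \<Longrightarrow> Re z \<ge> c * norm z \<Longrightarrow> norm (moment k (n + 1) V z) \<le> K2 * norm z powr (ex0 - 1 - real (n + 1) - \<delta> * real k)"
    using IH[OF Suc.prems(1) r(2) Suc.prems(3)] by blast
  obtain K3 where K3: "\<And>z. norm z \<ge> 1 \<Longrightarrow> Re z \<ge> c * norm z \<Longrightarrow> norm (moment k (n + 2) (\<lambda>j. V (Suc j)) z) \<le> K3 * norm z powr (ex0 - 1 - real (n + 2) - \<delta> * real k)"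
    using IH[OF V' r(1) Suc.prems(3)] by blast
  obtain K4 where K4: "\<And>z. norm z \<ge> 1 \<Longrightarrow> Re z \<ge> c * norm z \<Longrightarrow> norm (moment k (n + 1) (\<lambda>j. V (Suc j)) z) \<le> K4 * norm z powr (ex0 - 1 - real (n + 1) - \<delta> * real k)"
    using IH[OF V' r(2) Suc.prems(3)] by blast
  define \<tau> where "\<tau> = ex0 - 1 - real n - \<delta> * real (Suc k)"
  define B where "B = d + real n + 2 + 2 * norm coefA"
  have B: "B \<ge> 0" using d by (simp add: B_def)
  have comb: "norm (X * Y) \<le> A * \<bar>K\<bar> * t powr \<tau>"
    if "norm X \<le> A * t powr f" "norm Y \<le> K * t powr g" "f + g \<le> \<tau>" "t \<ge> 1" "A \<ge> 0" for X Y :: complex and A K t f g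
  proof -
    have "norm Y \<le> \<bar>K\<bar> * t powr g" by (rule order_trans[OF that(2)]) (intro mult_right_mono, auto)
    then have "norm (X * Y) \<le> (A * t powr f) * (\<bar>K\<bar> * t powr g)" unfolding norm_mult using that by (intro mult_mono) auto
    also have "\<dots> = A * \<bar>K\<bar> * t powr (f + g)" by (simp add: powr_add)
    also have "\<dots> \<le> A * \<bar>K\<bar> * t powr \<tau>" using that by (intro mult_left_mono powr_mono) auto
    finally show ?thesis .
  qed
  have \<delta>: "0 \<le> \<delta>" "\<delta> \<le> 1" by (auto simp: \<delta>_def)
  show ?case
    unfolding e \<tau>_def[symmetric]
  proof (intro exI allI impI)
    fix z :: complex assume z: "1 \<le> norm z" "c * norm z \<le> Re z"
    define t where "t = norm z"
    have t: "t \<ge> 1" using z by (simp add: t_def)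
    have a: "norm (z + 2 * \<i> * of_real \<sigma>) \<le> (1 + 2 * \<sigma>) * t powr 1"
    proof -
      have "norm (z + 2 * \<i> * of_real \<sigma>) \<le> t + 2 * \<sigma>"
        by (rule order_trans[OF norm_triangle_ineq]) (use \<sigma> in \<open>simp add: norm_mult t_def\<close>)
      also have "\<dots> \<le> t + 2 * \<sigma> * t" using t \<sigma> by simp
      finally show ?thesis using t by (simp add: algebra_simps)
    qed
    have b: "norm (z * of_real d - of_nat n - 2 + 2 * coefA) \<le> B * t powr (1 - \<delta>)"
    proof -
      have t1: "1 \<le> t powr (1 - \<delta>)" using t \<delta> by (intro ge_one_powr_ge_zero) auto
      have "norm (z * of_real d) \<le> d * t powr (1 - \<delta>)" using d t by (auto simp: norm_mult \<delta>_def t_def)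
      moreover have "real n + 2 + 2 * norm coefA \<le> (real n + 2 + 2 * norm coefA) * t powr (1 - \<delta>)"
        using mult_left_mono[OF t1, of "real n + 2 + 2 * norm coefA"] by simp
      moreover have "norm (z * of_real d - of_nat n - 2 + 2 * coefA) \<le> norm (z * of_real d) + norm (of_nat n :: complex) + norm (2::complex) + norm (2 * coefA)"
        by (intro order_trans[OF norm_triangle_ineq] order_trans[OF norm_triangle_ineq4] add_mono order_refl)
      then have "norm (z * of_real d - of_nat n - 2 + 2 * coefA) \<le> norm (z * of_real d) + (real n + 2 + 2 * norm coefA)" by (simp add: norm_mult)
      ultimately show ?thesis unfolding B_def by (simp add: algebra_simps)
    qed
    have f: "norm (of_real d :: complex) \<le> d * t powr (1 - \<delta>)" using d t by (auto simp: \<delta>_def)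
    have tr: "norm (A + B - C - D) \<le> norm A + norm B + norm C + norm D" for A B C D :: complex
      by (intro order_trans[OF norm_triangle_ineq4] order_trans[OF norm_triangle_ineq] add_mono order_refl)
    have "norm ((z + 2 * \<i> * of_real \<sigma>) * moment k (n + 2) V z
      + (z * of_real d - of_nat n - 2 + 2 * coefA) * moment k (n + 1) V z
      - 1 * moment k (n + 2) (\<lambda>j. V (Suc j)) z - of_real d * moment k (n + 1) (\<lambda>j. V (Suc j)) z)
      \<le> (1 + 2 * \<sigma>) * \<bar>K1\<bar> * t powr \<tau> + B * \<bar>K2\<bar> * t powr \<tau> + 1 * \<bar>K3\<bar> * t powr \<tau> + d * \<bar>K4\<bar> * t powr \<tau>"
    proof (intro order_trans[OF tr] add_mono)
      show "norm ((z + 2 * \<i> * of_real \<sigma>) * moment k (n + 2) V z) \<le> (1 + 2 * \<sigma>) * \<bar>K1\<bar> * t powr \<tau>"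
        by (rule comb[OF a K1[OF z, folded t_def]]) (use t \<delta> \<sigma> in \<open>auto simp: \<tau>_def algebra_simps\<close>)
      show "norm ((z * of_real d - of_nat n - 2 + 2 * coefA) * moment k (n + 1) V z) \<le> B * \<bar>K2\<bar> * t powr \<tau>"
        by (rule comb[OF b K2[OF z, folded t_def]]) (use t B in \<open>auto simp: \<tau>_def algebra_simps\<close>)
      show "norm (1 * moment k (n + 2) (\<lambda>j. V (Suc j)) z) \<le> 1 * \<bar>K3\<bar> * t powr \<tau>"
        by (rule comb[of _ _ _ 0, OF _ K3[OF z, folded t_def]]) (use t \<delta> in \<open>auto simp: \<tau>_def algebra_simps\<close>)
      show "norm (of_real d * moment k (n + 1) (\<lambda>j. V (Suc j)) z) \<le> d * \<bar>K4\<bar> * t powr \<tau>"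
        by (rule comb[OF f K4[OF z, folded t_def]]) (use t d in \<open>auto simp: \<tau>_def algebra_simps\<close>)
    qed
    also have "\<dots> = ((1 + 2 * \<sigma>) * \<bar>K1\<bar> + B * \<bar>K2\<bar> + 1 * \<bar>K3\<bar> + d * \<bar>K4\<bar>) * t powr \<tau>" by (simp add: algebra_simps)
    finally have "norm (moment (Suc k) n V z) \<le> ((1 + 2 * \<sigma>) * \<bar>K1\<bar> + B * \<bar>K2\<bar> + 1 * \<bar>K3\<bar> + d * \<bar>K4\<bar>) * t powr \<tau> / norm (denom n)"
      unfolding moment.simps(2) norm_divide mult_1 by (rule divide_right_mono) simp
    then show "norm (moment (Suc k) n V z) \<le> ((1 + 2 * \<sigma>) * \<bar>K1\<bar> + B * \<bar>K2\<bar> + 1 * \<bar>K3\<bar> + d * \<bar>K4\<bar>) / norm (denom n) * norm z powr \<tau>"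
      by (simp add: t_def)
  qed
qed

definition "mom j = moment reg j W"

lemma mom_deriv: "Re z > 0 \<Longrightarrow> (mom j has_field_derivative - mom (Suc j) z) (at z)"
  unfolding mom_def using moment_deriv[OF admissible_W, of j reg z] reg_pos by simp

text \<open>The same exponent for all \<open>d\<close>: for \<open>d = 0\<close> and
  \<open>s > 0\<close> the singularity has order 2 s, but the \<open>reg\<close> steps, at least 2 s
  of them, compensate for the surplus.\<close>

lemma mom_decay:
  assumes "0 < c"
  shows "\<exists>K. \<forall>z. norm z \<ge> 1 \<longrightarrow> Re z \<ge> c * norm z \<longrightarrow> norm (mom j z) \<le> K * norm z powr (s - 1 - real j)"
proof -
  obtain K where K: "\<And>z. norm z \<ge> 1 \<Longrightarrow> Re z \<ge> c * norm z \<Longrightarrow>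
    norm (mom j z) \<le> K * norm z powr (ex0 - 1 - real j - (if d = 0 then real reg else 0))"
    using moment_decay_regularized[OF admissible_W, of j reg c] assms unfolding mom_def by auto
  have e: "ex0 - 1 - real j - (if d = 0 then real reg else 0) \<le> s - 1 - real j"
    using reg_ge d by (auto simp: ex0_def)
  have "norm (mom j z) \<le> \<bar>K\<bar> * norm z powr (s - 1 - real j)" if "norm z \<ge> 1" "Re z \<ge> c * norm z" for z
    by (rule order_trans[OF K[OF that]]) (use that powr_mono[OF e that(1)] in \<open>auto intro!: mult_mono\<close>)
  then show ?thesis by blast
qed

lemma mom_bounded: "0 < c \<Longrightarrow> \<exists>K. \<forall>z. Re z > 0 \<longrightarrow> norm z \<ge> c \<longrightarrow> norm z \<le> R \<longrightarrow> norm (mom j z) \<le> K"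
  unfolding mom_def by (rule moment_bounded_on_annulus[OF admissible_W]) auto

definition "c1 z = - 2 * z + of_real d * z ^ 2 - 2 * \<i> * of_real \<sigma> + 2 * z * (\<i> * of_real (\<sigma> * d) + coefB) + 4 * \<i> * of_real (s * \<sigma>)"
definition "c0 z = - (of_real d * z) - (\<i> * of_real (\<sigma> * d) + coefB) + 2 * z * coefC + 4 * \<i> * of_real (s * \<sigma>) * of_real (m + d / 2) - of_real lam"

text \<open>The left side of the radial equation is an admissible family \<open>E\<close> that
  vanishes identically, so its moments are 0. Multiplication by \<open>x\<close> shifts the power,
  and the recursion, applied to W' and then to W, removes the derivatives and brings in
  \<open>z\<close>.\<close>

lemma mom_ode:
  assumes z: "Re z > 0"
  shows "z * (z + 2 * \<i> * of_real \<sigma>) * mom 2 z + c1 z * mom 1 z + c0 z * mom 0 z = 0"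
proof -
  define a where "a = - coefA + 4 * \<i> * of_real (s * \<sigma>) * of_real (m + d / 2) - of_real lam"
  define b where "b = - 2 * \<i> * of_real \<sigma> + 4 * \<i> * of_real (s * \<sigma>)"
  define W1 where "W1 = (\<lambda>j. W (Suc j))"
  define W2 where "W2 = (\<lambda>j. W1 (Suc j))"
  have adm: "admissible W" "admissible W1" "admissible W2"
    unfolding W2_def W1_def by (intro admissible_Suc admissible_W)+
  define E1 where "E1 = (\<lambda>j x. xmul (xmul W2) j x + of_real d * xmul W2 j x)"
  define E2 where "E2 = (\<lambda>j x. (of_real d - 2 * coefC) * W1 j x + (2 - 2 * coefA) * xmul W1 j x)"
  define E3 where "E3 = (\<lambda>j x. - 2 * \<i> * of_real \<sigma> * xmul (xmul W1) j x + (a * W j x + b * xmul W j x))"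
  define E where "E = (\<lambda>j x. E1 j x + (E2 j x + E3 j x))"
  have admE: "admissible E1" "admissible E2" "admissible E3" "admissible (\<lambda>j x. E2 j x + E3 j x)" "admissible E"
    unfolding E_def E1_def E2_def E3_def by (intro admissible_add admissible_cmult admissible_xmul adm)+
  \<comment> \<open>All members of the family are needed, not only the first, since regularized
    moments also evaluate derivatives.\<close>
  have E0: "E j x = 0" if "x > 0" for j x
    using that
  proof (induction j arbitrary: x)
    case 0
    have "E 0 x = of_real (x * (x + d)) * W 2 x + (of_real (2 * x + d) - 2 * P x) * W 1 x
      + (- (\<i> * of_real \<sigma> * of_real (2 * x + d) + (2 * \<i> * of_real (m * \<sigma>) + of_real s))
          + 4 * \<i> * of_real (s * \<sigma>) * of_real (x + m + d / 2) - of_real lam) * W 0 x"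
      unfolding E_def E1_def E2_def E3_def xmul_0 P_coef a_def b_def W1_def W2_def
      by (simp add: coefA_def coefB_def numeral_2_eq_2 power2_eq_square algebra_simps)
    then show ?case using ode[OF 0] by simp
  next
    case (Suc j)
    have "(E j has_vector_derivative E (Suc j) x) (at x)" by (rule admissible_deriv[OF admE(5) Suc.prems])
    moreover have "(E j has_vector_derivative 0) (at x)"
      by (rule has_vector_derivative_transform_within_open[OF has_vector_derivative_const[of 0] open_greaterThan[of 0]])
        (use Suc in auto)
    ultimately show ?case by (rule vector_derivative_unique_at)
  qed
  have r: "reg > 0 \<Longrightarrow> s > 0" using reg_pos by blast
  note x = moment_xmul[OF _ _ z r] and ad = moment_add[OF _ _ _ z]
  have "0 = moment reg 0 (\<lambda>j x. 0 * W j x) z" unfolding moment_cmult by simp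
  also have "\<dots> = moment reg 0 E z" by (rule moment_cong) (simp add: E0)
  also have "\<dots> = moment reg 0 E1 z + (moment reg 0 E2 z + moment reg 0 E3 z)"
    unfolding E_def by (subst ad | fact admE | simp)+
  also have "moment reg 0 E1 z = moment reg 2 W2 z + of_real d * moment reg 1 W2 z"
    unfolding E1_def by (subst ad x moment_cmult | intro admissible_add admissible_cmult admissible_xmul adm | simp add: numeral_2_eq_2)+
  also have "moment reg 0 E2 z = (of_real d - 2 * coefC) * moment reg 0 W1 z + (2 - 2 * coefA) * moment reg 1 W1 z"
    unfolding E2_def by (subst ad x moment_cmult | intro admissible_add admissible_cmult admissible_xmul adm | simp)+
  also have "moment reg 0 E3 z = - 2 * \<i> * of_real \<sigma> * moment reg 2 W1 z + (a * moment reg 0 W z + b * moment reg 1 W z)"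
    unfolding E3_def by (subst ad x moment_cmult | intro admissible_add admissible_cmult admissible_xmul adm | simp add: numeral_2_eq_2)+
  finally have e0: "0 = (moment reg 2 W2 z + of_real d * moment reg 1 W2 z)
    + ((of_real d - 2 * coefC) * moment reg 0 W1 z + (2 - 2 * coefA) * moment reg 1 W1 z
    + (- 2 * \<i> * of_real \<sigma> * moment reg 2 W1 z + (a * moment reg 0 W z + b * moment reg 1 W z)))" .
  \<comment> \<open>The moments of W'' occur in \<open>e0\<close> with the same combination as here,
    so this substitution cancels them; \<open>e2\<close> then does the same one order lower.\<close>
  have e1: "(of_real d - 2 * coefC) * moment reg 0 W1 z = (z + 2 * \<i> * of_real \<sigma>) * moment reg 2 W1 z
    + (z * of_real d - 2 + 2 * coefA) * moment reg 1 W1 z - moment reg 2 W2 z - of_real d * moment reg 1 W2 z"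
    using moment_recursion[OF adm(2) z, of 0, folded W2_def] by (simp add: denom_def numeral_2_eq_2)
  have e2: "(of_real d - 2 * coefC) * mom 0 z = (z + 2 * \<i> * of_real \<sigma>) * mom 2 z
    + (z * of_real d - 2 + 2 * coefA) * mom 1 z - moment reg 2 W1 z - of_real d * moment reg 1 W1 z"
    using moment_recursion[OF adm(1) z, of 0, folded W1_def] by (simp add: denom_def mom_def numeral_2_eq_2)
  have "0 = z * (moment reg 2 W1 z + of_real d * moment reg 1 W1 z) + (a * mom 0 z + b * mom 1 z)"
    using e0 unfolding e1 by (simp add: mom_def algebra_simps)
  moreover have "moment reg 2 W1 z + of_real d * moment reg 1 W1 z = (z + 2 * \<i> * of_real \<sigma>) * mom 2 z
    + (z * of_real d - 2 + 2 * coefA) * mom 1 z - (of_real d - 2 * coefC) * mom 0 z"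
    unfolding e2 by (simp add: algebra_simps)
  ultimately have "0 = z * ((z + 2 * \<i> * of_real \<sigma>) * mom 2 z
    + (z * of_real d - 2 + 2 * coefA) * mom 1 z - (of_real d - 2 * coefC) * mom 0 z) + (a * mom 0 z + b * mom 1 z)" by simp
  then show ?thesis unfolding c1_def c0_def a_def b_def coefA_def by (simp add: algebra_simps power2_eq_square)
qed

section \<open>The transform in a coordinate with singular points 0 and -2, in self-adjoint
  form\<close>

definition "zet z = - 2 * \<i> * of_real \<sigma> - \<i> * of_real \<sigma> * z"
text \<open>Minus the logarithmic derivative of \<open>EE\<close> is
  \<open>TT z / (z * (z + 2))\<close>. With this choice the first-order coefficient of the
  transformed equation is 2 z + 2 - 2 T, and conjugation by \<open>EE\<close> leaves 2 z + 2, the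
  derivative of z (z + 2).\<close>

definition "TT z = (z + 2) * (2 * \<i> * of_real (m * \<sigma>) - \<i> * of_real (\<sigma> * d / 2) * z) + of_real s * z"
definition "F0 z = mom 0 (zet z)"
definition "F1 z = \<i> * of_real \<sigma> * mom 1 (zet z)"
definition "F2 z = - of_real (\<sigma>\<^sup>2) * mom 2 (zet z)"
text \<open>At 0 it behaves like the power - 2 i m \<sigma> of \<open>z\<close>: the exponent at
  this singular point involves m \<sigma> and not \<kappa>. For \<open>d > 0\<close> the middle term
  decays into the upper half-plane and will outweigh the quadratic growth of
  \<open>TT\<close>.\<close>

definition "EE z = exp (- 2 * \<i> * of_real (m * \<sigma>) * Ln z + \<i> * of_real (\<sigma> * d / 2) * z - of_real s * Ln (z + 2))"
definition "GG z = EE z * F0 z"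
definition "PG z = EE z * (z * (z + 2) * F1 z - TT z * F0 z)"
text \<open>All coefficients are real, so the potential is real for real \<open>z\<close>; this, and
  not the sign of any single term, makes a flux argument possible. \<open>PG\<close> is z (z + 2)
  times the derivative of \<open>GG\<close>.\<close>

definition "QQ z = of_real (2 * \<sigma> * \<kappa>) * (z + 2) - of_real lam + of_real (\<sigma>\<^sup>2) * (z + 2) * (of_real (2 * m) - of_real (d / 2) * z) ^ 2 / z
    - of_real (s\<^sup>2) * z / (z + 2)"

lemma Re_zet: "Re (zet z) = \<sigma> * Im z"
  by (simp add: zet_def)

lemma F0_deriv: "Im z > 0 \<Longrightarrow> (F0 has_field_derivative F1 z) (at z)"
proof -
  assume z: "Im z > 0"
  have zd: "(zet has_field_derivative - \<i> * of_real \<sigma>) (at z)"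
    unfolding zet_def[abs_def] by (auto intro!: derivative_eq_intros)
  have "Re (zet z) > 0" using z \<sigma> by (simp add: Re_zet)
  from DERIV_chain2[OF mom_deriv[OF this, of 0] zd]
  show ?thesis unfolding F0_def[abs_def] F1_def by (simp add: mult_ac)
qed

lemma F1_deriv: "Im z > 0 \<Longrightarrow> (F1 has_field_derivative F2 z) (at z)"
proof -
  assume z: "Im z > 0"
  have zd: "(zet has_field_derivative - \<i> * of_real \<sigma>) (at z)"
    unfolding zet_def[abs_def] by (auto intro!: derivative_eq_intros)
  have "Re (zet z) > 0" using z \<sigma> by (simp add: Re_zet)
  from DERIV_cmult[OF DERIV_chain2[OF mom_deriv[OF this, of 1] zd], of "\<i> * of_real \<sigma>"]
  show ?thesis unfolding F1_def[abs_def] F2_def by (simp add: numeral_2_eq_2 power2_eq_square mult_ac)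
qed

lemma F_ode:
  assumes "Im z > 0"
  shows "z * (z + 2) * F2 z + (2 * z + 2 - 2 * TT z) * F1 z + c0 (zet z) * F0 z = 0"
proof -
  have "Re (zet z) > 0" using assms \<sigma> by (simp add: Re_zet)
  note o = mom_ode[OF this]
  have 1: "zet z * (zet z + 2 * \<i> * of_real \<sigma>) = z * (z + 2) * (- of_real (\<sigma>\<^sup>2))"
    by (simp add: zet_def power2_eq_square algebra_simps)
  define e where "e = d / 2"
  have de: "d = 2 * e" by (simp add: e_def)
  have 2: "c1 (zet z) = (2 * z + 2 - 2 * TT z) * (\<i> * of_real \<sigma>)"
    unfolding zet_def c1_def TT_def coefB_def unfolding de by (simp add: power2_eq_square algebra_simps)
  show ?thesis using o unfolding 1 2 F0_def F1_def F2_def by (simp add: algebra_simps)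
qed

lemma EE_deriv:
  assumes "Im z > 0"
  shows "(EE has_field_derivative - (TT z / (z * (z + 2))) * EE z) (at z)"
proof -
  have z: "z \<notin> \<real>\<^sub>\<le>\<^sub>0" "z + 2 \<notin> \<real>\<^sub>\<le>\<^sub>0" using assms by (auto simp: complex_nonpos_Reals_iff)
  then have z0: "z \<noteq> 0" "z + 2 \<noteq> 0" by auto
  have l1: "(Ln has_field_derivative inverse z) (at z)" by (rule has_field_derivative_Ln[OF z(1)])
  have "((\<lambda>z. z + 2) has_field_derivative 1) (at z)" by (auto intro!: derivative_eq_intros)
  from DERIV_chain2[OF has_field_derivative_Ln[OF z(2)] this]
  have l2: "((\<lambda>z. Ln (z + 2)) has_field_derivative inverse (z + 2)) (at z)" by simp
  note e = DERIV_chain2[OF DERIV_exp DERIV_diff[OF DERIV_add[OF DERIV_cmult[OF l1, of "- 2 * \<i> * of_real (m * \<sigma>)"]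
      DERIV_cmult[OF DERIV_ident, of "\<i> * of_real (\<sigma> * d / 2)"]] DERIV_cmult[OF l2, of "of_real s"]]]
  have "- 2 * \<i> * of_real (m * \<sigma>) * inverse z + \<i> * of_real (\<sigma> * d / 2) * 1 - of_real s * inverse (z + 2) = - (TT z / (z * (z + 2)))"
  proof -
    have "TT z / (z * (z + 2)) = (z + 2) * (2 * \<i> * of_real (m * \<sigma>) - \<i> * of_real (\<sigma> * d / 2) * z) / (z * (z + 2)) + of_real s * z / (z * (z + 2))"
      by (simp only: TT_def add_divide_distrib)
    also have "(z + 2) * (2 * \<i> * of_real (m * \<sigma>) - \<i> * of_real (\<sigma> * d / 2) * z) / (z * (z + 2))
        = (2 * \<i> * of_real (m * \<sigma>) - \<i> * of_real (\<sigma> * d / 2) * z) / z" using z0 by simp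
    also have "\<dots> = 2 * \<i> * of_real (m * \<sigma>) * inverse z - \<i> * of_real (\<sigma> * d / 2)"
    proof -
      have "(A - E * z) / z = A * inverse z - E" for A E :: complex using z0(1) by (simp add: field_simps)
      then show ?thesis .
    qed
    also have "of_real s * z / (z * (z + 2)) = of_real s / (z + 2)" using z0 by simp
    also have "\<dots> = of_real s * inverse (z + 2)" by (simp only: divide_inverse)
    finally show ?thesis by simp
  qed
  with e show ?thesis unfolding EE_def[abs_def] by (simp only: mult.commute)
qed

lemma GG_deriv:
  assumes "Im z > 0"
  shows "(GG has_field_derivative PG z / (z * (z + 2))) (at z)"
proof -
  have "z \<noteq> 0" "z + 2 \<noteq> 0" using assms by (auto simp: complex_eq_iff)
  then have z0: "z * (z + 2) \<noteq> 0" by simp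
  have "(GG has_field_derivative EE z * F1 z + (- (TT z / (z * (z + 2))) * EE z) * F0 z) (at z)"
    unfolding GG_def[abs_def] using DERIV_mult'[OF EE_deriv[OF assms] F0_deriv[OF assms]] .
  moreover have "EE z * F1 z + (- (TT z / (z * (z + 2))) * EE z) * F0 z = PG z / (z * (z + 2))"
  proof -
    have "PG z / (z * (z + 2)) = EE z * (z * (z + 2) * F1 z / (z * (z + 2)) - TT z * F0 z / (z * (z + 2)))"
      by (simp only: PG_def times_divide_eq_right[symmetric] diff_divide_distrib)
    also have "z * (z + 2) * F1 z / (z * (z + 2)) = F1 z" using z0 by simp
    finally show ?thesis by (simp add: algebra_simps)
  qed
  ultimately show ?thesis by simp
qed

text \<open>The zeroth-order term created by the conjugation with \<open>EE\<close> is T^2 / (z (z +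
  2)) - T' - c0. The imaginary parts of the three pieces cancel for real \<open>z\<close>, which the
  closed form shows.\<close>

lemma QQ_eq:
  assumes "z \<noteq> 0" "z + 2 \<noteq> 0"
  shows "TT z ^ 2 / (z * (z + 2)) - (2 * \<i> * of_real (m * \<sigma>) - \<i> * of_real (\<sigma> * d / 2) * z - \<i> * of_real (\<sigma> * d / 2) * (z + 2) + of_real s)
    - c0 (zet z) = - QQ z"
proof -
  define e where "e = d / 2"
  have de: "d = 2 * e" by (simp add: e_def)
  define y where "y = 2 * \<i> * of_real (m * \<sigma>) - \<i> * of_real (\<sigma> * d / 2) * z"
  have 1: "TT z ^ 2 / (z * (z + 2)) = (z + 2) * y\<^sup>2 / z + 2 * of_real s * y + of_real (s\<^sup>2) * z / (z + 2)"
    using assms unfolding TT_def y_def[symmetric] by (simp add: divide_simps) (simp add: power2_eq_square algebra_simps)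
  have y2: "y\<^sup>2 = - (of_real (\<sigma>\<^sup>2) * (of_real (2 * m) - of_real (d / 2) * z) ^ 2)"
    by (simp add: y_def power2_eq_square algebra_simps)
  have 2: "(z + 2) * y\<^sup>2 / z = - (of_real (\<sigma>\<^sup>2) * (z + 2) * (of_real (2 * m) - of_real (d / 2) * z) ^ 2 / z)"
    unfolding y2 by simp
  have 3: "(y - \<i> * of_real (\<sigma> * d / 2) * (z + 2) + of_real s) + c0 (zet z) = of_real (2 * \<sigma> * \<kappa>) * (z + 2) - of_real lam + 2 * of_real s * y"
    unfolding y_def c0_def zet_def coefB_def coefC_def unfolding de by (simp add: power2_eq_square algebra_simps)
  have "TT z ^ 2 / (z * (z + 2)) - (y - \<i> * of_real (\<sigma> * d / 2) * (z + 2) + of_real s) - c0 (zet z)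
    = TT z ^ 2 / (z * (z + 2)) - ((y - \<i> * of_real (\<sigma> * d / 2) * (z + 2) + of_real s) + c0 (zet z))"
    by (simp only: diff_diff_eq)
  also have "\<dots> = - QQ z"
    unfolding 3 1 2 QQ_def by simp
  finally show ?thesis by (simp only: y_def)
qed

lemma PG_deriv:
  assumes "Im z > 0"
  shows "(PG has_field_derivative - QQ z * GG z) (at z)"
proof -
  have z0: "z \<noteq> 0" "z + 2 \<noteq> 0" using assms by (auto simp: complex_eq_iff)
  define T' where "T' = 2 * \<i> * of_real (m * \<sigma>) - \<i> * of_real (\<sigma> * d / 2) * z - \<i> * of_real (\<sigma> * d / 2) * (z + 2) + of_real s"
  have Td: "(TT has_field_derivative T') (at z)"
    unfolding TT_def[abs_def] T'_def by (auto intro!: derivative_eq_intros simp: algebra_simps)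
  have pd: "((\<lambda>z. z * (z + 2)) has_field_derivative 2 * z + 2) (at z)"
    by (auto intro!: derivative_eq_intros simp: algebra_simps)
  have "((\<lambda>z. z * (z + 2) * F1 z - TT z * F0 z) has_field_derivative
      (z * (z + 2) * F2 z + (2 * z + 2) * F1 z) - (TT z * F1 z + T' * F0 z)) (at z)"
    by (rule DERIV_diff[OF DERIV_mult'[OF pd F1_deriv[OF assms]] DERIV_mult'[OF Td F0_deriv[OF assms]]])
  note inner = this
  define q where "q = TT z / (z * (z + 2))"
  have t: "q * (z * (z + 2)) = TT z" using z0 by (simp add: q_def)
  have q2: "TT z ^ 2 / (z * (z + 2)) = q * TT z" by (simp add: q_def power2_eq_square)
  have "(PG has_field_derivative EE z * ((z * (z + 2) * F2 z + (2 * z + 2) * F1 z) - (TT z * F1 z + T' * F0 z))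
      + (- q * EE z) * (z * (z + 2) * F1 z - TT z * F0 z)) (at z)" (is "(_ has_field_derivative ?D) _")
    unfolding PG_def[abs_def] using DERIV_mult'[OF EE_deriv[OF assms, folded q_def] inner] .
  moreover have "?D = - QQ z * GG z"
  proof -
    have "?D = EE z * ((z * (z + 2) * F2 z + (2 * z + 2) * F1 z) - (TT z * F1 z + T' * F0 z)
        - (q * (z * (z + 2))) * F1 z + q * TT z * F0 z)"
      by (simp add: algebra_simps)
    also have "\<dots> = EE z * ((z * (z + 2) * F2 z + (2 * z + 2 - 2 * TT z) * F1 z + c0 (zet z) * F0 z)
        + (q * TT z - T' - c0 (zet z)) * F0 z)"
      unfolding t by (simp add: algebra_simps)
    also have "q * TT z - T' - c0 (zet z) = - QQ z"
      unfolding q2[symmetric] T'_def by (rule QQ_eq[OF z0])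
    finally show ?thesis unfolding F_ode[OF assms] by (simp add: GG_def)
  qed
  ultimately show ?thesis by simp
qed

end

section \<open>Behaviour of the transformed potential along rays\<close>

text \<open>For small \<alpha> everything in the imaginary part is proportional to sin \<alpha>, and
  the leading coefficient decides the sign for large \<open>t\<close>. If the leading coefficient is
  \<open>c1 < 0\<close>, the rotation by \<open>- 2 * \<alpha>\<close> turns \<open>c1 * z\<close>
  into c1 t cis (- \<alpha>), whose imaginary part is positive. Estimating the quotient by sin
  \<alpha> keeps \<open>T\<close> and \<open>C\<close> independent of \<alpha>.\<close>

lemma tail_sign:
  fixes c1 c2 c0 k1 k2 \<delta> :: real
  defines "b \<equiv> (if c2 > 0 \<or> c1 > 0 then 0 else - 2)"
    and "Q \<equiv> \<lambda>z. of_real c1 * z + of_real c2 * z\<^sup>2 + of_real c0 + of_real k1 / z + of_real k2 / (z + 2)"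
  assumes c: "c2 > 0 \<or> (c2 = 0 \<and> c1 \<noteq> 0)" and k: "k1 \<ge> 0" "k2 \<ge> 0" and \<delta>: "\<delta> > 0"
  shows "\<exists>T\<ge>\<delta>. \<exists>C\<ge>0. \<forall>\<alpha>. 0 < \<alpha> \<longrightarrow> \<alpha> < pi / 6 \<longrightarrow>
    (\<forall>t\<ge>\<delta>. Im (cis (b * \<alpha>) * Q (of_real t * cis \<alpha>)) \<ge> - (C * \<alpha>)) \<and>
    (\<forall>t\<ge>T. Im (cis (b * \<alpha>) * Q (of_real t * cis \<alpha>)) \<ge> 0)"
proof -
  \<comment> \<open>Lower bound for the imaginary part divided by sin \<alpha>. In the rotated case
    sin (2 \<alpha>) \<le> 2 sin \<alpha> produces the constants 2, 3 and 3 t + 4.\<close>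
  define L where "L t = (if c2 > 0 then c1 * t + c2 * t\<^sup>2 - (k1 + k2) / t
    else if c1 > 0 then c1 * t - (k1 + k2) / t else - c1 * t - 2 * \<bar>c0\<bar> - 3 * k1 / t - k2 * (3 * t + 4) / t\<^sup>2)" for t
  define K where "K = \<bar>c1\<bar> + k1 + k2 + 2 * \<bar>c0\<bar> + 3 * k1 + 7 * k2"
  define g where "g = (if c2 > 0 then c2 else \<bar>c1\<bar>)"
  have g: "g > 0" using c by (auto simp: g_def)
  define T where "T = max (max 1 \<delta>) (K / g)"
  define C where "C = \<bar>c1\<bar> * T + (k1 + k2) / \<delta> + 2 * \<bar>c0\<bar> + 3 * k1 / \<delta> + k2 * (3 * T + 4) / \<delta>\<^sup>2"
  have T: "T \<ge> 1" "T \<ge> \<delta>" "T \<ge> K / g" by (auto simp: T_def)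
  have C: "C \<ge> 0" using k \<delta> T unfolding C_def by (intro add_nonneg_nonneg divide_nonneg_nonneg mult_nonneg_nonneg) auto
  have Lpos: "L t \<ge> 0" if t: "t \<ge> T" for t
  proof -
    have t1: "t \<ge> 1" using t T by simp
    have "K / g \<le> t" using t T by simp
    then have tg: "K \<le> g * t" using g by (simp add: field_simps)
    have kt: "(k1 + k2) / t \<le> k1 + k2" "3 * k1 / t \<le> 3 * k1"
      using mult_left_mono[OF t1 k(1)] mult_left_mono[OF t1 k(2)] t1 by (auto simp: divide_le_eq algebra_simps)
    have k7: "k2 * (3 * t + 4) / t\<^sup>2 \<le> 7 * k2"
    proof -
      have "3 * t + 4 \<le> 7 * t\<^sup>2" using t1 self_le_power[of t 2] by simp
      then have "k2 * (3 * t + 4) \<le> k2 * (7 * t\<^sup>2)" using k by (intro mult_left_mono)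
      then show ?thesis using t1 by (simp add: field_simps)
    qed
    have K3: "\<bar>c1\<bar> + k1 + k2 \<le> K" "2 * \<bar>c0\<bar> + 3 * k1 + 7 * k2 \<le> K" "k1 + k2 \<le> K" using k by (auto simp: K_def)
    show ?thesis
    proof (cases "c2 > 0")
      case True
      have "(\<bar>c1\<bar> + k1 + k2) * t \<le> (c2 * t) * t"
        using tg K3 t1 True by (intro mult_right_mono) (auto simp: g_def)
      moreover have "- c1 * t \<le> \<bar>c1\<bar> * t" using t1 by (intro mult_right_mono) auto
      moreover have "(k1 + k2) * 1 \<le> (k1 + k2) * t" using k t1 by (intro mult_left_mono) auto
      ultimately show ?thesis using kt True by (simp add: L_def power2_eq_square distrib_right)
    next
      case False
      then have g': "g = \<bar>c1\<bar>" by (simp add: g_def)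
      show ?thesis using tg K3 kt k7 False g' by (auto simp: L_def)
    qed
  qed
  have Llow: "L t \<ge> - C" if t: "t \<ge> \<delta>" for t
  proof (cases "t \<ge> T")
    case True
    then show ?thesis using Lpos C by (smt (verit))
  next
    case False
    have t0: "t > 0" "t \<le> T" using t \<delta> False by auto
    have a: "- (\<bar>c1\<bar> * T) \<le> c1 * t" "- (\<bar>c1\<bar> * T) \<le> - c1 * t"
    proof -
      have "\<bar>c1 * t\<bar> \<le> \<bar>c1\<bar> * T" using t0 by (auto simp: abs_mult intro: mult_left_mono)
      then show "- (\<bar>c1\<bar> * T) \<le> c1 * t" "- (\<bar>c1\<bar> * T) \<le> - c1 * t" by auto
    qed
    have b1: "(k1 + k2) / t \<le> (k1 + k2) / \<delta>" using k t \<delta> by (intro divide_left_mono) auto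
    have b2: "3 * k1 / t \<le> 3 * k1 / \<delta>" using k t \<delta> by (intro divide_left_mono) auto
    have b3: "k2 * (3 * t + 4) / t\<^sup>2 \<le> k2 * (3 * T + 4) / \<delta>\<^sup>2"
      using k t t0 \<delta> by (intro frac_le mult_left_mono power_mono) auto
    have nn: "(k1 + k2) / \<delta> \<ge> 0" "3 * k1 / \<delta> \<ge> 0" "k2 * (3 * T + 4) / \<delta>\<^sup>2 \<ge> 0" using k \<delta> T by auto
    show ?thesis
    proof (cases "c2 > 0")
      case True
      then have "0 \<le> c2 * t\<^sup>2" by simp
      moreover have "L t = c1 * t + c2 * t\<^sup>2 - (k1 + k2) / t" using True by (simp add: L_def)
      ultimately show ?thesis unfolding C_def using a b1 nn by linarith
    next
      case False
      then have "L t = c1 * t - (k1 + k2) / t \<or> L t = - c1 * t - 2 * \<bar>c0\<bar> - 3 * k1 / t - k2 * (3 * t + 4) / t\<^sup>2"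
        by (simp add: L_def)
      then show ?thesis unfolding C_def using a b1 b2 b3 nn by linarith
    qed
  qed
  have main: "Im (cis (b * \<alpha>) * Q (of_real t * cis \<alpha>)) \<ge> sin \<alpha> * L t"
    if \<alpha>: "0 < \<alpha>" "\<alpha> < pi / 6" and t: "t > 0" for \<alpha> t
  proof -
    define S where "S = sin \<alpha>"
    define u where "u = cos \<alpha>"
    have S: "S > 0" using \<alpha> by (simp add: S_def sin_gt_zero)
    have "cos (pi / 3) \<le> u" unfolding u_def using \<alpha> by (intro cos_monotone_0_pi_le) auto
    then have u: "1 / 2 \<le> u" "u \<le> 1" by (auto simp: cos_60 u_def)
    have SU: "S\<^sup>2 + u\<^sup>2 = 1" by (simp add: S_def u_def)
    define D where "D = (t * u + 2)\<^sup>2 + (t * S)\<^sup>2"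
    have tt: "(t * u)\<^sup>2 + (t * S)\<^sup>2 = t\<^sup>2"
    proof -
      have "(t * u)\<^sup>2 + (t * S)\<^sup>2 = t\<^sup>2 * (S\<^sup>2 + u\<^sup>2)" by (simp add: power_mult_distrib algebra_simps)
      then show ?thesis by (simp add: SU)
    qed
    have tu: "t * u \<ge> 0" using t u by simp
    have D: "D \<ge> t\<^sup>2"
    proof -
      have "D = ((t * u)\<^sup>2 + (t * S)\<^sup>2) + 4 * (t * u) + 4" by (simp add: D_def power2_eq_square algebra_simps)
      then show ?thesis using tt tu by simp
    qed
    have t2: "t\<^sup>2 > 0" using t by simp
    have D0: "D > 0" using D t2 by linarith
    have Im1: "Im (of_real k / (of_real t * cis \<alpha>)) = - (k * (t * S)) / t\<^sup>2" for k
      by (simp add: Im_divide tt[symmetric] S_def u_def)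
    have Im2: "Im (of_real k / (of_real t * cis \<alpha> + 2)) = - (k * (t * S)) / D" for k
      by (simp add: Im_divide D_def S_def u_def)
    have k2D: "k2 * (t * S) / D \<le> k2 * (t * S) / t\<^sup>2"
      by (rule divide_left_mono[OF D]) (use D0 t2 k t S in auto)
    have e1: "k * (t * S) / t\<^sup>2 = S * (k / t)" for k using t by (simp add: power2_eq_square)
    show ?thesis
    proof (cases "c2 > 0 \<or> c1 > 0")
      case True
      then have b0: "b = 0" by (simp add: b_def)
      have sq: "Im ((of_real t * cis \<alpha>)\<^sup>2) = 2 * t\<^sup>2 * (S * u)"
        by (simp add: power2_eq_square S_def u_def)
      have "Im (Q (of_real t * cis \<alpha>)) = c1 * (t * S) + c2 * (2 * t\<^sup>2 * (S * u)) - k1 * (t * S) / t\<^sup>2 - k2 * (t * S) / D"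
        unfolding Q_def using Im1[of k1] Im2[of k2] sq by (simp add: S_def Im_divide_of_real)
      also have "\<dots> \<ge> c1 * (t * S) + c2 * (2 * t\<^sup>2 * (S * u)) - S * (k1 / t) - S * (k2 / t)"
        using k2D e1[of k1] e1[of k2] by simp
      finally have 1: "Im (Q (of_real t * cis \<alpha>)) \<ge> c1 * (t * S) + c2 * (2 * t\<^sup>2 * (S * u)) - S * (k1 / t) - S * (k2 / t)" .
      have c20: "c2 \<ge> 0" using c by auto
      have "c2 * (t\<^sup>2 * S) * 1 \<le> c2 * (t\<^sup>2 * S) * (2 * u)" using c20 S u by (intro mult_left_mono) auto
      then have 2: "S * (c2 * t\<^sup>2) \<le> c2 * (2 * t\<^sup>2 * (S * u))" by (simp add: mult_ac)
      have LL: "L t = c1 * t + c2 * t\<^sup>2 - (k1 + k2) / t" using True c by (auto simp: L_def)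
      have "S * L t = c1 * (t * S) + S * (c2 * t\<^sup>2) - S * (k1 / t) - S * (k2 / t)"
        unfolding LL by (simp add: algebra_simps add_divide_distrib)
      then show ?thesis using 1 2 by (simp add: b0 S_def)
    next
      case False
      then have b2: "b = - 2" and c20: "c2 = 0" and c1: "c1 < 0" using c by (auto simp: b_def)
      define S2 where "S2 = sin (2 * \<alpha>)"
      define u2 where "u2 = cos (2 * \<alpha>)"
      have cis2: "cis (b * \<alpha>) = Complex u2 (- S2)" by (simp add: b2 S2_def u2_def cis.ctr)
      have S2: "0 \<le> S2" "S2 \<le> 2 * S" using S u by (auto simp: S2_def sin_double S_def[symmetric] u_def[symmetric])
      have u2: "u2 \<le> 1" by (simp add: u2_def)
      have a1: "Im (cis (b * \<alpha>) * (of_real c1 * (of_real t * cis \<alpha>))) = - c1 * (t * S)"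
      proof -
        have "cis (b * \<alpha>) * cis \<alpha> = cis (- \<alpha>)" by (simp add: cis_mult b2)
        moreover have "cis (b * \<alpha>) * (of_real c1 * (of_real t * cis \<alpha>)) = of_real (c1 * t) * (cis (b * \<alpha>) * cis \<alpha>)"
          by simp
        ultimately have "cis (b * \<alpha>) * (of_real c1 * (of_real t * cis \<alpha>)) = of_real (c1 * t) * cis (- \<alpha>)" by (simp only:)
        moreover have "Im (of_real (c1 * t) * cis (- \<alpha>)) = - c1 * (t * S)" by (simp add: S_def)
        ultimately show ?thesis by (simp only:)
      qed
      have a0: "Im (cis (b * \<alpha>) * of_real c0) \<ge> S * (- (2 * \<bar>c0\<bar>))"
      proof -
        have "S2 * c0 \<le> S2 * \<bar>c0\<bar>" using S2 by (intro mult_left_mono) auto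
        also have "\<dots> \<le> 2 * S * \<bar>c0\<bar>" using S2 by (intro mult_right_mono) auto
        finally show ?thesis unfolding cis2 by (simp add: mult_ac)
      qed
      have q: "Im (cis (b * \<alpha>) * (of_real k / z)) = - k * (S2 * Re z + u2 * Im z) / ((Re z)\<^sup>2 + (Im z)\<^sup>2)" for k z
      proof -
        have "cis (b * \<alpha>) * (of_real k / z) = (cis (b * \<alpha>) * of_real k) / z" by simp
        then show ?thesis by (simp only: Im_divide cis2) (simp add: algebra_simps)
      qed
      have a2: "Im (cis (b * \<alpha>) * (of_real k1 / (of_real t * cis \<alpha>))) \<ge> S * (- (3 * k1 / t))"
      proof -
        have "S2 * (t * u) + u2 * (t * S) \<le> (2 * S) * (t * 1) + 1 * (t * S)"
          using S2 u u2 t S by (intro add_mono mult_mono mult_left_mono mult_right_mono) auto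
        also have "\<dots> = 3 * (t * S)" by simp
        finally have "k1 * (S2 * (t * u) + u2 * (t * S)) \<le> k1 * (3 * (t * S))" using k by (intro mult_left_mono) auto
        then have "k1 * (S2 * (t * u) + u2 * (t * S)) / t\<^sup>2 \<le> k1 * (3 * (t * S)) / t\<^sup>2" using t2 by (intro divide_right_mono) auto
        also have "\<dots> = S * (3 * k1 / t)" using t by (simp add: power2_eq_square)
        finally show ?thesis unfolding q by (simp add: S_def[symmetric] u_def[symmetric] tt)
      qed
      have a3: "Im (cis (b * \<alpha>) * (of_real k2 / (of_real t * cis \<alpha> + 2))) \<ge> S * (- (k2 * (3 * t + 4) / t\<^sup>2))"
      proof -
        have "S2 * (t * u + 2) + u2 * (t * S) \<le> (2 * S) * (t * 1 + 2) + 1 * (t * S)"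
          using S2 u u2 t S by (intro add_mono mult_mono mult_left_mono mult_right_mono) auto
        also have "\<dots> = S * (3 * t + 4)" by (simp add: algebra_simps)
        finally have "k2 * (S2 * (t * u + 2) + u2 * (t * S)) \<le> k2 * (S * (3 * t + 4))" using k by (intro mult_left_mono) auto
        then have "k2 * (S2 * (t * u + 2) + u2 * (t * S)) / D \<le> k2 * (S * (3 * t + 4)) / D" using t2 D D0 by (intro divide_right_mono) auto
        also have "\<dots> \<le> k2 * (S * (3 * t + 4)) / t\<^sup>2"
          by (rule divide_left_mono[OF D]) (use D0 t2 k t S in auto)
        finally show ?thesis unfolding q by (simp add: S_def[symmetric] u_def[symmetric] D_def mult_ac)
      qed
      have "cis (b * \<alpha>) * Q (of_real t * cis \<alpha>) = cis (b * \<alpha>) * (of_real c1 * (of_real t * cis \<alpha>)) + cis (b * \<alpha>) * of_real c0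
          + cis (b * \<alpha>) * (of_real k1 / (of_real t * cis \<alpha>)) + cis (b * \<alpha>) * (of_real k2 / (of_real t * cis \<alpha> + 2))"
        unfolding Q_def c20 by (simp only: distrib_left of_real_0 mult_zero_left add_0_right mult_zero_right)
      then have "Im (cis (b * \<alpha>) * Q (of_real t * cis \<alpha>)) \<ge> - c1 * (t * S) + S * (- (2 * \<bar>c0\<bar>)) + S * (- (3 * k1 / t)) + S * (- (k2 * (3 * t + 4) / t\<^sup>2))"
        using a1 a0 a2 a3 by (simp only: plus_complex.sel)
      moreover have "S * L t = - c1 * (t * S) + S * (- (2 * \<bar>c0\<bar>)) + S * (- (3 * k1 / t)) + S * (- (k2 * (3 * t + 4) / t\<^sup>2))"
        using c20 c1 by (simp add: L_def algebra_simps)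
      ultimately show ?thesis by (simp add: S_def)
    qed
  qed
  show ?thesis
  proof (rule exI[of _ T], rule conjI[OF T(2)], rule exI[of _ C], intro conjI allI impI C)
    fix \<alpha> t :: real assume \<alpha>: "0 < \<alpha>" "\<alpha> < pi / 6"
    have S: "0 \<le> sin \<alpha>" "sin \<alpha> \<le> \<alpha>" using \<alpha> by (auto intro!: sin_ge_zero sin_x_le_x)
    show "Im (cis (b * \<alpha>) * Q (of_real t * cis \<alpha>)) \<ge> - (C * \<alpha>)" if t: "\<delta> \<le> t"
    proof -
      have "- (C * \<alpha>) \<le> - (C * sin \<alpha>)" using S C by (simp add: mult_left_mono)
      also have "\<dots> \<le> sin \<alpha> * L t" using mult_left_mono[OF Llow[OF t] S(1)] by (simp add: mult_ac)
      also have "\<dots> \<le> Im (cis (b * \<alpha>) * Q (of_real t * cis \<alpha>))" using main[OF \<alpha>] t \<delta> by auto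
      finally show ?thesis .
    qed
    show "0 \<le> Im (cis (b * \<alpha>) * Q (of_real t * cis \<alpha>))" if t: "T \<le> t"
    proof -
      have "0 \<le> sin \<alpha> * L t" using S Lpos[OF t] by simp
      also have "\<dots> \<le> Im (cis (b * \<alpha>) * Q (of_real t * cis \<alpha>))" using main[OF \<alpha>] t T by auto
      finally show ?thesis .
    qed
  qed
qed

text \<open>The leading coefficient vanishes at 0, so in the limit of the \<open>n\<close> times
  differentiated equation the term of order n + 2 drops out. What remains is the recurrence for the
  formal Taylor coefficients.\<close>

lemma quadratic_ode_limits:
  fixes f :: "nat \<Rightarrow> real \<Rightarrow> complex"
  assumes der: "\<And>j x. 0 < x \<Longrightarrow> (f j has_vector_derivative f (Suc j) x) (at x)"
    and ode: "\<And>x. 0 < x \<Longrightarrow>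
      (0 + p1 * of_real x + p2 * of_real x ^ 2) * f 2 x + (q0 + q1 * of_real x + q2 * of_real x ^ 2) * f 1 x
        + (r0 + r1 * of_real x) * f 0 x = 0"
    and lim: "\<And>j. (f j \<longlongrightarrow> L j) (at_right 0)"
  shows "(of_nat n * p1 + q0) * L (Suc n) + (of_nat n * (of_nat n - 1) * p2 + of_nat n * q1 + r0) * L n
      + (of_nat n * (of_nat n - 1) * q2 + of_nat n * r1) * L (n - 1) = 0"
proof -
  let ?G = "\<lambda>x. (0 + p1 * of_real x + p2 * of_real x ^ 2) * f (Suc (Suc n)) x
      + (of_nat n * (p1 + 2 * p2 * of_real x) + (q0 + q1 * of_real x + q2 * of_real x ^ 2)) * f (Suc n) x
      + (of_nat n * (of_nat n - 1) * p2 + of_nat n * (q1 + 2 * q2 * of_real x) + (r0 + r1 * of_real x)) * f n x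
      + (of_nat n * (of_nat n - 1) * q2 + of_nat n * r1) * f (n - 1) x"
  have "(?G \<longlongrightarrow> (0 + p1 * of_real 0 + p2 * of_real 0 ^ 2) * L (Suc (Suc n))
      + (of_nat n * (p1 + 2 * p2 * of_real 0) + (q0 + q1 * of_real 0 + q2 * of_real 0 ^ 2)) * L (Suc n)
      + (of_nat n * (of_nat n - 1) * p2 + of_nat n * (q1 + 2 * q2 * of_real 0) + (r0 + r1 * of_real 0)) * L n
      + (of_nat n * (of_nat n - 1) * q2 + of_nat n * r1) * L (n - 1)) (at_right 0)"
    by (intro tendsto_intros lim)
  moreover have "(?G \<longlongrightarrow> 0) (at_right 0)"
  proof (rule tendsto_eventually)
    show "eventually (\<lambda>x. ?G x = 0) (at_right 0)"
      unfolding eventually_at_right[OF zero_less_one]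
    proof (intro exI[of _ 1] conjI allI impI)
      fix x :: real assume x: "0 < x"
      show "?G x = 0"
        by (rule quadratic_ode_iterated_derivative[where f = f and x = x]) (fact der, fact ode, fact x)
    qed simp
  qed
  ultimately have "(0 + p1 * of_real 0 + p2 * of_real 0 ^ 2) * L (Suc (Suc n))
      + (of_nat n * (p1 + 2 * p2 * of_real 0) + (q0 + q1 * of_real 0 + q2 * of_real 0 ^ 2)) * L (Suc n)
      + (of_nat n * (of_nat n - 1) * p2 + of_nat n * (q1 + 2 * q2 * of_real 0) + (r0 + r1 * of_real 0)) * L n
      + (of_nat n * (of_nat n - 1) * q2 + of_nat n * r1) * L (n - 1) = 0"
    using tendsto_unique[OF trivial_limit_at_right_real] by blast
  then show ?thesis by simp
qed

section \<open>The flux along rays and the value of the transform at its singular point\<close>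

context radial_mode_regular
begin

definition "ray \<alpha> t = of_real t * cis \<alpha>"
text \<open>For \<alpha> = 0 this is the conserved quantity Im (p G' cnj G). The angle - \<alpha>
  compensates for differentiating along the ray instead of the real axis, and
  \<open>b * \<alpha>\<close> is the rotation demanded by \<open>tail_sign\<close>.\<close>

definition "flux b \<alpha> t = Im (cis ((b - 1) * \<alpha>) * (PG (ray \<alpha> t) * cnj (GG (ray \<alpha> t))))"

lemma Im_ray: "Im (ray \<alpha> t) = t * sin \<alpha>" and Re_ray: "Re (ray \<alpha> t) = t * cos \<alpha>"
  by (auto simp: ray_def)

text \<open>Brings the potential into the form required by \<open>tail_sign\<close>: the residues 8
  \<sigma>^2 m^2 and 2 s^2 are nonnegative, and for \<open>d = 0\<close> the coefficient of
  \<open>z\<close> is 2 \<sigma> \<kappa>.\<close>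

lemma QQ_partial_fractions:
  fixes z :: complex
  assumes "z \<noteq> 0" "z + 2 \<noteq> 0"
  shows "QQ z = of_real (2 * \<sigma> * \<kappa> + \<sigma>\<^sup>2 * (d\<^sup>2 / 2 - 2 * m * d)) * z + of_real (\<sigma>\<^sup>2 * d\<^sup>2 / 4) * z\<^sup>2
    + of_real (4 * \<sigma> * \<kappa> - lam + 4 * \<sigma>\<^sup>2 * m\<^sup>2 - 4 * \<sigma>\<^sup>2 * m * d - s\<^sup>2) + of_real (8 * \<sigma>\<^sup>2 * m\<^sup>2) / z + of_real (2 * s\<^sup>2) / (z + 2)"
proof -
  define e where "e = d / 2"
  have de: "d = 2 * e" by (simp add: e_def)
  have 1: "of_real (s\<^sup>2) * z / (z + 2) = of_real (s\<^sup>2) - of_real (2 * s\<^sup>2) / (z + 2)"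
    using assms(2) by (simp add: field_simps)
  have 2: "of_real (\<sigma>\<^sup>2) * (z + 2) * (of_real (2 * m) - of_real (d / 2) * z) ^ 2 / z
    = of_real (\<sigma>\<^sup>2 * (2 * e\<^sup>2 - 4 * m * e)) * z + of_real (\<sigma>\<^sup>2 * e\<^sup>2) * z\<^sup>2 + of_real (4 * \<sigma>\<^sup>2 * m\<^sup>2 - 8 * \<sigma>\<^sup>2 * m * e) + of_real (8 * \<sigma>\<^sup>2 * m\<^sup>2) / z"
    using assms(1) unfolding de by (simp add: divide_simps) (simp add: power2_eq_square algebra_simps)
  show ?thesis unfolding QQ_def 1 2 unfolding de by (simp add: power2_eq_square algebra_simps)
qed

text \<open>The derivative has two terms. The one with |P|^2 carries the imaginary part of cis ((b -
  2) \<alpha>) z (z + 2), that is t^2 sin (b \<alpha>) + 2 t sin ((b - 1) \<alpha>), which is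
  nonpositive for both values of \<open>b\<close>; only the potential term remains in the
  bound.\<close>

lemma flux_deriv:
  assumes \<alpha>: "0 < \<alpha>" "\<alpha> < pi / 6" and t: "t > 0" and b: "b = 0 \<or> b = - 2"
  shows "\<exists>D. (flux b \<alpha> has_real_derivative D) (at t) \<and>
    D \<le> - Im (cis (b * \<alpha>) * QQ (ray \<alpha> t)) * (norm (GG (ray \<alpha> t)))\<^sup>2"
proof -
  define z where "z = ray \<alpha> t"
  have sin0: "sin \<alpha> > 0" using \<alpha> by (intro sin_gt_zero) auto
  have z: "Im z > 0" using t sin0 by (simp add: z_def Im_ray)
  define p where "p = z * (z + 2)"
  have "z \<noteq> 0" "z + 2 \<noteq> 0" using z by (auto simp: complex_eq_iff)
  then have p0: "p \<noteq> 0" by (simp add: p_def)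
  have rd: "(ray \<alpha> has_vector_derivative cis \<alpha>) (at t)"
    unfolding ray_def[abs_def] by (rule has_vector_derivative_real_field[of "\<lambda>x. x * cis \<alpha>"]) (auto intro!: derivative_eq_intros)
  have Pd: "((\<lambda>t. PG (ray \<alpha> t)) has_vector_derivative cis \<alpha> * (- QQ z * GG z)) (at t)"
    using field_vector_diff_chain_at[OF rd PG_deriv[OF z[unfolded z_def]]] by (simp add: o_def z_def)
  have Gd: "((\<lambda>t. cnj (GG (ray \<alpha> t))) has_vector_derivative cnj (cis \<alpha> * (PG z / p))) (at t)"
    using has_vector_derivative_cnj[OF field_vector_diff_chain_at[OF rd GG_deriv[OF z[unfolded z_def]]]] by (simp add: o_def z_def p_def)
  note pd = has_vector_derivative_mult_right[OF has_vector_derivative_mult[OF Pd Gd], of "cis ((b - 1) * \<alpha>)", folded z_def]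
  define D where "D = Im (cis ((b - 1) * \<alpha>) * (PG z * cnj (cis \<alpha> * (PG z / p)) + cis \<alpha> * (- QQ z * GG z) * cnj (GG z)))"
  have "(flux b \<alpha> has_real_derivative D) (at t)"
    using bounded_linear.has_vector_derivative[OF bounded_linear_Im pd]
    unfolding flux_def[abs_def] D_def has_real_derivative_iff_has_vector_derivative z_def .
  moreover have "D \<le> - Im (cis (b * \<alpha>) * QQ z) * (norm (GG z))\<^sup>2"
  proof -
    have c1: "cis ((b - 1) * \<alpha>) * cis \<alpha> = cis (b * \<alpha>)" by (simp add: cis_mult algebra_simps)
    have c2: "cis ((b - 1) * \<alpha>) * cnj (cis \<alpha>) = cis ((b - 2) * \<alpha>)" by (simp add: cis_cnj cis_mult algebra_simps)
    have g2: "GG z * cnj (GG z) = of_real ((norm (GG z))\<^sup>2)" "PG z * cnj (PG z) = of_real ((norm (PG z))\<^sup>2)"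
      by (simp_all only: complex_norm_square)
    have ip: "1 / cnj p = of_real (1 / (norm p)\<^sup>2) * p"
    proof -
      have "p * cnj p = of_real ((norm p)\<^sup>2)" by (simp only: complex_norm_square)
      then show ?thesis using p0 by (simp add: field_simps)
    qed
    have "cis ((b - 1) * \<alpha>) * (PG z * cnj (cis \<alpha> * (PG z / p)) + cis \<alpha> * (- QQ z * GG z) * cnj (GG z))
      = (cis ((b - 1) * \<alpha>) * cnj (cis \<alpha>)) * (PG z * cnj (PG z)) * (1 / cnj p) - (cis ((b - 1) * \<alpha>) * cis \<alpha>) * QQ z * (GG z * cnj (GG z))"
      by (simp add: algebra_simps)
    also have "\<dots> = of_real ((norm (PG z))\<^sup>2 / (norm p)\<^sup>2) * (cis ((b - 2) * \<alpha>) * p) - cis (b * \<alpha>) * QQ z * of_real ((norm (GG z))\<^sup>2)"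
      unfolding c1 c2 g2 ip by simp
    finally have e: "cis ((b - 1) * \<alpha>) * (PG z * cnj (cis \<alpha> * (PG z / p)) + cis \<alpha> * (- QQ z * GG z) * cnj (GG z))
      = of_real ((norm (PG z))\<^sup>2 / (norm p)\<^sup>2) * (cis ((b - 2) * \<alpha>) * p) - cis (b * \<alpha>) * QQ z * of_real ((norm (GG z))\<^sup>2)" .
    have "Im (of_real x * X - Y * of_real y) = x * Im X - Im Y * y" for x y X Y by simp
    then have "D = (norm (PG z))\<^sup>2 / (norm p)\<^sup>2 * Im (cis ((b - 2) * \<alpha>) * p) - Im (cis (b * \<alpha>) * QQ z) * (norm (GG z))\<^sup>2"
      unfolding D_def e by (simp only:)
    moreover have ple: "Im (cis ((b - 2) * \<alpha>) * p) \<le> 0"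
    proof -
      have "p = of_real (t\<^sup>2) * cis (2 * \<alpha>) + of_real (2 * t) * cis \<alpha>"
      proof -
        have "cis (2 * \<alpha>) = cis \<alpha> * cis \<alpha>" by (simp add: cis_mult)
        then show ?thesis by (simp add: p_def z_def ray_def algebra_simps power2_eq_square)
      qed
      then have "cis ((b - 2) * \<alpha>) * p = of_real (t\<^sup>2) * (cis ((b - 2) * \<alpha>) * cis (2 * \<alpha>)) + of_real (2 * t) * (cis ((b - 2) * \<alpha>) * cis \<alpha>)"
        by (simp add: algebra_simps)
      also have "cis ((b - 2) * \<alpha>) * cis (2 * \<alpha>) = cis (b * \<alpha>)" by (simp add: cis_mult algebra_simps)
      also have "cis ((b - 2) * \<alpha>) * cis \<alpha> = cis ((b - 1) * \<alpha>)" by (simp add: cis_mult algebra_simps)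
      finally have e: "Im (cis ((b - 2) * \<alpha>) * p) = t\<^sup>2 * sin (b * \<alpha>) + 2 * t * sin ((b - 1) * \<alpha>)" by simp
      have s2: "sin (2 * \<alpha>) \<ge> 0" "sin (3 * \<alpha>) \<ge> 0" using \<alpha> by (auto intro!: sin_ge_zero)
      show ?thesis
      proof (cases "b = 0")
        case True
        then show ?thesis unfolding e using t sin0 by simp
      next
        case False
        then have b2: "b = - 2" using b by simp
        have "b * \<alpha> = - (2 * \<alpha>)" "(b - 1) * \<alpha> = - (3 * \<alpha>)" by (simp_all add: b2)
        then have "sin (b * \<alpha>) = - sin (2 * \<alpha>)" "sin ((b - 1) * \<alpha>) = - sin (3 * \<alpha>)" by (simp_all only: sin_minus)
        moreover have "0 \<le> t\<^sup>2 * sin (2 * \<alpha>)" "0 \<le> 2 * t * sin (3 * \<alpha>)"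
          using s2 t by (auto intro!: mult_nonneg_nonneg)
        ultimately show ?thesis unfolding e by simp
      qed
    qed
    moreover have "(norm (PG z))\<^sup>2 / (norm p)\<^sup>2 * Im (cis ((b - 2) * \<alpha>) * p) \<le> 0"
      by (rule mult_nonneg_nonpos[OF _ ple]) simp
    ultimately show ?thesis unfolding mult_minus_left by linarith
  qed
  ultimately show ?thesis unfolding z_def by blast
qed

text \<open>In the upper half-plane the argument of \<open>z\<close> lies between 0 and pi, so the
  oscillating power of \<open>z\<close> has modulus between 1 and exp (2 pi m \<sigma>), however
  close \<open>z\<close> is to 0.\<close>

lemma norm_EE:
  assumes "Im z > 0"
  shows "norm (EE z) = exp (2 * (m * \<sigma>) * Im (Ln z)) * exp (- (\<sigma> * d / 2) * Im z) * norm (z + 2) powr (- s)"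
    and "1 \<le> exp (2 * (m * \<sigma>) * Im (Ln z))" "exp (2 * (m * \<sigma>) * Im (Ln z)) \<le> exp (2 * (m * \<sigma>) * pi)"
proof -
  have z: "z \<noteq> 0" "z + 2 \<noteq> 0" using assms by (auto simp: complex_eq_iff)
  have "Re (- 2 * \<i> * of_real (m * \<sigma>) * Ln z + \<i> * of_real (\<sigma> * d / 2) * z - of_real s * Ln (z + 2))
      = 2 * (m * \<sigma>) * Im (Ln z) + - (\<sigma> * d / 2) * Im z + - s * ln (norm (z + 2))"
    using z by simp
  then show "norm (EE z) = exp (2 * (m * \<sigma>) * Im (Ln z)) * exp (- (\<sigma> * d / 2) * Im z) * norm (z + 2) powr (- s)"
    unfolding EE_def norm_exp_eq_Re using z by (simp only: exp_add powr_def) (simp add: powr_def)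
  have "0 \<le> Im (Ln z)" "Im (Ln z) \<le> pi" using Im_Ln_pos_lt_imp[OF assms] by auto
  then show "1 \<le> exp (2 * (m * \<sigma>) * Im (Ln z))" "exp (2 * (m * \<sigma>) * Im (Ln z)) \<le> exp (2 * (m * \<sigma>) * pi)"
    using m \<sigma> by (auto intro!: mult_left_mono)
qed

lemma norm_zet:
  assumes "Im z > 0" "Re z \<ge> 0"
  shows "norm (zet z) = \<sigma> * norm (z + 2)" "norm (zet z) \<ge> \<sigma>"
proof -
  have "zet z = - (\<i> * of_real \<sigma> * (z + 2))" by (simp add: zet_def algebra_simps)
  then show e: "norm (zet z) = \<sigma> * norm (z + 2)" using \<sigma> by (simp add: norm_mult)
  have "1 \<le> Re (z + 2)" using assms by simp
  also have "\<dots> \<le> norm (z + 2)" by (rule complex_Re_le_cmod)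
  finally show "norm (zet z) \<ge> \<sigma>" unfolding e using \<sigma> by simp
qed

text \<open>With y = |z + 2| the two transforms are of order y^(s-1) and y^(s-2), and |E| is at most
  of order y^(-s). Thus \<open>GG\<close> is O(1/y), \<open>PG\<close> is O(1), and the flux is
  O(1/t) on each fixed ray.\<close>

lemma flux_tendsto_0:
  assumes \<alpha>: "0 < \<alpha>" "\<alpha> < pi / 6"
  shows "(flux b \<alpha> \<longlongrightarrow> 0) at_top"
proof -
  define S where "S = sin \<alpha>"
  have S: "S > 0" "S \<le> 1" using \<alpha> by (auto simp: S_def intro!: sin_gt_zero)
  have cos0: "cos \<alpha> > 0" "cos \<alpha> \<le> 1" using \<alpha> by (auto intro!: cos_gt_zero)
  \<comment> \<open>The sector constant \<open>S / 3\<close> fits because |z + 2| \<le> 3 t for t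
    \<ge> 1, while Re (zet z) = \<sigma> t S.\<close>
  obtain K0 where K0: "\<And>z. norm z \<ge> 1 \<Longrightarrow> Re z \<ge> S / 3 * norm z \<Longrightarrow> norm (mom 0 z) \<le> K0 * norm z powr (s - 1)"
    using mom_decay[of "S / 3" 0] S by auto
  obtain K1 where K1: "\<And>z. norm z \<ge> 1 \<Longrightarrow> Re z \<ge> S / 3 * norm z \<Longrightarrow> norm (mom 1 z) \<le> K1 * norm z powr (s - 2)"
    using mom_decay[of "S / 3" 1] S by auto
  define A0 where "A0 = \<bar>K0\<bar> * \<sigma> powr (s - 1)"
  define A1 where "A1 = \<sigma> * (\<bar>K1\<bar> * \<sigma> powr (s - 2))"
  define M where "M = exp (2 * (m * \<sigma>) * pi)"
  define B where "B = 2 * (m * \<sigma>) + \<bar>s\<bar> + 3 / S"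
  define C where "C = M * M * (A1 + B * A0) * A0"
  have A0: "A0 \<ge> 0" "A1 \<ge> 0" "M > 0" using \<sigma> by (auto simp: A0_def A1_def M_def)
  have B0: "B \<ge> 0" using m \<sigma> S by (auto simp: B_def)
  show ?thesis
  proof (rule Lim_null_comparison)
    show "eventually (\<lambda>t. norm (flux b \<alpha> t) \<le> C / t) at_top"
      using eventually_ge_at_top[of "max 1 (1 / \<sigma>)"]
    proof eventually_elim
      case (elim t)
      then have t: "t \<ge> 1" "\<sigma> * t \<ge> 1" using \<sigma> by (auto simp: field_simps)
      define z where "z = ray \<alpha> t"
      have z: "Im z = t * S" "Re z = t * cos \<alpha>" by (auto simp: z_def Im_ray Re_ray S_def)
      have zi: "Im z > 0" "Re z \<ge> 0" using t S cos0 by (auto simp: z)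
      define y where "y = norm (z + 2)"
      have nz: "norm z = t" using t by (simp add: z_def ray_def norm_mult)
      have y3: "y \<le> 3 * t" unfolding y_def using norm_triangle_ineq[of z 2] nz t by simp
      have yt: "t \<le> y"
      proof -
        have "(norm z)\<^sup>2 \<le> (norm (z + 2))\<^sup>2" using zi unfolding cmod_power2 by (simp add: power2_eq_square algebra_simps)
        from power2_le_imp_le[OF this] show ?thesis using nz by (simp add: y_def)
      qed
      have y: "y \<ge> 1" using yt t by simp
      have zet: "norm (zet z) = \<sigma> * y" using norm_zet[OF zi] by (simp add: y_def)
      have zet1: "norm (zet z) \<ge> 1" 
        unfolding zet using mult_left_mono[OF yt, of \<sigma>] t \<sigma> by linarith
      have zet2: "Re (zet z) \<ge> S / 3 * norm (zet z)"
        unfolding zet Re_zet z using y3 S \<sigma> by (simp add: mult_left_mono mult_ac)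
      have F0: "norm (F0 z) \<le> A0 * y powr (s - 1)"
      proof -
        have "norm (F0 z) \<le> \<bar>K0\<bar> * norm (zet z) powr (s - 1)"
          unfolding F0_def by (rule order_trans[OF K0[OF zet1 zet2]]) (intro mult_right_mono, auto)
        then show ?thesis unfolding zet A0_def using \<sigma> y by (simp add: powr_mult)
      qed
      have F1: "norm (F1 z) \<le> A1 * y powr (s - 2)"
      proof -
        have "norm (mom 1 (zet z)) \<le> \<bar>K1\<bar> * norm (zet z) powr (s - 2)"
          by (rule order_trans[OF K1[OF zet1 zet2]]) (intro mult_right_mono, auto)
        then have "norm (F1 z) \<le> \<sigma> * (\<bar>K1\<bar> * norm (zet z) powr (s - 2))"
          unfolding F1_def norm_mult using \<sigma> by (simp add: mult_left_mono)
        then show ?thesis unfolding zet A1_def using \<sigma> y by (simp add: powr_mult)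
      qed
      define e where "e = exp (- (\<sigma> * d / 2) * Im z)"
      have e: "0 < e" "e \<le> 1" using \<sigma> d zi by (auto simp: e_def)
      have EEn: "norm (EE z) \<le> M * e * y powr (- s)"
        unfolding norm_EE(1)[OF zi(1)] M_def e_def y_def using norm_EE(3)[OF zi(1)]
        by (intro mult_right_mono) auto
      \<comment> \<open>For \<open>d > 0\<close> the factor \<open>TT\<close> is quadratic in
        \<open>z\<close>; one power is paid by the exponential decay \<open>e\<close>, through v S
        \<le> exp (v S). Here the positive angle is indispensable.\<close>
      have eT: "e * norm (TT z) \<le> B * y"
      proof -
        have "norm (2 * \<i> * of_real (m * \<sigma>) - \<i> * of_real (\<sigma> * d / 2) * z) \<le> 2 * (m * \<sigma>) + \<sigma> * d / 2 * t"
          by (rule order_trans[OF norm_triangle_ineq4]) (use m \<sigma> d nz in \<open>simp add: norm_mult\<close>)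
        then have "norm (TT z) \<le> y * (2 * (m * \<sigma>) + \<sigma> * d / 2 * t) + \<bar>s\<bar> * t"
          unfolding TT_def y_def using nz
          by (intro order_trans[OF norm_triangle_ineq] add_mono) (auto simp: norm_mult intro: mult_left_mono)
        from mult_left_mono[OF this, of e]
        have "e * norm (TT z) \<le> e * (y * (2 * (m * \<sigma>)) + \<bar>s\<bar> * t) + e * (\<sigma> * d / 2 * t) * y"
          using e by (simp add: algebra_simps)
        also have "e * (y * (2 * (m * \<sigma>)) + \<bar>s\<bar> * t) \<le> 1 * (y * (2 * (m * \<sigma>)) + \<bar>s\<bar> * y)"
          using e yt y m \<sigma> t by (intro mult_mono add_mono mult_left_mono) auto
        also have "e * (\<sigma> * d / 2 * t) * y \<le> (1 / S) * y"
        proof (intro mult_right_mono)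
          define v where "v = \<sigma> * d / 2 * t"
          have v: "v \<ge> 0" using \<sigma> d t by (simp add: v_def)
          have "- (\<sigma> * d / 2) * Im z = - (v * S)" by (simp add: v_def z)
          then have "e = 1 / exp (v * S)" by (simp only: e_def exp_minus inverse_eq_divide)
          moreover have "v * S \<le> exp (v * S)" using exp_ge_add_one_self[of "v * S"] by linarith
          ultimately have "e * (v * S) \<le> 1" by simp
          then have "e * v \<le> 1 / S" using S by (simp add: field_simps)
          then show "e * (\<sigma> * d / 2 * t) \<le> 1 / S" by (simp add: v_def)
        qed (use y in auto)
        also have "1 / S * y \<le> 3 / S * y" using S y by (intro mult_right_mono divide_right_mono) auto
        finally show ?thesis by (simp add: B_def algebra_simps)
      qed
      have pw1: "y * y * y powr (s - 2) = y * y powr (s - 1)"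
      proof -
        have "y powr (s - 1) = y powr 1 * y powr (s - 2)" using y by (simp only: powr_add[symmetric]) simp
        then show ?thesis using y by simp
      qed
      have bracket: "e * norm (z * (z + 2) * F1 z - TT z * F0 z) \<le> (A1 + B * A0) * (y * y powr (s - 1))"
      proof -
        have "e * norm (z * (z + 2) * F1 z - TT z * F0 z) \<le> e * (norm (z * (z + 2) * F1 z) + norm (TT z * F0 z))"
          using e by (intro mult_left_mono norm_triangle_ineq4) auto
        also have "\<dots> = e * (t * y * norm (F1 z)) + (e * norm (TT z)) * norm (F0 z)"
          by (simp only: norm_mult nz y_def[symmetric]) (simp add: algebra_simps)
        also have "\<dots> \<le> 1 * (y * y * (A1 * y powr (s - 2))) + (B * y) * (A0 * y powr (s - 1))"
        proof (rule add_mono)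
          show "e * (t * y * norm (F1 z)) \<le> 1 * (y * y * (A1 * y powr (s - 2)))"
            using e yt y t F1 A0 by (intro mult_mono) auto
          show "(e * norm (TT z)) * norm (F0 z) \<le> (B * y) * (A0 * y powr (s - 1))"
            using y B0 by (intro mult_mono eT F0) auto
        qed
        also have "\<dots> = A1 * (y * y * y powr (s - 2)) + B * A0 * (y * y powr (s - 1))" by (simp add: algebra_simps)
        also have "\<dots> = (A1 + B * A0) * (y * y powr (s - 1))" unfolding pw1 by (simp add: algebra_simps)
        finally show ?thesis .
      qed
      have "norm (flux b \<alpha> t) \<le> norm (cis ((b - 1) * \<alpha>) * (PG z * cnj (GG z)))"
        unfolding flux_def z_def by (simp only: real_norm_def abs_Im_le_cmod)
      also have "\<dots> = norm (PG z) * norm (GG z)" by (simp add: norm_mult)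
      also have "norm (PG z) = norm (EE z) * norm (z * (z + 2) * F1 z - TT z * F0 z)" unfolding PG_def by (rule norm_mult)
      also have "norm (GG z) = norm (EE z) * norm (F0 z)" unfolding GG_def by (rule norm_mult)
      also have "norm (EE z) * norm (z * (z + 2) * F1 z - TT z * F0 z) * (norm (EE z) * norm (F0 z))
        \<le> (M * e * y powr (- s)) * norm (z * (z + 2) * F1 z - TT z * F0 z) * ((M * 1 * y powr (- s)) * (A0 * y powr (s - 1)))"
      proof (intro mult_mono EEn F0)
        show "norm (EE z) \<le> M * 1 * y powr (- s)"
          by (rule order_trans[OF EEn]) (use e A0 in \<open>intro mult_right_mono mult_left_mono; simp\<close>)
      qed (use A0 e in auto)
      also have "\<dots> = M * y powr (- s) * (e * norm (z * (z + 2) * F1 z - TT z * F0 z)) * (M * y powr (- s) * (A0 * y powr (s - 1)))"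
        by (simp add: mult_ac)
      also have "\<dots> \<le> M * y powr (- s) * ((A1 + B * A0) * (y * y powr (s - 1))) * (M * y powr (- s) * (A0 * y powr (s - 1)))"
        using bracket A0 by (intro mult_right_mono mult_left_mono) auto
      also have "\<dots> = C * (y powr 1 * (y powr (- s) * y powr (s - 1)) * (y powr (- s) * y powr (s - 1)))"
        using y by (simp add: C_def mult_ac)
      also have "y powr 1 * (y powr (- s) * y powr (s - 1)) * (y powr (- s) * y powr (s - 1)) = y powr (- 1)"
        by (simp only: powr_add[symmetric]) simp
      also have "C * y powr (- 1) \<le> C / t"
      proof -
        have "y powr (- 1) = 1 / y" using y by (simp add: powr_minus_divide)
        also have "\<dots> \<le> 1 / t" using yt t by (simp add: frac_le)
        finally have "C * y powr (- 1) \<le> C * (1 / t)" using A0 B0 by (intro mult_left_mono) (auto simp: C_def)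
        then show ?thesis by simp
      qed
      finally show ?case .
    qed
    show "((\<lambda>t. C / t) \<longlongrightarrow> 0) at_top" by real_asymp
  qed
qed


text \<open>Compare the flux at distance \<delta> from the singular point with its limit 0 at
  infinity: up to errors it is - |E|^2 Im T |f|^2 with Im T at least m \<sigma>, yet monotonicity
  makes it at least - O(\<alpha>). The choices are made in the order \<delta>, then \<open>T\<close>
  and \<open>C\<close>, then \<alpha>; a Lipschitz bound carries smallness from one point of the ray
  to a full half-disc.\<close>

lemma mom0_limit:
  assumes nd: "d > 0 \<or> \<kappa> \<noteq> 0" and e: "e > 0"
  shows "\<exists>r>0. \<forall>z. Re z > 0 \<longrightarrow> norm (z + 2 * \<i> * of_real \<sigma>) < r \<longrightarrow> norm (mom 0 z) < e"
proof -
  obtain K0 where K0: "\<And>z. Re z > 0 \<Longrightarrow> norm z \<ge> \<sigma> \<Longrightarrow> norm z \<le> 3 * \<sigma> \<Longrightarrow> norm (mom 0 z) \<le> K0" using mom_bounded[OF \<sigma>] by blast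
  obtain K1 where K1: "\<And>z. Re z > 0 \<Longrightarrow> norm z \<ge> \<sigma> \<Longrightarrow> norm z \<le> 3 * \<sigma> \<Longrightarrow> norm (mom 1 z) \<le> K1" using mom_bounded[OF \<sigma>] by blast
  have K0p: "K0 \<ge> 0" using order_trans[OF norm_ge_zero K0[of "of_real \<sigma>"]] \<sigma> by simp
  have K1p: "K1 \<ge> 0" using order_trans[OF norm_ge_zero K1[of "of_real \<sigma>"]] \<sigma> by simp
  \<comment> \<open>A convex half-disc around -2 i \<sigma> that stays at distance \<sigma> from the
    other singular point 0, so that both moments are bounded on it.\<close>
  define X where "X = {z. Re z > 0} \<inter> ball (- 2 * \<i> * of_real \<sigma>) \<sigma>"
  have Xn: "norm z \<ge> \<sigma>" if "z \<in> X" for z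
  proof -
    have "norm (2 * \<i> * of_real \<sigma>) \<le> norm (- 2 * \<i> * of_real \<sigma> - z) + norm z"
      using norm_triangle_ineq[of "- 2 * \<i> * of_real \<sigma> - z" z] by (simp add: norm_mult)
    then show ?thesis using that \<sigma> by (simp add: X_def dist_norm norm_mult)
  qed
  have Xn2: "norm z \<le> 3 * \<sigma>" if "z \<in> X" for z
  proof -
    have "norm z \<le> norm (z - (- 2 * \<i> * of_real \<sigma>)) + norm (- 2 * \<i> * of_real \<sigma>)"
      using norm_triangle_ineq[of "z - (- 2 * \<i> * of_real \<sigma>)" "- 2 * \<i> * of_real \<sigma>"] by simp
    moreover have "norm (z - (- 2 * \<i> * of_real \<sigma>)) < \<sigma>" using that by (simp add: X_def dist_norm norm_minus_commute)
    ultimately show ?thesis using \<sigma> by (simp add: norm_mult)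
  qed
  have lip: "norm (mom 0 z - mom 0 z') \<le> K1 * norm (z - z')" if z: "z \<in> X" "z' \<in> X" for z z'
  proof (rule field_differentiable_bound[OF _ _ _ z])
    show "convex X" unfolding X_def by (intro convex_Int convex_halfspace_Re_gt convex_ball)
    fix y assume y: "y \<in> X"
    then have "Re y > 0" by (simp add: X_def)
    from mom_deriv[OF this, of 0] show "(mom 0 has_field_derivative - mom 1 y) (at y within X)"
      by (simp add: has_field_derivative_at_within)
    show "norm (- mom 1 y) \<le> K1" using K1[OF \<open>Re y > 0\<close> Xn[OF y] Xn2[OF y]] by simp
  qed
  define a1 where "a1 = 2 * \<sigma> * \<kappa> + \<sigma>\<^sup>2 * (d\<^sup>2 / 2 - 2 * m * d)"
  define a2 where "a2 = \<sigma>\<^sup>2 * d\<^sup>2 / 4"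
  define a0 where "a0 = 4 * \<sigma> * \<kappa> - lam + 4 * \<sigma>\<^sup>2 * m\<^sup>2 - 4 * \<sigma>\<^sup>2 * m * d - s\<^sup>2"
  define b :: real where "b = (if a2 > 0 \<or> a1 > 0 then 0 else - 2)"
  have ac: "a2 > 0 \<or> (a2 = 0 \<and> a1 \<noteq> 0)"
  proof (cases "d > 0")
    case True
    then show ?thesis using \<sigma> by (simp add: a2_def)
  next
    case False
    then have "d = 0" using d by simp
    then show ?thesis using nd \<sigma> by (simp add: a2_def a1_def)
  qed
  have b: "b = 0 \<or> b = - 2" by (simp add: b_def)
  \<comment> \<open>The entry with \<open>d + 1\<close> keeps the imaginary part of
    \<open>TT\<close> above 2 m \<sigma> at \<alpha> = 0, the one with \<open>e\<^sup>2\<close>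
    makes the derivative term of the flux at most m \<sigma> e^2 / 16, the one with \<open>e\<close>
    serves the final Lipschitz step, and \<open>1 / 2\<close> keeps the point inside
    \<open>X\<close>.\<close>
  define \<delta> where "\<delta> = Min {1, m / (d + 1), m * e\<^sup>2 / (16 * (3 * K1 * K0 + 1)), e / (4 * \<sigma> * (K1 + 1)), 1 / 2}"
  have \<delta>: "\<delta> > 0" using m d e K0p K1p \<sigma> unfolding \<delta>_def
    by (subst Min_gr_iff) (auto intro!: divide_pos_pos mult_pos_pos add_nonneg_pos)
  have \<delta>le: "\<delta> \<le> 1 / 2" "\<delta> \<le> m / (d + 1)" "\<delta> \<le> m * e\<^sup>2 / (16 * (3 * K1 * K0 + 1))" "\<delta> \<le> e / (4 * \<sigma> * (K1 + 1))"
    unfolding \<delta>_def by (intro Min_le; simp)+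
  obtain T C where T: "T \<ge> \<delta>" and C: "C \<ge> 0"
    and TC: "\<And>\<alpha>. 0 < \<alpha> \<Longrightarrow> \<alpha> < pi / 6 \<Longrightarrow>
      (\<forall>t\<ge>\<delta>. Im (cis (b * \<alpha>) * (of_real a1 * (of_real t * cis \<alpha>) + of_real a2 * (of_real t * cis \<alpha>)\<^sup>2 + of_real a0
         + of_real (8 * \<sigma>\<^sup>2 * m\<^sup>2) / (of_real t * cis \<alpha>) + of_real (2 * s\<^sup>2) / (of_real t * cis \<alpha> + 2))) \<ge> - (C * \<alpha>)) \<and>
      (\<forall>t\<ge>T. Im (cis (b * \<alpha>) * (of_real a1 * (of_real t * cis \<alpha>) + of_real a2 * (of_real t * cis \<alpha>)\<^sup>2 + of_real a0
         + of_real (8 * \<sigma>\<^sup>2 * m\<^sup>2) / (of_real t * cis \<alpha>) + of_real (2 * s\<^sup>2) / (of_real t * cis \<alpha> + 2))) \<ge> 0)"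
    using tail_sign[OF ac, of "8 * \<sigma>\<^sup>2 * m\<^sup>2" "2 * s\<^sup>2" \<delta> a0] \<delta> unfolding b_def by auto
  have rz: "ray \<alpha> t \<noteq> 0" "ray \<alpha> t + 2 \<noteq> 0" "Im (ray \<alpha> t) > 0" "Re (ray \<alpha> t) \<ge> 0" "norm (ray \<alpha> t) = t"
    if "0 < \<alpha>" "\<alpha> < pi / 6" "t > 0" for \<alpha> t
  proof -
    have "sin \<alpha> > 0" "cos \<alpha> > 0" using that by (auto intro!: sin_gt_zero cos_gt_zero)
    then show "Im (ray \<alpha> t) > 0" "Re (ray \<alpha> t) \<ge> 0" using that by (auto simp: Im_ray Re_ray)
    then show "ray \<alpha> t \<noteq> 0" "ray \<alpha> t + 2 \<noteq> 0" by (auto simp: complex_eq_iff)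
    show "norm (ray \<alpha> t) = t" using that by (simp add: ray_def norm_mult)
  qed
  have Q1: "Im (cis (b * \<alpha>) * QQ (ray \<alpha> t)) \<ge> - (C * \<alpha>)" if "0 < \<alpha>" "\<alpha> < pi / 6" "t \<ge> \<delta>" for \<alpha> t
    using TC[OF that(1,2)] that \<delta> rz(1,2)[OF that(1,2), of t]
    by (simp only: QQ_partial_fractions[OF rz(1,2)[OF that(1,2)]] a1_def[symmetric] a2_def[symmetric] a0_def[symmetric])
       (auto simp only: ray_def)
  have Q2: "Im (cis (b * \<alpha>) * QQ (ray \<alpha> t)) \<ge> 0" if "0 < \<alpha>" "\<alpha> < pi / 6" "t \<ge> T" for \<alpha> t
    using TC[OF that(1,2)] that \<delta> T rz(1,2)[OF that(1,2), of t]
    by (simp only: QQ_partial_fractions[OF rz(1,2)[OF that(1,2)]] a1_def[symmetric] a2_def[symmetric] a0_def[symmetric])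
       (auto simp only: ray_def)
  obtain KT where KT: "\<And>z. Re z > 0 \<Longrightarrow> norm z \<ge> \<sigma> \<Longrightarrow> norm z \<le> \<sigma> * (T + 2) \<Longrightarrow> norm (mom 0 z) \<le> KT" using mom_bounded[OF \<sigma>] by blast
  have KTp: "KT \<ge> 0" using order_trans[OF norm_ge_zero KT[of "of_real \<sigma>"]] \<sigma> T \<delta> by simp
  define CE where "CE = exp (2 * (m * \<sigma>) * pi) * max 1 ((T + 2) powr (- s))"
  define CG where "CG = (CE * KT)\<^sup>2"
  have GGb: "(norm (GG (ray \<alpha> t)))\<^sup>2 \<le> CG" if "0 < \<alpha>" "\<alpha> < pi / 6" "t > 0" "t \<le> T" for \<alpha> t
  proof -
    note r = rz[OF that(1-3)]
    have n2: "norm (ray \<alpha> t + 2) \<le> T + 2" using norm_triangle_ineq[of "ray \<alpha> t" 2] r that by simp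
    have n1: "1 \<le> norm (ray \<alpha> t + 2)" using complex_Re_le_cmod[of "ray \<alpha> t + 2"] r by simp
    have "norm (ray \<alpha> t + 2) powr (- s) \<le> max 1 ((T + 2) powr (- s))"
    proof (cases "s \<le> 0")
      case True
      then show ?thesis using n2 by (intro max.coboundedI2 powr_mono2) auto
    next
      case False
      then have "norm (ray \<alpha> t + 2) powr (- s) \<le> norm (ray \<alpha> t + 2) powr 0" using n1 by (intro powr_mono) auto
      then show ?thesis using n1 by (intro max.coboundedI1) (auto split: if_splits)
    qed
    moreover have "exp (- (\<sigma> * d / 2) * Im (ray \<alpha> t)) \<le> 1" using \<sigma> d r by auto
    ultimately have "norm (EE (ray \<alpha> t)) \<le> exp (2 * (m * \<sigma>) * pi) * 1 * max 1 ((T + 2) powr (- s))"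
      unfolding norm_EE(1)[OF r(3)] using norm_EE(3)[OF r(3)] by (intro mult_mono) auto
    moreover have "norm (F0 (ray \<alpha> t)) \<le> KT" unfolding F0_def using norm_zet[OF r(3,4)] r \<sigma> n2 by (intro KT) (auto simp: Re_zet)
    ultimately have "norm (GG (ray \<alpha> t)) \<le> CE * KT" unfolding GG_def norm_mult CE_def using KTp by (intro mult_mono) auto
    then show ?thesis unfolding CG_def by (intro power_mono) auto
  qed
  have CG0: "CG \<ge> 0" by (simp add: CG_def)
  \<comment> \<open>Beyond \<open>T\<close> the flux is nonincreasing with limit 0, hence
    nonnegative at \<open>T\<close>; on [\<delta>, T] its growth is at most C CG \<alpha> per unit
    length.\<close>
  have flux_low: "flux b \<alpha> \<delta> \<ge> - (C * CG * T * \<alpha>)" if \<alpha>: "0 < \<alpha>" "\<alpha> < pi / 6" for \<alpha>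
  proof -
    have JT: "flux b \<alpha> T \<ge> 0"
    proof (rule tendsto_upperbound[OF flux_tendsto_0[OF \<alpha>]])
      show "eventually (\<lambda>t. flux b \<alpha> t \<le> flux b \<alpha> T) at_top"
        using eventually_ge_at_top[of T]
      proof eventually_elim
        case (elim t)
        show ?case
        proof (rule DERIV_nonpos_imp_nonincreasing[OF elim])
          fix x assume x: "T \<le> x" "x \<le> t"
          then have "x > 0" using T \<delta> by simp
          from flux_deriv[OF \<alpha> this b] obtain D where D: "(flux b \<alpha> has_real_derivative D) (at x)"
            "D \<le> - Im (cis (b * \<alpha>) * QQ (ray \<alpha> x)) * (norm (GG (ray \<alpha> x)))\<^sup>2" by blast
          have "0 \<le> Im (cis (b * \<alpha>) * QQ (ray \<alpha> x)) * (norm (GG (ray \<alpha> x)))\<^sup>2"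
            using Q2[OF \<alpha> x(1)] by simp
          then have "D \<le> 0" using D(2) by (simp only: mult_minus_left)
          with D(1) show "\<exists>D. (flux b \<alpha> has_real_derivative D) (at x) \<and> D \<le> 0" by blast
        qed
      qed
    qed simp
    have "flux b \<alpha> T - C * CG * \<alpha> * T \<le> flux b \<alpha> \<delta> - C * CG * \<alpha> * \<delta>"
    proof (rule DERIV_nonpos_imp_nonincreasing[OF T, where f = "\<lambda>t. flux b \<alpha> t - C * CG * \<alpha> * t"])
      fix x assume x: "\<delta> \<le> x" "x \<le> T"
      then have x0: "x > 0" using \<delta> by simp
      from flux_deriv[OF \<alpha> this b] obtain D where D: "(flux b \<alpha> has_real_derivative D) (at x)"
        "D \<le> - Im (cis (b * \<alpha>) * QQ (ray \<alpha> x)) * (norm (GG (ray \<alpha> x)))\<^sup>2" by blast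
      have "- Im (cis (b * \<alpha>) * QQ (ray \<alpha> x)) * (norm (GG (ray \<alpha> x)))\<^sup>2 \<le> C * \<alpha> * (norm (GG (ray \<alpha> x)))\<^sup>2"
        using Q1[OF \<alpha> x(1)] by (intro mult_right_mono) auto
      also have "\<dots> \<le> C * \<alpha> * CG" using GGb[OF \<alpha> x0 x(2)] C \<alpha> by (intro mult_left_mono) auto
      finally have "D - C * CG * \<alpha> \<le> 0" using D(2) by (simp add: mult_ac)
      moreover have "((\<lambda>t. flux b \<alpha> t - C * CG * \<alpha> * t) has_real_derivative D - C * CG * \<alpha>) (at x)"
        using DERIV_diff[OF D(1) DERIV_cmult[OF DERIV_ident, of "C * CG * \<alpha>"]] by simp
      ultimately show "\<exists>D. ((\<lambda>t. flux b \<alpha> t - C * CG * \<alpha> * t) has_real_derivative D) (at x) \<and> D \<le> 0" by blast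
    qed
    moreover have "C * CG * \<alpha> * \<delta> \<ge> 0" using C CG0 \<alpha> \<delta> by simp
    ultimately show ?thesis using JT by (simp add: mult_ac)
  qed
  \<comment> \<open>The coefficient of - |F0|^2 in the flux. At \<alpha> = 0 it is at least 2 m
    \<sigma>, so by continuity above m \<sigma> for all small \<alpha>.\<close>
  define TI where "TI \<alpha> = Im (cis ((b - 1) * \<alpha>) * TT (ray \<alpha> \<delta>))" for \<alpha>
  have TI0: "TI 0 \<ge> 2 * (m * \<sigma>)"
  proof -
    have "TI 0 = (\<delta> + 2) * (\<sigma> * (2 * m - d / 2 * \<delta>))"
      by (simp add: TI_def ray_def TT_def algebra_simps)
    moreover have "d * \<delta> \<le> m"
    proof -
      have "d * \<delta> \<le> (d + 1) * \<delta>" using \<delta> by (simp add: distrib_right)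
      also have "\<dots> \<le> m" using \<delta>le(2) d by (simp add: field_simps)
      finally show ?thesis .
    qed
    then have "\<sigma> * m \<le> \<sigma> * (2 * m - d / 2 * \<delta>)" using m \<sigma> by (intro mult_left_mono) auto
    then have "2 * (\<sigma> * m) \<le> (\<delta> + 2) * (\<sigma> * (2 * m - d / 2 * \<delta>))" using \<delta> m \<sigma> by (intro mult_mono) auto
    ultimately show ?thesis by (simp add: mult_ac)
  qed
  have TIc: "(TI \<longlongrightarrow> TI 0) (at_right 0)"
    unfolding TI_def ray_def TT_def cis_conv_exp by (intro tendsto_intros) auto
  define cs where "cs = (3::real) powr (- \<bar>s\<bar>)"
  have cs: "cs > 0" by (simp add: cs_def)
  \<comment> \<open>The reciprocal of \<open>X2\<close> bounds |E|^2 from below at the chosen point,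
    independently of \<alpha>; thus \<open>C'\<close> may be fixed before \<alpha> is
    chosen.\<close>
  define X2 where "X2 = exp (\<sigma> * d * \<delta>) / cs\<^sup>2"
  define C' where "C' = C * CG * T * X2"
  have "eventually (\<lambda>\<alpha>. TI \<alpha> > m * \<sigma>) (at_right 0)"
    using m \<sigma> TI0 by (intro order_tendstoD(1)[OF TIc]) (smt (verit) mult_pos_pos)
  moreover have "((\<lambda>\<alpha>. C' * \<alpha>) \<longlongrightarrow> C' * 0) (at_right 0)" by (intro tendsto_intros)
  then have "eventually (\<lambda>\<alpha>. C' * \<alpha> < m * \<sigma> * e\<^sup>2 / 16) (at_right 0)"
    using m \<sigma> e by (intro order_tendstoD(2)) auto
  moreover have "eventually (\<lambda>\<alpha>. \<alpha> \<in> {0<..<pi/6}) (at_right 0)"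
    by (rule eventually_at_right_real) simp
  ultimately have "eventually (\<lambda>\<alpha>. TI \<alpha> > m * \<sigma> \<and> C' * \<alpha> < m * \<sigma> * e\<^sup>2 / 16 \<and> \<alpha> \<in> {0<..<pi/6}) (at_right 0)"
    by eventually_elim simp
  then obtain \<alpha> where \<alpha>: "TI \<alpha> > m * \<sigma>" "C' * \<alpha> < m * \<sigma> * e\<^sup>2 / 16" "0 < \<alpha>" "\<alpha> < pi / 6"
    using eventually_happens'[OF trivial_limit_at_right_real] by auto
  define z where "z = ray \<alpha> \<delta>"
  note r = rz[OF \<alpha>(3,4) \<delta>, folded z_def]
  have zx: "norm (zet z) \<ge> \<sigma>" "Re (zet z) > 0" using norm_zet(2)[OF r(3,4)] r \<sigma> by (auto simp: Re_zet)
  have z3: "norm (z + 2) \<le> 3" using norm_triangle_ineq[of z 2] r \<delta>le(1) by simp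
  have zx3: "norm (zet z) \<le> 3 * \<sigma>" using norm_zet(1)[OF r(3,4)] z3 \<sigma> by simp
  have F0b: "norm (F0 z) \<le> K0" unfolding F0_def by (rule K0[OF zx(2,1) zx3])
  have F1b: "norm (F1 z) \<le> \<sigma> * K1" unfolding F1_def using K1[OF zx(2,1) zx3] \<sigma> by (simp add: norm_mult)
  have EElow: "1 \<le> (norm (EE z))\<^sup>2 * X2"
  proof -
    have n2: "1 \<le> norm (z + 2)" using complex_Re_le_cmod[of "z + 2"] r by simp
    have "cs \<le> norm (z + 2) powr (- s)"
    proof -
      have "cs \<le> norm (z + 2) powr (- \<bar>s\<bar>)" unfolding cs_def using n2 z3 by (intro powr_mono2') auto
      also have "\<dots> \<le> norm (z + 2) powr (- s)" using n2 by (intro powr_mono) auto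
      finally show ?thesis .
    qed
    then have "1 * exp (- (\<sigma> * d / 2) * Im z) * cs \<le> norm (EE z)"
      unfolding norm_EE(1)[OF r(3)] using norm_EE(2)[OF r(3)] cs by (intro mult_mono) auto
    moreover have "Im z \<le> \<delta>" using abs_Im_le_cmod[of z] r by simp
    then have "\<sigma> * d / 2 * Im z \<le> \<sigma> * d / 2 * \<delta>" using \<sigma> d by (intro mult_left_mono) auto
    then have "exp (- (\<sigma> * d / 2 * \<delta>)) \<le> exp (- (\<sigma> * d / 2) * Im z)" by simp
    from mult_right_mono[OF this, of cs] have "exp (- (\<sigma> * d / 2 * \<delta>)) * cs \<le> exp (- (\<sigma> * d / 2) * Im z) * cs" using cs by simp
    ultimately have "exp (- (\<sigma> * d / 2 * \<delta>)) * cs \<le> norm (EE z)" by linarith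
    then have sq1: "(exp (- (\<sigma> * d / 2 * \<delta>)) * cs)\<^sup>2 \<le> (norm (EE z))\<^sup>2" using cs by (intro power_mono) auto
    have sq2: "(exp (- (\<sigma> * d / 2 * \<delta>)) * cs)\<^sup>2 = exp (- (\<sigma> * d * \<delta>)) * cs\<^sup>2"
      by (simp add: power_mult_distrib power2_eq_square[of "exp _"] exp_add[symmetric])
    have "exp (- (\<sigma> * d * \<delta>)) * cs\<^sup>2 * X2 \<le> (norm (EE z))\<^sup>2 * X2"
      by (rule mult_right_mono[OF sq1[unfolded sq2]]) (simp add: X2_def)
    moreover have "exp (- (\<sigma> * d * \<delta>)) * cs\<^sup>2 * X2 = 1" using cs by (simp add: X2_def exp_add[symmetric])
    ultimately show ?thesis by simp
  qed
  have flux_eq: "flux b \<alpha> \<delta> = (norm (EE z))\<^sup>2 * (Im (cis ((b - 1) * \<alpha>) * (z * (z + 2) * F1 z * cnj (F0 z))) - TI \<alpha> * (norm (F0 z))\<^sup>2)"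
  proof -
    have "cis ((b - 1) * \<alpha>) * (PG z * cnj (GG z))
      = (EE z * cnj (EE z)) * (cis ((b - 1) * \<alpha>) * (z * (z + 2) * F1 z * cnj (F0 z)) - cis ((b - 1) * \<alpha>) * TT z * (F0 z * cnj (F0 z)))"
      by (simp add: PG_def GG_def algebra_simps)
    also have "\<dots> = of_real ((norm (EE z))\<^sup>2) * (cis ((b - 1) * \<alpha>) * (z * (z + 2) * F1 z * cnj (F0 z)) - cis ((b - 1) * \<alpha>) * TT z * of_real ((norm (F0 z))\<^sup>2))"
      by (simp only: complex_norm_square)
    finally have e: "cis ((b - 1) * \<alpha>) * (PG z * cnj (GG z)) = of_real ((norm (EE z))\<^sup>2) * (cis ((b - 1) * \<alpha>) * (z * (z + 2) * F1 z * cnj (F0 z)) - cis ((b - 1) * \<alpha>) * TT z * of_real ((norm (F0 z))\<^sup>2))" .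
    have "Im (of_real x * (X - Y * of_real y)) = x * (Im X - Im Y * y)" for x y X Y by simp
    then show ?thesis unfolding flux_def z_def[symmetric] e TI_def by (simp only: z_def)
  qed
  define I1 where "I1 = Im (cis ((b - 1) * \<alpha>) * (z * (z + 2) * F1 z * cnj (F0 z)))"
  have I1: "I1 \<le> 3 * \<delta> * (\<sigma> * K1) * K0"
  proof -
    have "I1 \<le> norm (cis ((b - 1) * \<alpha>) * (z * (z + 2) * F1 z * cnj (F0 z)))"
      unfolding I1_def using abs_Im_le_cmod abs_le_D1 by blast
    also have "\<dots> = norm z * norm (z + 2) * norm (F1 z) * norm (F0 z)" by (simp add: norm_mult mult_ac)
    also have "\<dots> \<le> \<delta> * 3 * (\<sigma> * K1) * K0"
    proof (intro mult_mono F0b F1b)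
      show "norm (z + 2) \<le> 3" by (rule z3)
    qed (use r \<delta> K0p K1p \<sigma> in auto)
    finally show ?thesis by (simp add: mult_ac)
  qed
  \<comment> \<open>Each of the two error terms is at most m \<sigma> e^2 / 16, so |F0|^2 \<le> e^2
    / 8, which is below (e / 2)^2 and leaves e / 2 for the passage to neighbouring points.\<close>
  have "m * \<sigma> * (norm (F0 z))\<^sup>2 \<le> TI \<alpha> * (norm (F0 z))\<^sup>2" using \<alpha> by (intro mult_right_mono) auto
  also have "\<dots> \<le> I1 + C' * \<alpha>"
  proof (rule ccontr)
    assume "\<not> ?thesis"
    then have "I1 - TI \<alpha> * (norm (F0 z))\<^sup>2 < - (C' * \<alpha>)" by simp
    moreover have "C' * \<alpha> \<ge> 0" using C CG0 T \<delta> \<alpha> by (simp add: C'_def X2_def)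
    moreover have "(norm (EE z))\<^sup>2 > 0" using EElow by (cases "EE z = 0") auto
    ultimately have "flux b \<alpha> \<delta> < (norm (EE z))\<^sup>2 * (- (C' * \<alpha>))"
      unfolding flux_eq I1_def[symmetric] by (intro mult_strict_left_mono) auto
    also have "\<dots> = - (C * CG * T * \<alpha>) * ((norm (EE z))\<^sup>2 * X2)" by (simp add: C'_def)
    also have "\<dots> \<le> - (C * CG * T * \<alpha>) * 1"
      using EElow C CG0 T \<delta> \<alpha> by (intro mult_left_mono_neg) auto
    finally show False using flux_low[OF \<alpha>(3,4)] by simp
  qed
  also have "\<dots> \<le> 3 * \<delta> * (\<sigma> * K1) * K0 + m * \<sigma> * e\<^sup>2 / 16" using I1 \<alpha> by simp
  also have "3 * \<delta> * (\<sigma> * K1) * K0 \<le> m * \<sigma> * e\<^sup>2 / 16"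
  proof -
    have "\<delta> * (16 * (3 * K1 * K0 + 1)) \<le> m * e\<^sup>2"
      using \<delta>le(3) K0p K1p by (subst (asm) pos_le_divide_eq) (auto intro!: add_nonneg_pos)
    then have "\<sigma> * (\<delta> * (16 * (3 * K1 * K0 + 1))) \<le> \<sigma> * (m * e\<^sup>2)" using \<sigma> by (intro mult_left_mono) auto
    moreover have "\<sigma> * (\<delta> * 16) \<ge> 0" using \<sigma> \<delta> by simp
    ultimately show ?thesis by (simp add: algebra_simps)
  qed
  finally have "(m * \<sigma>) * (norm (F0 z))\<^sup>2 \<le> (m * \<sigma>) * (e\<^sup>2 / 8)" by (simp add: mult_ac)
  then have "(norm (F0 z))\<^sup>2 \<le> e\<^sup>2 / 8" by (rule mult_left_le_imp_le) (use m \<sigma> in simp)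
  also have "\<dots> \<le> (e / 2)\<^sup>2" by (simp add: power_divide)
  finally have F0e: "norm (F0 z) \<le> e / 2" using e by (simp add: power2_le_iff_abs_le)
  define r where "r = min \<sigma> (e / (8 * (K1 + 1)))"
  have r0: "r > 0" using \<sigma> e K1p by (simp add: r_def)
  have zd: "zet z - (- 2 * \<i> * of_real \<sigma>) = - (\<i> * of_real \<sigma> * z)" by (simp add: zet_def)
  have zdn: "norm (zet z - (- 2 * \<i> * of_real \<sigma>)) = \<sigma> * \<delta>" unfolding zd using \<open>norm z = \<delta>\<close> \<sigma> by (simp add: norm_mult)
  have zX: "zet z \<in> X"
    using zx zdn \<delta>le(1) \<sigma> by (simp add: X_def dist_norm norm_minus_commute)
  show ?thesis
  proof (intro exI conjI allI impI)
    show "r > 0" by (rule r0)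
    fix y assume y: "Re y > 0" "norm (y + 2 * \<i> * of_real \<sigma>) < r"
    have yX: "y \<in> X"
    proof -
      have "dist (- 2 * \<i> * of_real \<sigma>) y = norm (y + 2 * \<i> * of_real \<sigma>)"
        by (simp add: dist_norm norm_minus_commute[of _ y] add.commute)
      then show ?thesis using y by (simp add: X_def r_def)
    qed
    have "norm (mom 0 y) \<le> norm (mom 0 (zet z)) + norm (mom 0 y - mom 0 (zet z))"
      using norm_triangle_ineq[of "mom 0 (zet z)" "mom 0 y - mom 0 (zet z)"] by simp
    also have "\<dots> \<le> e / 2 + K1 * norm (y - zet z)" using F0e lip[OF yX zX] by (simp add: F0_def)
    also have "norm (y - zet z) \<le> norm (y + 2 * \<i> * of_real \<sigma>) + norm (zet z - (- 2 * \<i> * of_real \<sigma>))"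
      using norm_triangle_ineq4[of "y + 2 * \<i> * of_real \<sigma>" "zet z - (- 2 * \<i> * of_real \<sigma>)"] by simp
    also have "\<dots> \<le> e / (8 * (K1 + 1)) + e / (4 * (K1 + 1))"
    proof (rule add_mono)
      show "norm (y + 2 * \<i> * of_real \<sigma>) \<le> e / (8 * (K1 + 1))" using y by (simp add: r_def)
      have "\<sigma> * \<delta> \<le> \<sigma> * (e / (4 * \<sigma> * (K1 + 1)))" using \<delta>le(4) \<sigma> by (intro mult_left_mono) auto
      then show "norm (zet z - (- 2 * \<i> * of_real \<sigma>)) \<le> e / (4 * (K1 + 1))" unfolding zdn using \<sigma> by simp
    qed
    also have "\<dots> = (3 * e / 8) * (1 / (K1 + 1))"
    proof -
      define k where "k = 1 / (K1 + 1)"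
      have e1: "e / (8 * (K1 + 1)) = e / 8 * k" and e2: "e / (4 * (K1 + 1)) = e / 4 * k" by (simp_all add: k_def)
      show ?thesis unfolding e1 e2 k_def[symmetric] by (simp add: algebra_simps)
    qed
    finally have "norm (mom 0 y) \<le> e / 2 + K1 * ((3 * e / 8) * (1 / (K1 + 1)))"
      using K1p by (simp add: mult_left_mono)
    also have "K1 * ((3 * e / 8) * (1 / (K1 + 1))) = (3 * e / 8) * (K1 / (K1 + 1))" by simp
    also have "\<dots> \<le> (3 * e / 8) * 1" using e K1p by (intro mult_left_mono) auto
    finally show "norm (mom 0 y) < e" using e by simp
  qed
qed

end

section \<open>Flatness at a singular point and vanishing of the radial mode\<close>

context radial_mode
begin

lemma W_bounded_upto: "\<exists>C. \<forall>x. 0 < x \<longrightarrow> x \<le> T \<longrightarrow> norm (W j x) \<le> C"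
proof -
  obtain C where C: "\<And>x. 0 < x \<Longrightarrow> x \<le> 1 \<Longrightarrow> norm (W j x) \<le> C" using W_bdd[of j] by blast
  have "continuous_on {1..T} (W j)"
    by (rule continuous_on_vector_derivative, rule has_vector_derivative_at_within[OF W]) auto
  then have "bounded (W j ` {1..T})" by (intro compact_imp_bounded compact_continuous_image) auto
  then obtain D where D: "\<And>x. x \<in> {1..T} \<Longrightarrow> norm (W j x) \<le> D" unfolding bounded_iff by blast
  have "norm (W j x) \<le> max C D" if "0 < x" "x \<le> T" for x
    using C[of x] D[of x] that by (cases "x \<le> 1") (auto simp: le_max_iff_disj)
  then show ?thesis by blast
qed

text \<open>With d = \<kappa> = 0 the radial equation has leading coefficient x^2 and no constant
  term in the first-order coefficient, so the horizon is a regular singular point. The imaginary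
  part of the indicial polynomial at \<open>n\<close> is - 2 m \<sigma> (2 n + 1 - 2 s), nonzero
  under the assumption on \<open>s\<close>; all derivatives of W therefore vanish at 0.\<close>

lemma W_zero_degenerate:
  assumes dg: "d = 0" "\<kappa> = 0" and s: "s \<le> 0 \<or> (\<forall>n::nat. 2 * s \<noteq> real n)" and x: "x > 0"
  shows "W 0 x = 0"
proof -
  define q1 where "q1 = 2 - 2 * coefB"
  define q2 where "q2 = - 2 * \<i> * of_real \<sigma>"
  define r0 where "r0 = - coefB + 4 * \<i> * of_real (s * \<sigma>) * of_real m - of_real lam"
  define r1 where "r1 = - 2 * \<i> * of_real \<sigma> + 4 * \<i> * of_real (s * \<sigma>)"
  have ode': "(0 + 0 * of_real x + 1 * of_real x ^ 2) * W 2 x + (0 + q1 * of_real x + q2 * of_real x ^ 2) * W 1 x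
        + (r0 + r1 * of_real x) * W 0 x = 0" if "0 < x" for x
    using ode[OF that] unfolding dg
    by (simp add: P_def q1_def q2_def r0_def r1_def coefB_def dg power2_eq_square algebra_simps)
  have "\<exists>L. (W j \<longlongrightarrow> L) (at_right 0)" for j
  proof -
    obtain C where "\<And>t. 0 < t \<Longrightarrow> t \<le> 1 \<Longrightarrow> norm (W (Suc j) t) \<le> C" using W_bdd by blast
    then show ?thesis by (intro limit_at_right_if_derivative_bounded[OF zero_less_one W]) auto
  qed
  then obtain L where L: "\<And>j. (W j \<longlongrightarrow> L j) (at_right 0)" by metis
  have L0: "L n = 0" for n
  proof (induction n rule: less_induct)
    case (less n)
    have "(of_nat n * 0 + 0) * L (Suc n) + (of_nat n * (of_nat n - 1) * 1 + of_nat n * q1 + r0) * L n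
      + (of_nat n * (of_nat n - 1) * q2 + of_nat n * r1) * L (n - 1) = 0"
      by (rule quadratic_ode_limits[where f = W]) (fact W, fact ode', fact L)
    moreover have "of_nat n = (0::complex) \<or> L (n - 1) = 0" using less by (cases n) auto
    ultimately have "(of_nat n * (of_nat n - 1) + of_nat n * q1 + r0) * L n = 0" by auto
    moreover have "of_nat n * (of_nat n - 1) + of_nat n * q1 + r0 \<noteq> 0"
    proof
      assume "of_nat n * (of_nat n - 1) + of_nat n * q1 + r0 = 0"
      then have "Im (of_nat n * (of_nat n - 1) + of_nat n * q1 + r0) = 0" by simp
      then have "(2 * m * \<sigma>) * (2 * real n + 1 - 2 * s) = 0"
        by (simp add: q1_def r0_def coefB_def algebra_simps)
      then have "2 * s = real (2 * n + 1)" using m \<sigma> by simp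
      moreover from this have "s > 0" by simp
      ultimately show False using s not_less by blast
    qed
    ultimately show ?case by simp
  qed
  show ?thesis
  proof (rule regular_singular_point_unique[where f = W and T = x and t = x])
    define A where "A t = - (q1 + q2 * of_real t)" for t :: real
    define B where "B t = - (r0 + r1 * of_real t)" for t :: real
    define K where "K = max (norm q1 + norm q2 * x) (norm r0 + norm r1 * x)"
    show "0 < x" "x \<le> x" "0 < x" using x by auto
    show "\<And>j y. 0 < y \<Longrightarrow> y \<le> x \<Longrightarrow> (W j has_vector_derivative W (Suc j) y) (at y)" by (rule W)
    show "\<And>j. \<exists>C. \<forall>y. 0 < y \<longrightarrow> y \<le> x \<longrightarrow> norm (W j y) \<le> C" by (rule W_bounded_upto)
    show "\<And>j. (W j \<longlongrightarrow> 0) (at_right 0)" using L L0 by metis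
    show "of_real (y\<^sup>2) * W 2 y = A y * of_real y * W 1 y + B y * W 0 y" if y: "0 < y" "y \<le> x" for y
    proof -
      have "of_real (y\<^sup>2) * W 2 y = - ((0 + q1 * of_real y + q2 * of_real y ^ 2) * W 1 y + (r0 + r1 * of_real y) * W 0 y)"
        using ode'[OF y(1)] by (simp only: eq_neg_iff_add_eq_0 add.assoc) simp
      then show ?thesis by (simp add: A_def B_def power2_eq_square algebra_simps)
    qed
    show "norm (A y) \<le> K" if y: "0 < y" "y \<le> x" for y
      unfolding A_def norm_minus_cancel K_def using y
      by (intro max.coboundedI1 order_trans[OF norm_triangle_ineq] add_mono) (auto simp: norm_mult intro!: mult_left_mono)
    show "norm (B y) \<le> K" if y: "0 < y" "y \<le> x" for y
      unfolding B_def norm_minus_cancel K_def using y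
      by (intro max.coboundedI2 order_trans[OF norm_triangle_ineq] add_mono) (auto simp: norm_mult intro!: mult_left_mono)
  qed
qed

end

context radial_mode_regular
begin

text \<open>The transform is studied on the half-line -2 i \<sigma> + t. Its value at the end is 0
  by \<open>mom0_limit\<close>, the recurrence there gives all derivatives, and uniqueness at a
  regular singular point plus injectivity of the transform finish.\<close>

lemma W_zero_nondegenerate:
  assumes x: "x > 0"
  shows "W 0 x = 0"
proof -
  define Z where "Z t = - 2 * \<i> * of_real \<sigma> + of_real t" for t :: real
  define f where "f j t = (- 1) ^ j * mom j (Z t)" for j t
  have Zn: "norm (Z t) \<ge> \<sigma>" "Re (Z t) = t" for t
  proof -
    have "2 * \<sigma> \<le> norm (Z t)" using abs_Im_le_cmod[of "Z t"] \<sigma> by (simp add: Z_def)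
    then show "norm (Z t) \<ge> \<sigma>" using \<sigma> by simp
    show "Re (Z t) = t" by (simp add: Z_def)
  qed
  have Zd: "(Z has_vector_derivative 1) (at t)" for t
    unfolding Z_def by (rule has_vector_derivative_real_field[of "\<lambda>t. - 2 * \<i> * of_real \<sigma> + t"]) (auto intro!: derivative_eq_intros)
  have fd: "(f j has_vector_derivative f (Suc j) t) (at t)" if "0 < t" for j t
  proof -
    have "((\<lambda>t. mom j (Z t)) has_vector_derivative 1 * - mom (Suc j) (Z t)) (at t)"
      using field_vector_diff_chain_at[OF Zd mom_deriv] Zn that by (simp add: o_def)
    from has_vector_derivative_mult_right[OF this, of "(- 1) ^ j"] show ?thesis
      unfolding f_def by simp
  qed
  have Zn2: "norm (Z t) \<le> 2 * \<sigma> + T" if "0 < t" "t \<le> T" for t T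
    unfolding Z_def by (rule order_trans[OF norm_triangle_ineq]) (use that \<sigma> in \<open>simp add: norm_mult\<close>)
  have fb: "\<exists>C. \<forall>t. 0 < t \<longrightarrow> t \<le> T \<longrightarrow> norm (f j t) \<le> C" for j T
  proof -
    obtain K where "\<And>z. Re z > 0 \<Longrightarrow> norm z \<ge> \<sigma> \<Longrightarrow> norm z \<le> 2 * \<sigma> + T \<Longrightarrow> norm (mom j z) \<le> K" using mom_bounded[OF \<sigma>] by blast
    then have "norm (f j t) \<le> K" if "0 < t" "t \<le> T" for t using Zn Zn2[OF that] that by (simp add: f_def norm_mult norm_power)
    then show ?thesis by blast
  qed
  have "\<exists>L. (f j \<longlongrightarrow> L) (at_right 0)" for j
  proof -
    obtain C where "\<And>t. 0 < t \<Longrightarrow> t \<le> 1 \<Longrightarrow> norm (f (Suc j) t) \<le> C" using fb by blast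
    then show ?thesis by (intro limit_at_right_if_derivative_bounded[OF zero_less_one fd]) auto
  qed
  then obtain L where L: "\<And>j. (f j \<longlongrightarrow> L j) (at_right 0)" by metis
  define q0 where "q0 = - 2 * \<i> * of_real \<sigma> - 8 * of_real (m * \<sigma>\<^sup>2)"
  define q1 where "q1 = 2 + 2 * \<i> * of_real (\<sigma> * d) - 2 * coefB"
  define q2 where "q2 = (- of_real d :: complex)"
  define r1 where "r1 = - of_real d + 2 * coefC"
  define r0 where "r0 = 2 * \<i> * of_real (\<sigma> * d) - (\<i> * of_real (\<sigma> * d) + coefB) - 4 * \<i> * of_real \<sigma> * coefC + 4 * \<i> * of_real (s * \<sigma>) * of_real (m + d / 2) - of_real lam"
  define p1 where "p1 = - 2 * \<i> * of_real \<sigma>"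
  have ode: "(0 + p1 * of_real t + 1 * of_real t ^ 2) * f 2 t + (q0 + q1 * of_real t + q2 * of_real t ^ 2) * f 1 t
        + (r0 + r1 * of_real t) * f 0 t = 0" if t: "0 < t" for t
  proof -
    have "Re (Z t) > 0" using Zn t by simp
    note o = mom_ode[OF this]
    have 1: "Z t * (Z t + 2 * \<i> * of_real \<sigma>) = 0 + p1 * of_real t + 1 * of_real t ^ 2"
      by (simp add: Z_def p1_def algebra_simps power2_eq_square)
    have 2: "c1 (Z t) = - (q0 + q1 * of_real t + q2 * of_real t ^ 2)"
      by (simp add: c1_def Z_def q0_def q1_def q2_def coefB_def algebra_simps power2_eq_square)
    have 3: "c0 (Z t) = r0 + r1 * of_real t"
      by (simp add: c0_def Z_def r0_def r1_def algebra_simps)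
    show ?thesis using o unfolding 1 2 3 f_def mult_minus_left by simp
  qed
  have L0: "L n = 0" for n
  proof (induction n rule: less_induct)
    case (less n)
    show ?case
    proof (cases n)
      case 0
      have "(f 0 \<longlongrightarrow> 0) (at_right 0)"
      proof (rule tendstoI)
        fix e :: real assume "e > 0"
        from mom0_limit[OF nd this] obtain r where r: "r > 0"
          "\<And>z. Re z > 0 \<Longrightarrow> norm (z + 2 * \<i> * of_real \<sigma>) < r \<Longrightarrow> norm (mom 0 z) < e" by blast
        show "eventually (\<lambda>t. dist (f 0 t) 0 < e) (at_right 0)"
          unfolding eventually_at_right[OF r(1)]
        proof (intro exI[of _ r] conjI allI impI r)
          fix t assume "0 < t" "t < r"
          then have "norm (mom 0 (Z t)) < e" using Zn by (intro r) (auto simp: Z_def)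
          then show "dist (f 0 t) 0 < e" by (simp add: f_def)
        qed
      qed
      then show ?thesis using tendsto_unique[OF trivial_limit_at_right_real L[of 0]] 0 by simp
    next
      case (Suc k)
      have "(of_nat k * p1 + q0) * L (Suc k) + (of_nat k * (of_nat k - 1) * 1 + of_nat k * q1 + r0) * L k
        + (of_nat k * (of_nat k - 1) * q2 + of_nat k * r1) * L (k - 1) = 0"
        by (rule quadratic_ode_limits[where f = f]) (fact fd, fact ode, fact L)
      moreover have "L k = 0" "L (k - 1) = 0" using less Suc by auto
      \<comment> \<open>The second exponent at this point is not a nonnegative integer: the
        imaginary part of the leading coefficient is - 2 \<sigma> (k + 1).\<close>
      moreover have "of_nat k * p1 + q0 \<noteq> 0"
      proof
        assume "of_nat k * p1 + q0 = 0"
        then have "Im (of_nat k * p1 + q0) = 0" by simp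
        then have "(2 * \<sigma>) * (real k + 1) = 0" by (simp add: p1_def q0_def algebra_simps)
        then show False using \<sigma> by (simp add: add_nonneg_eq_0_iff)
      qed
      ultimately show ?thesis using Suc by simp
    qed
  qed
  have f0: "f 0 t = 0" if t: "0 < t" for t
  proof (rule regular_singular_point_unique[where f = f and T = t and t = t])
    define A where "A t = - (q0 + q1 * of_real t + q2 * of_real t ^ 2) / (of_real t + p1)" for t :: real
    define B where "B t = - (of_real t * (r0 + r1 * of_real t)) / (of_real t + p1)" for t :: real
    define K where "K = max ((norm q0 + norm q1 * t + norm q2 * t\<^sup>2) / \<sigma>) (t * (norm r0 + norm r1 * t) / \<sigma>)"
    have den: "norm (of_real x + p1) \<ge> \<sigma>" for x :: real
      using Zn(1)[of x] by (simp add: Z_def p1_def add.commute)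
    show "0 < t" "t \<le> t" "0 < t" using t by auto
    show "\<And>j x. 0 < x \<Longrightarrow> x \<le> t \<Longrightarrow> (f j has_vector_derivative f (Suc j) x) (at x)" by (rule fd)
    show "\<And>j. \<exists>C. \<forall>x. 0 < x \<longrightarrow> x \<le> t \<longrightarrow> norm (f j x) \<le> C" using fb by blast
    show "\<And>j. (f j \<longlongrightarrow> 0) (at_right 0)" using L L0 by metis
    show "of_real (x\<^sup>2) * f 2 x = A x * of_real x * f 1 x + B x * f 0 x" if x: "0 < x" "x \<le> t" for x
    proof -
      have n0: "of_real x + p1 \<noteq> 0" using den[of x] \<sigma> by auto
      have "(of_real x + p1) * (of_real x * f 2 x) = - (q0 + q1 * of_real x + q2 * of_real x ^ 2) * f 1 x - (r0 + r1 * of_real x) * f 0 x"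
      proof -
        have "(0 + p1 * of_real x + 1 * of_real x ^ 2) * f 2 x = (of_real x + p1) * (of_real x * f 2 x)"
          by (simp add: algebra_simps power2_eq_square)
        then have E: "(of_real x + p1) * (of_real x * f 2 x) = - ((q0 + q1 * of_real x + q2 * of_real x ^ 2) * f 1 x + (r0 + r1 * of_real x) * f 0 x)"
          using ode[OF x(1)] by (simp only: eq_neg_iff_add_eq_0 add.assoc)
        show ?thesis unfolding E by (simp add: algebra_simps)
      qed
      then have "of_real x * f 2 x = (- (q0 + q1 * of_real x + q2 * of_real x ^ 2) * f 1 x - (r0 + r1 * of_real x) * f 0 x) / (of_real x + p1)"
        using n0 by (simp add: nonzero_eq_divide_eq mult.commute)
      then have "of_real x * (of_real x * f 2 x) = of_real x * ((- (q0 + q1 * of_real x + q2 * of_real x ^ 2) * f 1 x - (r0 + r1 * of_real x) * f 0 x) / (of_real x + p1))"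
        by simp
      also have "\<dots> = A x * of_real x * f 1 x + B x * f 0 x"
        by (simp add: A_def B_def diff_divide_distrib add_divide_distrib ring_distribs mult_ac)
      finally show ?thesis by (simp add: power2_eq_square mult.assoc)
    qed
    show "norm (A x) \<le> K" if x: "0 < x" "x \<le> t" for x
    proof -
      have "norm (q0 + q1 * of_real x + q2 * of_real x ^ 2) \<le> norm q0 + norm (q1 * of_real x) + norm (q2 * of_real x ^ 2)"
        by (rule order_trans[OF norm_triangle_ineq add_right_mono[OF norm_triangle_ineq]])
      also have "\<dots> \<le> norm q0 + norm q1 * t + norm q2 * t\<^sup>2"
        using x by (intro add_mono) (auto simp: norm_mult norm_power intro!: mult_left_mono power_mono)
      finally have "norm (A x) \<le> (norm q0 + norm q1 * t + norm q2 * t\<^sup>2) / \<sigma>"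
        unfolding A_def norm_divide norm_minus_cancel using den[of x] \<sigma> t by (intro frac_le) (auto intro!: add_nonneg_nonneg mult_nonneg_nonneg)
      then show ?thesis by (simp add: K_def)
    qed
    show "norm (B x) \<le> K" if x: "0 < x" "x \<le> t" for x
    proof -
      have "norm (of_real x * (r0 + r1 * of_real x)) \<le> t * (norm r0 + norm r1 * t)"
        unfolding norm_mult[of "of_real x"] using x
        by (intro mult_mono order_trans[OF norm_triangle_ineq] add_mono) (auto simp: norm_mult intro!: mult_left_mono)
      then have "norm (B x) \<le> t * (norm r0 + norm r1 * t) / \<sigma>"
        unfolding B_def norm_divide norm_minus_cancel using den[of x] \<sigma> t by (intro frac_le) (auto intro!: add_nonneg_nonneg mult_nonneg_nonneg)
      then show ?thesis by (simp add: K_def)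
    qed
  qed
  have fj: "f j t = 0" if "0 < t" for j t
    using that
  proof (induction j arbitrary: t)
    case 0
    then show ?case by (rule f0)
  next
    case (Suc j)
    have "(f j has_vector_derivative 0) (at t)"
      by (rule has_vector_derivative_transform_within_open[OF has_vector_derivative_const[of 0] open_greaterThan[of 0]])
        (use Suc in auto)
    with fd[OF Suc.prems] show ?case by (rule vector_derivative_unique_at)
  qed
  \<comment> \<open>The moment of order \<open>reg\<close> is an honest integral, so injectivity is
    applied to it rather than to the regularized transform. The shift by -2 i \<sigma> becomes a
    phase of modulus 1.\<close>
  define v where "v x = of_real x ^ reg * (exp (- 2 * H x) * W 0 x)" for x
  have sv: "subexponential v" unfolding v_def by (rule moment_subexponential[OF admissible_W]) simp
  define \<phi> where "\<phi> x = exp (2 * \<i> * of_real \<sigma> * of_real x) * v x" for x :: real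
  have n\<phi>: "norm (\<phi> x) = norm (v x)" for x by (simp add: \<phi>_def norm_mult)
  obtain B where B: "B \<ge> 0" "\<And>x. x > 0 \<Longrightarrow> norm (v x) \<le> B * exp (1 * x)" using subexponentialD[OF sv, of 1] by auto
  have "\<phi> x = 0"
  proof (rule laplace_injective[where B = "B * exp 1", OF _ _ x])
    show "subexponential \<phi>"
      unfolding subexponential_def n\<phi>
    proof
      show "continuous_on {0<..} \<phi>" unfolding \<phi>_def by (intro continuous_intros subexponential_continuous[OF sv])
      show "\<forall>e>0. \<exists>K. \<forall>x>0. norm (v x) \<le> K * exp (e * x)"
        using sv unfolding subexponential_def by blast
    qed
    fix t :: real assume t: "t > 0"
    have "laplace \<phi> (of_real t) = mom reg (Z t)"
    proof -
      have "exp (- of_real t * of_real x) * \<phi> x = exp (- Z t * of_real x) * v x" for x :: real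
      proof -
        have "exp (- Z t * of_real x) = exp (- of_real t * of_real x + 2 * \<i> * of_real \<sigma> * of_real x)"
          by (simp add: Z_def algebra_simps)
        then show ?thesis unfolding \<phi>_def exp_add by simp
      qed
      moreover have "mom reg (Z t) = laplace v (Z t)"
        unfolding mom_def v_def[abs_def] using moment_regular[OF admissible_W order_refl, of "Z t"] Zn t by simp
      ultimately show ?thesis unfolding laplace_def by (simp only:)
    qed
    then show "laplace \<phi> (of_real t) = 0" using fj[OF t, of reg] by (simp add: f_def)
  next
    fix x :: real assume x: "0 < x" "x \<le> 1"
    have "B * exp (1 * x) \<le> B * exp 1" using B(1) x by (intro mult_left_mono) auto
    then show "norm (\<phi> x) \<le> B * exp 1" using B(2)[OF x(1)] by (simp add: n\<phi>)
  qed
  then show ?thesis using x by (simp add: \<phi>_def v_def)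
qed

end

lemma (in radial_mode) W_zero:
  assumes s: "s \<le> 0 \<or> (\<forall>n::nat. 2 * s \<noteq> real n)" and x: "x > 0"
  shows "W 0 x = 0"
proof (cases "d = 0 \<and> \<kappa> = 0")
  case True
  then show ?thesis using W_zero_degenerate s x by blast
next
  case False
  have "s \<le> 0 \<or> (\<forall>n::nat. s \<noteq> real n)" using s by (metis of_nat_mult of_nat_numeral)
  then interpret radial_mode_regular m d \<sigma> s \<kappa> lam N0 H W P
    using False d by unfold_locales auto
  show ?thesis by (rule W_zero_nondegenerate[OF x])
qed

section \<open>The Teukolsky--Starobinsky reduction\<close>

context radial_mode
begin

text \<open>Ellipticity of H'. Up to \<open>X\<close> the real part of \<open>P\<close> is at least
  s x, where the sign of \<open>s\<close> enters; beyond \<open>X\<close>, chosen to make |\<kappa>|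
  at most half of \<sigma> x^2, the imaginary part is at least \<sigma> x^2 / 2.\<close>

lemma inverse_rational_symb:
  assumes "s > 0"
  shows "symb n 0 (\<lambda>x. of_real (x * (x + d)) / P x)"
proof -
  have x2: "symb n 2 (\<lambda>x. of_real x * of_real x :: complex)"
    using symb_mult[OF symb_of_real symb_of_real, of n] by simp
  have mu: "symb n 2 (\<lambda>x. of_real (x * (x + d)) :: complex)"
  proof -
    have "symb n 2 (\<lambda>x. of_real d * of_real x :: complex)"
      by (rule symb_mono[of 1]) (auto intro: symb_cmult symb_of_real)
    from symb_add[OF x2 this] show ?thesis by (rule symb_cong[rotated]) (simp add: algebra_simps)
  qed
  have q: "symb n 0 (\<lambda>x. P x / of_real (x * (x + d)))" by (rule rational_symb)
  define X where "X = 1 + sqrt (2 * \<bar>\<kappa>\<bar> / \<sigma>)"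
  have X: "X \<ge> 1" using \<sigma> by (simp add: X_def)
  define c where "c = min (\<sigma> / 2) (s / X) / (1 + d)"
  have c: "c > 0" using \<sigma> assms X d by (simp add: c_def)
  have low: "norm (P x / of_real (x * (x + d))) \<ge> c * x powr 0" if x: "x > 1" for x
  proof -
    have mub: "0 < x * (x + d)" "x * (x + d) \<le> (1 + d) * x\<^sup>2"
    proof -
      show "0 < x * (x + d)" using x d by (intro mult_pos_pos) auto
      have "x * d \<le> x\<^sup>2 * d" using x d self_le_power[of x 2] by (intro mult_right_mono) auto
      then show "x * (x + d) \<le> (1 + d) * x\<^sup>2" by (simp add: power2_eq_square algebra_simps)
    qed
    have "min (\<sigma> / 2) (s / X) * x\<^sup>2 \<le> norm (P x)"
    proof (cases "x \<le> X")
      case True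
      have "min (\<sigma> / 2) (s / X) * x\<^sup>2 \<le> (s / X) * x\<^sup>2" by (rule mult_right_mono[OF min.cobounded2]) simp
      also have "\<dots> = s * x * (x / X)" by (simp add: power2_eq_square)
      also have "\<dots> \<le> s * x * 1" using True x X assms by (intro mult_left_mono) auto
      also have "\<dots> \<le> Re (P x)" using assms d by (simp add: P_def power2_eq_square)
      also have "\<dots> \<le> norm (P x)" by (rule complex_Re_le_cmod)
      finally show ?thesis .
    next
      case False
      have "sqrt (2 * \<bar>\<kappa>\<bar> / \<sigma>) \<le> x" using False by (simp add: X_def)
      then have "(sqrt (2 * \<bar>\<kappa>\<bar> / \<sigma>))\<^sup>2 \<le> x\<^sup>2" using \<sigma> by (intro power_mono) auto
      then have "2 * \<bar>\<kappa>\<bar> / \<sigma> \<le> x\<^sup>2" using \<sigma> by simp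
      then have k: "\<bar>\<kappa>\<bar> \<le> \<sigma> / 2 * x\<^sup>2" using \<sigma> by (simp add: field_simps)
      have "Im (P x) = \<kappa> + (\<sigma> * d) * x + 2 * (m * \<sigma>) * x + \<sigma> * x\<^sup>2" by (simp add: P_def power2_eq_square algebra_simps)
      moreover have "(\<sigma> * d) * x \<ge> 0" "2 * (m * \<sigma>) * x \<ge> 0" using \<sigma> d m x by auto
      ultimately have I: "\<sigma> / 2 * x\<^sup>2 \<le> Im (P x)" using k abs_ge_minus_self[of \<kappa>] by linarith
      have "min (\<sigma> / 2) (s / X) * x\<^sup>2 \<le> \<sigma> / 2 * x\<^sup>2" by (rule mult_right_mono[OF min.cobounded1]) simp
      also note I
      also have "Im (P x) \<le> norm (P x)" using abs_Im_le_cmod[of "P x"] by linarith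
      finally show ?thesis .
    qed
    then have "min (\<sigma> / 2) (s / X) * x\<^sup>2 / ((1 + d) * x\<^sup>2) \<le> norm (P x) / (x * (x + d))"
      using mub by (intro frac_le) auto
    moreover have "min (\<sigma> / 2) (s / X) * x\<^sup>2 / ((1 + d) * x\<^sup>2) = c" using x by (simp add: c_def)
    ultimately show ?thesis using mub x by (simp only: norm_divide norm_of_real) simp
  qed
  from symb_inverse[OF q c low] show ?thesis by simp
qed

text \<open>W_j is a constant y, and v = exp (- 2 H) y satisfies v' = - 2 H' v. Since H' is elliptic
  of order 0, v is a multiple of its derivative by a symbol of order 0 and gains one order of decay;
  repeating this gives rapid decay. But |v| is exactly of order x^(- 2 s), so y = 0.\<close>

lemma W_Suc_zero:
  assumes s: "s > 0" and z: "\<And>x. x > 0 \<Longrightarrow> W (Suc j) x = 0"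
  shows "x > 0 \<Longrightarrow> W j x = 0"
proof -
  have "\<exists>y. \<forall>x\<in>{0<..}. W j x = y"
  proof (rule has_derivative_zero_constant)
    show "convex {0::real<..}" by simp
    fix x :: real assume "x \<in> {0<..}"
    then show "(W j has_derivative (\<lambda>h. 0)) (at x within {0<..})"
      using W[of x j] z[of x] by (auto simp: has_vector_derivative_def intro: has_derivative_at_withinI)
  qed
  then obtain y where y: "\<And>x. x > 0 \<Longrightarrow> W j x = y" by auto
  define v where "v x = exp (- 2 * H x) * W j x" for x
  have vd: "(v has_vector_derivative (- 2 * (P x / of_real (x * (x + d)))) * v x) (at x)" if "x > 0" for x
    using exp_H_W_deriv[OF that, of j] z[OF that] by (simp add: v_def[abs_def])
  \<comment> \<open>Bootstrap: differentiate, which lowers the order by one, then divide by - 2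
    H'.\<close>
  have sv: "symb n (N0 - real i) v" for n i
  proof (induction i arbitrary: n)
    case 0
    then show ?case using exp_H_W_symb[of n j] by (simp add: v_def[abs_def])
  next
    case (Suc i)
    have "symb n (N0 - real i - 1) (\<lambda>x. (- 2 * (P x / of_real (x * (x + d)))) * v x)"
      by (rule symb_derivative[OF Suc[of "Suc n"]]) (use vd in auto)
    from symb_mult[OF symb_cmult[OF inverse_rational_symb[OF s], of n "- 1 / 2"] this]
    have "symb n (0 + (N0 - real i - 1)) (\<lambda>x. - 1 / 2 * (of_real (x * (x + d)) / P x) * ((- 2 * (P x / of_real (x * (x + d)))) * v x))" .
    then have "symb n (0 + (N0 - real i - 1)) v"
    proof (rule symb_cong[rotated])
      fix x :: real assume x: "1 < x"
      have "Re (P x) > 0" using s d x by (simp add: P_def power2_eq_square add_nonneg_pos)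
      then have "P x \<noteq> 0" by auto
      moreover have "of_real (x * (x + d)) \<noteq> (0::complex)" using x d by (simp del: of_real_mult)
      ultimately show "- 1 / 2 * (of_real (x * (x + d)) / P x) * ((- 2 * (P x / of_real (x * (x + d)))) * v x) = v x" by simp
    qed
    then show ?case by (simp add: algebra_simps)
  qed
  obtain A where A: "A > 0" "\<And>x. x > 0 \<Longrightarrow> norm (exp (- 2 * H x)) = A * (x * (x + d)) powr (- s)"
    using norm_exp_H by blast
  obtain i :: nat where i: "N0 + 2 * s + 1 < real i" using reals_Archimedean2 by blast
  obtain C where C: "C \<ge> 0" "\<And>x. x > 1 \<Longrightarrow> norm (v x) \<le> C * x powr (N0 - real i)" using symb_bound[OF sv[of 0 i]] by blast
  have "y = 0"
  proof (rule ccontr)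
    assume y0: "y \<noteq> 0"
    define B where "B = A * (1 + d) powr (- s) * norm y"
    have B: "B > 0" using A y0 d by (simp add: B_def)
    have le: "B \<le> C * (1 / x)" if x: "x > 1" for x
    proof -
      have "x * (x + d) \<le> (1 + d) * x\<^sup>2"
      proof -
        have "x * d \<le> x\<^sup>2 * d" using x d self_le_power[of x 2] by (intro mult_right_mono) auto
        then show "x * (x + d) \<le> (1 + d) * x\<^sup>2" by (simp add: power2_eq_square algebra_simps)
      qed
      moreover have "x * (x + d) > 0" using x d by (intro mult_pos_pos) auto
      ultimately have "((1 + d) * x\<^sup>2) powr (- s) \<le> (x * (x + d)) powr (- s)" using s by (intro powr_mono2') auto
      then have "A * ((1 + d) * x\<^sup>2) powr (- s) * norm y \<le> norm (v x)"
        using A x y[of x] by (simp add: v_def norm_mult mult_left_mono mult_right_mono)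
      also have "\<dots> \<le> C * x powr (N0 - real i)" by (rule C(2)[OF x])
      finally have "A * ((1 + d) * x\<^sup>2) powr (- s) * norm y \<le> C * x powr (N0 - real i)" .
      moreover have "((1 + d) * x\<^sup>2) powr (- s) = (1 + d) powr (- s) * x powr (- 2 * s)"
      proof -
        have "(x\<^sup>2) powr (- s) = (x powr 2) powr (- s)" using x by simp
        also have "\<dots> = x powr (- 2 * s)" by (simp only: powr_powr) simp
        finally show ?thesis using d x by (simp add: powr_mult)
      qed
      ultimately have "B * x powr (- 2 * s) \<le> C * x powr (N0 - real i)" by (simp add: B_def mult_ac)
      then have "B * x powr (- 2 * s) * x powr (2 * s) \<le> C * x powr (N0 - real i) * x powr (2 * s)" by (intro mult_right_mono) auto
      then have "B \<le> C * x powr (N0 - real i + 2 * s)" using x by (simp add: mult.assoc powr_add[symmetric])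
      also have "\<dots> \<le> C * x powr (- 1)" using C(1) i x by (intro mult_left_mono powr_mono) auto
      finally show ?thesis using x by (simp add: powr_minus_divide)
    qed
    define x where "x = max 2 (2 * C / B)"
    have "x > 1" by (simp add: x_def)
    from le[OF this] have "B * x \<le> C" using \<open>x > 1\<close> by (simp add: field_simps)
    moreover have "2 * C \<le> B * x" using B by (simp add: x_def field_simps max_def)
    ultimately have "C \<le> 0" by simp
    then show False using le[of 2] B by simp
  qed
  then show "x > 0 \<Longrightarrow> W j x = 0" using y by simp
qed

text \<open>Differentiating the equation 2 s times reverses the sign of \<open>s\<close>, a radial
  Teukolsky--Starobinsky identity. For - s the mode is known to vanish, and
  \<open>W_Suc_zero\<close> integrates back one derivative at a time.\<close>

lemma W_zero_halfinteger:
  assumes s: "s > 0" and n: "2 * s = real n" and x: "x > 0"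
  shows "W 0 x = 0"
proof -
  \<comment> \<open>The phase of the equation for - s. Then exp (- 2 H') is exp (- 2 H) times the
    power \<open>n\<close> of x (x + d), which accounts for the additional order 2 n of the
    symbol.\<close>
  define H' where "H' x = H x - of_real (s * ln (x * (x + d)))" for x
  have mu0: "x * (x + d) > 0" if "x > 0" for x using that d by (intro mult_pos_pos) auto
  interpret neg: radial_mode m d \<sigma> "- s" \<kappa> lam "N0 + real n * 2" H' "\<lambda>j. W (j + n)"
    "\<lambda>x. (\<i> * of_real \<kappa> + of_real (- s * d / 2)) + (\<i> * of_real (\<sigma> * d) + (2 * \<i> * of_real (m * \<sigma>) + of_real (- s))) * of_real x
      + \<i> * of_real \<sigma> * of_real x ^ 2"
  proof unfold_locales
    show "m > 0" "d \<ge> 0" "\<sigma> > 0" using m d \<sigma> by auto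
    show "\<And>j x. 0 < x \<Longrightarrow> (W (j + n) has_vector_derivative W (Suc j + n) x) (at x)" using W by simp
    show "\<And>j. \<exists>C. \<forall>x. 0 < x \<longrightarrow> x \<le> 1 \<longrightarrow> norm (W (j + n) x) \<le> C" by (rule W_bdd)
    show "(H' has_vector_derivative
        ((\<i> * of_real \<kappa> + of_real (- s * d / 2)) + (\<i> * of_real (\<sigma> * d) + (2 * \<i> * of_real (m * \<sigma>) + of_real (- s))) * of_real x
         + \<i> * of_real \<sigma> * of_real x ^ 2) / of_real (x * (x + d))) (at x)" if x: "0 < x" for x
    proof -
      have "((\<lambda>x. s * ln (x * (x + d))) has_real_derivative s * ((2 * x + d) / (x * (x + d)))) (at x)"
        using mu0[OF x] by (auto intro!: derivative_eq_intros simp: divide_simps) (auto simp: algebra_simps)?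
      from has_vector_derivative_diff[OF H[OF x] has_vector_derivative_of_real[OF this]]
      have "(H' has_vector_derivative P x / of_real (x * (x + d)) - of_real (s * ((2 * x + d) / (x * (x + d))))) (at x)"
        unfolding H'_def .
      moreover have "of_real (s * ((2 * x + d) / (x * (x + d)))) = of_real (s * (2 * x + d)) / (of_real (x * (x + d)) :: complex)"
        by simp
      moreover have "P x - of_real (s * (2 * x + d)) = (\<i> * of_real \<kappa> + of_real (- s * d / 2)) + (\<i> * of_real (\<sigma> * d) + (2 * \<i> * of_real (m * \<sigma>) + of_real (- s))) * of_real x
         + \<i> * of_real \<sigma> * of_real x ^ 2"
        by (simp add: P_def algebra_simps)
      ultimately show ?thesis by (simp only: diff_divide_distrib[symmetric])
    qed
    show "symb k (N0 + real n * 2) (\<lambda>x. exp (- 2 * H' x) * W (0 + n) x)" for k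
    proof -
      have mu: "symb k 2 (\<lambda>x. of_real (x * (x + d)) :: complex)"
      proof -
        have x2: "symb k 2 (\<lambda>x. of_real x * of_real x :: complex)"
          using symb_mult[OF symb_of_real symb_of_real, of k] by simp
        have "symb k 2 (\<lambda>x. of_real d * of_real x :: complex)"
          by (rule symb_mono[of 1]) (auto intro: symb_cmult symb_of_real)
        from symb_add[OF x2 this] show ?thesis by (rule symb_cong[rotated]) (simp add: algebra_simps)
      qed
      have pw: "symb k (real j * 2) (\<lambda>x. of_real (x * (x + d)) ^ j :: complex)" for j
      proof (induction j)
        case 0
        show ?case using symb_const[of k 1] by simp
      next
        case (Suc j)
        from symb_mult[OF mu this] show ?case by (simp add: algebra_simps del: of_real_mult of_real_add)
      qed
      show ?thesis
      proof (rule symb_cong[OF _ symb_mult[OF exp_H_W_symb[of k n] pw[of n]]])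
        fix x :: real assume "1 < x"
        then have p: "x * (x + d) > 0" using d by (intro mult_pos_pos) auto
        have "- 2 * H' x = - 2 * H x + of_real (real n * ln (x * (x + d)))" by (simp add: H'_def n[symmetric] algebra_simps)
        moreover have "exp (of_real (real n * ln (x * (x + d))) :: complex) = of_real (x * (x + d)) ^ n"
        proof -
          have "exp (real n * ln (x * (x + d))) = (x * (x + d)) ^ n" using p by (simp only: exp_of_nat_mult exp_ln)
          then show ?thesis by (simp only: exp_of_real of_real_power)
        qed
        ultimately have "exp (- 2 * H' x) = exp (- 2 * H x) * of_real (x * (x + d)) ^ n" by (simp only: exp_add)
        then show "exp (- 2 * H x) * W n x * of_real (x * (x + d)) ^ n = exp (- 2 * H' x) * W (0 + n) x"
          by (simp only: add_0 mult_ac)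
      qed
    qed
    show "of_real (x * (x + d)) * W (2 + n) x + (of_real (2 * x + d) - 2 * ((\<i> * of_real \<kappa> + of_real (- s * d / 2)) + (\<i> * of_real (\<sigma> * d) + (2 * \<i> * of_real (m * \<sigma>) + of_real (- s))) * of_real x
         + \<i> * of_real \<sigma> * of_real x ^ 2)) * W (1 + n) x
      + (- (\<i> * of_real \<sigma> * of_real (2 * x + d) + (2 * \<i> * of_real (m * \<sigma>) + of_real (- s)))
          + 4 * \<i> * of_real (- s * \<sigma>) * of_real (x + m + d / 2) - of_real lam) * W (0 + n) x = 0" if x: "0 < x" for x
    proof -
      define C where "C = \<i> * of_real \<kappa> + of_real (s * d / 2)"
      define B where "B = \<i> * of_real (\<sigma> * d) + (2 * \<i> * of_real (m * \<sigma>) + of_real s)"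
      define q0 where "q0 = of_real d - 2 * C"
      define q1 where "q1 = 2 - 2 * B"
      define q2 where "q2 = - 2 * \<i> * of_real \<sigma>"
      define r0 where "r0 = - (\<i> * of_real (\<sigma> * d) + (2 * \<i> * of_real (m * \<sigma>) + of_real s)) + 4 * \<i> * of_real (s * \<sigma>) * of_real (m + d / 2) - of_real lam"
      define r1 where "r1 = - 2 * \<i> * of_real \<sigma> + 4 * \<i> * of_real (s * \<sigma>)"
      have o: "(0 + of_real d * of_real x + 1 * of_real x ^ 2) * W 2 x + (q0 + q1 * of_real x + q2 * of_real x ^ 2) * W 1 x
        + (r0 + r1 * of_real x) * W 0 x = 0" if "0 < x" for x
      proof -
        have "of_real (x * (x + d)) = 0 + of_real d * of_real x + 1 * (of_real x :: complex) ^ 2" by (simp add: power2_eq_square algebra_simps)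
        moreover have "of_real (2 * x + d) - 2 * P x = q0 + q1 * of_real x + q2 * of_real x ^ 2"
          by (simp add: P_def q0_def q1_def q2_def B_def C_def algebra_simps)
        moreover have "- (\<i> * of_real \<sigma> * of_real (2 * x + d) + (2 * \<i> * of_real (m * \<sigma>) + of_real s))
          + 4 * \<i> * of_real (s * \<sigma>) * of_real (x + m + d / 2) - of_real lam = r0 + r1 * of_real x"
          by (simp add: r0_def r1_def algebra_simps)
        ultimately show ?thesis using ode[OF that] by (simp only:)
      qed
      have it: "(0 + of_real d * of_real x + 1 * of_real x ^ 2) * W (Suc (Suc n)) x
        + (of_nat n * (of_real d + 2 * 1 * of_real x) + (q0 + q1 * of_real x + q2 * of_real x ^ 2)) * W (Suc n) x
        + (of_nat n * (of_nat n - 1) * 1 + of_nat n * (q1 + 2 * q2 * of_real x) + (r0 + r1 * of_real x)) * W n x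
        + (of_nat n * (of_nat n - 1) * q2 + of_nat n * r1) * W (n - 1) x = 0"
        by (rule quadratic_ode_iterated_derivative[where f = W and x = x]) (fact W, fact o, fact x)
      have nn: "of_nat n = (of_real (2 * s) :: complex)" using n by simp
      \<comment> \<open>This is where \<open>n\<close> must equal 2 s: the coefficient of the
        derivative of order n - 1 is 2 i \<sigma> n (2 s - n), so the differentiated equation
        closes.\<close>
      have z1: "of_nat n * (of_nat n - 1) * q2 + of_nat n * r1 = 0"
        unfolding nn q2_def r1_def by (simp add: algebra_simps)
      have z2: "0 + of_real d * of_real x + 1 * (of_real x :: complex) ^ 2 = of_real (x * (x + d))"
        by (simp add: power2_eq_square algebra_simps)
      have z3: "of_nat n * (of_real d + 2 * 1 * of_real x) + (q0 + q1 * of_real x + q2 * of_real x ^ 2)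
        = of_real (2 * x + d) - 2 * ((\<i> * of_real \<kappa> + of_real (- s * d / 2)) + (\<i> * of_real (\<sigma> * d) + (2 * \<i> * of_real (m * \<sigma>) + of_real (- s))) * of_real x
         + \<i> * of_real \<sigma> * of_real x ^ 2)"
        unfolding nn q0_def q1_def q2_def B_def C_def by (simp add: algebra_simps)
      have z4: "of_nat n * (of_nat n - 1) * 1 + of_nat n * (q1 + 2 * q2 * of_real x) + (r0 + r1 * of_real x)
        = - (\<i> * of_real \<sigma> * of_real (2 * x + d) + (2 * \<i> * of_real (m * \<sigma>) + of_real (- s)))
          + 4 * \<i> * of_real (- s * \<sigma>) * of_real (x + m + d / 2) - of_real lam"
        unfolding nn q1_def q2_def r0_def r1_def B_def by (simp add: algebra_simps)
      show ?thesis using it unfolding z1 z2 z3 z4 by (simp only: mult_zero_left add_0_right numeral_2_eq_2 add_Suc One_nat_def add_0)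
    qed
  qed
  have "\<forall>x>0. W j x = 0" if "j \<le> n" for j
    using that
  proof (induction "n - j" arbitrary: j)
    case 0
    then have "j = n" by simp
    then show ?case using neg.W_zero[OF disjI1] s by simp
  next
    case (Suc k)
    then have "\<forall>x>0. W (Suc j) x = 0" by auto
    then show ?case using W_Suc_zero[OF s, of j] by blast
  qed
  then show ?thesis using x by blast
qed

end

lemma symb_cnj:
  assumes "symb n N h"
  shows "symb n N (\<lambda>x. cnj (h x))"
  using assms
proof (induction n arbitrary: N h)
  case (Suc n)
  then obtain h' where h': "\<And>x. x > 1 \<Longrightarrow> (h has_vector_derivative h' x) (at x)" "symb n (N - 1) h'" by auto
  have "symb n (N - 1) (\<lambda>x. cnj (h' x))" by (rule Suc.IH[OF h'(2)])
  moreover have "((\<lambda>x. cnj (h x)) has_vector_derivative cnj (h' x)) (at x)" if "x > 1" for x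
    by (rule has_vector_derivative_cnj[OF h'(1)[OF that]])
  moreover have "\<exists>C. \<forall>x>1. norm (cnj (h x)) \<le> C * x powr N" using Suc.prems by simp
  ultimately show ?case unfolding symb.simps by (intro conjI exI[of _ "\<lambda>x. cnj (h' x)"] allI impI)
qed auto

text \<open>Negative \<sigma> is reduced to the positive case by complex conjugation, which reverses
  \<sigma> and \<kappa> and keeps the real parameters \<open>s\<close> and
  \<open>lam\<close>.\<close>

theorem radial_mode_stability:
  fixes m d \<sigma> s \<kappa> lam N0 :: real and H :: "real \<Rightarrow> complex" and W :: "nat \<Rightarrow> real \<Rightarrow> complex"
    and P :: "real \<Rightarrow> complex"
  assumes P: "\<And>x. P x = (\<i> * of_real \<kappa> + of_real (s * d / 2)) + (\<i> * of_real (\<sigma> * d) + (2 * \<i> * of_real (m * \<sigma>) + of_real s)) * of_real x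
      + \<i> * of_real \<sigma> * of_real x ^ 2"
    and "m > 0" "d \<ge> 0" "\<sigma> \<noteq> 0"
    and H: "\<And>x. x > 0 \<Longrightarrow> (H has_vector_derivative P x / of_real (x * (x + d))) (at x)"
    and W: "\<And>j x. x > 0 \<Longrightarrow> (W j has_vector_derivative W (Suc j) x) (at x)"
    and ode: "\<And>x. x > 0 \<Longrightarrow>
      of_real (x * (x + d)) * W 2 x + (of_real (2 * x + d) - 2 * P x) * W 1 x
      + (- (\<i> * of_real \<sigma> * of_real (2 * x + d) + (2 * \<i> * of_real (m * \<sigma>) + of_real s))
          + 4 * \<i> * of_real (s * \<sigma>) * of_real (x + m + d / 2) - of_real lam) * W 0 x = 0"
    and W_bdd: "\<And>j. \<exists>C. \<forall>x. 0 < x \<longrightarrow> x \<le> 1 \<longrightarrow> norm (W j x) \<le> C"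
    and w_symb: "\<And>n. symb n N0 (\<lambda>x. exp (- 2 * H x) * W 0 x)"
    and x: "x > 0"
  shows "W 0 x = 0"
proof -
  have main: "W 0 x = 0"
    if \<sigma>: "\<sigma> > 0"
    and H: "\<And>x. x > 0 \<Longrightarrow> (H has_vector_derivative ((\<i> * of_real \<kappa> + of_real (s * d / 2)) + (\<i> * of_real (\<sigma> * d) + (2 * \<i> * of_real (m * \<sigma>) + of_real s)) * of_real x
      + \<i> * of_real \<sigma> * of_real x ^ 2) / of_real (x * (x + d))) (at x)"
    and W: "\<And>j x. x > 0 \<Longrightarrow> (W j has_vector_derivative W (Suc j) x) (at x)"
    and ode: "\<And>x. x > 0 \<Longrightarrow>
      of_real (x * (x + d)) * W 2 x + (of_real (2 * x + d) - 2 * ((\<i> * of_real \<kappa> + of_real (s * d / 2)) + (\<i> * of_real (\<sigma> * d) + (2 * \<i> * of_real (m * \<sigma>) + of_real s)) * of_real x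
      + \<i> * of_real \<sigma> * of_real x ^ 2)) * W 1 x
      + (- (\<i> * of_real \<sigma> * of_real (2 * x + d) + (2 * \<i> * of_real (m * \<sigma>) + of_real s))
          + 4 * \<i> * of_real (s * \<sigma>) * of_real (x + m + d / 2) - of_real lam) * W 0 x = 0"
    and W_bdd: "\<And>j. \<exists>C. \<forall>x. 0 < x \<longrightarrow> x \<le> 1 \<longrightarrow> norm (W j x) \<le> C"
    and w_symb: "\<And>n. symb n N0 (\<lambda>x. exp (- 2 * H x) * W 0 x)"
    for \<sigma> \<kappa> H W
  proof -
    interpret radial_mode m d \<sigma> s \<kappa> lam N0 H W
    "\<lambda>x. (\<i> * of_real \<kappa> + of_real (s * d / 2)) + (\<i> * of_real (\<sigma> * d) + (2 * \<i> * of_real (m * \<sigma>) + of_real s)) * of_real x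
    + \<i> * of_real \<sigma> * of_real x ^ 2"
    by unfold_locales (rule assms(2) assms(3) \<sigma> W_bdd w_symb | erule H | erule W | erule ode)+
    show ?thesis
    proof (cases "s \<le> 0 \<or> (\<forall>n::nat. 2 * s \<noteq> real n)")
      case True
      then show ?thesis by (rule W_zero[OF _ x])
    next
      case False
      then obtain n :: nat where "s > 0" "2 * s = real n" by auto
      then show ?thesis using W_zero_halfinteger x by auto
    qed
  qed
  show ?thesis
  proof (cases "\<sigma> > 0")
    case True
    show ?thesis
      by (rule main[OF True, where H = H and W = W and \<kappa> = \<kappa>])
        (fact H[unfolded P], fact W, fact ode[unfolded P], fact W_bdd, fact w_symb)
  next
    case False
    then have \<sigma>: "- \<sigma> > 0" using \<open>\<sigma> \<noteq> 0\<close> by simp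
    have Pc: "cnj (P x) = (\<i> * of_real (- \<kappa>) + of_real (s * d / 2)) + (\<i> * of_real (- \<sigma> * d) + (2 * \<i> * of_real (m * - \<sigma>) + of_real s)) * of_real x
      + \<i> * of_real (- \<sigma>) * of_real x ^ 2" for x
      unfolding P by simp
    have "cnj (W 0 x) = 0"
    proof (rule main[OF \<sigma>, where \<kappa> = "- \<kappa>" and H = "\<lambda>x. cnj (H x)" and W = "\<lambda>j x. cnj (W j x)"], unfold Pc[symmetric])
      fix x :: real assume x: "x > 0"
      show "((\<lambda>x. cnj (H x)) has_vector_derivative cnj (P x) / of_real (x * (x + d))) (at x)"
        using has_vector_derivative_cnj[OF H[OF x]] by simp
      show "((\<lambda>x. cnj (W j x)) has_vector_derivative cnj (W (Suc j) x)) (at x)" for j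
        by (rule has_vector_derivative_cnj[OF W[OF x]])
      show "of_real (x * (x + d)) * cnj (W 2 x) + (of_real (2 * x + d) - 2 * cnj (P x)) * cnj (W 1 x)
        + (- (\<i> * of_real (- \<sigma>) * of_real (2 * x + d) + (2 * \<i> * of_real (m * - \<sigma>) + of_real s))
          + 4 * \<i> * of_real (s * - \<sigma>) * of_real (x + m + d / 2) - of_real lam) * cnj (W 0 x) = 0"
        using arg_cong[OF ode[OF x], of cnj] by (simp add: algebra_simps)
    next
      show "\<exists>C. \<forall>x. 0 < x \<longrightarrow> x \<le> 1 \<longrightarrow> norm (cnj (W j x)) \<le> C" for j using W_bdd by simp
      show "symb n N0 (\<lambda>x. exp (- 2 * cnj (H x)) * cnj (W 0 x))" for n
        using symb_cnj[OF w_symb[of n]] by (simp add: exp_cnj)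
    qed
    then show ?thesis by simp
  qed
qed

section \<open>The angular operator\<close>

type_synonym angular_tuple = "(real \<Rightarrow> complex) \<times> (real \<Rightarrow> complex) \<times> (real \<Rightarrow> complex) \<times> (real \<Rightarrow> complex)"

text \<open>The last component is the image of \<psi> under the angular operator, and the equation
  is multiplied by sin \<theta>. It is imposed between the poles because \<open>V\<close> may be
  singular there; differentiability on all of the real line and continuity of \<open>h\<close> up to
  the poles take the place of a boundary condition.\<close>

definition angular_solution :: "(real \<Rightarrow> real) \<Rightarrow> angular_tuple \<Rightarrow> bool" where
  "angular_solution V = (\<lambda>(\<psi>, \<psi>1, \<psi>2, h).
     (\<forall>\<theta>. (\<psi> has_vector_derivative \<psi>1 \<theta>) (at \<theta>)) \<and> (\<forall>\<theta>. (\<psi>1 has_vector_derivative \<psi>2 \<theta>) (at \<theta>)) \<and>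
     continuous_on {0..pi} h \<and>
     (\<forall>\<theta>\<in>{0<..<pi}. of_real (sin \<theta>) * \<psi>2 \<theta> + of_real (cos \<theta>) * \<psi>1 \<theta> = of_real (sin \<theta>) * (of_real (V \<theta>) * \<psi> \<theta> - h \<theta>)))"

text \<open>The complex span, with the graph of the operator carried along, so that the image of a
  combination need not be recomputed. The inductive form lets linear statements be proved by rule
  induction.\<close>

inductive_set linear_combinations :: "angular_tuple set \<Rightarrow> angular_tuple set" for A where
  base: "p \<in> A \<Longrightarrow> p \<in> linear_combinations A"
| scale: "(\<psi>, \<psi>1, \<psi>2, h) \<in> linear_combinations A \<Longrightarrow>
    (\<lambda>\<theta>. c * \<psi> \<theta>, \<lambda>\<theta>. c * \<psi>1 \<theta>, \<lambda>\<theta>. c * \<psi>2 \<theta>, \<lambda>\<theta>. c * h \<theta>) \<in> linear_combinations A"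
| add: "(\<psi>, \<psi>1, \<psi>2, h) \<in> linear_combinations A \<Longrightarrow> (\<phi>, \<phi>1, \<phi>2, g) \<in> linear_combinations A \<Longrightarrow>
    (\<lambda>\<theta>. \<psi> \<theta> + \<phi> \<theta>, \<lambda>\<theta>. \<psi>1 \<theta> + \<phi>1 \<theta>, \<lambda>\<theta>. \<psi>2 \<theta> + \<phi>2 \<theta>, \<lambda>\<theta>. h \<theta> + g \<theta>) \<in> linear_combinations A"

lemma angular_solution_linear_combinations:
  assumes "\<And>p. p \<in> A \<Longrightarrow> angular_solution V p" "p \<in> linear_combinations A"
  shows "angular_solution V p"
  using assms(2)
proof induction
  case (scale \<psi> \<psi>1 \<psi>2 h c)
  have "of_real (sin \<theta>) * (c * \<psi>2 \<theta>) + of_real (cos \<theta>) * (c * \<psi>1 \<theta>) = of_real (sin \<theta>) * (of_real (V \<theta>) * (c * \<psi> \<theta>) - c * h \<theta>)"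
    if "\<theta> \<in> {0<..<pi}" for \<theta>
  proof -
    have "of_real (sin \<theta>) * \<psi>2 \<theta> + of_real (cos \<theta>) * \<psi>1 \<theta> = of_real (sin \<theta>) * (of_real (V \<theta>) * \<psi> \<theta> - h \<theta>)"
      using scale.IH that by (auto simp: angular_solution_def)
    from arg_cong[OF this, of "\<lambda>x. c * x"] show ?thesis by (simp add: algebra_simps)
  qed
  then show ?case using scale.IH
    by (auto simp: angular_solution_def intro: has_vector_derivative_mult_right continuous_intros)
next
  case (add \<psi> \<psi>1 \<psi>2 h \<phi> \<phi>1 \<phi>2 g)
  have "of_real (sin \<theta>) * (\<psi>2 \<theta> + \<phi>2 \<theta>) + of_real (cos \<theta>) * (\<psi>1 \<theta> + \<phi>1 \<theta>) = of_real (sin \<theta>) * (of_real (V \<theta>) * (\<psi> \<theta> + \<phi> \<theta>) - (h \<theta> + g \<theta>))"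
    if "\<theta> \<in> {0<..<pi}" for \<theta>
  proof -
    have 1: "of_real (sin \<theta>) * \<psi>2 \<theta> + of_real (cos \<theta>) * \<psi>1 \<theta> = of_real (sin \<theta>) * (of_real (V \<theta>) * \<psi> \<theta> - h \<theta>)"
      using add.IH that by (auto simp: angular_solution_def)
    have 2: "of_real (sin \<theta>) * \<phi>2 \<theta> + of_real (cos \<theta>) * \<phi>1 \<theta> = of_real (sin \<theta>) * (of_real (V \<theta>) * \<phi> \<theta> - g \<theta>)"
      using add.IH that by (auto simp: angular_solution_def)
    from arg_cong2[OF 1 2, of "(+)"] show ?thesis by (simp add: algebra_simps)
  qed
  then show ?case using add.IH
    by (auto simp: angular_solution_def intro: has_vector_derivative_add continuous_intros)
qed (use assms in auto)

lemma angular_solution_continuous: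
  assumes "angular_solution V (\<psi>, \<psi>1, \<psi>2, h)"
  shows "continuous_on S \<psi>" "continuous_on S \<psi>1" "continuous_on {0..pi} h"
proof -
  have "(\<psi> has_vector_derivative \<psi>1 \<theta>) (at \<theta>)" "(\<psi>1 has_vector_derivative \<psi>2 \<theta>) (at \<theta>)" for \<theta>
    using assms by (auto simp: angular_solution_def)
  then show "continuous_on S \<psi>" "continuous_on S \<psi>1"
    by (auto intro!: continuous_on_vector_derivative intro: has_vector_derivative_at_within)
  show "continuous_on {0..pi} h" using assms by (simp add: angular_solution_def)
qed

text \<open>Lagrange's identity. The boundary term contains the factor sin \<theta> and continuous
  functions, hence vanishes at both poles.\<close>

lemma angular_symmetry:
  assumes p: "angular_solution V (\<psi>, \<psi>1, \<psi>2, h)" and q: "angular_solution V (\<phi>, \<phi>1, \<phi>2, g)"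
  shows "integral {0..pi} (\<lambda>\<theta>. of_real (sin \<theta>) * (cnj (\<psi> \<theta>) * g \<theta>)) = integral {0..pi} (\<lambda>\<theta>. of_real (sin \<theta>) * (cnj (h \<theta>) * \<phi> \<theta>))"
proof -
  define B where "B \<theta> = of_real (sin \<theta>) * (cnj (\<psi> \<theta>) * \<phi>1 \<theta> - cnj (\<psi>1 \<theta>) * \<phi> \<theta>)" for \<theta>
  note pc = angular_solution_continuous[OF p] and qc = angular_solution_continuous[OF q]
  have d: "(\<psi> has_vector_derivative \<psi>1 \<theta>) (at \<theta>)" "(\<psi>1 has_vector_derivative \<psi>2 \<theta>) (at \<theta>)"
    "(\<phi> has_vector_derivative \<phi>1 \<theta>) (at \<theta>)" "(\<phi>1 has_vector_derivative \<phi>2 \<theta>) (at \<theta>)" for \<theta>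
    using p q by (auto simp: angular_solution_def)
  have sd: "((\<lambda>\<theta>. of_real (sin \<theta>) :: complex) has_vector_derivative of_real (cos \<theta>)) (at \<theta>)" for \<theta>
    by (rule has_vector_derivative_of_real) (auto intro!: derivative_eq_intros)
  have "((\<lambda>\<theta>. of_real (sin \<theta>) * (cnj (h \<theta>) * \<phi> \<theta>) - of_real (sin \<theta>) * (cnj (\<psi> \<theta>) * g \<theta>)) has_integral (B pi - B 0)) {0..pi}"
  proof (rule fundamental_theorem_of_calculus_interior)
    show "continuous_on {0..pi} B" unfolding B_def by (intro continuous_intros pc qc)
    fix \<theta> assume th: "\<theta> \<in> {0<..<pi}"
    have e1: "of_real (sin \<theta>) * \<psi>2 \<theta> + of_real (cos \<theta>) * \<psi>1 \<theta> = of_real (sin \<theta>) * (of_real (V \<theta>) * \<psi> \<theta> - h \<theta>)"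
      using p th by (auto simp: angular_solution_def)
    have e2: "of_real (sin \<theta>) * \<phi>2 \<theta> + of_real (cos \<theta>) * \<phi>1 \<theta> = of_real (sin \<theta>) * (of_real (V \<theta>) * \<phi> \<theta> - g \<theta>)"
      using q th by (auto simp: angular_solution_def)
    have e1': "of_real (sin \<theta>) * cnj (\<psi>2 \<theta>) + of_real (cos \<theta>) * cnj (\<psi>1 \<theta>) = of_real (sin \<theta>) * (of_real (V \<theta>) * cnj (\<psi> \<theta>) - cnj (h \<theta>))"
      using arg_cong[OF e1, of cnj] by simp
    have "(B has_vector_derivative of_real (sin \<theta>) * ((cnj (\<psi> \<theta>) * \<phi>2 \<theta> + cnj (\<psi>1 \<theta>) * \<phi>1 \<theta>) - (cnj (\<psi>1 \<theta>) * \<phi>1 \<theta> + cnj (\<psi>2 \<theta>) * \<phi> \<theta>))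
        + of_real (cos \<theta>) * (cnj (\<psi> \<theta>) * \<phi>1 \<theta> - cnj (\<psi>1 \<theta>) * \<phi> \<theta>)) (at \<theta>)" (is "(B has_vector_derivative ?D) _")
      unfolding B_def by (intro has_vector_derivative_mult has_vector_derivative_diff has_vector_derivative_cnj d sd)
    moreover have "?D = cnj (\<psi> \<theta>) * (of_real (sin \<theta>) * \<phi>2 \<theta> + of_real (cos \<theta>) * \<phi>1 \<theta>) - (of_real (sin \<theta>) * cnj (\<psi>2 \<theta>) + of_real (cos \<theta>) * cnj (\<psi>1 \<theta>)) * \<phi> \<theta>"
      by (simp add: algebra_simps)
    moreover have "\<dots> = of_real (sin \<theta>) * (cnj (h \<theta>) * \<phi> \<theta>) - of_real (sin \<theta>) * (cnj (\<psi> \<theta>) * g \<theta>)"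
      unfolding e1' e2 by (simp add: algebra_simps)
    ultimately show "(B has_vector_derivative of_real (sin \<theta>) * (cnj (h \<theta>) * \<phi> \<theta>) - of_real (sin \<theta>) * (cnj (\<psi> \<theta>) * g \<theta>)) (at \<theta>)" by simp
  qed simp
  moreover have "B pi - B 0 = 0" by (simp add: B_def)
  ultimately have "integral {0..pi} (\<lambda>\<theta>. of_real (sin \<theta>) * (cnj (h \<theta>) * \<phi> \<theta>) - of_real (sin \<theta>) * (cnj (\<psi> \<theta>) * g \<theta>)) = 0"
    by (simp add: integral_unique)
  moreover have "integral {0..pi} (\<lambda>\<theta>. of_real (sin \<theta>) * (cnj (h \<theta>) * \<phi> \<theta>) - of_real (sin \<theta>) * (cnj (\<psi> \<theta>) * g \<theta>))
      = integral {0..pi} (\<lambda>\<theta>. of_real (sin \<theta>) * (cnj (h \<theta>) * \<phi> \<theta>)) - integral {0..pi} (\<lambda>\<theta>. of_real (sin \<theta>) * (cnj (\<psi> \<theta>) * g \<theta>))"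
    by (intro Henstock_Kurzweil_Integration.integral_diff integrable_continuous_real continuous_intros pc qc)
  ultimately show ?thesis by simp
qed

text \<open>Integrates the derivative of sin \<theta> times the real inner product of \<psi> and
  \<psi>'. Replacing \<open>V\<close> by its lower bound only inside the interval is enough, since
  sin \<theta> vanishes at the ends.\<close>

lemma angular_energy:
  assumes p: "angular_solution V (\<psi>, \<psi>1, \<psi>2, h)" and V: "\<And>\<theta>. \<theta> \<in> {0<..<pi} \<Longrightarrow> V \<theta> \<ge> - L"
  shows "integral {0..pi} (\<lambda>\<theta>. sin \<theta> * (norm (\<psi>1 \<theta>))\<^sup>2) \<le> integral {0..pi} (\<lambda>\<theta>. sin \<theta> * Re (cnj (\<psi> \<theta>) * h \<theta>))
    + L * integral {0..pi} (\<lambda>\<theta>. sin \<theta> * (norm (\<psi> \<theta>))\<^sup>2)"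
proof -
  note pc = angular_solution_continuous[OF p]
  define G where "G \<theta> = sin \<theta> * (\<psi> \<theta> \<bullet> \<psi>1 \<theta>)" for \<theta>
  have ir: "x \<bullet> (of_real c * y) = c * (x \<bullet> y)" for x y :: complex and c
    by (simp add: inner_complex_def algebra_simps)
  have d: "(\<psi> has_vector_derivative \<psi>1 \<theta>) (at \<theta>)" "(\<psi>1 has_vector_derivative \<psi>2 \<theta>) (at \<theta>)" for \<theta>
    using p by (auto simp: angular_solution_def)
  have in1: "((\<lambda>\<theta>. sin \<theta> * (norm (\<psi>1 \<theta>))\<^sup>2 + sin \<theta> * (V \<theta> * (norm (\<psi> \<theta>))\<^sup>2) - sin \<theta> * Re (cnj (\<psi> \<theta>) * h \<theta>)) has_integral (G pi - G 0)) {0..pi}"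
  proof (rule fundamental_theorem_of_calculus_interior)
    show "continuous_on {0..pi} G" unfolding G_def by (intro continuous_intros pc)
    fix \<theta> assume th: "\<theta> \<in> {0<..<pi}"
    have e1: "of_real (sin \<theta>) * \<psi>2 \<theta> + of_real (cos \<theta>) * \<psi>1 \<theta> = of_real (sin \<theta>) * (of_real (V \<theta>) * \<psi> \<theta> - h \<theta>)"
      using p th by (auto simp: angular_solution_def)
    have D1: "(G has_real_derivative sin \<theta> * (\<psi> \<theta> \<bullet> \<psi>2 \<theta> + \<psi>1 \<theta> \<bullet> \<psi>1 \<theta>) + cos \<theta> * (\<psi> \<theta> \<bullet> \<psi>1 \<theta>)) (at \<theta>)"
      unfolding G_def by (rule DERIV_mult'[OF DERIV_sin has_real_derivative_inner[OF d]])
    have E1: "sin \<theta> * (\<psi> \<theta> \<bullet> \<psi>2 \<theta> + \<psi>1 \<theta> \<bullet> \<psi>1 \<theta>) + cos \<theta> * (\<psi> \<theta> \<bullet> \<psi>1 \<theta>)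
      = sin \<theta> * (norm (\<psi>1 \<theta>))\<^sup>2 + \<psi> \<theta> \<bullet> (of_real (sin \<theta>) * \<psi>2 \<theta> + of_real (cos \<theta>) * \<psi>1 \<theta>)"
      unfolding power2_norm_eq_inner inner_add_right ir by (simp add: algebra_simps)
    have E2: "\<psi> \<theta> \<bullet> (of_real (sin \<theta>) * (of_real (V \<theta>) * \<psi> \<theta> - h \<theta>)) = sin \<theta> * (V \<theta> * (norm (\<psi> \<theta>))\<^sup>2) - sin \<theta> * Re (cnj (\<psi> \<theta>) * h \<theta>)"
      unfolding power2_norm_eq_inner ir inner_diff_right ir by (simp add: inner_complex_def algebra_simps)
    show "(G has_vector_derivative sin \<theta> * (norm (\<psi>1 \<theta>))\<^sup>2 + sin \<theta> * (V \<theta> * (norm (\<psi> \<theta>))\<^sup>2) - sin \<theta> * Re (cnj (\<psi> \<theta>) * h \<theta>)) (at \<theta>)"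
      using D1[unfolded E1[unfolded e1 E2]] unfolding has_real_derivative_iff_has_vector_derivative add_diff_eq .
  qed simp
  have c: "continuous_on {0..pi} (\<lambda>\<theta>. sin \<theta> * (norm (\<psi>1 \<theta>))\<^sup>2)" "continuous_on {0..pi} (\<lambda>\<theta>. sin \<theta> * (norm (\<psi> \<theta>))\<^sup>2)"
    "continuous_on {0..pi} (\<lambda>\<theta>. sin \<theta> * Re (cnj (\<psi> \<theta>) * h \<theta>))"
    by (intro continuous_intros pc)+
  note i = c[THEN integrable_continuous_real, THEN integrable_integral]
  have in2: "((\<lambda>\<theta>. sin \<theta> * (norm (\<psi>1 \<theta>))\<^sup>2 + (- L) * (sin \<theta> * (norm (\<psi> \<theta>))\<^sup>2) - sin \<theta> * Re (cnj (\<psi> \<theta>) * h \<theta>)) has_integral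
      (integral {0..pi} (\<lambda>\<theta>. sin \<theta> * (norm (\<psi>1 \<theta>))\<^sup>2) + (- L) * integral {0..pi} (\<lambda>\<theta>. sin \<theta> * (norm (\<psi> \<theta>))\<^sup>2)
        - integral {0..pi} (\<lambda>\<theta>. sin \<theta> * Re (cnj (\<psi> \<theta>) * h \<theta>)))) {0..pi}"
    by (intro has_integral_diff has_integral_add has_integral_mult_right i)
  have "integral {0..pi} (\<lambda>\<theta>. sin \<theta> * (norm (\<psi>1 \<theta>))\<^sup>2) + (- L) * integral {0..pi} (\<lambda>\<theta>. sin \<theta> * (norm (\<psi> \<theta>))\<^sup>2)
        - integral {0..pi} (\<lambda>\<theta>. sin \<theta> * Re (cnj (\<psi> \<theta>) * h \<theta>)) \<le> G pi - G 0"
  proof (rule has_integral_le[OF in2 in1])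
    fix \<theta> :: real assume th: "\<theta> \<in> {0..pi}"
    have "(- L) * (sin \<theta> * (norm (\<psi> \<theta>))\<^sup>2) \<le> sin \<theta> * (V \<theta> * (norm (\<psi> \<theta>))\<^sup>2)"
    proof (cases "\<theta> \<in> {0<..<pi}")
      case True
      then have "sin \<theta> \<ge> 0" by (intro sin_ge_zero) auto
      then have "(- L) * (sin \<theta> * (norm (\<psi> \<theta>))\<^sup>2) \<le> V \<theta> * (sin \<theta> * (norm (\<psi> \<theta>))\<^sup>2)"
        using V[OF True] by (intro mult_right_mono) auto
      then show ?thesis by (simp add: mult_ac)
    next
      case False
      then have "\<theta> = 0 \<or> \<theta> = pi" using th by auto
      then show ?thesis by auto
    qed
    then show "sin \<theta> * (norm (\<psi>1 \<theta>))\<^sup>2 + (- L) * (sin \<theta> * (norm (\<psi> \<theta>))\<^sup>2) - sin \<theta> * Re (cnj (\<psi> \<theta>) * h \<theta>)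
      \<le> sin \<theta> * (norm (\<psi>1 \<theta>))\<^sup>2 + sin \<theta> * (V \<theta> * (norm (\<psi> \<theta>))\<^sup>2) - sin \<theta> * Re (cnj (\<psi> \<theta>) * h \<theta>)" by simp
  qed
  moreover have "G pi - G 0 = 0" by (simp add: G_def)
  ultimately show ?thesis by simp
qed

section \<open>Compactness from the weighted energy\<close>

definition "lnt \<theta> = ln (tan (\<theta> / 2))"

lemma lnt_deriv:
  assumes "\<theta> \<in> {0<..<pi}"
  shows "(lnt has_real_derivative 1 / sin \<theta>) (at \<theta>)"
proof -
  have h: "sin (\<theta> / 2) > 0" "cos (\<theta> / 2) > 0" using assms by (auto intro!: sin_gt_zero cos_gt_zero)
  have "((\<lambda>\<theta>. ln (sin (\<theta> / 2)) - ln (cos (\<theta> / 2))) has_real_derivative (cos (\<theta> / 2) * (1 / 2)) / sin (\<theta> / 2) - (- sin (\<theta> / 2) * (1 / 2)) / cos (\<theta> / 2)) (at \<theta>)"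
    using h by (auto intro!: derivative_eq_intros)
  moreover have "(cos (\<theta> / 2) * (1 / 2)) / sin (\<theta> / 2) - (- sin (\<theta> / 2) * (1 / 2)) / cos (\<theta> / 2) = 1 / sin \<theta>"
  proof -
    have "sin \<theta> = 2 * sin (\<theta> / 2) * cos (\<theta> / 2)" using sin_double[of "\<theta> / 2"] by simp
    moreover have "(cos (\<theta> / 2) * (1 / 2)) / sin (\<theta> / 2) - (- sin (\<theta> / 2) * (1 / 2)) / cos (\<theta> / 2)
       = ((sin (\<theta> / 2))\<^sup>2 + (cos (\<theta> / 2))\<^sup>2) / (2 * sin (\<theta> / 2) * cos (\<theta> / 2))"
      using h by (simp add: field_simps power2_eq_square)
    ultimately show ?thesis by simp
  qed
  ultimately have "((\<lambda>\<theta>. ln (sin (\<theta> / 2)) - ln (cos (\<theta> / 2))) has_real_derivative 1 / sin \<theta>) (at \<theta>)" by simp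
  then show ?thesis
  proof (rule has_field_derivative_transform_within_open)
    show "open {0<..<pi}" "\<theta> \<in> {0<..<pi}" using assms by auto
    fix x :: real assume "x \<in> {0<..<pi}"
    then have "sin (x / 2) > 0" "cos (x / 2) > 0" by (auto intro!: sin_gt_zero cos_gt_zero)
    then show "ln (sin (x / 2)) - ln (cos (x / 2)) = lnt x" by (simp add: lnt_def tan_def ln_div)
  qed
qed

text \<open>The logarithmic singularity at the poles is traded for the power 1/4. Any exponent below
  1/2 would do: after multiplication by the square root of sin \<theta> the bound must still tend to
  0 at the poles.\<close>

lemma lnt_bound:
  assumes "\<theta> \<in> {0<..<pi}"
  shows "\<bar>lnt \<theta>\<bar> \<le> 4 * (2 / sin \<theta>) powr (1/4)"
proof -
  have h: "sin (\<theta> / 2) > 0" "cos (\<theta> / 2) > 0" using assms by (auto intro!: sin_gt_zero cos_gt_zero)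
  have s0: "sin \<theta> > 0" using assms by (auto intro!: sin_gt_zero)
  have sd: "sin \<theta> = 2 * sin (\<theta> / 2) * cos (\<theta> / 2)" using sin_double[of "\<theta> / 2"] by simp
  have "sin \<theta> / 2 \<le> tan (\<theta> / 2)"
  proof -
    have "(cos (\<theta> / 2))\<^sup>2 \<le> 1\<^sup>2" using h by (intro power_mono) auto
    then have "sin (\<theta> / 2) * (cos (\<theta> / 2))\<^sup>2 \<le> sin (\<theta> / 2) * 1" using h by (intro mult_left_mono) auto
    then show ?thesis using h unfolding sd tan_def by (simp add: field_simps power2_eq_square)
  qed
  moreover have "tan (\<theta> / 2) \<le> 2 / sin \<theta>"
  proof -
    have "(sin (\<theta> / 2))\<^sup>2 \<le> 1\<^sup>2" using h by (intro power_mono) auto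
    then show ?thesis using h unfolding sd tan_def by (simp add: field_simps power2_eq_square)
  qed
  moreover have t0: "tan (\<theta> / 2) > 0" using h by (simp add: tan_def)
  ultimately have "ln (sin \<theta> / 2) \<le> lnt \<theta>" "lnt \<theta> \<le> ln (2 / sin \<theta>)" unfolding lnt_def using s0 by auto
  then have "\<bar>lnt \<theta>\<bar> \<le> ln (2 / sin \<theta>)" using s0 by (simp add: ln_div)
  also have "ln (2 / sin \<theta>) = 4 * ln ((2 / sin \<theta>) powr (1/4))" using s0 by (simp add: ln_powr)
  also have "\<dots> \<le> 4 * (2 / sin \<theta>) powr (1/4)"
    using ln_le_minus_one[of "(2 / sin \<theta>) powr (1/4)"] s0 by simp
  finally show ?thesis .
qed

text \<open>Young's inequality splits |\<psi>'| into e sin \<theta> |\<psi>'|^2 and 1 / (e sin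
  \<theta>), and the latter has primitive \<open>lnt\<close>. The free parameter \<open>e\<close>
  replaces the square root of Cauchy-Schwarz: the first term is made small by \<open>e\<close>, the
  second by closeness of the points.\<close>

lemma angular_holder:
  fixes \<psi> \<psi>1 :: "real \<Rightarrow> complex"
  assumes d: "\<And>\<theta>. (\<psi> has_vector_derivative \<psi>1 \<theta>) (at \<theta>)" and c: "continuous_on {0..pi} \<psi>1"
    and M: "integral {0..pi} (\<lambda>\<theta>. sin \<theta> * (norm (\<psi>1 \<theta>))\<^sup>2) \<le> M" and e: "e > 0"
    and ab: "x \<in> {0<..<pi}" "y \<in> {0<..<pi}"
  shows "norm (\<psi> x - \<psi> y) \<le> e * M + \<bar>lnt x - lnt y\<bar> / e"
proof -
  have main: "norm (\<psi> b - \<psi> a) \<le> e * M + \<bar>lnt b - lnt a\<bar> / e" if ab: "0 < a" "a \<le> b" "b < pi" for a b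
  proof -
    have sub: "{a..b} \<subseteq> {0..pi}" using ab by auto
    have i1: "(\<psi>1 has_integral (\<psi> b - \<psi> a)) {a..b}"
      by (rule fundamental_theorem_of_calculus[OF ab(2)]) (rule has_vector_derivative_at_within[OF d])
    have i2: "((\<lambda>\<theta>. 1 / sin \<theta>) has_integral (lnt b - lnt a)) {a..b}"
    proof (rule fundamental_theorem_of_calculus[OF ab(2)])
      fix x assume "x \<in> {a..b}"
      then have x: "x \<in> {0<..<pi}" using ab by auto
      show "(lnt has_vector_derivative 1 / sin x) (at x within {a..b})"
        unfolding has_real_derivative_iff_has_vector_derivative[symmetric]
        by (rule has_field_derivative_at_within[OF lnt_deriv[OF x]])
    qed
    have cq: "continuous_on {0..pi} (\<lambda>\<theta>. sin \<theta> * (norm (\<psi>1 \<theta>))\<^sup>2)" by (intro continuous_intros c)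
    have i3: "(\<lambda>\<theta>. sin \<theta> * (norm (\<psi>1 \<theta>))\<^sup>2) integrable_on {a..b}"
      by (rule integrable_continuous_real[OF continuous_on_subset[OF cq sub]])
    have le3: "integral {a..b} (\<lambda>\<theta>. sin \<theta> * (norm (\<psi>1 \<theta>))\<^sup>2) \<le> M"
    proof (rule order_trans[OF _ M])
      show "integral {a..b} (\<lambda>\<theta>. sin \<theta> * (norm (\<psi>1 \<theta>))\<^sup>2) \<le> integral {0..pi} (\<lambda>\<theta>. sin \<theta> * (norm (\<psi>1 \<theta>))\<^sup>2)"
        by (rule integral_subset_le[OF sub i3 integrable_continuous_real[OF cq]]) (auto intro!: mult_nonneg_nonneg sin_ge_zero)
    qed
    have "norm (integral {a..b} \<psi>1) \<le> integral {a..b} (\<lambda>\<theta>. e * (sin \<theta> * (norm (\<psi>1 \<theta>))\<^sup>2) + (1 / sin \<theta>) * (1 / e))"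
    proof (rule integral_norm_bound_integral)
      show "\<psi>1 integrable_on {a..b}" using i1 by blast
      show "(\<lambda>\<theta>. e * (sin \<theta> * (norm (\<psi>1 \<theta>))\<^sup>2) + (1 / sin \<theta>) * (1 / e)) integrable_on {a..b}"
        using i2 by (intro integrable_add integrable_on_mult_right integrable_on_mult_left i3) blast
      fix x assume "x \<in> {a..b}"
      then have s: "sin x > 0" using ab by (intro sin_gt_zero) auto
      define n where "n = norm (\<psi>1 x)"
      have "0 \<le> (e * sin x * n - 1 / 2)\<^sup>2" by simp
      then have "e * sin x * n \<le> (e * sin x * n)\<^sup>2 + 1 / 4" by (simp add: power2_diff power_divide)
      then have "n * (e * sin x) \<le> (e * (sin x * n\<^sup>2) + 1 / sin x * (1 / e)) * (e * sin x)"
        using s e by (simp add: power2_eq_square algebra_simps)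
      then show "norm (\<psi>1 x) \<le> e * (sin x * (norm (\<psi>1 x))\<^sup>2) + 1 / sin x * (1 / e)"
        unfolding n_def by (rule mult_right_le_imp_le) (use s e in simp)
    qed
    also have "\<dots> = e * integral {a..b} (\<lambda>\<theta>. sin \<theta> * (norm (\<psi>1 \<theta>))\<^sup>2) + (lnt b - lnt a) * (1 / e)"
    proof (rule integral_unique)
      show "((\<lambda>\<theta>. e * (sin \<theta> * (norm (\<psi>1 \<theta>))\<^sup>2) + 1 / sin \<theta> * (1 / e)) has_integral
        e * integral {a..b} (\<lambda>\<theta>. sin \<theta> * (norm (\<psi>1 \<theta>))\<^sup>2) + (lnt b - lnt a) * (1 / e)) {a..b}"
        by (intro has_integral_add has_integral_mult_right has_integral_mult_left i2 integrable_integral i3)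
    qed
    also have "\<dots> \<le> e * M + \<bar>lnt b - lnt a\<bar> * (1 / e)"
      using le3 e by (intro add_mono mult_left_mono mult_right_mono) auto
    finally show ?thesis using i1 by (simp add: integral_unique)
  qed
  show ?thesis
  proof (cases "x \<le> y")
    case True
    then show ?thesis using main[of x y] ab by (simp add: norm_minus_commute abs_minus_commute)
  next
    case False
    then show ?thesis using main[of y x] ab by simp
  qed
qed

definition pairing :: "(real \<Rightarrow> complex) \<Rightarrow> (real \<Rightarrow> complex) \<Rightarrow> complex" where
  "pairing f g = integral {0..pi} (\<lambda>\<theta>. of_real (sin \<theta>) * (cnj (f \<theta>) * g \<theta>))"

lemma pairing_integrable:
  assumes "continuous_on {0..pi} f" "continuous_on {0..pi} g"
  shows "(\<lambda>\<theta>. of_real (sin \<theta>) * (cnj (f \<theta>) * g \<theta>)) integrable_on {0..pi}"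
  by (intro integrable_continuous_real continuous_intros assms)

lemma pairing_add_left:
  assumes "continuous_on {0..pi} f" "continuous_on {0..pi} g" "continuous_on {0..pi} k"
  shows "pairing (\<lambda>\<theta>. f \<theta> + c * g \<theta>) k = pairing f k + cnj c * pairing g k"
proof -
  note i = pairing_integrable[OF assms(1,3)] integrable_on_mult_right[OF pairing_integrable[OF assms(2,3)], of "cnj c"]
  show ?thesis unfolding pairing_def integral_mult_right[symmetric] Henstock_Kurzweil_Integration.integral_add[OF i, symmetric]
    by (simp add: algebra_simps)
qed

lemma pairing_add_right:
  assumes "continuous_on {0..pi} f" "continuous_on {0..pi} g" "continuous_on {0..pi} k"
  shows "pairing k (\<lambda>\<theta>. f \<theta> + c * g \<theta>) = pairing k f + c * pairing k g"
proof -
  note i = pairing_integrable[OF assms(3,1)] integrable_on_mult_right[OF pairing_integrable[OF assms(3,2)], of c]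
  show ?thesis unfolding pairing_def integral_mult_right[symmetric] Henstock_Kurzweil_Integration.integral_add[OF i, symmetric]
    by (simp add: algebra_simps)
qed

lemma pairing_scale: "pairing (\<lambda>\<theta>. c * f \<theta>) (\<lambda>\<theta>. c * g \<theta>) = (cnj c * c) * pairing f g"
  unfolding pairing_def integral_mult_right[symmetric] by (simp add: mult_ac)

lemma pairing_cnj: "cnj (pairing f g) = pairing g f"
  unfolding pairing_def by (subst integral_cnj) (simp add: mult_ac)

lemma Re_pairing:
  assumes "continuous_on {0..pi} f" "continuous_on {0..pi} g"
  shows "Re (pairing f g) = integral {0..pi} (\<lambda>\<theta>. sin \<theta> * Re (cnj (f \<theta>) * g \<theta>))"
  using integral_linear[OF pairing_integrable[OF assms] bounded_linear_Re] by (simp add: pairing_def o_def)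

lemma pairing_self:
  assumes "continuous_on {0..pi} f"
  shows "Re (pairing f f) = integral {0..pi} (\<lambda>\<theta>. sin \<theta> * (norm (f \<theta>))\<^sup>2)"
  unfolding Re_pairing[OF assms assms] cmod_power2 by (simp add: power2_eq_square)

lemma integral_mult_uniform_limit:
  fixes f g :: "nat \<Rightarrow> real \<Rightarrow> complex"
  assumes f: "\<And>n. continuous_on {a..b} (f n)" and g: "\<And>n. continuous_on {a..b} (g n)"
    and F: "uniform_limit {a..b} f F sequentially" and G: "uniform_limit {a..b} g G sequentially"
  shows "(\<lambda>n. integral {a..b} (\<lambda>x. f n x * g n x)) \<longlonglongrightarrow> integral {a..b} (\<lambda>x. F x * G x)"
proof -
  have c: "continuous_on {a..b} F" "continuous_on {a..b} G"
    using uniform_limit_theorem[OF _ F] uniform_limit_theorem[OF _ G] f g by auto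
  have "uniform_limit {a..b} (\<lambda>n x. f n x * g n x) (\<lambda>x. F x * G x) sequentially"
    by (intro uniform_lim_mult F G compact_imp_bounded compact_continuous_image c compact_Icc)
  then obtain I J where I: "\<And>n. ((\<lambda>x. f n x * g n x) has_integral I n) {a..b}" "((\<lambda>x. F x * G x) has_integral J) {a..b}" "I \<longlonglongrightarrow> J"
    by (rule uniform_limit_integral) (auto intro!: continuous_intros f g)
  from I(3) show ?thesis unfolding integral_unique[OF I(1)] integral_unique[OF I(2)] .
qed

lemma sin_ge_half:
  assumes "\<theta> \<in> {pi/6..5*pi/6}"
  shows "1 / 2 \<le> sin \<theta>"
proof (cases "\<theta> \<le> pi / 2")
  case True
  then show ?thesis using sin_monotone_2pi_le[of "pi/6" \<theta>] assms pi_gt_zero by (simp add: sin_30)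
next
  case False
  then show ?thesis using sin_monotone_2pi_le[of "pi/6" "pi - \<theta>"] assms pi_gt_zero by (simp add: sin_30)
qed

lemma sqrt_sin_powr_bound:
  assumes "0 < y" "y \<le> (1::real)" "B \<ge> 0"
  shows "sqrt y * (B + 4 * (2 / y) powr (1/4)) \<le> (B + 8) * sqrt (sqrt y)"
proof -
  have y: "sqrt (sqrt y) = y powr (1/4)" "sqrt y = y powr (1/2)" using assms by (simp_all add: powr_half_sqrt[symmetric] powr_powr)
  have "sqrt y * (2 / y) powr (1/4) = 2 powr (1/4) * (y powr (1/2) * y powr (- (1/4)))"
    using assms unfolding y by (simp add: powr_divide powr_minus_divide)
  also have "y powr (1/2) * y powr (- (1/4)) = y powr (1/4)" by (simp add: powr_add[symmetric])
  also have "2 powr (1/4) * y powr (1/4) \<le> 2 powr 1 * y powr (1/4)" by (intro mult_right_mono powr_mono) auto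
  finally have 1: "sqrt y * (2 / y) powr (1/4) \<le> 2 * sqrt (sqrt y)" unfolding y(1) by simp
  have "sqrt y \<le> sqrt (sqrt y)" unfolding y(1) unfolding y(2) using assms by (intro powr_mono') auto
  from mult_left_mono[OF this assms(3)] 1 show ?thesis by (simp add: algebra_simps)
qed

text \<open>\<open>X\<close> plays the role of a conjugated eigenfunction weighted by sin \<theta>,
  but it is only tested against the span of \<open>A\<close>; no equation for \<open>X\<close> is
  needed. The multiplier \<open>lam\<close> is the infimum of the Rayleigh quotient over the span,
  and \<open>X\<close> a limit of normalized almost minimizers.\<close>

lemma angular_eigenfunctional:
  fixes A :: "angular_tuple set"
  assumes sol: "\<And>p. p \<in> A \<Longrightarrow> angular_solution V p" and V: "\<And>\<theta>. \<theta> \<in> {0<..<pi} \<Longrightarrow> V \<theta> \<ge> - L"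
    and p0: "p0 \<in> A" "\<theta>0 \<in> {0<..<pi}" "fst p0 \<theta>0 \<noteq> 0"
  obtains lam :: real and X where "continuous_on {0..pi} X"
    "\<And>p. p \<in> A \<Longrightarrow> integral {0..pi} (\<lambda>\<theta>. (snd (snd (snd p)) \<theta> - of_real lam * fst p \<theta>) * X \<theta>) = 0"
    "\<exists>p\<in>A. integral {0..pi} (\<lambda>\<theta>. fst p \<theta> * X \<theta>) \<noteq> 0"
proof -
  define T where "T = linear_combinations A"
  define g where "g p = snd (snd (snd p))" for p :: angular_tuple
  define u where "u p = fst p" for p :: angular_tuple
  define v where "v p = fst (snd p)" for p :: angular_tuple
  have solT: "angular_solution V p" if "p \<in> T" for p
    using angular_solution_linear_combinations[OF sol] that by (simp add: T_def)
  have cont: "continuous_on {0..pi} (u p)" "continuous_on {0..pi} (v p)" "continuous_on {0..pi} (g p)" if "p \<in> T" for p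
    using angular_solution_continuous[of V "fst p" "fst (snd p)" "fst (snd (snd p))" "snd (snd (snd p))"] solT[OF that]
    by (auto simp: u_def g_def v_def)
  have der: "(u p has_vector_derivative v p \<theta>) (at \<theta>)" if "p \<in> T" for p \<theta>
    using solT[OF that] by (cases p) (auto simp: angular_solution_def u_def v_def)
  have sym: "pairing (u p) (g q) = pairing (g p) (u q)" if "p \<in> T" "q \<in> T" for p q
    using angular_symmetry[of V "fst p" "fst (snd p)" "fst (snd (snd p))" "snd (snd (snd p))"
        "fst q" "fst (snd q)" "fst (snd (snd q))" "snd (snd (snd q))"] solT that
    by (simp add: pairing_def u_def g_def)
  define n where "n p = Re (pairing (u p) (u p))" for p
  define Q where "Q p = Re (pairing (u p) (g p))" for p
  have n_eq: "n p = integral {0..pi} (\<lambda>\<theta>. sin \<theta> * (norm (u p \<theta>))\<^sup>2)" if "p \<in> T" for p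
    unfolding n_def by (rule pairing_self[OF cont(1)[OF that]])
  have n_nonneg: "n p \<ge> 0" if "p \<in> T" for p
    unfolding n_eq[OF that] by (intro Henstock_Kurzweil_Integration.integral_nonneg integrable_continuous_real continuous_intros cont that) (auto intro!: mult_nonneg_nonneg sin_ge_zero)
  have energy: "integral {0..pi} (\<lambda>\<theta>. sin \<theta> * (norm (v p \<theta>))\<^sup>2) \<le> Q p + L * n p" if "p \<in> T" for p
    using angular_energy[of V "fst p" "fst (snd p)" "fst (snd (snd p))" "snd (snd (snd p))" L] solT[OF that] V
      Re_pairing[OF cont(1,3)[OF that]]
    unfolding n_eq[OF that] by (simp add: Q_def u_def g_def v_def)
  have energy_nonneg: "0 \<le> integral {0..pi} (\<lambda>\<theta>. sin \<theta> * (norm (v p \<theta>))\<^sup>2)" if "p \<in> T" for p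
    by (intro Henstock_Kurzweil_Integration.integral_nonneg integrable_continuous_real continuous_intros cont that) (auto intro!: mult_nonneg_nonneg sin_ge_zero)
  have scale: "\<exists>r\<in>T. u r = (\<lambda>\<theta>. c * u p \<theta>) \<and> g r = (\<lambda>\<theta>. c * g p \<theta>)" if "p \<in> T" for p c
    using linear_combinations.scale[of "fst p" "fst (snd p)" "fst (snd (snd p))" "snd (snd (snd p))" A c] that
    by (intro bexI[of _ "(\<lambda>\<theta>. c * fst p \<theta>, \<lambda>\<theta>. c * fst (snd p) \<theta>, \<lambda>\<theta>. c * fst (snd (snd p)) \<theta>, \<lambda>\<theta>. c * snd (snd (snd p)) \<theta>)"])
       (auto simp: u_def g_def T_def)
  have comb: "\<exists>r\<in>T. u r = (\<lambda>\<theta>. u p \<theta> + c * u q \<theta>) \<and> g r = (\<lambda>\<theta>. g p \<theta> + c * g q \<theta>)" if pq: "p \<in> T" "q \<in> T" for p q c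
  proof -
    obtain r where r: "r \<in> T" "u r = (\<lambda>\<theta>. c * u q \<theta>)" "g r = (\<lambda>\<theta>. c * g q \<theta>)" using scale[OF pq(2)] by blast
    have mp: "(fst p, fst (snd p), fst (snd (snd p)), snd (snd (snd p))) \<in> linear_combinations A"
      and mr: "(fst r, fst (snd r), fst (snd (snd r)), snd (snd (snd r))) \<in> linear_combinations A"
      using pq(1) r(1) by (simp_all add: T_def)
    show ?thesis
      by (rule bexI[OF _ linear_combinations.add[OF mp mr, folded T_def]]) (use r in \<open>simp add: u_def g_def\<close>)
  qed
  have p0T: "p0 \<in> T" using p0(1) by (simp add: T_def linear_combinations.base)
  have n0: "n p0 > 0"
  proof -
    have "n p0 \<noteq> 0"
    proof
      assume "n p0 = 0"
      then have "integral {0..pi} (\<lambda>\<theta>. sin \<theta> * (norm (u p0 \<theta>))\<^sup>2) = 0" using n_eq[OF p0T] by simp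
      then have "\<forall>\<theta>\<in>{0..pi}. sin \<theta> * (norm (u p0 \<theta>))\<^sup>2 = 0"
        by (subst (asm) integral_eq_0_iff) (auto intro!: continuous_intros cont p0T mult_nonneg_nonneg sin_ge_zero)
      moreover have "sin \<theta>0 > 0" using p0 by (intro sin_gt_zero) auto
      moreover have "\<theta>0 \<in> {0..pi}" using p0 by auto
      ultimately have "norm (u p0 \<theta>0) = 0" by fastforce
      then show False using p0(3) by (simp add: u_def)
    qed
    then show ?thesis using n_nonneg[OF p0T] by simp
  qed
  define S where "S = (\<lambda>p. Q p / n p) ` {p \<in> T. n p > 0}"
  have Slow: "- L \<le> x" if "x \<in> S" for x
  proof -
    from that obtain p where p: "p \<in> T" "n p > 0" "x = Q p / n p" unfolding S_def by blast
    then have "- L * n p \<le> Q p" using energy[OF p(1)] energy_nonneg[OF p(1)] by simp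
    then have "- L \<le> Q p / n p" using p(2) by (simp only: pos_le_divide_eq)
    then show ?thesis using p(3) by simp
  qed
  have Sne: "S \<noteq> {}" unfolding S_def using p0T n0 by blast
  have Sb: "bdd_below S" using Slow by (rule bdd_belowI)
  define lam where "lam = Inf S"
  have Qlow: "lam * n p \<le> Q p" if "p \<in> T" for p
  proof (cases "n p > 0")
    case True
    then have "Q p / n p \<in> S" unfolding S_def using that by blast
    then have "lam \<le> Q p / n p" unfolding lam_def by (rule cInf_lower[OF _ Sb])
    then show ?thesis using True by (simp add: field_simps)
  next
    case False
    then have "n p = 0" using n_nonneg[OF that] by simp
    then show ?thesis using energy[OF that] energy_nonneg[OF that] by simp
  qed
  \<comment> \<open>The form of the operator minus \<open>lam\<close>: Hermitian by symmetry,
    nonnegative on the span by the choice of \<open>lam\<close>.\<close>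
  define b where "b p q = pairing (u p) (g q) - of_real lam * pairing (u p) (u q)" for p q
  define N where "N p = Re (b p p)" for p
  have N_eq: "N p = Q p - lam * n p" for p by (simp add: N_def b_def Q_def n_def)
  have N_nonneg: "N p \<ge> 0" if "p \<in> T" for p using Qlow[OF that] by (simp add: N_eq)
  have herm: "b q p = cnj (b p q)" if "p \<in> T" "q \<in> T" for p q
    unfolding b_def using sym[OF that(2,1)] by (simp add: pairing_cnj)
  \<comment> \<open>Cauchy-Schwarz for a semidefinite form, from nonnegativity at p + c q. The
    summand 1 avoids dividing by \<open>N q\<close>, which may be 0.\<close>
  have CS: "(norm (b p q))\<^sup>2 \<le> (N q + 1) * N p" if pq: "p \<in> T" "q \<in> T" for p q
  proof -
    define \<beta> where "\<beta> = b p q"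
    define t where "t = 1 / (N q + 1)"
    have t: "t > 0" "t * (N q + 1) = 1" using N_nonneg[OF pq(2)] by (auto simp: t_def)
    define c where "c = - of_real t * cnj \<beta>"
    obtain r where r: "r \<in> T" "u r = (\<lambda>\<theta>. u p \<theta> + c * u q \<theta>)" "g r = (\<lambda>\<theta>. g p \<theta> + c * g q \<theta>)" using comb[OF pq] by blast
    note cp = cont[OF pq(1)] and cq = cont[OF pq(2)]
    have cr: "continuous_on {0..pi} (\<lambda>\<theta>. u p \<theta> + c * u q \<theta>)" "continuous_on {0..pi} (\<lambda>\<theta>. g p \<theta> + c * g q \<theta>)"
      using cont[OF r(1)] by (auto simp: r)
    have "b r r = b p p + c * b p q + cnj c * b q p + cnj c * c * b q q"
      unfolding b_def r pairing_add_left[OF cp(1) cq(1) cr(1)] pairing_add_left[OF cp(1) cq(1) cr(2)]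
        pairing_add_right[OF cp(1) cq(1) cp(1)] pairing_add_right[OF cp(1) cq(1) cq(1)]
        pairing_add_right[OF cp(3) cq(3) cp(1)] pairing_add_right[OF cp(3) cq(3) cq(1)]
      by (simp add: algebra_simps)
    also have "c * b p q = of_real (- t * (norm \<beta>)\<^sup>2)"
      using complex_norm_square[of \<beta>] by (simp add: c_def \<beta>_def[symmetric] mult_ac)
    also have "cnj c * b q p = of_real (- t * (norm \<beta>)\<^sup>2)"
      unfolding herm[OF pq] using complex_norm_square[of \<beta>] by (simp add: c_def \<beta>_def[symmetric] mult_ac)
    also have "cnj c * c = of_real (t\<^sup>2 * (norm \<beta>)\<^sup>2)"
      using complex_norm_square[of \<beta>] by (simp add: c_def power2_eq_square mult_ac)
    finally have "N r = N p - 2 * (t * (norm \<beta>)\<^sup>2) + t * (norm \<beta>)\<^sup>2 * (t * N q)"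
      by (simp add: N_def power2_eq_square)
    also have "t * N q = 1 - t" using t(2) by (simp add: algebra_simps)
    also have "t * (norm \<beta>)\<^sup>2 * (1 - t) \<le> t * (norm \<beta>)\<^sup>2 * 1" using t(1) by (intro mult_left_mono) auto
    finally have "t * (norm \<beta>)\<^sup>2 \<le> N p" using N_nonneg[OF r(1)] by simp
    then have "(N q + 1) * (t * (norm \<beta>)\<^sup>2) \<le> (N q + 1) * N p" using N_nonneg[OF pq(2)] by (intro mult_left_mono) auto
    also have "(N q + 1) * (t * (norm \<beta>)\<^sup>2) = (t * (N q + 1)) * (norm \<beta>)\<^sup>2" by simp
    finally show ?thesis unfolding t(2) \<beta>_def by simp
  qed
  have "\<exists>p\<in>T. n p = 1 \<and> Q p < lam + 1 / (real j + 1)" for j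
  proof -
    have "Inf S < lam + 1 / (real j + 1)" by (simp add: lam_def)
    then obtain x where x: "x \<in> S" "x < lam + 1 / (real j + 1)" using cInf_lessD[OF Sne] by blast
    then obtain p where p: "p \<in> T" "n p > 0" "x = Q p / n p" unfolding S_def by blast
    obtain r where r: "r \<in> T" "u r = (\<lambda>\<theta>. of_real (1 / sqrt (n p)) * u p \<theta>)" "g r = (\<lambda>\<theta>. of_real (1 / sqrt (n p)) * g p \<theta>)" using scale[OF p(1)] by blast
    have c: "cnj (of_real (1 / sqrt (n p))) * of_real (1 / sqrt (n p)) = (of_real (1 / n p) :: complex)"
      using p(2) by (simp flip: of_real_mult)
    have Re: "Re (of_real k * X) = k * Re X" for k X by simp
    have "n r = 1 / n p * n p" "Q r = 1 / n p * Q p"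
      by (simp_all only: n_def[of r] Q_def[of r] r pairing_scale c Re n_def[of p, symmetric] Q_def[of p, symmetric])
    then show ?thesis using r(1) p x by (intro bexI[of _ r]) auto
  qed
  then obtain R where R: "\<And>j. R j \<in> T" "\<And>j. n (R j) = 1" "\<And>j. Q (R j) < lam + 1 / (real j + 1)" by metis
  define M where "M = lam + 1 + L"
  have EM: "integral {0..pi} (\<lambda>\<theta>. sin \<theta> * (norm (v (R j) \<theta>))\<^sup>2) \<le> M" for j
  proof -
    have "1 / (real j + 1) \<le> 1" by simp
    then show ?thesis using energy[OF R(1)[of j]] R(3)[of j] unfolding R(2)[of j] M_def by linarith
  qed
  have M: "M \<ge> 0" using order_trans[OF energy_nonneg[OF R(1)] EM] .
  have hol: "norm (u (R j) x - u (R j) y) \<le> e * M + \<bar>lnt x - lnt y\<bar> / e"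
    if "e > 0" "x \<in> {0<..<pi}" "y \<in> {0<..<pi}" for j x y e
    by (rule angular_holder[OF der[OF R(1)] cont(2)[OF R(1)] EM that])
  \<comment> \<open>The interval has length 2 pi / 3 and sin \<theta> is at least 1/2 on it, so |u|
    > 1 throughout would give norm at least pi / 3 > 1.\<close>
  have base: "\<exists>\<theta>\<in>{pi/6..5*pi/6}. norm (u (R j) \<theta>) \<le> 1" for j
  proof (rule ccontr)
    assume "\<not> ?thesis"
    then have big: "norm (u (R j) \<theta>) > 1" if "\<theta> \<in> {pi/6..5*pi/6}" for \<theta> using that by force
    have sub: "{pi/6..5*pi/6} \<subseteq> {0..pi}" using pi_gt_zero by auto
    have cs: "continuous_on {0..pi} (\<lambda>\<theta>. sin \<theta> * (norm (u (R j) \<theta>))\<^sup>2)" by (intro continuous_intros cont R)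
    have i1: "(\<lambda>\<theta>. sin \<theta> * (norm (u (R j) \<theta>))\<^sup>2) integrable_on {pi/6..5*pi/6}"
      by (rule integrable_continuous_real[OF continuous_on_subset[OF cs sub]])
    have "integral {pi/6..5*pi/6} (\<lambda>\<theta>. 1 / 2 :: real) \<le> integral {pi/6..5*pi/6} (\<lambda>\<theta>. sin \<theta> * (norm (u (R j) \<theta>))\<^sup>2)"
    proof (rule integral_le[OF _ i1])
      fix \<theta> assume th: "\<theta> \<in> {pi/6..5*pi/6}"
      have "1 / 2 * 1 \<le> sin \<theta> * (norm (u (R j) \<theta>))\<^sup>2"
        using sin_ge_half[OF th] big[OF th] by (intro mult_mono) auto
      then show "1 / 2 \<le> sin \<theta> * (norm (u (R j) \<theta>))\<^sup>2" by simp
    qed auto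
    also have "\<dots> \<le> integral {0..pi} (\<lambda>\<theta>. sin \<theta> * (norm (u (R j) \<theta>))\<^sup>2)"
      by (rule integral_subset_le[OF sub i1 integrable_continuous_real[OF cs]]) (auto intro!: mult_nonneg_nonneg sin_ge_zero)
    also have "\<dots> = 1" using n_eq[OF R(1)[of j]] R(2) by simp
    finally have "pi / 3 \<le> 1" using pi_gt_zero by simp
    then show False using pi_gt3 by simp
  qed
  \<comment> \<open>The constant collects 1 from \<open>base\<close>, 16 from the bound of
    \<open>lnt\<close> at that point, and \<open>M\<close> from \<open>angular_holder\<close> with
    \<open>e = 1\<close>.\<close>
  have ub: "norm (u (R j) \<theta>) \<le> (17 + M) + 4 * (2 / sin \<theta>) powr (1/4)" if th: "\<theta> \<in> {0<..<pi}" for j \<theta>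
  proof -
    obtain \<theta>1 where t1: "\<theta>1 \<in> {pi/6..5*pi/6}" "norm (u (R j) \<theta>1) \<le> 1" using base by blast
    then have "pi / 6 \<le> \<theta>1" "\<theta>1 \<le> 5 * pi / 6" by auto
    then have "0 < \<theta>1" "\<theta>1 < pi" using pi_gt_zero by linarith+
    then have t2: "\<theta>1 \<in> {0<..<pi}" by simp
    have "2 / sin \<theta>1 \<le> 4" using sin_ge_half[OF t1(1)] by (simp add: field_simps)
    moreover have "sin \<theta>1 > 0" using sin_ge_half[OF t1(1)] by simp
    ultimately have "(2 / sin \<theta>1) powr (1/4) \<le> 4 powr (1/4)" by (intro powr_mono2) auto
    also have "(4::real) powr (1/4) \<le> 4 powr 1" by (intro powr_mono) auto
    finally have "\<bar>lnt \<theta>1\<bar> \<le> 16" using lnt_bound[OF t2] by simp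
    moreover have "norm (u (R j) \<theta>) \<le> norm (u (R j) \<theta> - u (R j) \<theta>1) + norm (u (R j) \<theta>1)"
      using norm_triangle_ineq[of "u (R j) \<theta> - u (R j) \<theta>1" "u (R j) \<theta>1"] by simp
    ultimately show ?thesis using hol[of 1 \<theta> \<theta>1 j] th t2 t1(2) lnt_bound[OF th] by simp
  qed
  \<comment> \<open>The functions themselves may grow logarithmically at the poles along the
    sequence. With half of the weight sin \<theta> attached they tend to 0 there uniformly in
    \<open>j\<close>, and Arzela-Ascoli applies on the closed interval.\<close>
  define Z where "Z j \<theta> = of_real (sqrt (sin \<theta>)) * u (R j) \<theta>" for j \<theta>
  have Zc: "continuous_on {0..pi} (Z j)" for j unfolding Z_def by (intro continuous_intros cont R)
  have Zb: "norm (Z j \<theta>) \<le> (25 + M) * sqrt (sqrt (sin \<theta>))" if "\<theta> \<in> {0..pi}" for j \<theta>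
  proof (cases "\<theta> \<in> {0<..<pi}")
    case True
    then have s: "0 < sin \<theta>" by (intro sin_gt_zero) auto
    have "norm (Z j \<theta>) = sqrt (sin \<theta>) * norm (u (R j) \<theta>)" using s by (simp add: Z_def norm_mult)
    also have "\<dots> \<le> sqrt (sin \<theta>) * ((17 + M) + 4 * (2 / sin \<theta>) powr (1/4))"
      using s ub[OF True] by (intro mult_left_mono) auto
    also have "\<dots> \<le> (17 + M + 8) * sqrt (sqrt (sin \<theta>))" using s M by (intro sqrt_sin_powr_bound) auto
    finally show ?thesis by simp
  next
    case False
    then have "\<theta> = 0 \<or> \<theta> = pi" using that by auto
    then show ?thesis by (auto simp: Z_def)
  qed
  obtain Y k where Y: "continuous_on {0..pi} Y" "strict_mono (k :: nat \<Rightarrow> nat)"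
    "\<And>e. 0 < e \<Longrightarrow> \<exists>N. \<forall>n x. n \<ge> N \<and> x \<in> {0..pi} \<longrightarrow> norm (Z (k n) x - Y x) < e"
  proof (rule Arzela_Ascoli[of "{0..pi}" Z "25 + M"])
    show "compact {0..pi}" by simp
    show "norm (Z j x) \<le> 25 + M" if "x \<in> {0..pi}" for j x
    proof -
      have "sin x \<ge> 0" using that by (intro sin_ge_zero) auto
      then have "sqrt (sqrt (sin x)) \<le> 1" by simp
      then have "(25 + M) * sqrt (sqrt (sin x)) \<le> (25 + M) * 1" using M by (intro mult_left_mono) auto
      then show ?thesis using Zb[OF that, of j] by simp
    qed
    fix x e :: real assume x: "x \<in> {0..pi}" and e: "0 < e"
    show "\<exists>d. 0 < d \<and> (\<forall>j y. y \<in> {0..pi} \<and> norm (x - y) < d \<longrightarrow> norm (Z j x - Z j y) < e)"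
    proof (cases "x \<in> {0<..<pi}")
      case False
      then have x0: "x = 0 \<or> x = pi" using x by auto
      have "isCont (\<lambda>y. (25 + M) * sqrt (sqrt (sin y))) x" by (intro continuous_intros)
      moreover have "(25 + M) * sqrt (sqrt (sin x)) = 0" using x0 by auto
      ultimately obtain d where d: "d > 0" "\<And>y. dist y x < d \<Longrightarrow> dist ((25 + M) * sqrt (sqrt (sin y))) 0 < e"
        using e unfolding continuous_at_eps_delta by metis
      show ?thesis
      proof (intro exI[of _ d] conjI allI impI d(1))
        fix j y assume y: "y \<in> {0..pi} \<and> norm (x - y) < d"
        have "Z j x = 0" using x0 by (auto simp: Z_def)
        moreover have "norm (Z j y) \<le> (25 + M) * sqrt (sqrt (sin y))" using y by (intro Zb) auto
        moreover have "dist y x < d" using y by (simp add: dist_real_def abs_minus_commute)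
        from d(2)[OF this] have "(25 + M) * sqrt (sqrt (sin y)) < e" by simp
        ultimately show "norm (Z j x - Z j y) < e" by simp
      qed
    next
      case True
      define B where "B = (17 + M) + 4 * (2 / sin x) powr (1/4)"
      define e' where "e' = e / (2 * (M + 1))"
      have e': "e' > 0" "e' * M \<le> e / 2"
      proof -
        show "e' > 0" using e M by (simp add: e'_def)
        have "e' * M \<le> e' * (M + 1)" using \<open>e' > 0\<close> by (intro mult_left_mono) auto
        also have "\<dots> = e / 2" using M by (simp add: e'_def field_simps)
        finally show "e' * M \<le> e / 2" .
      qed
      define D where "D y = \<bar>sqrt (sin x) - sqrt (sin y)\<bar> * B + \<bar>lnt x - lnt y\<bar> / e'" for y
      have "isCont lnt x" using lnt_deriv[OF True] by (rule DERIV_isCont)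
      then have "isCont D x" unfolding D_def by (intro continuous_intros) (use e' in auto)
      moreover have "D x = 0" by (simp add: D_def)
      moreover have "e / 2 > 0" using e by simp
      ultimately obtain d where d: "d > 0" "\<And>y. dist y x < d \<Longrightarrow> dist (D y) 0 < e / 2"
        unfolding continuous_at_eps_delta by metis
      define d' where "d' = min d (min x (pi - x))"
      show ?thesis
      proof (intro exI[of _ d'] conjI allI impI)
        show "0 < d'" using d True by (simp add: d'_def)
        fix j y assume y: "y \<in> {0..pi} \<and> norm (x - y) < d'"
        then have yi: "y \<in> {0<..<pi}" by (auto simp: d'_def)
        have "Z j x - Z j y = of_real (sqrt (sin x) - sqrt (sin y)) * u (R j) x + of_real (sqrt (sin y)) * (u (R j) x - u (R j) y)"
          by (simp add: Z_def algebra_simps)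
        then have "norm (Z j x - Z j y) \<le> norm (of_real (sqrt (sin x) - sqrt (sin y)) * u (R j) x) + norm (of_real (sqrt (sin y)) * (u (R j) x - u (R j) y))"
          by (simp only: norm_triangle_ineq)
        also have "\<dots> \<le> \<bar>sqrt (sin x) - sqrt (sin y)\<bar> * B + 1 * (e' * M + \<bar>lnt x - lnt y\<bar> / e')"
          unfolding norm_mult norm_of_real
        proof (intro add_mono mult_mono)
          show "norm (u (R j) x) \<le> B" unfolding B_def by (rule ub[OF True])
          have "sin y \<ge> 0" using yi by (intro sin_ge_zero) auto
          then show "\<bar>sqrt (sin y)\<bar> \<le> 1" by simp
          show "norm (u (R j) x - u (R j) y) \<le> e' * M + \<bar>lnt x - lnt y\<bar> / e'" by (rule hol[OF e'(1) True yi])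
        qed auto
        also have "\<dots> = D y + e' * M" by (simp add: D_def)
        also have "\<dots> < e"
        proof -
          have "dist y x < d" using y by (simp add: d'_def dist_real_def abs_minus_commute)
          then have "D y < e / 2" using d(2)[of y] by simp
          then show ?thesis using e'(2) by simp
        qed
        finally show "norm (Z j x - Z j y) < e" .
      qed
    qed
  qed auto
  have ul: "uniform_limit {0..pi} (\<lambda>i. Z (k i)) Y sequentially"
    unfolding uniform_limit_iff eventually_sequentially dist_norm using Y(3) by (metis)
  have ulc: "uniform_limit {0..pi} (\<lambda>i \<theta>. cnj (Z (k i) \<theta>)) (\<lambda>\<theta>. cnj (Y \<theta>)) sequentially"
    using ul unfolding uniform_limit_iff dist_norm complex_cnj_diff[symmetric] complex_mod_cnj .
  have Zcc: "continuous_on {0..pi} (\<lambda>\<theta>. cnj (Z j \<theta>))" for j by (intro continuous_intros Zc)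
  \<comment> \<open>The other half of the weight is restored here, so integrals against
    \<open>X\<close> are limits of the pairings with the minimizing sequence.\<close>
  define X where "X \<theta> = of_real (sqrt (sin \<theta>)) * cnj (Y \<theta>)" for \<theta>
  have Xc: "continuous_on {0..pi} X" unfolding X_def by (intro continuous_intros Y)
  have sq: "of_real (sqrt (sin \<theta>)) * of_real (sqrt (sin \<theta>)) = (of_real (sin \<theta>) :: complex)" if "\<theta> \<in> {0..pi}" for \<theta>
  proof -
    have "sin \<theta> \<ge> 0" using that by (intro sin_ge_zero) auto
    then show ?thesis by (simp flip: of_real_mult)
  qed
  \<comment> \<open>By Cauchy-Schwarz |b (R j) q|^2 is at most (N q + 1) N (R j), and the last
    factor tends to 0 along the minimizing sequence.\<close>
  have zero: "integral {0..pi} (\<lambda>\<theta>. (g q \<theta> - of_real lam * u q \<theta>) * X \<theta>) = 0" if q: "q \<in> T" for q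
  proof -
    define w where "w \<theta> = of_real (sqrt (sin \<theta>)) * (g q \<theta> - of_real lam * u q \<theta>)" for \<theta>
    have wc: "continuous_on {0..pi} w" unfolding w_def by (intro continuous_intros cont q)
    have "(\<lambda>i. integral {0..pi} (\<lambda>\<theta>. cnj (Z (k i) \<theta>) * w \<theta>)) \<longlonglongrightarrow> integral {0..pi} (\<lambda>\<theta>. cnj (Y \<theta>) * w \<theta>)"
      by (rule integral_mult_uniform_limit[OF Zcc wc ulc uniform_limit_const])
    moreover have "(\<lambda>i. integral {0..pi} (\<lambda>\<theta>. cnj (Z (k i) \<theta>) * w \<theta>)) \<longlonglongrightarrow> 0"
    proof -
      have e: "integral {0..pi} (\<lambda>\<theta>. cnj (Z j \<theta>) * w \<theta>) = b (R j) q" for j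
      proof -
        have "integral {0..pi} (\<lambda>\<theta>. cnj (Z j \<theta>) * w \<theta>) = pairing (u (R j)) (\<lambda>\<theta>. g q \<theta> + (- of_real lam) * u q \<theta>)"
          unfolding pairing_def
        proof (rule Henstock_Kurzweil_Integration.integral_cong)
          fix \<theta> :: real assume th: "\<theta> \<in> {0..pi}"
          have "cnj (Z j \<theta>) * w \<theta> = (of_real (sqrt (sin \<theta>)) * of_real (sqrt (sin \<theta>))) * (cnj (u (R j) \<theta>) * (g q \<theta> + (- of_real lam) * u q \<theta>))"
            by (simp add: Z_def w_def algebra_simps)
          then show "cnj (Z j \<theta>) * w \<theta> = of_real (sin \<theta>) * (cnj (u (R j) \<theta>) * (g q \<theta> + (- of_real lam) * u q \<theta>))"
            unfolding sq[OF th] .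
        qed
        also have "\<dots> = b (R j) q" unfolding pairing_add_right[OF cont(3)[OF q] cont(1)[OF q] cont(1)[OF R(1)]] b_def by simp
        finally show ?thesis .
      qed
      have bb: "norm (b (R j) q) \<le> sqrt ((N q + 1) * (1 / (real j + 1)))" for j
      proof (rule real_le_rsqrt)
        have "(norm (b (R j) q))\<^sup>2 \<le> (N q + 1) * N (R j)" by (rule CS[OF R(1) q])
        also have "\<dots> \<le> (N q + 1) * (1 / (real j + 1))"
          using N_nonneg[OF q] R(2,3)[of j] by (intro mult_left_mono) (auto simp: N_eq)
        finally show "(norm (b (R j) q))\<^sup>2 \<le> (N q + 1) * (1 / (real j + 1))" .
      qed
      have lim: "(\<lambda>j. sqrt ((N q + 1) * (1 / (real j + 1)))) \<longlonglongrightarrow> sqrt ((N q + 1) * 0)"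
      proof (intro tendsto_real_sqrt tendsto_mult tendsto_const)
        show "(\<lambda>j. 1 / (real j + 1)) \<longlonglongrightarrow> 0" using LIMSEQ_Suc[OF lim_inverse_n'] by (simp add: add.commute)
      qed
      have "(\<lambda>j. b (R j) q) \<longlonglongrightarrow> 0"
        by (rule Lim_null_comparison[OF always_eventually[OF allI[OF bb]] lim[unfolded mult_zero_right real_sqrt_zero]])
      from LIMSEQ_subseq_LIMSEQ[OF this Y(2)] show ?thesis unfolding e by (simp add: o_def)
    qed
    ultimately have "integral {0..pi} (\<lambda>\<theta>. cnj (Y \<theta>) * w \<theta>) = 0" by (rule LIMSEQ_unique)
    then show ?thesis by (simp add: X_def w_def mult_ac)
  qed
  \<comment> \<open>If \<open>X\<close> annihilated \<open>A\<close>, it would annihilate the span,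
    in particular the sequence itself; the limit would have norm 0, although uniform convergence
    preserves the norm 1.\<close>
  have nz: "\<exists>p\<in>A. integral {0..pi} (\<lambda>\<theta>. fst p \<theta> * X \<theta>) \<noteq> 0"
  proof (rule ccontr)
    assume "\<not> ?thesis"
    then have A0: "integral {0..pi} (\<lambda>\<theta>. fst p \<theta> * X \<theta>) = 0" if "p \<in> A" for p using that by blast
    have T0: "integral {0..pi} (\<lambda>\<theta>. fst p \<theta> * X \<theta>) = 0" if "p \<in> linear_combinations A" for p
      using that
    proof induction
      case (base p)
      then show ?case by (rule A0)
    next
      case (scale \<psi> \<psi>1 \<psi>2 h c)
      then show ?case by (simp add: mult.assoc)
    next
      case (add \<psi> \<psi>1 \<psi>2 h \<phi> \<phi>1 \<phi>2 g')
      have "(\<lambda>\<theta>. \<psi> \<theta> * X \<theta>) integrable_on {0..pi}" "(\<lambda>\<theta>. \<phi> \<theta> * X \<theta>) integrable_on {0..pi}"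
        using cont(1)[of "(\<psi>, \<psi>1, \<psi>2, h)"] cont(1)[of "(\<phi>, \<phi>1, \<phi>2, g')"] add.hyps
        by (auto simp: T_def u_def intro!: integrable_continuous_real continuous_intros Xc)
      from Henstock_Kurzweil_Integration.integral_add[OF this] add.IH show ?case by (simp add: distrib_right)
    qed
    have "(\<lambda>i. integral {0..pi} (\<lambda>\<theta>. cnj (Y \<theta>) * Z (k i) \<theta>)) \<longlonglongrightarrow> integral {0..pi} (\<lambda>\<theta>. cnj (Y \<theta>) * Y \<theta>)"
      by (rule integral_mult_uniform_limit[OF _ Zc uniform_limit_const ul]) (intro continuous_intros Y)
    moreover have "integral {0..pi} (\<lambda>\<theta>. cnj (Y \<theta>) * Z j \<theta>) = 0" for j
      using T0[of "R j"] R(1)[of j] by (simp add: T_def X_def Z_def u_def mult_ac)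
    ultimately have 0: "integral {0..pi} (\<lambda>\<theta>. cnj (Y \<theta>) * Y \<theta>) = 0" using LIMSEQ_unique[OF _ tendsto_const] by fastforce
    have "(\<lambda>i. integral {0..pi} (\<lambda>\<theta>. cnj (Z (k i) \<theta>) * Z (k i) \<theta>)) \<longlonglongrightarrow> integral {0..pi} (\<lambda>\<theta>. cnj (Y \<theta>) * Y \<theta>)"
      by (rule integral_mult_uniform_limit[OF Zcc Zc ulc ul])
    moreover have "Re (integral {0..pi} (\<lambda>\<theta>. cnj (Z j \<theta>) * Z j \<theta>)) = 1" for j
    proof -
      have "integral {0..pi} (\<lambda>\<theta>. cnj (Z j \<theta>) * Z j \<theta>) = pairing (u (R j)) (u (R j))"
        unfolding pairing_def
      proof (rule Henstock_Kurzweil_Integration.integral_cong)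
        fix \<theta> :: real assume th: "\<theta> \<in> {0..pi}"
        have "cnj (Z j \<theta>) * Z j \<theta> = (of_real (sqrt (sin \<theta>)) * of_real (sqrt (sin \<theta>))) * (cnj (u (R j) \<theta>) * u (R j) \<theta>)"
          by (simp add: Z_def algebra_simps)
        then show "cnj (Z j \<theta>) * Z j \<theta> = of_real (sin \<theta>) * (cnj (u (R j) \<theta>) * u (R j) \<theta>)"
          unfolding sq[OF th] .
      qed
      then show ?thesis using R(2)[of j] by (simp add: n_def)
    qed
    ultimately have "(\<lambda>i. 1) \<longlonglongrightarrow> (0::real)" unfolding 0 using tendsto_Re by fastforce
    then show False using LIMSEQ_unique[OF tendsto_const] by fastforce
  qed
  show thesis
  proof (rule that[OF Xc _ nz])
    fix p assume "p \<in> A"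
    then have "p \<in> T" by (simp add: T_def linear_combinations.base)
    from zero[OF this] show "integral {0..pi} (\<lambda>\<theta>. (snd (snd (snd p)) \<theta> - of_real lam * fst p \<theta>) * X \<theta>) = 0"
      by (simp add: g_def u_def)
  qed
qed

section \<open>Smooth functions near the horizon\<close>

text \<open>The meridian \<phi> = 0, continued to a full great circle as \<theta> runs over the
  reals. Restricting a smooth function on the sphere to it yields a function smooth across the
  poles, without the coordinate singularity.\<close>

definition gam :: "real \<Rightarrow> real \<Rightarrow> real \<times> (real^3)" where
  "gam r \<theta> = (r, sph 0 \<theta>)"

lemma sph_0: "sph 0 \<theta> = sin \<theta> *\<^sub>R axis 1 1 + cos \<theta> *\<^sub>R axis 3 1"
  by (simp add: vec_eq_iff forall_3 sph_def axis_def)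

lemma gam_continuous: "continuous_on S (\<lambda>p. gam (fst p) (snd p))"
  unfolding gam_def sph_0 by (intro continuous_intros)

lemma gam_radial: "((\<lambda>r. gam r \<theta>) has_vector_derivative (1, 0)) (at r)"
  unfolding gam_def has_vector_derivative_def
  by (rule has_derivative_eq_rhs[OF has_derivative_Pair[OF has_derivative_ident has_derivative_const]]) auto

lemma gam_angular: "(gam r has_vector_derivative (0, cos \<theta> *\<^sub>R axis 1 1 - sin \<theta> *\<^sub>R axis 3 1)) (at \<theta>)"
proof -
  have s: "((\<lambda>\<theta>. sin \<theta> *\<^sub>R axis 1 1 + cos \<theta> *\<^sub>R axis 3 1 :: real^3) has_vector_derivative cos \<theta> *\<^sub>R axis 1 1 + (- sin \<theta>) *\<^sub>R axis 3 1) (at \<theta>)"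
    by (rule has_vector_derivative_eq_rhs[OF has_vector_derivative_add[OF has_vector_derivative_scaleR[OF DERIV_sin has_vector_derivative_const]
          has_vector_derivative_scaleR[OF DERIV_cos has_vector_derivative_const]]]) simp
  show ?thesis
    unfolding gam_def[abs_def] sph_0 has_vector_derivative_def
    by (rule has_derivative_eq_rhs[OF has_derivative_Pair[OF has_derivative_const s[unfolded has_vector_derivative_def]]]) auto
qed

lemma has_vector_derivative_along_curve:
  assumes "g differentiable (at (\<gamma> t))" "(\<gamma> has_vector_derivative v) (at t)"
  shows "((\<lambda>t. g (\<gamma> t)) has_vector_derivative frechet_derivative g (at (\<gamma> t)) v) (at t)"
proof -
  have g: "(g has_derivative frechet_derivative g (at (\<gamma> t))) (at (\<gamma> t))" using assms(1) frechet_derivative_works by blast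
  have "((\<lambda>t. g (\<gamma> t)) has_derivative (\<lambda>h. frechet_derivative g (at (\<gamma> t)) (h *\<^sub>R v))) (at t)"
    using diff_chain_at[OF assms(2)[unfolded has_vector_derivative_def] g] by (simp add: o_def)
  then show ?thesis unfolding has_vector_derivative_def using has_derivative_linear[OF g] by (simp add: linear_scale)
qed

text \<open>Smoothness up to the horizon without using values at the horizon: the representatives
  are smooth around points with \<open>r \<ge> \<rho>\<close>, but agreement is asked only for
  \<open>r > \<rho>\<close>. Hence only two-sided radial derivatives ever occur.\<close>

definition locally_smooth :: "real \<Rightarrow> (real \<Rightarrow> real \<Rightarrow> complex) \<Rightarrow> bool" where
  "locally_smooth \<rho> f \<longleftrightarrow> (\<forall>r\<ge>\<rho>. \<forall>\<theta>. \<exists>U g. open U \<and> gam r \<theta> \<in> U \<and> (\<forall>n. Cn_on U g n) \<and>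
     (\<forall>r'>\<rho>. \<forall>\<theta>'. gam r' \<theta>' \<in> U \<longrightarrow> f r' \<theta>' = g (gam r' \<theta>')))"

lemma locally_smoothE:
  assumes "locally_smooth \<rho> f" "r \<ge> \<rho>"
  obtains U g where "open U" "gam r \<theta> \<in> U" "\<And>n. Cn_on U g n"
    "\<And>r' \<theta>'. r' > \<rho> \<Longrightarrow> gam r' \<theta>' \<in> U \<Longrightarrow> f r' \<theta>' = g (gam r' \<theta>')"
  using assms unfolding locally_smooth_def by metis

lemma Cn_on_frechet:
  assumes "\<And>n. Cn_on U g n"
  shows "Cn_on U (\<lambda>p. frechet_derivative g (at p) v) n" "p \<in> U \<Longrightarrow> g differentiable (at p)" "continuous_on U g"
  using assms[of "Suc n"] assms[of 0] by auto

lemma open_gam_vimage: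
  assumes "open U"
  shows "open {p. gam (fst p) (snd p) \<in> U}"
  using open_vimage[OF assms gam_continuous[of UNIV, unfolded]] by (simp add: vimage_def)

text \<open>Locally the radial derivative is the derivative of the representative in the fixed
  direction (1, 0), which is again smooth across the horizon; so the class is stable and all orders
  follow by iteration.\<close>

lemma locally_smooth_radial:
  assumes f: "locally_smooth \<rho> f"
  shows "locally_smooth \<rho> (\<lambda>r \<theta>. vector_derivative (\<lambda>r. f r \<theta>) (at r))"
    and "r > \<rho> \<Longrightarrow> ((\<lambda>r. f r \<theta>) has_vector_derivative vector_derivative (\<lambda>r. f r \<theta>) (at r)) (at r)"
proof -
  have key: "((\<lambda>r. f r \<theta>') has_vector_derivative frechet_derivative g (at (gam r' \<theta>')) (1, 0)) (at r')"
    if U: "open U" and g: "\<And>n. Cn_on U g n" and eq: "\<And>r' \<theta>'. r' > \<rho> \<Longrightarrow> gam r' \<theta>' \<in> U \<Longrightarrow> f r' \<theta>' = g (gam r' \<theta>')"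
    and r: "r' > \<rho>" "gam r' \<theta>' \<in> U" for U g r' \<theta>'
  proof (rule has_vector_derivative_transform_within_open)
    show "((\<lambda>r. g (gam r \<theta>')) has_vector_derivative frechet_derivative g (at (gam r' \<theta>')) (1, 0)) (at r')"
      by (rule has_vector_derivative_along_curve[OF Cn_on_frechet(2)[OF g r(2)] gam_radial])
    have "open ((\<lambda>r. (r, \<theta>')) -` {p. gam (fst p) (snd p) \<in> U})"
      by (intro open_vimage open_gam_vimage U continuous_intros)
    then show "open ({\<rho><..} \<inter> (\<lambda>r. (r, \<theta>')) -` {p. gam (fst p) (snd p) \<in> U})" by (intro open_Int) auto
    show "r' \<in> {\<rho><..} \<inter> (\<lambda>r. (r, \<theta>')) -` {p. gam (fst p) (snd p) \<in> U}" using r by simp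
    show "\<And>x. x \<in> {\<rho><..} \<inter> (\<lambda>r. (r, \<theta>')) -` {p. gam (fst p) (snd p) \<in> U} \<Longrightarrow> g (gam x \<theta>') = f x \<theta>'"
      by (simp add: eq)
  qed
  show "locally_smooth \<rho> (\<lambda>r \<theta>. vector_derivative (\<lambda>r. f r \<theta>) (at r))"
    unfolding locally_smooth_def
  proof (intro allI impI)
    fix r \<theta> assume "r \<ge> \<rho>"
    then obtain U g where U: "open U" "gam r \<theta> \<in> U" and g: "\<And>n. Cn_on U g n"
      and eq: "\<And>r' \<theta>'. r' > \<rho> \<Longrightarrow> gam r' \<theta>' \<in> U \<Longrightarrow> f r' \<theta>' = g (gam r' \<theta>')" using locally_smoothE[OF f] by blast
    show "\<exists>U h. open U \<and> gam r \<theta> \<in> U \<and> (\<forall>n. Cn_on U h n) \<and>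
     (\<forall>r'>\<rho>. \<forall>\<theta>'. gam r' \<theta>' \<in> U \<longrightarrow> vector_derivative (\<lambda>r. f r \<theta>') (at r') = h (gam r' \<theta>'))"
      using U Cn_on_frechet(1)[OF g] vector_derivative_at[OF key[OF U(1) g eq]]
      by (intro exI[of _ U] exI[of _ "\<lambda>p. frechet_derivative g (at p) (1, 0)"]) auto
  qed
  assume r: "r > \<rho>"
  then obtain U g where U: "open U" "gam r \<theta> \<in> U" and g: "\<And>n. Cn_on U g n"
    and eq: "\<And>r' \<theta>'. r' > \<rho> \<Longrightarrow> gam r' \<theta>' \<in> U \<Longrightarrow> f r' \<theta>' = g (gam r' \<theta>')" using locally_smoothE[OF f, of r] by (metis less_imp_le)
  from key[OF U(1) g eq r U(2)]
  show "((\<lambda>r. f r \<theta>) has_vector_derivative vector_derivative (\<lambda>r. f r \<theta>) (at r)) (at r)"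
    by (simp add: vector_derivative_at)
qed

lemma locally_smooth_continuous:
  assumes f: "locally_smooth \<rho> f"
  shows "continuous_on ({\<rho><..} \<times> UNIV) (\<lambda>(r, \<theta>). f r \<theta>)"
proof -
  have "isCont (\<lambda>(r, \<theta>). f r \<theta>) p" if p: "p \<in> {\<rho><..} \<times> UNIV" for p
  proof -
    obtain r \<theta> where rt: "p = (r, \<theta>)" "r > \<rho>" using p by auto
    then obtain U g where U: "open U" "gam r \<theta> \<in> U" and g: "\<And>n. Cn_on U g n"
      and eq: "\<And>r' \<theta>'. r' > \<rho> \<Longrightarrow> gam r' \<theta>' \<in> U \<Longrightarrow> f r' \<theta>' = g (gam r' \<theta>')" using locally_smoothE[OF f, of r] by (metis less_imp_le)
    define S0 where "S0 = ({\<rho><..} \<times> UNIV) \<inter> {p. gam (fst p) (snd p) \<in> U}"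
    have S0: "open S0" "p \<in> S0" unfolding S0_def using U rt by (auto intro!: open_Int open_Times open_gam_vimage)
    have "continuous_on S0 (\<lambda>p. g (gam (fst p) (snd p)))"
      by (rule continuous_on_compose2[OF Cn_on_frechet(3)[OF g] gam_continuous]) (auto simp: S0_def)
    then have "continuous_on S0 (\<lambda>(r, \<theta>). f r \<theta>)"
      by (rule continuous_on_eq) (auto simp: S0_def eq)
    then show ?thesis using S0 by (simp add: continuous_on_eq_continuous_at)
  qed
  then show ?thesis by (simp add: continuous_at_imp_continuous_on)
qed

text \<open>Each representative is bounded near its point, including points on the horizon, and
  finitely many of these neighbourhoods cover the compact strip. This is the source of
  \<open>W_bdd\<close>.\<close>

lemma locally_smooth_bounded:
  assumes f: "locally_smooth \<rho> f"
  shows "\<exists>C. \<forall>r \<theta>. \<rho> < r \<longrightarrow> r \<le> \<rho> + 1 \<longrightarrow> \<theta> \<in> {0..pi} \<longrightarrow> norm (f r \<theta>) \<le> C"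
proof -
  have "\<exists>V C. open V \<and> p \<in> V \<and> (\<forall>q\<in>V. fst q > \<rho> \<longrightarrow> norm (f (fst q) (snd q)) \<le> C)" if p: "p \<in> {\<rho>..\<rho>+1} \<times> {0..pi}" for p
  proof -
    obtain r \<theta> where rt: "p = (r, \<theta>)" "r \<ge> \<rho>" using p by auto
    then obtain U g where U: "open U" "gam r \<theta> \<in> U" and g: "\<And>n. Cn_on U g n"
      and eq: "\<And>r' \<theta>'. r' > \<rho> \<Longrightarrow> gam r' \<theta>' \<in> U \<Longrightarrow> f r' \<theta>' = g (gam r' \<theta>')" using locally_smoothE[OF f] by blast
    have "isCont g (gam r \<theta>)" using Cn_on_frechet(3)[OF g] U by (simp add: continuous_on_eq_continuous_at)
    then obtain d where d: "d > 0" "\<And>y. dist y (gam r \<theta>) < d \<Longrightarrow> dist (g y) (g (gam r \<theta>)) < 1"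
      unfolding continuous_at_eps_delta by (metis zero_less_one)
    define V where "V = {p. gam (fst p) (snd p) \<in> U \<inter> ball (gam r \<theta>) d}"
    have "open V" unfolding V_def by (intro open_gam_vimage open_Int U open_ball)
    moreover have "p \<in> V" unfolding V_def using U d rt by simp
    moreover have "norm (f (fst q) (snd q)) \<le> norm (g (gam r \<theta>)) + 1" if q: "q \<in> V" "fst q > \<rho>" for q
    proof -
      have "f (fst q) (snd q) = g (gam (fst q) (snd q))" using q by (intro eq) (auto simp: V_def)
      moreover have "dist (g (gam (fst q) (snd q))) (g (gam r \<theta>)) < 1" using q by (intro d) (auto simp: V_def dist_commute)
      then have "norm (g (gam (fst q) (snd q)) - g (gam r \<theta>)) < 1" by (simp add: dist_norm)
      ultimately show ?thesis using norm_triangle_sub[of "g (gam (fst q) (snd q))" "g (gam r \<theta>)"] by simp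
    qed
    ultimately show ?thesis by blast
  qed
  then obtain V C where V: "\<And>p. p \<in> {\<rho>..\<rho>+1} \<times> {0..pi} \<Longrightarrow> open (V p) \<and> p \<in> V p \<and> (\<forall>q\<in>V p. fst q > \<rho> \<longrightarrow> norm (f (fst q) (snd q)) \<le> C p)"
    by metis
  obtain D where D: "D \<subseteq> {\<rho>..\<rho>+1} \<times> {0..pi}" "finite D" "{\<rho>..\<rho>+1} \<times> {0..pi} \<subseteq> (\<Union>p\<in>D. V p)"
    by (rule compactE_image[of "{\<rho>..\<rho>+1} \<times> {0..pi}" "{\<rho>..\<rho>+1} \<times> {0..pi}" V]) (use V in \<open>auto intro!: compact_Times\<close>)
  have "norm (f r \<theta>) \<le> (\<Sum>p\<in>D. \<bar>C p\<bar>)" if "\<rho> < r" "r \<le> \<rho> + 1" "\<theta> \<in> {0..pi}" for r \<theta>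
  proof -
    have "(r, \<theta>) \<in> {\<rho>..\<rho>+1} \<times> {0..pi}" using that by simp
    then obtain p where p: "p \<in> D" "(r, \<theta>) \<in> V p" using D(3) by blast
    then have "norm (f r \<theta>) \<le> C p" using V[of p] D(1) that by force
    also have "\<dots> \<le> \<bar>C p\<bar>" by simp
    also have "\<dots> \<le> (\<Sum>p\<in>D. \<bar>C p\<bar>)" using p D by (intro member_le_sum) auto
    finally show ?thesis .
  qed
  then show ?thesis by blast
qed

text \<open>The tangent to the great circle turns with \<theta>, whereas \<open>Cn_on\<close> speaks
  of derivatives in fixed directions. It is therefore expanded in \<open>axis 1 1\<close> and
  \<open>axis 3 1\<close>, and the product rule gives the second derivative.\<close>

lemma locally_smooth_angular:
  assumes f: "locally_smooth \<rho> f" and r: "r > \<rho>"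
  obtains \<psi>1 \<psi>2 where "\<And>\<theta>. (f r has_vector_derivative \<psi>1 \<theta>) (at \<theta>)" "\<And>\<theta>. (\<psi>1 has_vector_derivative \<psi>2 \<theta>) (at \<theta>)"
proof -
  define \<psi>1 where "\<psi>1 \<theta> = vector_derivative (f r) (at \<theta>)" for \<theta>
  have main: "(f r has_vector_derivative \<psi>1 \<theta>) (at \<theta>) \<and> \<psi>1 differentiable (at \<theta>)" for \<theta>
  proof -
    obtain U g where U: "open U" "gam r \<theta> \<in> U" and g: "\<And>n. Cn_on U g n"
      and eq: "\<And>r' \<theta>'. r' > \<rho> \<Longrightarrow> gam r' \<theta>' \<in> U \<Longrightarrow> f r' \<theta>' = g (gam r' \<theta>')" using locally_smoothE[OF f, of r] r by (metis less_imp_le)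
    define S0 where "S0 = (\<lambda>\<theta>. (r, \<theta>)) -` {p. gam (fst p) (snd p) \<in> U}"
    have S0: "open S0" unfolding S0_def by (intro open_vimage open_gam_vimage U continuous_intros)
    have \<theta>S0: "\<theta> \<in> S0" using U by (simp add: S0_def)
    have Og: "gam r \<theta>' \<in> U" if "\<theta>' \<in> S0" for \<theta>' using that by (simp add: S0_def)
    define G where "G v p = frechet_derivative g (at p) v" for v p
    have Gd: "G v differentiable (at p)" if "p \<in> U" for v p
      unfolding G_def using Cn_on_frechet(2)[OF Cn_on_frechet(1)[OF g] that] .
    have 1: "(f r has_vector_derivative of_real (cos \<theta>') * G (0, axis 1 1) (gam r \<theta>') - of_real (sin \<theta>') * G (0, axis 3 1) (gam r \<theta>')) (at \<theta>')"
      if \<theta>': "\<theta>' \<in> S0" for \<theta>'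
    proof -
      have gd: "g differentiable (at (gam r \<theta>'))" by (rule Cn_on_frechet(2)[OF g Og[OF \<theta>']])
      then have lin: "linear (frechet_derivative g (at (gam r \<theta>')))"
        using frechet_derivative_works has_derivative_linear by blast
      have v: "(0, cos \<theta>' *\<^sub>R axis 1 1 - sin \<theta>' *\<^sub>R axis 3 1) = cos \<theta>' *\<^sub>R (0::real, axis 1 1 :: real^3) - sin \<theta>' *\<^sub>R (0, axis 3 1)" by simp
      have e: "frechet_derivative g (at (gam r \<theta>')) (0, cos \<theta>' *\<^sub>R axis 1 1 - sin \<theta>' *\<^sub>R axis 3 1)
        = of_real (cos \<theta>') * G (0, axis 1 1) (gam r \<theta>') - of_real (sin \<theta>') * G (0, axis 3 1) (gam r \<theta>')"
        unfolding v linear_diff[OF lin] linear_scale[OF lin] by (simp add: G_def scaleR_conv_of_real)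
      have "((\<lambda>\<theta>. g (gam r \<theta>)) has_vector_derivative of_real (cos \<theta>') * G (0, axis 1 1) (gam r \<theta>') - of_real (sin \<theta>') * G (0, axis 3 1) (gam r \<theta>')) (at \<theta>')"
        using has_vector_derivative_along_curve[OF gd gam_angular] unfolding e .
      then show ?thesis
        by (rule has_vector_derivative_transform_within_open[OF _ S0 \<theta>']) (use eq[OF r] Og in auto)
    qed
    have "(\<lambda>\<theta>'. of_real (cos \<theta>') * G (0, axis 1 1) (gam r \<theta>') - of_real (sin \<theta>') * G (0, axis 3 1) (gam r \<theta>')) differentiable (at \<theta>)"
    proof (intro differentiable_diff differentiable_mult)
      show "(\<lambda>\<theta>'. of_real (cos \<theta>') :: complex) differentiable (at \<theta>)" "(\<lambda>\<theta>'. of_real (sin \<theta>') :: complex) differentiable (at \<theta>)"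
        using has_vector_derivative_of_real[OF DERIV_cos] has_vector_derivative_of_real[OF DERIV_sin]
        by (auto simp: has_vector_derivative_def intro: differentiableI)
      show "(\<lambda>\<theta>'. G (0, axis 1 1) (gam r \<theta>')) differentiable (at \<theta>)" "(\<lambda>\<theta>'. G (0, axis 3 1) (gam r \<theta>')) differentiable (at \<theta>)"
        using has_vector_derivative_along_curve[OF Gd[OF Og[OF \<theta>S0]] gam_angular]
        unfolding has_vector_derivative_def by (auto intro: differentiableI)
    qed
    then obtain D where D: "((\<lambda>\<theta>'. of_real (cos \<theta>') * G (0, axis 1 1) (gam r \<theta>') - of_real (sin \<theta>') * G (0, axis 3 1) (gam r \<theta>')) has_derivative D) (at \<theta>)"
      unfolding differentiable_def by blast
    have "(\<psi>1 has_derivative D) (at \<theta>)"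
      by (rule has_derivative_transform_within_open[OF D S0 \<theta>S0]) (simp add: \<psi>1_def vector_derivative_at[OF 1])
    then show ?thesis using 1[OF \<theta>S0] by (auto simp: \<psi>1_def vector_derivative_at[OF 1[OF \<theta>S0]] intro: differentiableI)
  qed
  show thesis
    by (rule that[of \<psi>1 "\<lambda>\<theta>. vector_derivative \<psi>1 (at \<theta>)"]) (use main vector_derivative_works in blast)+
qed

section \<open>Separation of variables\<close>

text \<open>The coefficients of (r d/dr)^j (q \<omega>) in terms of the derivatives of \<omega>.
  Taking them from a holomorphic \<open>Q\<close> makes all their derivatives exist at no
  cost.\<close>

primrec leibniz_coeff :: "(complex \<Rightarrow> complex) \<Rightarrow> nat \<Rightarrow> nat \<Rightarrow> complex \<Rightarrow> complex" where
  "leibniz_coeff Q 0 = (\<lambda>i z. if i = 0 then Q z else 0)"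
| "leibniz_coeff Q (Suc j) = (\<lambda>i z. z * (deriv (leibniz_coeff Q j i) z + (if i = 0 then 0 else leibniz_coeff Q j (i - 1) z)))"

lemma leibniz_coeff_zero: "i > j \<Longrightarrow> leibniz_coeff Q j i = (\<lambda>z. 0)"
proof (induction j arbitrary: i)
  case (Suc j)
  then have "leibniz_coeff Q j i = (\<lambda>z. 0)" "leibniz_coeff Q j (i - 1) = (\<lambda>z. 0)" by auto
  then show ?case using Suc.prems by simp
qed (auto simp: fun_eq_iff)

lemma leibniz_coeff_holomorphic:
  assumes "open S" "Q holomorphic_on S"
  shows "leibniz_coeff Q j i holomorphic_on S"
proof (induction j arbitrary: i)
  case 0
  show ?case using assms(2) by (cases "i = 0") auto
next
  case (Suc j)
  show ?case
    by (cases "i = 0") (auto intro!: holomorphic_intros holomorphic_deriv Suc assms(1))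
qed

text \<open>A finite sum over plain derivatives, with coefficients independent of \<theta>, commutes
  with integration in \<theta>. That is how conormal bounds pass from the mode to its
  projection.\<close>

lemma r_ddr_leibniz:
  assumes Q: "Q holomorphic_on {z. Re z > \<rho>}" and q: "\<And>r. r > \<rho> \<Longrightarrow> q r = Q (of_real r)"
    and \<omega>: "\<And>i r. r > \<rho> \<Longrightarrow> (\<omega> i has_vector_derivative \<omega> (Suc i) r) (at r)" and r: "r > \<rho>"
  shows "(r_ddr ^^ j) (\<lambda>r. q r * \<omega> 0 r) r = (\<Sum>i\<le>j. leibniz_coeff Q j i (of_real r) * \<omega> i r)"
    and "\<exists>D. ((r_ddr ^^ j) (\<lambda>r. q r * \<omega> 0 r) has_vector_derivative D) (at r)"
proof -
  let ?L = "\<lambda>j r. \<Sum>i\<le>j. leibniz_coeff Q j i (of_real r) * \<omega> i r"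
  let ?D = "\<lambda>j r. \<Sum>i\<le>j. leibniz_coeff Q j i (of_real r) * \<omega> (Suc i) r + deriv (leibniz_coeff Q j i) (of_real r) * \<omega> i r"
  have op: "open {z. Re z > \<rho>}" by (rule open_halfspace_Re_gt)
  have d: "(?L j has_vector_derivative ?D j r) (at r)" if r: "r > \<rho>" for j r
  proof (rule has_vector_derivative_sum)
    fix i
    have "(leibniz_coeff Q j i has_field_derivative deriv (leibniz_coeff Q j i) (of_real r)) (at (of_real r))"
      by (rule holomorphic_derivI[OF leibniz_coeff_holomorphic[OF op Q] op]) (use r in simp)
    then have "((\<lambda>r. leibniz_coeff Q j i (of_real r)) has_vector_derivative deriv (leibniz_coeff Q j i) (of_real r)) (at r)"
      by (rule has_vector_derivative_real_field)
    from has_vector_derivative_mult[OF this \<omega>[OF r]]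
    show "((\<lambda>r. leibniz_coeff Q j i (of_real r) * \<omega> i r) has_vector_derivative
      leibniz_coeff Q j i (of_real r) * \<omega> (Suc i) r + deriv (leibniz_coeff Q j i) (of_real r) * \<omega> i r) (at r)" .
  qed
  have tr: "((r_ddr ^^ j) (\<lambda>r. q r * \<omega> 0 r) has_vector_derivative ?D j r) (at r)"
    if e: "\<And>r. r > \<rho> \<Longrightarrow> (r_ddr ^^ j) (\<lambda>r. q r * \<omega> 0 r) r = ?L j r" and r: "r > \<rho>" for j r
    by (rule has_vector_derivative_transform_within_open[OF d[OF r] open_greaterThan[of \<rho>]]) (use r e in auto)
  have main: "(r_ddr ^^ j) (\<lambda>r. q r * \<omega> 0 r) r = ?L j r" if "r > \<rho>" for j r
    using that
  proof (induction j arbitrary: r)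
    case 0
    then show ?case by (simp add: q)
  next
    case (Suc j)
    have "(r_ddr ^^ Suc j) (\<lambda>r. q r * \<omega> 0 r) r = of_real r * ?D j r"
      using vector_derivative_at[OF tr[OF Suc.IH Suc.prems]] by (simp add: r_ddr_def)
    also have "?D j r = (\<Sum>i\<le>j. leibniz_coeff Q j i (of_real r) * \<omega> (Suc i) r) + (\<Sum>i\<le>j. deriv (leibniz_coeff Q j i) (of_real r) * \<omega> i r)"
      by (rule sum.distrib)
    also have "(\<Sum>i\<le>j. deriv (leibniz_coeff Q j i) (of_real r) * \<omega> i r) = (\<Sum>i\<le>Suc j. deriv (leibniz_coeff Q j i) (of_real r) * \<omega> i r)"
      by (simp add: leibniz_coeff_zero)
    also have "(\<Sum>i\<le>j. leibniz_coeff Q j i (of_real r) * \<omega> (Suc i) r) = (\<Sum>i\<le>Suc j. (if i = 0 then 0 else leibniz_coeff Q j (i - 1) (of_real r)) * \<omega> i r)"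
      by (subst sum.atMost_Suc_shift) simp
    finally show ?case
      by (simp only: sum.distrib[symmetric] sum_distrib_left) (rule sum.cong, simp_all add: algebra_simps)
  qed
  show "(r_ddr ^^ j) (\<lambda>r. q r * \<omega> 0 r) r = ?L j r" by (rule main[OF r])
  show "\<exists>D. ((r_ddr ^^ j) (\<lambda>r. q r * \<omega> 0 r) has_vector_derivative D) (at r)"
    using tr[OF main r] by blast
qed

lemma has_vector_derivative_translate:
  assumes "(f has_vector_derivative D) (at (c + x))"
  shows "((\<lambda>x. f (c + x)) has_vector_derivative D) (at (x::real))"
proof -
  have "((\<lambda>x. c + x) has_vector_derivative 1) (at x)"
    unfolding has_real_derivative_iff_has_vector_derivative[symmetric] by (auto intro!: derivative_eq_intros)
  from vector_diff_chain_at[OF this assms] show ?thesis by (simp add: o_def)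
qed

lemma symb_translated_powr:
  assumes c: "c \<ge> 0"
  shows "symb n b (\<lambda>x. of_real ((c + x) powr b))"
proof (induction n arbitrary: b)
  have bound: "\<exists>C. \<forall>x>1. norm (of_real ((c + x) powr b) :: complex) \<le> C * x powr b" for b
  proof (cases "b \<ge> 0")
    case True
    have "(c + x) powr b \<le> (c + 1) powr b * x powr b" if x: "x > 1" for x
    proof -
      have "c + x \<le> (c + 1) * x" using mult_left_mono[of 1 x c] c x by (simp add: algebra_simps)
      then have "(c + x) powr b \<le> ((c + 1) * x) powr b" using True c x by (intro powr_mono2) auto
      then show ?thesis using c x by (simp add: powr_mult)
    qed
    then show ?thesis by (intro exI[of _ "(c + 1) powr b"]) auto
  next
    case False
    have "(c + x) powr b \<le> 1 * x powr b" if "x > 1" for x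
      using powr_mono2'[of b x "c + x"] False c that by simp
    then show ?thesis by (intro exI[of _ 1]) auto
  qed
  case 0
  show ?case using bound by simp
  case (Suc n)
  have d: "((\<lambda>x. of_real ((c + x) powr b) :: complex) has_vector_derivative of_real b * of_real ((c + x) powr (b - 1))) (at x)" if "x > 1" for x
  proof -
    have "((\<lambda>x. (c + x) powr b) has_real_derivative b * (c + x) powr (b - 1)) (at x)"
      using that c by (auto intro!: derivative_eq_intros)
    from has_vector_derivative_of_real[OF this] show ?thesis by simp
  qed
  show ?case
    unfolding symb.simps(2)
    by (intro conjI bound exI[of _ "\<lambda>x. of_real b * of_real ((c + x) powr (b - 1))"] allI impI d symb_cmult Suc.IH)
qed

text \<open>A derivative is 1/r times r d/dr: the first factor lowers the order by one, the second
  preserves boundedness.\<close>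

lemma conormal_symb:
  assumes \<rho>: "\<rho> \<ge> 0" and D: "\<And>j r. r > \<rho> \<Longrightarrow> \<exists>D. ((r_ddr ^^ j) F has_vector_derivative D) (at r)"
    and b: "\<And>j. \<exists>C. \<forall>r>\<rho> + 1. norm ((r_ddr ^^ j) F r) \<le> C"
  shows "symb n 0 (\<lambda>x. (r_ddr ^^ j) F (\<rho> + x))"
proof (induction n arbitrary: j)
  have bound: "\<exists>C. \<forall>x>1. norm ((r_ddr ^^ j) F (\<rho> + x)) \<le> C * x powr 0" for j
  proof -
    obtain C where C: "\<And>r. r > \<rho> + 1 \<Longrightarrow> norm ((r_ddr ^^ j) F r) \<le> C" using b by blast
    show ?thesis by (intro exI[of _ C] allI impI) (use C in simp)
  qed
  case 0
  show ?case using bound by simp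
  case (Suc n)
  have d: "((\<lambda>x. (r_ddr ^^ j) F (\<rho> + x)) has_vector_derivative of_real ((\<rho> + x) powr (- 1)) * (r_ddr ^^ Suc j) F (\<rho> + x)) (at x)" if x: "x > 1" for x
  proof -
    have "\<rho> + x > \<rho>" using x by simp
    then obtain D where D: "((r_ddr ^^ j) F has_vector_derivative D) (at (\<rho> + x))" using D by blast
    have "of_real ((\<rho> + x) powr (- 1)) * (r_ddr ^^ Suc j) F (\<rho> + x) = of_real ((\<rho> + x) powr (- 1) * (\<rho> + x)) * D"
      using vector_derivative_at[OF D] by (simp add: r_ddr_def)
    also have "(\<rho> + x) powr (- 1) * (\<rho> + x) = 1" using x \<rho> by (simp add: powr_minus_divide)
    finally show ?thesis using has_vector_derivative_translate[OF D] by simp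
  qed
  have s: "symb n (0 - 1) (\<lambda>x. of_real ((\<rho> + x) powr (- 1)) * (r_ddr ^^ Suc j) F (\<rho> + x))"
    using symb_mult[OF symb_translated_powr[OF \<rho>, of n "- 1"] Suc.IH[of "Suc j"]] by simp
  show ?case
    unfolding symb.simps(2)
    by (intro conjI bound exI[of _ "\<lambda>x. of_real ((\<rho> + x) powr (- 1)) * (r_ddr ^^ Suc j) F (\<rho> + x)"] allI impI d s)
qed

section \<open>The Teukolsky operator on modes\<close>

lemma D_t_mode:
  "D_t (\<lambda>t r \<phi> \<theta>. exp (- \<i> * of_real t * \<sigma> - \<i> * of_int k * of_real \<phi>) * c r \<theta>) t r \<phi> \<theta>
    = - \<i> * \<sigma> * (exp (- \<i> * of_real t * \<sigma> - \<i> * of_int k * of_real \<phi>) * c r \<theta>)"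
  unfolding D_t_def
proof (rule vector_derivative_at, rule has_vector_derivative_real_field[of "\<lambda>t. exp (- \<i> * t * \<sigma> - \<i> * of_int k * of_real \<phi>) * c r \<theta>"])
qed (auto intro!: derivative_eq_intros)

lemma D_phi_mode:
  "D_phi (\<lambda>t r \<phi> \<theta>. exp (- \<i> * of_real t * \<sigma> - \<i> * of_int k * of_real \<phi>) * c r \<theta>) t r \<phi> \<theta>
    = - \<i> * of_int k * (exp (- \<i> * of_real t * \<sigma> - \<i> * of_int k * of_real \<phi>) * c r \<theta>)"
  unfolding D_phi_def
proof (rule vector_derivative_at, rule has_vector_derivative_real_field[of "\<lambda>\<phi>. exp (- \<i> * of_real t * \<sigma> - \<i> * of_int k * \<phi>) * c r \<theta>"])
qed (auto intro!: derivative_eq_intros)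

definition radial_symbol :: "real \<Rightarrow> real \<Rightarrow> real \<Rightarrow> real \<Rightarrow> int \<Rightarrow> real \<Rightarrow> complex" where
  "radial_symbol m a s \<sigma> k r = \<i> * (of_real (r^2 + a^2) * of_real \<sigma> + of_real a * of_int k) + of_real ((r - m) * s)"

definition angular_symbol :: "real \<Rightarrow> real \<Rightarrow> real \<Rightarrow> int \<Rightarrow> real \<Rightarrow> real" where
  "angular_symbol a s \<sigma> k \<theta> = a * \<sigma> * (sin \<theta>)^2 + of_int k - s * cos \<theta>"

lemma radial_factor_mode:
  "radial_factor m a s (\<lambda>t r \<phi> \<theta>. exp (- \<i> * of_real t * of_real \<sigma> - \<i> * of_int k * of_real \<phi>) * c r \<theta>)
    = (\<lambda>t r \<phi> \<theta>. exp (- \<i> * of_real t * of_real \<sigma> - \<i> * of_int k * of_real \<phi>) * (- radial_symbol m a s \<sigma> k r * c r \<theta>))"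
  unfolding fun_eq_iff radial_factor_def D_t_mode D_phi_mode radial_symbol_def by (simp add: algebra_simps)

lemma angular_factor_mode:
  "angular_factor a s (\<lambda>t r \<phi> \<theta>. exp (- \<i> * of_real t * of_real \<sigma> - \<i> * of_int k * of_real \<phi>) * c r \<theta>)
    = (\<lambda>t r \<phi> \<theta>. exp (- \<i> * of_real t * of_real \<sigma> - \<i> * of_int k * of_real \<phi>) * (- \<i> * of_real (angular_symbol a s \<sigma> k \<theta>) * c r \<theta>))"
  unfolding fun_eq_iff angular_factor_def D_t_mode D_phi_mode angular_symbol_def by (simp add: algebra_simps)

text \<open>Writing the mode as exp (- H) w removes the double pole P^2 / mu: the square of the
  radial factor is cancelled by the second derivative of exp (- H), so that the radial side has
  coefficients regular at the horizon. Evaluation at t = \<phi> = 0 suffices, since the exponential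
  factors out.\<close>

lemma teukolsky_mode_equation:
  fixes w1 w2 \<psi>1 :: "real \<Rightarrow> complex" and \<psi>2 :: complex
  assumes T: "Teukolsky m a s (\<lambda>t r \<phi> \<theta>. exp (- \<i> * of_real t * of_real \<sigma> - \<i> * of_int k * of_real \<phi>) * u r \<theta>) 0 r 0 \<theta> = 0"
    and \<theta>: "\<theta> \<in> {0<..<pi}" and r: "r > \<rho>" and mu: "\<And>y. y > \<rho> \<Longrightarrow> mu m a y \<noteq> 0"
    and H: "\<And>y. y > \<rho> \<Longrightarrow> (H has_vector_derivative radial_symbol m a s \<sigma> k y / of_real (mu m a y)) (at y)"
    and u: "\<And>y \<eta>. y > \<rho> \<Longrightarrow> \<eta> \<in> {0<..<pi} \<Longrightarrow> u y \<eta> = exp (- H y) * w y \<eta>"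
    and w: "\<And>y. y > \<rho> \<Longrightarrow> ((\<lambda>y. w y \<theta>) has_vector_derivative w1 y) (at y)"
      "\<And>y. y > \<rho> \<Longrightarrow> (w1 has_vector_derivative w2 y) (at y)"
    and \<psi>: "\<And>\<eta>. (w r has_vector_derivative \<psi>1 \<eta>) (at \<eta>)" "(\<psi>1 has_vector_derivative \<psi>2) (at \<theta>)"
  shows "of_real (sin \<theta>) * \<psi>2 + of_real (cos \<theta>) * \<psi>1 \<theta>
    = of_real (sin \<theta>) * (of_real ((angular_symbol a s \<sigma> k \<theta>)\<^sup>2 / (sin \<theta>)\<^sup>2 + 4 * s * a * \<sigma> * cos \<theta>) * w r \<theta>
      - (of_real (mu m a r) * w2 r + (of_real (2 * r - 2 * m) - 2 * radial_symbol m a s \<sigma> k r) * w1 r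
         + (- (2 * \<i> * of_real (\<sigma> * r) + of_real s) + 4 * \<i> * of_real (s * \<sigma> * r)) * w r \<theta>))"
proof -
  define P where "P = radial_symbol m a s \<sigma> k"
  define E where "E y = exp (- H y)" for y
  define v where "v = (\<lambda>t r \<phi> \<theta>. exp (- \<i> * of_real t * of_real \<sigma> - \<i> * of_int k * of_real \<phi>) * u r \<theta>)"
  have E0: "E y \<noteq> 0" for y by (simp add: E_def)
  have Ed: "(E has_vector_derivative - (P y / of_real (mu m a y)) * E y) (at y)" if "y > \<rho>" for y
  proof -
    have "((\<lambda>y. - H y) has_vector_derivative - (P y / of_real (mu m a y))) (at y)"
      unfolding P_def by (rule has_vector_derivative_minus[OF H[OF that]])
    from field_vector_diff_chain_at[OF this DERIV_exp] show ?thesis by (simp add: o_def E_def[abs_def])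
  qed
  have Pd: "(P has_vector_derivative 2 * \<i> * of_real (\<sigma> * y) + of_real s) (at y)" for y
  proof -
    have e: "P = (\<lambda>r. \<i> * of_real (\<sigma> * (r^2 + a^2)) + (\<i> * of_real a * of_int k + of_real ((r - m) * s)))"
      by (auto simp: P_def radial_symbol_def fun_eq_iff algebra_simps)
    have 1: "((\<lambda>r. \<i> * of_real (\<sigma> * (r^2 + a^2))) has_vector_derivative \<i> * of_real (\<sigma> * (2 * y))) (at y)"
      by (rule has_vector_derivative_mult_right, rule has_vector_derivative_of_real) (auto intro!: derivative_eq_intros)
    have 2: "((\<lambda>r. of_real ((r - m) * s) :: complex) has_vector_derivative of_real s) (at y)"
      by (rule has_vector_derivative_of_real) (auto intro!: derivative_eq_intros)
    show ?thesis unfolding e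
      by (rule has_vector_derivative_eq_rhs[OF has_vector_derivative_add[OF 1 has_vector_derivative_add[OF has_vector_derivative_const 2]]]) simp
  qed
  have Dr: "D_r v 0 y 0 \<theta> = E y * w1 y + (- (P y / of_real (mu m a y)) * E y) * w y \<theta>" if y: "y > \<rho>" for y
    unfolding D_r_def
  proof (rule vector_derivative_at, rule has_vector_derivative_transform_within_open)
    show "((\<lambda>y. E y * w y \<theta>) has_vector_derivative E y * w1 y + (- (P y / of_real (mu m a y)) * E y) * w y \<theta>) (at y)"
      by (rule has_vector_derivative_mult[OF Ed[OF y] w(1)[OF y]])
    show "open {\<rho><..}" "y \<in> {\<rho><..}" using y by auto
    show "\<And>x. x \<in> {\<rho><..} \<Longrightarrow> E x * w x \<theta> = v 0 x 0 \<theta>" using u \<theta> by (simp add: v_def E_def)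
  qed
  define q where "q = P r / of_real (mu m a r)"
  have qm: "q * of_real (mu m a r) = P r" using mu[OF r] by (simp add: q_def)
  have Drr: "D_r (\<lambda>t r \<phi> \<theta>. of_real (mu m a r) * D_r v t r \<phi> \<theta>) 0 r 0 \<theta>
    = E r * ((of_real (mu m a r) * w2 r + of_real (2 * r - 2 * m) * w1 r) - (P r * w1 r + (2 * \<i> * of_real (\<sigma> * r) + of_real s) * w r \<theta>))
      + (- q * E r) * (of_real (mu m a r) * w1 r - P r * w r \<theta>)"
    unfolding D_r_def[of "\<lambda>t r \<phi> \<theta>. of_real (mu m a r) * D_r v t r \<phi> \<theta>"]
  proof (rule vector_derivative_at, rule has_vector_derivative_transform_within_open)
    have md: "((\<lambda>r. of_real (mu m a r) :: complex) has_vector_derivative of_real (2 * r - 2 * m)) (at r)"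
      unfolding mu_def by (rule has_vector_derivative_of_real) (auto intro!: derivative_eq_intros)
    show "((\<lambda>y. E y * (of_real (mu m a y) * w1 y - P y * w y \<theta>)) has_vector_derivative
      E r * ((of_real (mu m a r) * w2 r + of_real (2 * r - 2 * m) * w1 r) - (P r * w1 r + (2 * \<i> * of_real (\<sigma> * r) + of_real s) * w r \<theta>))
      + (- q * E r) * (of_real (mu m a r) * w1 r - P r * w r \<theta>)) (at r)"
      unfolding q_def
      by (rule has_vector_derivative_mult[OF Ed[OF r] has_vector_derivative_diff[OF has_vector_derivative_mult[OF md w(2)[OF r]]
            has_vector_derivative_mult[OF Pd w(1)[OF r]]]])
    show "open {\<rho><..}" "r \<in> {\<rho><..}" using r by auto
    fix y assume "y \<in> {\<rho><..}"
    then have y: "y > \<rho>" by simp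
    define qy where "qy = P y / of_real (mu m a y)"
    have "qy * of_real (mu m a y) = P y" using mu[OF y] by (simp add: qy_def)
    then have "of_real (mu m a y) * (E y * w1 y + (- qy * E y) * w y \<theta>) = E y * (of_real (mu m a y) * w1 y - P y * w y \<theta>)"
      by (simp add: algebra_simps flip: \<open>qy * of_real (mu m a y) = P y\<close>)
    then show "E y * (of_real (mu m a y) * w1 y - P y * w y \<theta>) = of_real (mu m a y) * D_r v 0 y 0 \<theta>"
      unfolding Dr[OF y] qy_def by simp
  qed
  have Dth: "D_theta v 0 r 0 \<eta> = E r * \<psi>1 \<eta>" if \<eta>: "\<eta> \<in> {0<..<pi}" for \<eta>
    unfolding D_theta_def
  proof (rule vector_derivative_at, rule has_vector_derivative_transform_within_open)
    show "((\<lambda>\<eta>. E r * w r \<eta>) has_vector_derivative E r * \<psi>1 \<eta>) (at \<eta>)"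
      by (rule has_vector_derivative_mult_right[OF \<psi>(1)])
    show "open {0<..<pi}" "\<eta> \<in> {0<..<pi}" using \<eta> by auto
    show "\<And>x. x \<in> {0<..<pi} \<Longrightarrow> E r * w r x = v 0 r 0 x" using u r by (simp add: v_def E_def)
  qed
  define y where "y = of_real (sin \<theta>) * \<psi>2 + of_real (cos \<theta>) * \<psi>1 \<theta>"
  have Dtt: "D_theta (\<lambda>t r \<phi> \<theta>. of_real (sin \<theta>) * D_theta v t r \<phi> \<theta>) 0 r 0 \<theta> = E r * y"
    unfolding D_theta_def[of "\<lambda>t r \<phi> \<theta>. of_real (sin \<theta>) * D_theta v t r \<phi> \<theta>"]
  proof (rule vector_derivative_at, rule has_vector_derivative_transform_within_open)
    show "((\<lambda>\<eta>. E r * (of_real (sin \<eta>) * \<psi>1 \<eta>)) has_vector_derivative E r * y) (at \<theta>)"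
      unfolding y_def by (rule has_vector_derivative_mult_right[OF has_vector_derivative_mult[OF has_vector_derivative_of_real[OF DERIV_sin] \<psi>(2)]])
    show "open {0<..<pi}" "\<theta> \<in> {0<..<pi}" using \<theta> by auto
    show "\<And>x. x \<in> {0<..<pi} \<Longrightarrow> E r * (of_real (sin x) * \<psi>1 x) = of_real (sin x) * D_theta v 0 r 0 x" using Dth by simp
  qed
  define S where "S = (of_real (sin \<theta>) :: complex)"
  have S0: "S \<noteq> 0" using \<theta> sin_gt_zero[of \<theta>] by (simp add: S_def)
  define B where "B = (of_real (angular_symbol a s \<sigma> k \<theta>) :: complex)"
  define C where "C = (of_real (cos \<theta>) :: complex)"
  have ur: "u r \<theta> = E r * w r \<theta>" using u[OF r \<theta>] by (simp add: E_def)
  have T': "Teukolsky m a s v 0 r 0 \<theta> = 0" using T by (simp only: v_def)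
  have rf: "radial_factor m a s (radial_factor m a s v) 0 r 0 \<theta> = P r * P r * (E r * w r \<theta>)"
    unfolding v_def radial_factor_mode by (simp add: ur P_def)
  have af: "angular_factor a s (angular_factor a s v) 0 r 0 \<theta> = - (B * B) * (E r * w r \<theta>)"
    unfolding v_def angular_factor_mode by (simp add: ur B_def algebra_simps)
  have dt: "D_t v 0 r 0 \<theta> = - \<i> * of_real \<sigma> * (E r * w r \<theta>)"
    unfolding v_def D_t_mode by (simp add: ur)
  have i: "of_real (1 / mu m a r) * (P r * P r) = q * P r" "of_real (1 / sin \<theta>) = 1 / S" "of_real (1 / (sin \<theta>)\<^sup>2) = 1 / S\<^sup>2"
    by (simp_all add: q_def S_def)
  have "E r * (- (of_real (mu m a r) * w2 r + of_real (2 * r - 2 * m) * w1 r - 2 * P r * w1 r - (2 * \<i> * of_real (\<sigma> * r) + of_real s) * w r \<theta>)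
     - 4 * of_real s * (of_real r + \<i> * of_real a * C) * (\<i> * of_real \<sigma>) * w r \<theta> - 1 / S * y + 1 / S\<^sup>2 * (B * B) * w r \<theta>) = 0"
  proof -
    have f1: "- (E r * ((of_real (mu m a r) * w2 r + of_real (2 * r - 2 * m) * w1 r) - (P r * w1 r + (2 * \<i> * of_real (\<sigma> * r) + of_real s) * w r \<theta>))
      + (- q * E r) * (of_real (mu m a r) * w1 r - P r * w r \<theta>)) + (of_real (1 / mu m a r) * (P r * P r)) * (E r * w r \<theta>)
      + of_real (4 * s) * (of_real r + \<i> * of_real a * C) * (- \<i> * of_real \<sigma> * (E r * w r \<theta>)) - 1 / S * (E r * y)
      - 1 / S\<^sup>2 * (- (B * B) * (E r * w r \<theta>)) = 0"
      using T' unfolding Teukolsky_def Drr rf af dt Dtt i(2,3) by (simp add: C_def mult.assoc)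
    have f2: "(- q * E r) * (of_real (mu m a r) * w1 r - P r * w r \<theta>) = - (E r * ((q * of_real (mu m a r)) * w1 r)) + q * P r * (E r * w r \<theta>)"
      by (simp add: algebra_simps)
    show ?thesis using f1[unfolded i(1) f2[unfolded qm]] by (simp add: algebra_simps)
  qed
  then have "- (of_real (mu m a r) * w2 r + of_real (2 * r - 2 * m) * w1 r - 2 * P r * w1 r - (2 * \<i> * of_real (\<sigma> * r) + of_real s) * w r \<theta>)
     - 4 * of_real s * (of_real r + \<i> * of_real a * C) * (\<i> * of_real \<sigma>) * w r \<theta> - 1 / S * y + 1 / S\<^sup>2 * (B * B) * w r \<theta> = 0"
    using E0 by simp
  then have "1 / S * y = - (of_real (mu m a r) * w2 r + of_real (2 * r - 2 * m) * w1 r - 2 * P r * w1 r - (2 * \<i> * of_real (\<sigma> * r) + of_real s) * w r \<theta>)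
     - 4 * of_real s * (of_real r + \<i> * of_real a * C) * (\<i> * of_real \<sigma>) * w r \<theta> + 1 / S\<^sup>2 * (B * B) * w r \<theta>"
    by (simp add: algebra_simps)
  then have ye: "S * (1 / S * y) = S * (- (of_real (mu m a r) * w2 r + of_real (2 * r - 2 * m) * w1 r - 2 * P r * w1 r - (2 * \<i> * of_real (\<sigma> * r) + of_real s) * w r \<theta>)
     - 4 * of_real s * (of_real r + \<i> * of_real a * C) * (\<i> * of_real \<sigma>) * w r \<theta> + 1 / S\<^sup>2 * (B * B) * w r \<theta>)"
    by (simp only:)
  have yy: "S * (1 / S * y) = y" using S0 by simp
  have e3: "of_real ((angular_symbol a s \<sigma> k \<theta>)\<^sup>2 / (sin \<theta>)\<^sup>2 + 4 * s * a * \<sigma> * cos \<theta>)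
      = 1 / S\<^sup>2 * (B * B) + 4 * of_real s * of_real a * of_real \<sigma> * C"
    by (simp add: S_def B_def C_def power2_eq_square)
  show ?thesis
    unfolding y_def[symmetric] e3 unfolding S_def[symmetric] P_def[symmetric]
    by (rule trans[OF ye[unfolded yy]]) (simp add: algebra_simps)
qed

text \<open>\<open>vector_derivative\<close> is a choice determined by the derivative predicate, so
  the predicates for both functions are shown to agree; differentiability is not assumed.\<close>

lemma r_ddr_cong:
  assumes "\<And>r. r > \<rho> \<Longrightarrow> f r = g r" "r > \<rho>"
  shows "(r_ddr ^^ j) f r = (r_ddr ^^ j) g r"
  using assms(2)
proof (induction j arbitrary: r)
  case 0
  then show ?case using assms(1) by simp
next
  case (Suc j)
  have iff: "((r_ddr ^^ j) f has_vector_derivative D) (at r) \<longleftrightarrow> ((r_ddr ^^ j) g has_vector_derivative D) (at r)" for D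
    using has_vector_derivative_transform_within_open[of "(r_ddr ^^ j) f" D r "{\<rho><..}" "(r_ddr ^^ j) g"]
      has_vector_derivative_transform_within_open[of "(r_ddr ^^ j) g" D r "{\<rho><..}" "(r_ddr ^^ j) f"] Suc
    by auto
  have e: "(r_ddr ^^ Suc j) h r = of_real r * vector_derivative ((r_ddr ^^ j) h) (at r)" for h
    by (simp add: r_ddr_def[of "(r_ddr ^^ j) h"])
  show ?case unfolding e vector_derivative_def iff ..
qed

text \<open>The derivative of H is the restriction of a function holomorphic on a convex half-plane.
  A primitive of it agrees with H on the real half-line up to a constant, and the power is exp
  (\<beta> Ln z), defined there because \<rho> \<ge> 0.\<close>

lemma weighted_phase_holomorphic:
  assumes \<rho>: "\<rho> \<ge> 0" and p: "p holomorphic_on {z. Re z > \<rho>}"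
    and H: "\<And>r. r > \<rho> \<Longrightarrow> (H has_vector_derivative p (of_real r)) (at r)"
  shows "\<exists>Q. Q holomorphic_on {z. Re z > \<rho>} \<and> (\<forall>r>\<rho>. of_real (r powr \<beta>) * exp (- 2 * H r) = Q (of_real r))"
proof -
  define S where "S = {z. Re z > \<rho>}"
  have S: "open S" "convex S" unfolding S_def by (auto simp: open_halfspace_Re_gt convex_halfspace_Re_gt)
  obtain g where g0: "\<And>z. z \<in> S \<Longrightarrow> (g has_field_derivative p z) (at z within S)"
    using holomorphic_convex_primitive'[OF S(2,1) p[folded S_def]] by blast
  have g: "(g has_field_derivative p z) (at z)" if "z \<in> S" for z
    using g0[OF that] unfolding at_within_open[OF that S(1)] .
  have gh: "g holomorphic_on S" unfolding holomorphic_on_open[OF S(1)] using g by blast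
  have zero: "((\<lambda>r. g (of_real r) - H r) has_vector_derivative 0) (at r)" if "r > \<rho>" for r
  proof -
    have "(g has_field_derivative p (of_real r)) (at (of_real r))" using that by (intro g) (simp add: S_def)
    from has_vector_derivative_diff[OF has_vector_derivative_real_field[OF this] H[OF that]] show ?thesis by simp
  qed
  have "\<exists>c. \<forall>r\<in>{\<rho><..}. g (of_real r) - H r = c"
  proof (rule has_derivative_zero_constant)
    show "convex {\<rho><..}" by simp
    fix r assume "r \<in> {\<rho><..}"
    then show "((\<lambda>r. g (of_real r) - H r) has_derivative (\<lambda>h. 0)) (at r within {\<rho><..})"
      using zero[of r] by (auto simp: has_vector_derivative_def intro: has_derivative_at_withinI)
  qed
  then obtain c where c: "\<And>r. r > \<rho> \<Longrightarrow> g (of_real r) - H r = c" by auto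
  have nz: "z \<notin> \<real>\<^sub>\<le>\<^sub>0" if "z \<in> S" for z using that \<rho> by (auto simp: S_def complex_nonpos_Reals_iff)
  show ?thesis
    unfolding S_def[symmetric]
  proof (intro exI[of _ "\<lambda>z. exp (of_real \<beta> * Ln z) * exp (2 * c - 2 * g z)"] conjI allI impI)
    show "(\<lambda>z. exp (of_real \<beta> * Ln z) * exp (2 * c - 2 * g z)) holomorphic_on S"
      by (intro holomorphic_intros gh nz)
    fix r assume r: "r > \<rho>"
    then have Hr: "H r = g (of_real r) - c" using c[OF r] by (simp add: algebra_simps)
    have pw: "of_real (r powr \<beta>) = exp (of_real \<beta> * Ln (of_real r))"
    proof -
      have "r powr \<beta> = exp (\<beta> * ln r)" using r \<rho> by (simp add: powr_def)
      then show ?thesis using r \<rho> by (simp add: Ln_of_real exp_of_real[symmetric])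
    qed
    show "of_real (r powr \<beta>) * exp (- 2 * H r) = exp (of_real \<beta> * Ln (of_real r)) * exp (2 * c - 2 * g (of_real r))"
      unfolding Hr pw by (simp add: algebra_simps)
  qed
qed

section \<open>From the mode to the radial equation\<close>

theorem theorem1p5:
  fixes m a s \<sigma> :: real and k :: int
    and H :: "real \<Rightarrow> complex" and u :: "real \<Rightarrow> real \<Rightarrow> complex"
  assumes "m > 0" and "\<bar>a\<bar> \<le> m" and "\<sigma> \<noteq> 0"
    and "phase_function m a s (of_real \<sigma>) k H"
    and "quasinormal_mode_solution m a s (of_real \<sigma>) k H u"
  shows "\<forall>r>r_plus m a. \<forall>\<theta>\<in>{0<..<pi}. u r \<theta> = 0"
proof (rule ccontr)
  assume contra: "\<not> ?thesis"
  define \<rho> where "\<rho> = r_plus m a"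
  define \<delta> where "\<delta> = sqrt (m^2 - a^2)"
  define d where "d = 2 * \<delta>"
  have "a^2 \<le> m^2" using assms(1,2) abs_le_square_iff[of a m] by simp
  then have \<delta>: "\<delta> \<ge> 0" "\<delta> * \<delta> = m * m - a * a" by (auto simp: \<delta>_def power2_eq_square)
  have d: "d \<ge> 0" using \<delta> by (simp add: d_def)
  have \<rho>: "\<rho> = m + \<delta>" by (simp add: \<rho>_def r_plus_def \<delta>_def)
  have \<rho>0: "\<rho> > 0" using \<rho> \<delta> assms(1) by simp
  have mu_eq: "mu m a (\<rho> + x) = x * (x + d)" for x
    using \<delta>(2) by (simp add: mu_def \<rho> d_def power2_eq_square algebra_simps)
  have mu_pos: "mu m a r > 0" if "r > \<rho>" for r
    using mu_eq[of "r - \<rho>"] that d by (simp add: mult_pos_pos)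
  define P where "P = radial_symbol m a s \<sigma> k"
  have Hd: "(H has_vector_derivative P r / of_real (mu m a r)) (at r)" if r: "r > \<rho>" for r
  proof -
    have "r \<notin> {r_minus m a, r_plus m a}" using r \<delta> unfolding \<rho> by (auto simp: r_minus_def r_plus_def \<delta>_def)
    then show ?thesis using assms(4) by (simp add: phase_function_def P_def radial_symbol_def)
  qed
  obtain F where F: "smooth_on ({\<rho>..} \<times> sphere 0 1) F"
    "\<And>r \<phi> \<theta>. r > \<rho> \<Longrightarrow> \<theta> \<in> {0<..<pi} \<Longrightarrow> F (r, sph \<phi> \<theta>) = exp (- \<i> * of_int k * of_real \<phi>) * (exp (H r) * u r \<theta>)"
    using assms(5) unfolding quasinormal_mode_solution_def extends_smoothly_def \<rho>_def by blast
  \<comment> \<open>Radial derivatives of the smooth extension on the great circle, used in place of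
    exp H times \<open>u\<close>: they are defined for every \<theta>, the poles included, and agree
    with it at \<phi> = 0 between the poles.\<close>
  define w where "w j = ((\<lambda>f r \<theta>. vector_derivative (\<lambda>r. f r \<theta>) (at r)) ^^ j) (\<lambda>r \<theta>. F (gam r \<theta>))" for j
  have gS: "gam r \<theta> \<in> {\<rho>..} \<times> sphere 0 1" if "r \<ge> \<rho>" for r \<theta>
  proof -
    have "(norm (sph 0 \<theta>))\<^sup>2 = 1" unfolding power2_norm_eq_inner by (simp add: inner_vec_def sum_3 sph_def power2_eq_square[symmetric])
    then have "norm (sph 0 \<theta>) = 1" by (intro power2_eq_imp_eq[of "norm (sph 0 \<theta>)" 1]) auto
    then show ?thesis using that by (simp add: gam_def)
  qed
  have ls: "locally_smooth \<rho> (w j)" for j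
  proof (induction j)
    case 0
    show ?case unfolding locally_smooth_def
    proof (intro allI impI)
      fix r \<theta> assume "r \<ge> \<rho>"
      then obtain U g where "open U" "gam r \<theta> \<in> U" "\<forall>n. Cn_on U g n" "\<forall>y\<in>({\<rho>..} \<times> sphere 0 1) \<inter> U. g y = F y"
        using F(1) gS unfolding smooth_on_def by meson
      then show "\<exists>U g. open U \<and> gam r \<theta> \<in> U \<and> (\<forall>n. Cn_on U g n) \<and> (\<forall>r'>\<rho>. \<forall>\<theta>'. gam r' \<theta>' \<in> U \<longrightarrow> w 0 r' \<theta>' = g (gam r' \<theta>'))"
        using gS by (intro exI[of _ U] exI[of _ g]) (auto simp: w_def)
    qed
  next
    case (Suc j)
    then show ?case using locally_smooth_radial(1)[OF Suc] by (simp add: w_def)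
  qed
  have wd: "((\<lambda>r. w j r \<theta>) has_vector_derivative w (Suc j) r \<theta>) (at r)" if "r > \<rho>" for j r \<theta>
    using locally_smooth_radial(2)[OF ls that, of j \<theta>] by (simp add: w_def)
  have u_eq: "u r \<theta> = exp (- H r) * w 0 r \<theta>" if "r > \<rho>" "\<theta> \<in> {0<..<pi}" for r \<theta>
    using F(2)[OF that, of 0] by (simp add: w_def gam_def mult.assoc[symmetric] exp_add[symmetric])
  have wc: "continuous_on {0..pi} (w j r)" if "r > \<rho>" for j r
  proof -
    have "continuous_on {0..pi} (\<lambda>\<theta>. (\<lambda>(r, \<theta>). w j r \<theta>) (r, \<theta>))"
      by (rule continuous_on_compose2[OF locally_smooth_continuous[OF ls[of j]]]) (use that in \<open>auto intro!: continuous_intros\<close>)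
    then show ?thesis by simp
  qed
  have "\<exists>\<psi>1 \<psi>2. \<forall>\<theta>. (w 0 r has_vector_derivative \<psi>1 \<theta>) (at \<theta>) \<and> (\<psi>1 has_vector_derivative \<psi>2 \<theta>) (at \<theta>)" if "r > \<rho>" for r
    using locally_smooth_angular[OF ls[of 0] that] by metis
  then obtain \<psi>1 \<psi>2 where \<psi>: "\<And>r \<theta>. r > \<rho> \<Longrightarrow> (w 0 r has_vector_derivative \<psi>1 r \<theta>) (at \<theta>)"
    "\<And>r \<theta>. r > \<rho> \<Longrightarrow> (\<psi>1 r has_vector_derivative \<psi>2 r \<theta>) (at \<theta>)" by metis
  \<comment> \<open>The radial operator applied to the mode at fixed \<theta>. By separation it
    equals the angular operator applied to \<open>w 0 r\<close>, so every slice gives a tuple for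
    the angular theory.\<close>
  define h where "h r \<theta> = of_real (mu m a r) * w 2 r \<theta> + (of_real (2 * r - 2 * m) - 2 * P r) * w 1 r \<theta>
    + (- (2 * \<i> * of_real (\<sigma> * r) + of_real s) + 4 * \<i> * of_real (s * \<sigma> * r)) * w 0 r \<theta>" for r \<theta>
  define V where "V \<theta> = (angular_symbol a s \<sigma> k \<theta>)\<^sup>2 / (sin \<theta>)\<^sup>2 + 4 * s * a * \<sigma> * cos \<theta>" for \<theta>
  define p where "p r = (w 0 r, \<psi>1 r, \<psi>2 r, h r)" for r
  have hc: "continuous_on {0..pi} (h r)" if "r > \<rho>" for r unfolding h_def by (intro continuous_intros wc that)
  have sol: "angular_solution V (p r)" if r: "r > \<rho>" for r
    unfolding angular_solution_def p_def prod.case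
  proof (intro conjI allI ballI \<psi>[OF r] hc[OF r])
    fix \<theta> :: real assume \<theta>: "\<theta> \<in> {0<..<pi}"
    have "mode_solution m a s (of_real \<sigma>) k u" using assms(5) by (simp add: quasinormal_mode_solution_def)
    then have T: "Teukolsky m a s (\<lambda>t r \<phi> \<theta>. exp (- \<i> * of_real t * of_real \<sigma> - \<i> * of_int k * of_real \<phi>) * u r \<theta>) 0 r 0 \<theta> = 0"
      using r \<theta> by (simp only: mode_solution_def \<rho>_def)
    show "of_real (sin \<theta>) * \<psi>2 r \<theta> + of_real (cos \<theta>) * \<psi>1 r \<theta> = of_real (sin \<theta>) * (of_real (V \<theta>) * w 0 r \<theta> - h r \<theta>)"
      unfolding V_def h_def P_def
    proof (rule teukolsky_mode_equation[OF T \<theta> r])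
      show "(H has_vector_derivative radial_symbol m a s \<sigma> k y / of_real (mu m a y)) (at y)" if "y > \<rho>" for y
        using Hd[OF that] unfolding P_def .
      show "u y \<eta> = exp (- H y) * w 0 y \<eta>" if "y > \<rho>" "\<eta> \<in> {0<..<pi}" for y \<eta> by (rule u_eq[OF that])
      show "(w 0 r has_vector_derivative \<psi>1 r \<eta>) (at \<eta>)" "(\<psi>1 r has_vector_derivative \<psi>2 r \<theta>) (at \<theta>)" for \<eta>
        by (rule \<psi>[OF r])+
      show "mu m a y \<noteq> 0" if "y > \<rho>" for y using mu_pos[OF that] by simp
      show "((\<lambda>y. w 0 y \<theta>) has_vector_derivative w 1 y \<theta>) (at y)" if "y > \<rho>" for y using wd[OF that, of 0] by simp
      show "((\<lambda>y. w 1 y \<theta>) has_vector_derivative w 2 y \<theta>) (at y)" if "y > \<rho>" for y using wd[OF that, of 1] by (simp add: numeral_2_eq_2)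
    qed
  qed
  have Vlow: "V \<theta> \<ge> - \<bar>4 * s * a * \<sigma>\<bar>" for \<theta>
  proof -
    have "\<bar>4 * s * a * \<sigma> * cos \<theta>\<bar> \<le> \<bar>4 * s * a * \<sigma>\<bar> * 1" unfolding abs_mult[of _ "cos \<theta>"] by (intro mult_left_mono) auto
    then have "- \<bar>4 * s * a * \<sigma>\<bar> \<le> 4 * s * a * \<sigma> * cos \<theta>" by linarith
    moreover have "0 \<le> (angular_symbol a s \<sigma> k \<theta>)\<^sup>2 / (sin \<theta>)\<^sup>2" by simp
    ultimately show ?thesis unfolding V_def by linarith
  qed
  obtain r1 \<theta>1 where r1: "r1 > \<rho>" "\<theta>1 \<in> {0<..<pi}" "u r1 \<theta>1 \<noteq> 0" using contra by (auto simp: \<rho>_def)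
  then have "fst (p r1) \<theta>1 \<noteq> 0" using u_eq[OF r1(1,2)] by (auto simp: p_def)
  then have nz: "fst (p r1) \<theta>1 \<noteq> 0" .
  obtain lam :: real and X where X: "continuous_on {0..pi} X"
    "\<And>q. q \<in> p ` {\<rho><..} \<Longrightarrow> integral {0..pi} (\<lambda>\<theta>. (snd (snd (snd q)) \<theta> - of_real lam * fst q \<theta>) * X \<theta>) = 0"
    "\<exists>q\<in>p ` {\<rho><..}. integral {0..pi} (\<lambda>\<theta>. fst q \<theta> * X \<theta>) \<noteq> 0"
  proof (rule angular_eigenfunctional[of "p ` {\<rho><..}" V "\<bar>4 * s * a * \<sigma>\<bar>" "p r1" \<theta>1])
    show "angular_solution V q" if "q \<in> p ` {\<rho><..}" for q using that sol by auto
    show "V \<theta> \<ge> - \<bar>4 * s * a * \<sigma>\<bar>" for \<theta> by (rule Vlow)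
    show "p r1 \<in> p ` {\<rho><..}" using r1(1) by simp
    show "\<theta>1 \<in> {0<..<pi}" by (rule r1(2))
    show "fst (p r1) \<theta>1 \<noteq> 0" by (rule nz)
  qed (rule that, assumption, (blast | simp), assumption)
  \<comment> \<open>Projection of the mode and of its radial derivatives onto the functional found
    above.\<close>
  define c where "c j r = integral {0..pi} (\<lambda>\<theta>. w j r \<theta> * X \<theta>)" for j r
  have wXi: "(\<lambda>\<theta>. w j r \<theta> * X \<theta>) integrable_on {0..pi}" if "r > \<rho>" for j r
    by (intro integrable_continuous_real continuous_intros wc X that)
  have cd: "(c j has_vector_derivative c (Suc j) r) (at r)" if r: "r > \<rho>" for j r
  proof -
    have "((\<lambda>r. integral (cbox 0 pi) (\<lambda>\<theta>. w j r \<theta> * X \<theta>)) has_vector_derivative integral (cbox 0 pi) (\<lambda>\<theta>. w (Suc j) r \<theta> * X \<theta>)) (at r within {\<rho><..})"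
    proof (rule leibniz_rule_vector_derivative)
      show "((\<lambda>r. w j r \<theta> * X \<theta>) has_vector_derivative w (Suc j) y \<theta> * X \<theta>) (at y within {\<rho><..})" if "y \<in> {\<rho><..}" for y \<theta>
        by (rule has_vector_derivative_at_within[OF has_vector_derivative_mult_left[OF wd]]) (use that in simp)
      show "(\<lambda>\<theta>. w j y \<theta> * X \<theta>) integrable_on cbox 0 pi" if "y \<in> {\<rho><..}" for y using wXi[of y j] that by simp
      have "continuous_on ({\<rho><..} \<times> cbox 0 pi) (\<lambda>q. (\<lambda>(r, \<theta>). w (Suc j) r \<theta>) q * X (snd q))"
        by (rule continuous_on_mult[OF continuous_on_subset[OF locally_smooth_continuous[OF ls]]
              continuous_on_compose2[OF X(1) continuous_on_snd[OF continuous_on_id]]]) auto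
      then show "continuous_on ({\<rho><..} \<times> cbox 0 pi) (\<lambda>(y, \<theta>). w (Suc j) y \<theta> * X \<theta>)" by (simp add: case_prod_beta)
    qed (use r in auto)
    moreover have "at r within {\<rho><..} = at r" by (rule at_within_open) (use r in auto)
    ultimately show ?thesis by (simp add: c_def[abs_def])
  qed
  \<comment> \<open>The eigenfunctional property says that \<open>h\<close> and
    \<open>lam * w\<close> have the same projection; since \<open>h\<close> is a radial combination
    of \<open>w 2\<close>, \<open>w 1\<close> and \<open>w 0\<close>, this is the radial
    equation.\<close>
  have c_ode: "of_real (mu m a r) * c 2 r + (of_real (2 * r - 2 * m) - 2 * P r) * c 1 r
    + (- (2 * \<i> * of_real (\<sigma> * r) + of_real s) + 4 * \<i> * of_real (s * \<sigma> * r) - of_real lam) * c 0 r = 0" if r: "r > \<rho>" for r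
  proof -
    define A B C where "A = (of_real (mu m a r) :: complex)" and "B = of_real (2 * r - 2 * m) - 2 * P r"
      and "C = - (2 * \<i> * of_real (\<sigma> * r) + of_real s) + 4 * \<i> * of_real (s * \<sigma> * r) - of_real lam"
    have i: "((\<lambda>\<theta>. K * (w j r \<theta> * X \<theta>)) has_integral K * c j r) {0..pi}" for K j
      unfolding c_def by (intro has_integral_mult_right integrable_integral wXi r)
    have hi: "((\<lambda>\<theta>. A * (w 2 r \<theta> * X \<theta>) + B * (w 1 r \<theta> * X \<theta>) + C * (w 0 r \<theta> * X \<theta>)) has_integral A * c 2 r + B * c 1 r + C * c 0 r) {0..pi}"
      by (intro has_integral_add i)
    have eqf: "(\<lambda>\<theta>. A * (w 2 r \<theta> * X \<theta>) + B * (w 1 r \<theta> * X \<theta>) + C * (w 0 r \<theta> * X \<theta>)) = (\<lambda>\<theta>. (h r \<theta> - of_real lam * w 0 r \<theta>) * X \<theta>)"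
      unfolding h_def A_def[symmetric] B_def[symmetric] C_def by (simp add: algebra_simps)
    have "integral {0..pi} (\<lambda>\<theta>. (h r \<theta> - of_real lam * w 0 r \<theta>) * X \<theta>) = 0"
      using X(2)[of "p r"] r by (simp add: p_def)
    then show ?thesis unfolding A_def[symmetric] B_def[symmetric] C_def[symmetric] using integral_unique[OF hi[unfolded eqf]] by simp
  qed
  have "bounded (X ` {0..pi})" by (intro compact_imp_bounded compact_continuous_image X compact_Icc)
  then obtain BX where "\<forall>y\<in>X ` {0..pi}. norm y \<le> BX" unfolding bounded_iff by blast
  then have BX: "norm (X \<theta>) \<le> BX" if "\<theta> \<in> {0..pi}" for \<theta> using that by blast
  have bound: "norm (integral {0..pi} (\<lambda>\<theta>. f \<theta> * X \<theta>)) \<le> C * BX * (pi - 0)"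
    if "continuous_on {0..pi} f" "\<And>\<theta>. \<theta> \<in> {0..pi} \<Longrightarrow> norm (f \<theta>) \<le> C" for f and C :: real
  proof (rule integral_bound)
    show "continuous_on {0..pi} (\<lambda>\<theta>. f \<theta> * X \<theta>)" by (intro continuous_intros that X)
    show "\<And>t. t \<in> {0..pi} \<Longrightarrow> norm (f t * X t) \<le> C * BX"
      unfolding norm_mult using that(2) BX order_trans[OF norm_ge_zero that(2)] by (intro mult_mono) auto
  qed simp
  obtain \<beta> where \<beta>: "\<And>j. \<exists>C. \<forall>r>\<rho> + 1. \<forall>\<theta>\<in>{0<..<pi}. norm ((r_ddr ^^ j) (\<lambda>r. of_real (r powr \<beta>) * (exp (- H r) * u r \<theta>)) r) \<le> C"
    using assms(5) unfolding quasinormal_mode_solution_def conormal_at_infinity_def \<rho>_def by blast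
  \<comment> \<open>As \<open>u\<close> is exp (- H) times \<open>w 0\<close>, the product of
    \<open>q\<close> and \<open>w 0\<close> is exactly the function in the conormality
    hypothesis.\<close>
  define q where "q r = of_real (r powr \<beta>) * exp (- 2 * H r)" for r
  define pc where "pc z = (\<i> * ((z\<^sup>2 + of_real (a\<^sup>2)) * of_real \<sigma> + of_real a * of_int k) + (z - of_real m) * of_real s) / (z\<^sup>2 - 2 * of_real m * z + of_real (a\<^sup>2))" for z :: complex
  have pch: "pc holomorphic_on {z. Re z > \<rho>}"
  proof -
    have "z\<^sup>2 - 2 * of_real m * z + of_real (a\<^sup>2) \<noteq> 0" if "Re z > \<rho>" for z
    proof -
      have "z\<^sup>2 - 2 * of_real m * z + of_real (a\<^sup>2) = (z - of_real \<rho>) * (z - of_real \<rho> + of_real d)"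
      proof -
        have "of_real \<delta> * of_real \<delta> = (of_real m * of_real m - of_real a * of_real a :: complex)"
          using arg_cong[OF \<delta>(2), of complex_of_real] by simp
        then show ?thesis by (simp add: \<rho> d_def power2_eq_square algebra_simps)
      qed
      moreover have "Re (z - of_real \<rho>) > 0" "Re (z - of_real \<rho> + of_real d) > 0" using that d by auto
      then have "z - of_real \<rho> \<noteq> 0" "z - of_real \<rho> + of_real d \<noteq> 0" using that d by (auto simp: complex_eq_iff)
      ultimately show ?thesis by simp
    qed
    then show ?thesis unfolding pc_def by (intro holomorphic_intros) auto
  qed
  have Hpc: "(H has_vector_derivative pc (of_real r)) (at r)" if "r > \<rho>" for r
    using Hd[OF that] by (simp add: pc_def P_def radial_symbol_def mu_def)
  have "\<exists>Q. Q holomorphic_on {z. Re z > \<rho>} \<and> (\<forall>r>\<rho>. q r = Q (of_real r))"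
    unfolding q_def by (rule weighted_phase_holomorphic[OF less_imp_le[OF \<rho>0] pch]) (erule Hpc)
  then obtain Q where Q: "Q holomorphic_on {z. Re z > \<rho>}" "\<And>r. r > \<rho> \<Longrightarrow> q r = Q (of_real r)" by blast
  define Fc where "Fc r = q r * c 0 r" for r
  have leib: "(r_ddr ^^ j) (\<lambda>r. q r * \<omega> 0 r) r = (\<Sum>i\<le>j. leibniz_coeff Q j i (of_real r) * \<omega> i r)"
    "\<exists>D. ((r_ddr ^^ j) (\<lambda>r. q r * \<omega> 0 r) has_vector_derivative D) (at r)"
    if \<omega>: "\<And>i r. r > \<rho> \<Longrightarrow> (\<omega> i has_vector_derivative \<omega> (Suc i) r) (at r)" and r: "r > \<rho>" for \<omega> j r
    by (rule r_ddr_leibniz[OF Q(1)], erule Q(2), erule \<omega>, rule r)+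
  have leib_c: "(r_ddr ^^ j) Fc r = (\<Sum>i\<le>j. leibniz_coeff Q j i (of_real r) * c i r)"
    "\<exists>D. ((r_ddr ^^ j) Fc has_vector_derivative D) (at r)" if "r > \<rho>" for j r
    unfolding Fc_def[abs_def] by (rule leib, erule cd, rule that)+
  have Fcs: "symb n 0 (\<lambda>x. (r_ddr ^^ 0) Fc (\<rho> + x))" for n
  proof (rule conormal_symb)
    show "\<rho> \<ge> 0" using \<rho>0 by simp
    show "\<exists>D. ((r_ddr ^^ j) Fc has_vector_derivative D) (at r)" if "r > \<rho>" for j r by (rule leib_c(2)[OF that])
    fix j
    obtain C where C: "\<And>r \<theta>. r > \<rho> + 1 \<Longrightarrow> \<theta> \<in> {0<..<pi} \<Longrightarrow>
      norm ((r_ddr ^^ j) (\<lambda>r. of_real (r powr \<beta>) * (exp (- H r) * u r \<theta>)) r) \<le> C" using \<beta>[of j] by blast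
    show "\<exists>C. \<forall>r>\<rho> + 1. norm ((r_ddr ^^ j) Fc r) \<le> C"
    proof (intro exI allI impI)
      fix r assume r1: "r > \<rho> + 1"
      then have r: "r > \<rho>" by simp
      \<comment> \<open>The j-fold r d/dr of that function at fixed \<open>r\<close>, as a function
        of \<theta>; its integral against \<open>X\<close> is the same expression for the
        projection.\<close>
      define f where "f \<theta> = (\<Sum>i\<le>j. leibniz_coeff Q j i (of_real r) * w i r \<theta>)" for \<theta>
      have fc: "continuous_on {0..pi} f" unfolding f_def by (intro continuous_intros wc r)
      have "norm (f \<theta>) \<le> C" if \<theta>: "\<theta> \<in> {0<..<pi}" for \<theta>
      proof -
        have "f \<theta> = (r_ddr ^^ j) (\<lambda>r. q r * w 0 r \<theta>) r"
          unfolding f_def by (rule leib(1)[where \<omega> = "\<lambda>i r. w i r \<theta>", symmetric], erule wd, rule r)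
        also have "\<dots> = (r_ddr ^^ j) (\<lambda>r. of_real (r powr \<beta>) * (exp (- H r) * u r \<theta>)) r"
        proof (rule r_ddr_cong[OF _ r])
          fix y assume y: "y > \<rho>"
          have "exp (- 2 * H y) = exp (- H y) * exp (- H y)" by (simp add: exp_add[symmetric])
          then show "q y * w 0 y \<theta> = of_real (y powr \<beta>) * (exp (- H y) * u y \<theta>)"
            unfolding q_def u_eq[OF y \<theta>] by (simp only: mult_ac)
        qed
        finally show ?thesis using C[OF r1 \<theta>] by simp
      qed
      \<comment> \<open>Conormality is assumed between the poles only; continuity of
        \<open>f\<close> carries the bound to the closed interval.\<close>
      then have fb: "norm (f \<theta>) \<le> C" if "\<theta> \<in> {0..pi}" for \<theta>
        using continuous_on_closure_norm_le[of "{0<..<pi}" f C \<theta>] fc that by simp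
      have "(r_ddr ^^ j) Fc r = integral {0..pi} (\<lambda>\<theta>. f \<theta> * X \<theta>)"
      proof -
        have "((\<lambda>\<theta>. \<Sum>i\<le>j. leibniz_coeff Q j i (of_real r) * (w i r \<theta> * X \<theta>)) has_integral (\<Sum>i\<le>j. leibniz_coeff Q j i (of_real r) * c i r)) {0..pi}"
          unfolding c_def by (intro has_integral_sum has_integral_mult_right integrable_integral wXi r finite_atMost)
        then have "integral {0..pi} (\<lambda>\<theta>. \<Sum>i\<le>j. leibniz_coeff Q j i (of_real r) * (w i r \<theta> * X \<theta>)) = (\<Sum>i\<le>j. leibniz_coeff Q j i (of_real r) * c i r)"
          by (rule integral_unique)
        then show ?thesis using leib_c(1)[OF r, of j] by (simp add: f_def sum_distrib_right mult.assoc)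
      qed
      then show "norm ((r_ddr ^^ j) Fc r) \<le> C * BX * (pi - 0)" using bound[OF fc fb] by simp
    qed
  qed
  have w_symb: "symb n (- \<beta>) (\<lambda>x. exp (- 2 * H (\<rho> + x)) * c 0 (\<rho> + x))" for n
  proof -
    have "symb n (- \<beta> + 0) (\<lambda>x. of_real ((\<rho> + x) powr (- \<beta>)) * (r_ddr ^^ 0) Fc (\<rho> + x))"
      using \<rho>0 by (intro symb_mult symb_translated_powr Fcs) simp
    then have "symb n (- \<beta>) (\<lambda>x. of_real ((\<rho> + x) powr (- \<beta>)) * Fc (\<rho> + x))" by simp
    then show ?thesis
    proof (rule symb_cong[rotated])
      fix x :: real assume "1 < x"
      then have "(\<rho> + x) powr (- \<beta>) * (\<rho> + x) powr \<beta> = 1" using \<rho>0 by (simp add: powr_add[symmetric])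
      then have one: "of_real ((\<rho> + x) powr (- \<beta>)) * of_real ((\<rho> + x) powr \<beta>) = (1::complex)"
        unfolding of_real_mult[symmetric] by simp
      have as: "A * ((B * E) * C) = (A * B) * (E * C)" for A B E C :: complex by (simp only: mult.assoc)
      show "of_real ((\<rho> + x) powr (- \<beta>)) * Fc (\<rho> + x) = exp (- 2 * H (\<rho> + x)) * c 0 (\<rho> + x)"
        unfolding Fc_def q_def as one by (rule mult_1_left)
    qed
  qed
  \<comment> \<open>From \<rho>^2 + a^2 = 2 m \<rho> the value at the horizon yields \<kappa> = 2 m
    \<rho> \<sigma> + a k, and 2 \<rho> = 2 m + d gives the linear coefficient.\<close>
  have P_eq: "P (\<rho> + x) = (\<i> * of_real (2 * m * \<rho> * \<sigma> + a * of_int k) + of_real (s * d / 2))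
      + (\<i> * of_real (\<sigma> * d) + (2 * \<i> * of_real (m * \<sigma>) + of_real s)) * of_real x + \<i> * of_real \<sigma> * of_real x ^ 2" for x
  proof -
    have "of_real \<delta> * of_real \<delta> = (of_real m * of_real m - of_real a * of_real a :: complex)"
      using arg_cong[OF \<delta>(2), of complex_of_real] by simp
    then have "\<i> * of_real \<sigma> * (of_real \<delta> * of_real \<delta>) = \<i> * of_real \<sigma> * (of_real m * of_real m - of_real a * of_real a)" by simp
    then show ?thesis by (simp add: P_def radial_symbol_def \<rho> d_def power2_eq_square algebra_simps)
  qed
  have c0: "c 0 (\<rho> + x) = 0" if x: "x > 0" for x
  proof (rule radial_mode_stability[where P = "\<lambda>x. P (\<rho> + x)" and m = m and d = d and \<sigma> = \<sigma> and s = s and \<kappa> = "2 * m * \<rho> * \<sigma> + a * of_int k"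
      and lam = lam and H = "\<lambda>x. H (\<rho> + x)" and W = "\<lambda>j x. c j (\<rho> + x)", OF P_eq assms(1) d assms(3)])
    show "((\<lambda>x. H (\<rho> + x)) has_vector_derivative P (\<rho> + x) / of_real (x * (x + d))) (at x)" if "x > 0" for x
      unfolding mu_eq[symmetric] by (rule has_vector_derivative_translate[OF Hd]) (use that in simp)
    show "((\<lambda>x. c j (\<rho> + x)) has_vector_derivative c (Suc j) (\<rho> + x)) (at x)" if "x > 0" for j x
      by (rule has_vector_derivative_translate[OF cd]) (use that in simp)
    show "of_real (x * (x + d)) * c 2 (\<rho> + x) + (of_real (2 * x + d) - 2 * P (\<rho> + x)) * c 1 (\<rho> + x)
      + (- (\<i> * of_real \<sigma> * of_real (2 * x + d) + (2 * \<i> * of_real (m * \<sigma>) + of_real s))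
          + 4 * \<i> * of_real (s * \<sigma>) * of_real (x + m + d / 2) - of_real lam) * c 0 (\<rho> + x) = 0" if "x > 0" for x
    proof -
      have e: "2 * (\<rho> + x) - 2 * m = 2 * x + d" "x + m + d / 2 = \<rho> + x" by (auto simp: \<rho> d_def)
      have e2: "\<i> * of_real \<sigma> * of_real (2 * x + d) + (2 * \<i> * of_real (m * \<sigma>) + of_real s) = 2 * \<i> * of_real (\<sigma> * (\<rho> + x)) + of_real s"
        unfolding \<rho> d_def by (simp add: algebra_simps)
      have e3: "4 * \<i> * of_real (s * \<sigma>) * of_real (\<rho> + x) = 4 * \<i> * of_real (s * \<sigma> * (\<rho> + x))" by simp
      show ?thesis using c_ode[of "\<rho> + x"] that unfolding mu_eq e e2 e3 by simp
    qed
    show "\<exists>C. \<forall>x. 0 < x \<longrightarrow> x \<le> 1 \<longrightarrow> norm (c j (\<rho> + x)) \<le> C" for j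
    proof -
      obtain C where C: "\<And>r \<theta>. \<rho> < r \<Longrightarrow> r \<le> \<rho> + 1 \<Longrightarrow> \<theta> \<in> {0..pi} \<Longrightarrow> norm (w j r \<theta>) \<le> C"
        using locally_smooth_bounded[OF ls[of j]] by blast
      show ?thesis unfolding c_def by (intro exI[of _ "C * BX * (pi - 0)"] allI impI bound wc C) auto
    qed
    show "\<And>n. symb n (- \<beta>) (\<lambda>x. exp (- 2 * H (\<rho> + x)) * c 0 (\<rho> + x))" by (rule w_symb)
    show "0 < x" by (rule x)
  qed
  \<comment> \<open>The functional was chosen nonzero on at least one slice, which contradicts the
    vanishing of the projection.\<close>
  obtain r2 where r2: "r2 > \<rho>" "integral {0..pi} (\<lambda>\<theta>. fst (p r2) \<theta> * X \<theta>) \<noteq> 0" using X(3) by auto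
  then show False using c0[of "r2 - \<rho>"] by (simp add: c_def p_def)
qed

end
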